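(* Let $R=K[x_1,\dots,x_n]$ be a polynomial ring over a field $K$, $\mathfrak m=(x_1,\dots,x_n)$, and let $I=\mathrm{Sss}(B)\subset R$ be an equigenerated, normal symmetric strongly shifted ideal (for example, one with exactly one partition Borel generator, or one for which $\mathrm{Borel}(x^{B(I)})$ is an equigenerated lex-segment ideal). Then the Rees ring $\mathcal R(I)=\bigoplus_{i\ge0}I^it^i\subseteq R[t]$ and the special fiber ring $\mathcal F(I)=\mathcal R(I)/\mathfrak m\mathcal R(I)$ are Cohen–Macaulay normal domains. Moreover, $\mathcal F(I)$ has rational singularities if $K$ has characteristic $0$, and is $F$-rational if $K$ has positive characteristic.
   Context: $\mathfrak S_n$ acts on $R$ by permuting variables. $P_n=\{\lambda\in\mathbb Z^n: 0\le\lambda_1\le\cdots\le\lambda_n\}$, $x^\lambda=x_1^{\lambda_1}\cdots x_n^{\lambda_n}$, $x^B=\{x^\lambda:\lambda\in B\}$. For an $\mathfrak S_n$-fixed monomial ideal $I$ put $P(I)=\{\lambda\in P_n: x^\lambda\in I\}$. An $\mathfrak S_n$-fixed monomial ideal $I$ is symmetric strongly shifted if for every $\lambda\in P(I)$ and $1\le i<j\le n$ with $\lambda_i<\lambda_j$ one has $x^\lambda x_i/x_j\in I$. For $B\subseteq P_n$, $\mathrm{Sss}(B)$ is the smallest symmetric strongly shifted ideal containing $x^B$; the set $B(I)$ of partition Borel generators of $I$ is the smallest $B\subseteq P_n$ with $I=\mathrm{Sss}(B)$. A monomial ideal $J$ is strongly stable if for every monomial $x^\alpha\in J$ and every $i<j$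 with $\alpha_j\ne0$ one has $x^\alpha x_i/x_j\in J$; $\mathrm{Borel}(M)$ is the smallest strongly stable ideal containing the set of monomials $M$. A lex-segment ideal is a monomial ideal such that whenever it contains a monomial $u$ it contains every monomial of the same degree that is larger than $u$ in the lexicographic order. Equigenerated means that all minimal generators have the same degree. An ideal is normal if all its powers are integrally closed. All ideals considered are nonzero and proper. *)

theory Defs
  imports
    "HOL-Algebra.Algebra"
    "HOL-Algebra.Algebraic_Closure_Type"
    "HOL-Algebra.Ideal_Product"
    "HOL-Algebra.Generated_Rings"
    "HOL-Library.Poly_Mapping"
    "HOL-Library.Extended_Nat"
begin

section \<open>Localization, dimension, Cohen--Macaulay and regular rings\<close>

text \<open>All rings are commutative.  For a multiplicatively closed \<open>S\<close>, the ring \<open>localize A S\<close> is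
  \<open>S\<^sup>-\<^sup>1A\<close>, whose elements are the equivalence classes \<open>fract_class A S a s\<close> of
  the fractions \<open>a/s\<close>.\<close>

definition fract_rel :: "('a, 'b) ring_scheme \<Rightarrow> 'a set \<Rightarrow> (('a \<times> 'a) \<times> ('a \<times> 'a)) set" where
  "fract_rel A S = {((a, s), (b, t)). a \<in> carrier A \<and> s \<in> S \<and> b \<in> carrier A \<and> t \<in> S \<and>
     (\<exists>u\<in>S. u \<otimes>\<^bsub>A\<^esub> (t \<otimes>\<^bsub>A\<^esub> a \<ominus>\<^bsub>A\<^esub> s \<otimes>\<^bsub>A\<^esub> b) = \<zero>\<^bsub>A\<^esub>)}"

definition fract_class :: "('a, 'b) ring_scheme \<Rightarrow> 'a set \<Rightarrow> 'a \<Rightarrow> 'a \<Rightarrow> ('a \<times> 'a) set" where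
  "fract_class A S a s = fract_rel A S `` {(a, s)}"

definition localize :: "('a, 'b) ring_scheme \<Rightarrow> 'a set \<Rightarrow> ('a \<times> 'a) set ring" where
  "localize A S =
     \<lparr>carrier = (carrier A \<times> S) // fract_rel A S,
      monoid.mult = (\<lambda>U V. \<Union>(a, s)\<in>U. \<Union>(b, t)\<in>V. fract_class A S (a \<otimes>\<^bsub>A\<^esub> b) (s \<otimes>\<^bsub>A\<^esub> t)),
      one = fract_class A S \<one>\<^bsub>A\<^esub> \<one>\<^bsub>A\<^esub>,
      ring.zero = fract_class A S \<zero>\<^bsub>A\<^esub> \<one>\<^bsub>A\<^esub>,
      add = (\<lambda>U V. \<Union>(a, s)\<in>U. \<Union>(b, t)\<in>V.
               fract_class A S (a \<otimes>\<^bsub>A\<^esub> t \<oplus>\<^bsub>A\<^esub> b \<otimes>\<^bsub>A\<^esub> s) (s \<otimes>\<^bsub>A\<^esub> t))\<rparr>"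

definition localize_at :: "('a, 'b) ring_scheme \<Rightarrow> 'a set \<Rightarrow> ('a \<times> 'a) set ring" where
  "localize_at A P = localize A (carrier A - P)"

definition krull_dim :: "('a, 'b) ring_scheme \<Rightarrow> enat" where
  "krull_dim A = Sup {enat k | k. \<exists>P :: nat \<Rightarrow> 'a set.
     (\<forall>i\<le>k. primeideal (P i) A) \<and> (\<forall>i<k. P i \<subset> P (Suc i))}"

text \<open>The unit ideal has height \<open>\<infinity>\<close> (\<open>Inf {} = \<infinity>\<close> in \<^typ>\<open>enat\<close>).\<close>

definition ideal_height :: "('a, 'b) ring_scheme \<Rightarrow> 'a set \<Rightarrow> enat" where
  "ideal_height A J = Inf {krull_dim (localize_at A P) | P. primeideal P A \<and> J \<subseteq> P}"

definition local_ring :: "('a, 'b) ring_scheme \<Rightarrow> bool" where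
  "local_ring A \<longleftrightarrow> cring A \<and> (\<exists>!M. maximalideal M A)"

definition max_ideal :: "('a, 'b) ring_scheme \<Rightarrow> 'a set" where
  "max_ideal A = (THE M. maximalideal M A)"

definition regular_sequence :: "('a, 'b) ring_scheme \<Rightarrow> 'a list \<Rightarrow> bool" where
  "regular_sequence A xs \<longleftrightarrow> set xs \<subseteq> carrier A \<and> Idl\<^bsub>A\<^esub> (set xs) \<noteq> carrier A \<and>
     (\<forall>i<length xs. \<forall>a\<in>carrier A.
        xs ! i \<otimes>\<^bsub>A\<^esub> a \<in> Idl\<^bsub>A\<^esub> (set (take i xs)) \<longrightarrow> a \<in> Idl\<^bsub>A\<^esub> (set (take i xs)))"

definition local_depth :: "('a, 'b) ring_scheme \<Rightarrow> enat" where
  "local_depth A =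
     Sup {enat (length xs) | xs. regular_sequence A xs \<and> set xs \<subseteq> max_ideal A}"

definition cm_local_ring :: "('a, 'b) ring_scheme \<Rightarrow> bool" where
  "cm_local_ring A \<longleftrightarrow> noetherian_ring A \<and> local_ring A \<and> local_depth A = krull_dim A"

definition cohen_macaulay_ring :: "('a, 'b) ring_scheme \<Rightarrow> bool" where
  "cohen_macaulay_ring A \<longleftrightarrow> cring A \<and> noetherian_ring A \<and>
     (\<forall>P. primeideal P A \<longrightarrow> cm_local_ring (localize_at A P))"

definition regular_local_ring :: "('a, 'b) ring_scheme \<Rightarrow> bool" where
  "regular_local_ring A \<longleftrightarrow> noetherian_ring A \<and> local_ring A \<and>
     (\<exists>G. finite G \<and> G \<subseteq> carrier A \<and> Idl\<^bsub>A\<^esub> G = max_ideal A \<and> enat (card G) = krull_dim A)"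

definition regular_ring :: "('a, 'b) ring_scheme \<Rightarrow> bool" where
  "regular_ring A \<longleftrightarrow> cring A \<and> noetherian_ring A \<and>
     (\<forall>P. primeideal P A \<longrightarrow> regular_local_ring (localize_at A P))"


section \<open>Normal domains\<close>

definition frac_field :: "('a, 'b) ring_scheme \<Rightarrow> ('a \<times> 'a) set ring" where
  "frac_field A = localize A (carrier A - {\<zero>\<^bsub>A\<^esub>})"

definition frac :: "('a, 'b) ring_scheme \<Rightarrow> 'a \<Rightarrow> 'a \<Rightarrow> ('a \<times> 'a) set" where
  "frac A a b = fract_class A (carrier A - {\<zero>\<^bsub>A\<^esub>}) a b"

definition base_image :: "('a, 'b) ring_scheme \<Rightarrow> ('a \<times> 'a) set set" where
  "base_image A = (\<lambda>a. frac A a \<one>\<^bsub>A\<^esub>) ` carrier A"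

definition integral_over :: "('a, 'b) ring_scheme \<Rightarrow> 'a set \<Rightarrow> 'a \<Rightarrow> bool" where
  "integral_over L C z \<longleftrightarrow> (\<exists>m c. (\<forall>i<m. c i \<in> C) \<and>
     z [^]\<^bsub>L\<^esub> (m::nat) \<oplus>\<^bsub>L\<^esub> (\<Oplus>\<^bsub>L\<^esub>i\<in>{..<m}. c i \<otimes>\<^bsub>L\<^esub> z [^]\<^bsub>L\<^esub> i) = \<zero>\<^bsub>L\<^esub>)"

definition normal_domain :: "('a, 'b) ring_scheme \<Rightarrow> bool" where
  "normal_domain A \<longleftrightarrow> domain A \<and>
     (\<forall>z\<in>carrier (frac_field A). integral_over (frac_field A) (base_image A) z \<longrightarrow> z \<in> base_image A)"


section \<open>Rational singularities\<close>

text \<open>Let \<open>A\<close> be a domain of finite type over a field of characteristic \<open>0\<close>.  Then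
  \<open>Y = Spec A\<close> has rational singularities if \<open>A\<close> is normal and \<open>H\<^sup>q(Z, \<O>\<^sub>Z) = 0\<close> for all
  \<open>q \<ge> 1\<close> and some resolution of singularities \<open>Z \<rightarrow> Y\<close>, that is, a projective birational morphism from a
  regular integral scheme \<open>Z\<close>.

  Projective birational morphisms from integral schemes to \<open>Y\<close> are exactly the blow-ups of
  nonzero ideals of \<open>A\<close> (Hartshorne II.7.17).  If the ideal is generated by nonzero elements
  \<open>f\<^sub>0, \<dots>, f\<^sub>r\<^sub>-\<^sub>1\<close>, then \<open>Z\<close> is covered by the affine open sets
  \<open>U\<^sub>i = Spec A[f\<^sub>0/f\<^sub>i, \<dots>, f\<^sub>r\<^sub>-\<^sub>1/f\<^sub>i]\<close>, and for nonempty \<open>T \<subseteq> {..<r}\<close> the intersection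
  of the \<open>U\<^sub>i\<close>, \<open>i \<in> T\<close>, is the spectrum of the subring \<open>blowup_chart A fs T\<close> of
  \<open>Frac A\<close>.  As \<open>Z\<close> is separated, \<open>H\<^sup>q(Z, \<O>\<^sub>Z)\<close> is the Cech cohomology of this
  cover, computed by alternating cochains, that is, families indexed by the
  \<open>(q+1)\<close>-element subsets \<open>T\<close> of \<open>{..<r}\<close>.\<close>

definition blowup_chart :: "('a, 'b) ring_scheme \<Rightarrow> 'a list \<Rightarrow> nat set \<Rightarrow> ('a \<times> 'a) set set" where
  "blowup_chart A fs T = generate_ring (frac_field A)
     (base_image A \<union> {frac A (fs ! k) (fs ! i) | k i. k < length fs \<and> i \<in> T})"

definition cech_cochains ::
  "('a, 'b) ring_scheme \<Rightarrow> 'a list \<Rightarrow> nat \<Rightarrow> (nat set \<Rightarrow> ('a \<times> 'a) set) set" where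
  "cech_cochains A fs q =
     {c. \<forall>T. T \<subseteq> {..<length fs} \<and> card T = Suc q \<longrightarrow> c T \<in> blowup_chart A fs T}"

definition cech_d ::
  "('a, 'b) ring_scheme \<Rightarrow> (nat set \<Rightarrow> ('a \<times> 'a) set) \<Rightarrow> nat set \<Rightarrow> ('a \<times> 'a) set" where
  "cech_d A c T = (let L = frac_field A in
     \<Oplus>\<^bsub>L\<^esub>i\<in>T. (\<ominus>\<^bsub>L\<^esub> \<one>\<^bsub>L\<^esub>) [^]\<^bsub>L\<^esub> card {j \<in> T. j < i} \<otimes>\<^bsub>L\<^esub> c (T - {i}))"

definition cech_vanishes :: "('a, 'b) ring_scheme \<Rightarrow> 'a list \<Rightarrow> nat \<Rightarrow> bool" where
  "cech_vanishes A fs q \<longleftrightarrow>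
     (\<forall>c\<in>cech_cochains A fs q.
        (\<forall>T. T \<subseteq> {..<length fs} \<and> card T = q + 2 \<longrightarrow> cech_d A c T = \<zero>\<^bsub>frac_field A\<^esub>) \<longrightarrow>
        (\<exists>b\<in>cech_cochains A fs (q - 1).
           \<forall>T. T \<subseteq> {..<length fs} \<and> card T = q + 1 \<longrightarrow> c T = cech_d A b T))"

definition blowup_is_regular :: "('a, 'b) ring_scheme \<Rightarrow> 'a list \<Rightarrow> bool" where
  "blowup_is_regular A fs \<longleftrightarrow>
     (\<forall>i<length fs. regular_ring ((frac_field A)\<lparr>carrier := blowup_chart A fs {i}\<rparr>))"

definition rational_singularities :: "('a, 'b) ring_scheme \<Rightarrow> bool" where
  "rational_singularities A \<longleftrightarrow> normal_domain A \<and>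
     (\<exists>fs. fs \<noteq> [] \<and> set fs \<subseteq> carrier A - {\<zero>\<^bsub>A\<^esub>} \<and> blowup_is_regular A fs \<and>
        (\<forall>q\<ge>1. cech_vanishes A fs q))"


section \<open>Tight closure and F-rational rings\<close>

definition minimal_prime :: "('a, 'b) ring_scheme \<Rightarrow> 'a set \<Rightarrow> bool" where
  "minimal_prime A P \<longleftrightarrow> primeideal P A \<and> (\<forall>Q. primeideal Q A \<and> Q \<subseteq> P \<longrightarrow> Q = P)"

definition frobenius_power :: "nat \<Rightarrow> ('a, 'b) ring_scheme \<Rightarrow> 'a set \<Rightarrow> nat \<Rightarrow> 'a set" where
  "frobenius_power p A J e = Idl\<^bsub>A\<^esub> ((\<lambda>a. a [^]\<^bsub>A\<^esub> (p ^ e)) ` J)"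

definition tight_closure :: "nat \<Rightarrow> ('a, 'b) ring_scheme \<Rightarrow> 'a set \<Rightarrow> 'a set" where
  "tight_closure p A J = {x \<in> carrier A. \<exists>c\<in>carrier A. (\<forall>P. minimal_prime A P \<longrightarrow> c \<notin> P) \<and>
     (\<exists>e0. \<forall>e\<ge>e0. c \<otimes>\<^bsub>A\<^esub> x [^]\<^bsub>A\<^esub> (p ^ e) \<in> frobenius_power p A J e)}"

text \<open>A Noetherian ring of prime characteristic \<open>p\<close> is F-rational if every ideal \<open>J\<close> generated
  by \<open>height J\<close> elements is tightly closed (Bruns--Herzog, Section 10.3).\<close>

definition F_rational :: "nat \<Rightarrow> ('a, 'b) ring_scheme \<Rightarrow> bool" where
  "F_rational p A \<longleftrightarrow> cring A \<and> noetherian_ring A \<and> Factorial_Ring.prime p \<and> add_pow A p \<one>\<^bsub>A\<^esub> = \<zero>\<^bsub>A\<^esub> \<and>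
     (\<forall>G. finite G \<and> G \<subseteq> carrier A \<and> enat (card G) = ideal_height A (Idl\<^bsub>A\<^esub> G) \<longrightarrow>
        tight_closure p A (Idl\<^bsub>A\<^esub> G) = Idl\<^bsub>A\<^esub> G)"


section \<open>Monomial ideals\<close>

text \<open>The index type \<open>'n\<close>, finite and linearly ordered, plays the role of \<open>{1 < \<dots> < n}\<close>;
  exponent vectors have type \<open>'n \<Rightarrow>\<^sub>0 nat\<close>, and \<open>K[x\<^sub>1, \<dots>, x\<^sub>n]\<close> is the following type.\<close>

type_synonym ('n, 'k) mpol = "('n \<Rightarrow>\<^sub>0 nat) \<Rightarrow>\<^sub>0 'k"

abbreviation pring :: "('n, 'k::field) mpol ring" where
  "pring \<equiv> ring_of_type_algebra"

definition xpow :: "('n \<Rightarrow>\<^sub>0 nat) \<Rightarrow> ('n, 'k::field) mpol" where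
  "xpow \<alpha> = Poly_Mapping.single \<alpha> 1"

definition var_ideal :: "('n, 'k::field) mpol set" where
  "var_ideal = Idl\<^bsub>pring\<^esub> (range (\<lambda>i. xpow (Poly_Mapping.single i 1)))"

definition expdeg :: "('n::finite \<Rightarrow>\<^sub>0 nat) \<Rightarrow> nat" where
  "expdeg \<alpha> = (\<Sum>i\<in>UNIV. Poly_Mapping.lookup \<alpha> i)"

definition monomial_ideal :: "('n, 'k::field) mpol set \<Rightarrow> bool" where
  "monomial_ideal I \<longleftrightarrow> (\<exists>M. I = Idl\<^bsub>pring\<^esub> (xpow ` M))"

text \<open>For \<open>x\<^sup>\<alpha>\<close> in \<open>I\<close> with \<open>\<alpha>\<^sub>j \<noteq> 0\<close>, \<open>xpow (move \<alpha> i j)\<close> is \<open>x\<^sup>\<alpha> x\<^sub>i / x\<^sub>j\<close>.\<close>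

definition move :: "('n \<Rightarrow>\<^sub>0 nat) \<Rightarrow> 'n \<Rightarrow> 'n \<Rightarrow> ('n \<Rightarrow>\<^sub>0 nat)" where
  "move \<alpha> i j = \<alpha> - Poly_Mapping.single j 1 + Poly_Mapping.single i 1"

text \<open>The \<open>K\<close>-algebra automorphism with \<open>x\<^sub>i \<mapsto> x\<^bsub>\<sigma> i\<^esub>\<close>: the coefficient of \<open>x\<^sup>\<alpha>\<close> in the
  image of \<open>f\<close> is that of \<open>x\<^bsup>\<alpha> \<circ> \<sigma>\<^esup>\<close> in \<open>f\<close>.\<close>

definition permute_vars :: "('n \<Rightarrow> 'n) \<Rightarrow> ('n, 'k::field) mpol \<Rightarrow> ('n, 'k) mpol" where
  "permute_vars \<sigma> f = Poly_Mapping.map_key (Poly_Mapping.map_key \<sigma>) f"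

definition sym_fixed :: "('n, 'k::field) mpol set \<Rightarrow> bool" where
  "sym_fixed I \<longleftrightarrow> (\<forall>\<sigma>. bij \<sigma> \<longrightarrow> permute_vars \<sigma> ` I \<subseteq> I)"

definition parts :: "('n::linorder \<Rightarrow>\<^sub>0 nat) set" where
  "parts = {\<mu>. mono (Poly_Mapping.lookup \<mu>)}"

definition parts_of :: "('n::linorder, 'k::field) mpol set \<Rightarrow> ('n \<Rightarrow>\<^sub>0 nat) set" where
  "parts_of I = {\<mu> \<in> parts. xpow \<mu> \<in> I}"

definition sym_strongly_shifted :: "('n::linorder, 'k::field) mpol set \<Rightarrow> bool" where
  "sym_strongly_shifted I \<longleftrightarrow> monomial_ideal I \<and> sym_fixed I \<and>
     (\<forall>\<mu>\<in>parts_of I. \<forall>i j. i < j \<and> Poly_Mapping.lookup \<mu> i < Poly_Mapping.lookup \<mu> j \<longrightarrow>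
        xpow (move \<mu> i j) \<in> I)"

text \<open>The properties involved in the next hulls are closed under intersection, so the hulls are
  the smallest ideals with these properties.\<close>

definition Sss :: "('n::linorder \<Rightarrow>\<^sub>0 nat) set \<Rightarrow> ('n, 'k::field) mpol set" where
  "Sss B = sym_strongly_shifted hull (xpow ` B)"

definition strongly_stable :: "('n::linorder, 'k::field) mpol set \<Rightarrow> bool" where
  "strongly_stable J \<longleftrightarrow> monomial_ideal J \<and>
     (\<forall>\<alpha> i j. xpow \<alpha> \<in> J \<and> i < j \<and> Poly_Mapping.lookup \<alpha> j \<noteq> 0 \<longrightarrow> xpow (move \<alpha> i j) \<in> J)"

definition Borel :: "('n::linorder, 'k::field) mpol set \<Rightarrow> ('n, 'k) mpol set" where
  "Borel M = strongly_stable hull M"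

definition borel_gens :: "('n::linorder, 'k::field) mpol set \<Rightarrow> ('n \<Rightarrow>\<^sub>0 nat) set" where
  "borel_gens I = (LEAST B. B \<subseteq> parts \<and> I = Sss B)"

definition lex_greater :: "('n::linorder \<Rightarrow>\<^sub>0 nat) \<Rightarrow> ('n \<Rightarrow>\<^sub>0 nat) \<Rightarrow> bool" where
  "lex_greater \<beta> \<alpha> \<longleftrightarrow>
     (\<exists>i. Poly_Mapping.lookup \<alpha> i < Poly_Mapping.lookup \<beta> i \<and>
        (\<forall>j<i. Poly_Mapping.lookup \<alpha> j = Poly_Mapping.lookup \<beta> j))"

definition lex_segment_ideal :: "('n::{finite,linorder}, 'k::field) mpol set \<Rightarrow> bool" where
  "lex_segment_ideal J \<longleftrightarrow> monomial_ideal J \<and>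
     (\<forall>\<alpha> \<beta>. xpow \<alpha> \<in> J \<and> expdeg \<beta> = expdeg \<alpha> \<and> lex_greater \<beta> \<alpha> \<longrightarrow> xpow \<beta> \<in> J)"

definition min_mono_gens :: "('n, 'k::field) mpol set \<Rightarrow> ('n \<Rightarrow>\<^sub>0 nat) set" where
  "min_mono_gens J =
     {\<alpha>. xpow \<alpha> \<in> J \<and> (\<forall>\<beta>. xpow \<beta> \<in> J \<and> (xpow \<beta> :: ('n, 'k) mpol) dvd xpow \<alpha> \<longrightarrow> \<beta> = \<alpha>)}"

definition equigenerated :: "('n::finite, 'k::field) mpol set \<Rightarrow> bool" where
  "equigenerated J \<longleftrightarrow> (\<exists>d. \<forall>\<alpha>\<in>min_mono_gens J. expdeg \<alpha> = d)"


section \<open>Powers of ideals, normality, Rees ring and special fiber ring\<close>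

definition ideal_power :: "('n, 'k::field) mpol set \<Rightarrow> nat \<Rightarrow> ('n, 'k) mpol set" where
  "ideal_power I k = I [^]\<^bsub>ideals_set pring\<^esub> k"

definition integral_closure :: "('n, 'k::field) mpol set \<Rightarrow> ('n, 'k) mpol set" where
  "integral_closure J = {f. \<exists>m a. (\<forall>i\<in>{1..m}. a i \<in> ideal_power J i) \<and>
     f ^ m + (\<Sum>i=1..m. a i * f ^ (m - i)) = 0}"

definition normal_ideal :: "('n, 'k::field) mpol set \<Rightarrow> bool" where
  "normal_ideal I \<longleftrightarrow> (\<forall>k\<ge>1. integral_closure (ideal_power I k) = ideal_power I k)"

definition rees_ring :: "('n, 'k::field) mpol set \<Rightarrow> ('n, 'k) mpol Polynomial.poly ring" where
  "rees_ring I =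
     ring_of_type_algebra\<lparr>carrier := {p. \<forall>i. Polynomial.coeff p i \<in> ideal_power I i}\<rparr>"

definition special_fiber_ring ::
  "('n, 'k::field) mpol set \<Rightarrow> ('n, 'k) mpol Polynomial.poly set ring" where
  "special_fiber_ring I = rees_ring I Quot (Idl\<^bsub>rees_ring I\<^esub> ((\<lambda>f. Polynomial.pCons f 0) ` var_ideal))"

end

theory Submission
  imports Defs
begin

text \<open>A set of exponents closed under multiplication, permutations and moves is closed under domination of
  partitions, so the powers of a principal \<open>Sss\<close> ideal are given by linear inequalities and the ideal is
  normal; the lex-segment case is principal. For a normal equigenerated ideal the Rees ring is the algebra of
  a saturated affine monoid, and the special fibre ring that of its face of minimal degree. For such a
  monoid algebra: a unimodular projective triangulation of the cone with a proper colouring yields, by a line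
  shelling, a free module over a polynomial subring, hence the Cohen--Macaulay property; a splitting of the
  Frobenius onto any nonzero element gives \<open>F\<close>-rationality; and blowing up the lattice points near the
  vertices of a polytope with unimodular normal fan is a toric resolution, whose Cech complex is acyclic
  degree by degree because the supports are cones.\<close>

section \<open>Unimodular projective fans\<close>

text \<open>The definitions quantify over every prime, not only the graded maximal ideal, so
  freeness over a polynomial ring has to yield information at each prime by elementary means. At a
  prime p, every parameter \<open>th j\<close> that is algebraic modulo p over the earlier ones
  contributes a relation of least degree. These relations form a sequence that is regular after
  localizing at p, and its length bounds the chains of primes below p, because each step down a
  chain frees one more parameter. For the charts, where the free basis is 1, the relations even
  generate p locally.

  Unimodular fans are grown from the coordinate orthants rather than from the cone under study: an
  edge a, b crossed by a hyperplane is cut at a + b, which keeps unimodularity, and the widths of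
  crossed edges shrink as in the Euclidean algorithm. A strictly convex support function is carried
  along by rescaling; it orders the cones for the shelling and provides the polyhedron of the
  resolution. The construction is applied to the cone of M and to its dual.

  Computations take place in Laurent polynomials and reach the abstract rings through
  \<open>typed_ring\<close>.\<close>

type_synonym vec = "nat \<Rightarrow>\<^sub>0 int"
type_synonym 'k lau = "vec \<Rightarrow>\<^sub>0 'k"
abbreviation (input) eqv (infixr "<->" 25) where "A <-> B == A = (B::bool)"
lemmas pmI = poly_mapping_eqI and fin_ind = infinite_finite_induct
lemmas lk_add = lookup_add and lk_sng = lookup_single and lk_diff = lookup_minus and lk_sum = lookup_sum and ik = in_keys_iff
abbreviation (input) "cr == carrier"
notation (input) monoid.mult (infixl "*.\<index>" 70) and ring.add (infixl "+.\<index>" 65)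
abbreviation (input) "pco == Polynomial.coeff"
abbreviation "sng == Poly_Mapping.single"
abbreviation sc :: "int => vec => vec" (infixr "**" 75) where
"c ** u == frag_cmul c u"

section \<open>Integer linear functionals\<close>

definition lin :: "(vec => int) => bool" where
"lin k <-> (ALL u v. k (u + v) = k u + k v)"

lemma lin_add: "lin k ==> k (u + v) = k u + k v"
by(simp add: lin_def)

lemma lin_0: "lin k ==> k 0 = 0"
using lin_add[of k 0 0] by simp

lemma lin_neg: "lin k ==> k (- u) = - k u"
using lin_add[of k u "- u"] lin_0[of k] by simp

lemma lin_diff: "lin k ==> k (u - v) = k u - k v"
using lin_add[of k u "- v"] lin_neg[of k v] by simp

lemma lin_sc: "lin k ==> k (c ** u) = c * k u"
proof(induction c rule: int_induct[of _ 0])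
case base
thus ?case by(simp add: lin_0)
next
case (step1 i)
thus ?case by(simp add: frag_cmul_distrib lin_add algebra_simps)
next
case (step2 i)
thus ?case by(simp add: frag_cmul_diff_distrib lin_diff algebra_simps)
qed

lemma lin_sum: "lin k ==> k (sum f A) = (SUM x:A. k (f x))"
by(induction A rule: fin_ind) (simp_all add: lin_0 lin_add)

lemma lin_plus: "lin k ==> lin l ==> lin (%u. k u + l u)"
and lin_minus: "lin k ==> lin l ==> lin (%u. k u - l u)"
and lin_times: "lin k ==> lin (%u. c * k u)"
and lin_uminus: "lin k ==> lin (%u. - k u)"
and lin_times2: "lin k ==> lin (%u. k u * c)"
by(simp_all add: lin_def algebra_simps)

lemma lin_Sum: "(!!x. x : A ==> lin (k x)) ==> lin (%u. SUM x:A. k x u)"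
by(simp add: lin_def sum.distrib)

text \<open>Integer form of letting u + m/k tend to u. If one of finitely many cones contains k u +
  m for infinitely many k, which the pigeonhole principle provides, all coordinates of u in that
  cone are nonnegative; this replaces closedness of cones.\<close>

lemma nonneg_limit:
fixes a b :: int
assumes "infinite A" "!!k::nat. k : A ==> 0 <= int k * a + b"
shows "0 <= a"
proof(rule ccontr)
assume "~ 0 <= a"
obtain k where "k : A" "k > nat b" using assms(1) unfolding infinite_nat_iff_unbounded by blast
have "int k * a <= int k * (- 1)" using \<open>~ 0 <= a\<close> by(intro mult_left_mono) auto
hence "int k * a + b < 0" using \<open>k > nat b\<close> by linarith
with assms(2)[OF \<open>k : A\<close>] show False by simp
qed

lemma sc_neg_neg: "(- c) ** (- x) = c ** x"
by(intro pmI) simp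

section \<open>Lattices, unimodular cones and projective fans\<close>

locale lattice_vec =
fixes V :: "vec set"
assumes V_0: "0 : V" and V_add: "u : V ==> v : V ==> u + v : V"
 and V_neg: "u : V ==> - u : V"
begin

lemma V_diff: "u : V ==> v : V ==> u - v : V"
using V_add[of u "- v"] V_neg by simp

lemma V_sc: "u : V ==> c ** u : V"
by(rule frag_closure_minus_cmul) (auto intro: V_0 V_diff)

lemma V_sum: "(!!x. x : A ==> f x : V) ==> sum f A : V"
by(induction A rule: fin_ind) (auto intro: V_0 V_add)
text \<open>A Z-basis of the lattice with its dual basis \<open>D\<close>. The functionals live on
  all vectors but are determined only on \<open>V\<close>, so uniqueness of coordinates is stated
  for points of \<open>V\<close>.\<close>

definition unimodD :: "vec set => (vec => vec => int) => bool" where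
"unimodD A D <-> finite A & A <= V & (ALL r:A. lin (D r)) &
 (ALL r:A. ALL s:A. D r s = (if r = s then 1 else 0)) & (ALL u:V. u = (SUM r:A. D r u ** r))"
definition unimod :: "vec set => bool" where
"unimod A <-> (EX D. unimodD A D)"
definition cf :: "vec set => vec => vec => int" where
"cf A = (SOME D. unimodD A D)"

lemma unimodD_cf: "unimod A ==> unimodD A (cf A)"
unfolding unimod_def cf_def by(rule someI_ex[of "unimodD A"])

lemma umfin: "unimod A ==> finite A"
and um_sub: "unimod A ==> A <= V"
and lin_cf: "unimod A ==> r : A ==> lin (cf A r)"
and cf_ray: "unimod A ==> r : A ==> s : A ==> cf A r s = (if r = s then 1 else 0)"
and cf_expand: "unimod A ==> u : V ==> (SUM r:A. cf A r u ** r) = u"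
using unimodD_cf[of A] unfolding unimodD_def by auto

lemma lin_expand:
assumes "unimod A" "u : V" "lin k"
shows "k u = (SUM r:A. cf A r u * k r)"
using assms(3) by(subst (1) cf_expand[OF assms(1,2), symmetric]) (simp only: lin_sum lin_sc)

lemma cf_unique:
assumes "unimod A" "r : A" "u : V" "lin k" "!!s. s : A ==> k s = (if r = s then 1 else 0)"
shows "cf A r u = k u"
proof -
have "k u = (SUM s:A. cf A s u * (if r = s then 1 else 0))"
 using lin_expand[OF assms(1,3,4)] assms(5) by simp
also have "... = (SUM s:A. if s = r then cf A s u else 0)" by(rule sum.cong) auto
also have "... = cf A r u" using assms(2) umfin[OF assms(1)] by simp
finally show ?thesis by simp
qed
definition cone :: "vec set => vec set" where
"cone A = {u : V. ALL r:A. 0 <= cf A r u}"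

lemma cone_add: "unimod A ==> u : cone A ==> v : cone A ==> u + v : cone A"
unfolding cone_def by(auto simp: V_add lin_add[OF lin_cf])

lemma ray_cone: "unimod A ==> r : A ==> r : cone A"
unfolding cone_def using um_sub cf_ray by fastforce

lemma lin_nn:
assumes "unimod A" "u : cone A" "lin k" "!!r. r : A ==> 0 <= k r"
shows "0 <= k u"
using assms lin_expand[of A u k] unfolding cone_def by(auto intro!: sum_nonneg)
text \<open>Linear extension of the heights at the rays of one cone; for a fan these are the pieces
  of its support function.\<close>

definition pl :: "(vec => int) => vec set => vec => int" where
"pl fi A u = (SUM r:A. cf A r u * fi r)"

lemma lin_pl: "unimod A ==> lin (pl fi A)"
unfolding pl_def by(intro lin_Sum lin_times2 lin_cf)

lemma pl_ray:
assumes "unimod A" "r : A"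
shows "pl fi A r = fi r"
proof -
have "pl fi A r = (SUM s:A. if s = r then fi s else 0)"
 unfolding pl_def by(rule sum.cong) (use assms cf_ray in auto)
thus ?thesis using assms umfin by simp
qed

lemma pl_unique: "unimod A ==> u : V ==> lin k ==> (!!r. r : A ==> k r = fi r) ==> pl fi A u = k u"
using lin_expand[of A u k] by(simp add: pl_def)
text \<open>A projective unimodular fan with support \<open>C\<close>. That cones meet in common
  faces is not an axiom: the strict inequality lifts every other ray above the piece of
  \<open>A\<close>, and \<open>fan_convex\<close> derives it from this.\<close>

definition fan :: "nat => vec set => vec set set => (vec => int) => bool" where
"fan n C Fa fi <-> finite Fa & (ALL A:Fa. unimod A & card A = n & cone A <= C) &
 (ALL A:Fa. ALL r:Union Fa - A. pl fi A r < fi r) & C <= (UN A:Fa. cone A)"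

lemma fanD:
assumes "fan n C Fa fi"
shows "finite Fa" "A : Fa ==> unimod A" "A : Fa ==> card A = n" "A : Fa ==> cone A <= C"
 "A : Fa ==> r : Union Fa ==> r ~: A ==> pl fi A r < fi r" "u : C ==> EX A:Fa. u : cone A"
 "A : Fa ==> r : Union Fa ==> pl fi A r <= fi r"
proof -
note a = assms[unfolded fan_def]
show "finite Fa" "A : Fa ==> unimod A" "A : Fa ==> card A = n" "A : Fa ==> cone A <= C"
 "A : Fa ==> r : Union Fa ==> r ~: A ==> pl fi A r < fi r" "u : C ==> EX A:Fa. u : cone A"
 using a by blast+
show "pl fi A r <= fi r" if "A : Fa" "r : Union Fa"
proof(cases "r : A")
 case False
 hence "pl fi A r < fi r" using a that by blast
 thus ?thesis by simp
qed (use a that pl_ray[of A r fi] in auto)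
qed

text \<open>The functions \<open>pl fi A\<close> are the linear pieces of one strictly convex function.\<close>
lemma fan_convex:
assumes "fan n C Fa fi" "A : Fa" "Y : Fa" "u : cone Y"
shows "pl fi A u <= pl fi Y u"
 and "pl fi A u = pl fi Y u ==> u : cone A"
 and "pl fi A u = pl fi Y u ==> r : Y ==> 0 < cf Y r u ==> r : A"
proof -
note f = fanD[OF assms(1)]
have uV: "u : V" and nn: "!!r. r : Y ==> 0 <= cf Y r u" using assms(4) by(auto simp: cone_def)
have *: "pl fi Y u - pl fi A u = (SUM r:Y. cf Y r u * (fi r - pl fi A r))"
 using lin_expand[OF f(2)[OF assms(3)] uV lin_pl[OF f(2)[OF assms(2)], of fi]]
 by(simp add: pl_def sum_subtractf right_diff_distrib)
have t: "0 <= cf Y r u * (fi r - pl fi A r)" if "r : Y" for r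
 using nn[OF that] f(7)[OF assms(2), of r] assms(3) that by(intro mult_nonneg_nonneg) auto
show "pl fi A u <= pl fi Y u" using * t by(smt (verit) sum_nonneg)
assume eq: "pl fi A u = pl fi Y u"
have z: "cf Y r u * (fi r - pl fi A r) = 0" if "r : Y" for r
 using * eq t that sum_nonneg_eq_0_iff[OF umfin[OF f(2)[OF assms(3)]], of "%r. cf Y r u * (fi r - pl fi A r)"] by auto
have in_X: "r : A" if "r : Y" "cf Y r u ~= 0" for r
 using z[OF that(1)] that f(5)[OF assms(2), of r] assms(3) by auto
thus "r : Y ==> 0 < cf Y r u ==> r : A" by auto
have "0 <= cf A s u" if "s : A" for s
proof -
 have "cf A s u = (SUM r:Y. cf Y r u * cf A s r)"
  by(rule lin_expand[OF f(2)[OF assms(3)] uV lin_cf[OF f(2)[OF assms(2)] that]])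
 moreover have "0 <= cf Y r u * cf A s r" if "r : Y" for r
  using in_X[OF that] nn[OF that] cf_ray[OF f(2)[OF assms(2)] \<open>s : A\<close>, of r]
  by(cases "cf Y r u = 0") auto
 ultimately show ?thesis by(simp add: sum_nonneg)
qed
thus "u : cone A" using uV by(simp add: cone_def)
qed

lemma cone_trans:
assumes "unimod A" "unimod Y" "A <= cone Y"
shows "cone A <= cone Y"
proof
fix u assume u: "u : cone A"
have "0 <= cf Y s u" if "s : Y" for s
 by(rule lin_nn[OF assms(1) u lin_cf[OF assms(2) that]]) (use assms(3) that in "auto simp: cone_def")
thus "u : cone Y" using u by(auto simp: cone_def)
qed

text \<open>Elementary change of basis: with a replaced by a + b, the coordinate at a passes to a +
  b and is subtracted from the coordinate at b. The new cone is therefore the half where the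
  coordinate at a is the smaller one.\<close>

lemma unimod_star:
assumes A: "unimod A" and a: "a : A" and b: "b : A" and ab: "a ~= b"
shows "a + b ~: A" "unimod (insert (a + b) (A - {a}))" "card (insert (a + b) (A - {a})) = card A"
 "cone (insert (a + b) (A - {a})) = {u : cone A. cf A a u <= cf A b u}"
proof -
let ?c = "a + b" and ?X' = "insert (a + b) (A - {a})"
note fin = umfin[OF A] and ray = cf_ray[OF A] and lin = lin_cf[OF A]
have ac: "cf A a ?c = 1" "cf A b ?c = 1"
 using ray[OF a a] ray[OF a b] ray[OF b a] ray[OF b b] ab lin_add[OF lin[OF a]] lin_add[OF lin[OF b]] by auto
show c: "?c ~: A"
 using ac ray[OF a, of ?c] ray[OF b, of ?c] ab by(auto split: if_splits)
show "card ?X' = card A" using c fin a by(simp add: card_gt_0_iff) (metis Suc_pred card_gt_0_iff empty_iff)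
define D where "D = (%r. if r = ?c then cf A a else if r = b then (%u. cf A b u - cf A a u) else cf A r)"
have cb: "b ~= ?c" using c b by auto
have cr: "cf A r ?c = 0" if "r : A" "r ~= a" "r ~= b" for r
 using ray[OF that(1) a] ray[OF that(1) b] that lin_add[OF lin[OF that(1)]] by auto
have DD: "unimodD ?X' D"
 unfolding unimodD_def
proof(intro conjI ballI)
 show "finite ?X'" using fin by simp
 show "?X' <= V" using um_sub[OF A] a b V_add by auto
 show "lin (D r)" if "r : ?X'" for r
  unfolding D_def using that lin a b by(auto intro: lin_minus)
 show "D r s = (if r = s then 1 else 0)" if "r : ?X'" "s : ?X'" for r s
  using that c cb ac cr ray a b ab unfolding D_def by(auto split: if_splits)
 show "u = (SUM r:?X'. D r u ** r)" if "u : V" for u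
 proof -
  let ?Y = "A - {a} - {b}"
  have "(SUM r:?X'. D r u ** r) = D ?c u ** ?c + (SUM r:A - {a}. D r u ** r)"
   using fin c by simp
  also have "(SUM r:A - {a}. D r u ** r) = D b u ** b + (SUM r:?Y. D r u ** r)"
   using fin b ab by(subst sum.remove[of _ b]) auto
  also have "(SUM r:?Y. D r u ** r) = (SUM r:?Y. cf A r u ** r)"
   by(rule sum.cong) (use c in "auto simp: D_def")
  also have "D ?c u ** ?c + (D b u ** b + (SUM r:?Y. cf A r u ** r)) =
    cf A a u ** a + (cf A b u ** b + (SUM r:?Y. cf A r u ** r))"
   using cb by(simp add: D_def frag_cmul_distrib2 frag_cmul_diff_distrib)
  also have "cf A b u ** b + (SUM r:?Y. cf A r u ** r) = (SUM r:A - {a}. cf A r u ** r)"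
   using fin b ab by(subst (2) sum.remove[of _ b]) auto
  also have "cf A a u ** a + ... = (SUM r:A. cf A r u ** r)"
   using fin a by(subst (2) sum.remove[of _ a]) auto
  finally show ?thesis using cf_expand[OF A that] by simp
 qed
qed
thus X': "unimod ?X'" unfolding unimod_def by blast
have eq: "cf ?X' r u = D r u" if "r : ?X'" "u : V" for r u
 by(rule cf_unique[OF X' that]) (use DD that in "auto simp: unimodD_def")
show "cone ?X' = {u : cone A. cf A a u <= cf A b u}"
proof(intro Set.set_eqI iffI)
 fix u assume "u : cone ?X'"
 hence uV: "u : V" and D: "!!r. r : ?X' ==> 0 <= D r u" by(auto simp: cone_def eq)
 have 1: "0 <= cf A a u" using D[of ?c] by(simp add: D_def)
 have 2: "cf A a u <= cf A b u" using D[of b] b ab cb by(simp add: D_def)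
 have "0 <= cf A r u" if "r : A" "r ~= a" "r ~= b" for r
  using D[of r] that c by(auto simp: D_def split: if_splits)
 with 1 2 uV show "u : {u : cone A. cf A a u <= cf A b u}"
  by(smt (verit) cone_def mem_Collect_eq)
next
 fix u assume u: "u : {u : cone A. cf A a u <= cf A b u}"
 thus "u : cone ?X'" using a b by(auto simp: cone_def eq D_def)
qed
qed

section \<open>Star subdivision of an edge\<close>

definition star :: "vec => vec => vec set set => vec set set" where
"star a b Fa = {A : Fa. ~ {a, b} <= A} Un (%A. insert (a + b) (A - {a})) ` {A : Fa. {a, b} <= A}
 Un (%A. insert (a + b) (A - {b})) ` {A : Fa. {a, b} <= A}"

text \<open>The height at the new ray lies 1 below N times its interpolated value, which folds the
  support function along the cut. On the half without the ray p the new piece is N times the old one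
  minus the coordinate at p.\<close>

lemma fan_star:
assumes F: "fan n C Fa fi" and X0: "X0 : Fa" "a : X0" "b : X0" and ab: "a ~= b"
shows "a + b ~: Union Fa" "EX fi'. fan n C (star a b Fa) fi'"
proof -
note f = fanD[OF F]
let ?c = "a + b"
have aV: "a : V" "b : V" using um_sub[OF f(2)[OF X0(1)]] X0 by auto
have aR: "a : Union Fa" "b : Union Fa" using X0 by auto
have plc: "pl fi A ?c = pl fi A a + pl fi A b" if "A : Fa" for A
 by(rule lin_add[OF lin_pl[OF f(2)[OF that]]])
\<comment> \<open>A ray at a + b in a cone Y would have height \<open>pl\<close> of Y at a plus at
  b, at most \<open>fi a + fi b\<close>. This is the value of the piece of \<open>X0\<close> at a +
  b, which lies strictly below that height.\<close>
show c: "?c ~: Union Fa"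
proof
 assume cR: "?c : Union Fa"
 then obtain Y where Y: "Y : Fa" "?c : Y" by auto
 have "?c ~: X0" using unimod_star(1)[OF f(2)[OF X0(1)] X0(2,3) ab] .
 hence "pl fi X0 ?c < fi ?c" using f(5)[OF X0(1) cR] by simp
 moreover have "pl fi X0 ?c = fi a + fi b"
  using plc[OF X0(1)] pl_ray[OF f(2)[OF X0(1)]] X0 by simp
 moreover have "fi ?c = pl fi Y a + pl fi Y b" using plc[OF Y(1)] pl_ray[OF f(2)[OF Y(1)] Y(2), of fi] by simp
 ultimately show False using f(7)[OF Y(1) aR(1)] f(7)[OF Y(1) aR(2)] by linarith
qed
have finR: "finite (Union Fa)" using f(1,2) umfin by auto
have RV: "Union Fa <= V" using f(2) um_sub by auto
\<comment> \<open>N exceeds all coordinates at a and b. The old gaps, at least N after scaling, thus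
  absorb the coordinate subtracted in the new pieces.\<close>
define N where "N = 2 + (SUM A:Fa. SUM r:Union Fa. abs(cf A a r) + abs(cf A b r))"
have N2: "N >= 2" unfolding N_def by(simp add: sum_nonneg)
have Nb: "abs(cf A a r) < N & abs(cf A b r) < N" if "A : Fa" "r : Union Fa" for A r
proof -
 have 1: "abs(cf A a r) + abs(cf A b r) <= (SUM r:Union Fa. abs(cf A a r) + abs(cf A b r))"
  by(rule member_le_sum[OF that(2)]) (use finR in auto)
 have 2: "(SUM r:Union Fa. abs(cf A a r) + abs(cf A b r)) <= (SUM A:Fa. SUM r:Union Fa. abs(cf A a r) + abs(cf A b r))"
  by(rule member_le_sum[OF that(1), of "%A. SUM r:Union Fa. abs(cf A a r) + abs(cf A b r)"]) (use f(1) in "auto intro: sum_nonneg")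
 show ?thesis using 1 2 unfolding N_def by linarith
qed
define fi' where "fi' = (%r. if r = ?c then N * (fi a + fi b) - 1 else N * fi r)"
have R': "Union (star a b Fa) <= insert ?c (Union Fa)" unfolding star_def by auto
have old: "pl fi' A r < fi' r" if A: "A : Fa" "~ {a, b} <= A" and r: "r : insert ?c (Union Fa)" "r ~: A" for A r
proof -
 have e: "pl fi' A u = N * pl fi A u" for u
  unfolding pl_def sum_distrib_left by(rule sum.cong) (use A c in "auto simp: fi'_def")
 show ?thesis
 proof(cases "r = ?c")
  case True
  have "pl fi A ?c <= fi a + fi b - 1"
   using plc[OF A(1)] f(5,7)[OF A(1) aR(1)] f(5,7)[OF A(1) aR(2)] A(2) by fastforce
  hence "N * pl fi A ?c <= N * (fi a + fi b - 1)" using N2 by simp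
  moreover have "fi' ?c = N * (fi a + fi b) - 1" by(simp add: fi'_def)
  ultimately show ?thesis using N2 unfolding True e right_diff_distrib by linarith
 next
  case False
  hence "pl fi A r < fi r" "fi' r = N * fi r" using r f(5)[OF A(1)] by(auto simp: fi'_def)
  thus ?thesis using N2 unfolding e by simp
 qed
qed
have new: "pl fi' (insert (p + q) (A - {p})) r < fi' r"
 if A: "A : Fa" "p : A" "q : A" and pq: "{p, q} = {a, b}" and r: "r : insert ?c (Union Fa)" "r ~: insert (p + q) (A - {p})" for A p q r
proof -
 have "p ~= q" using pq ab by auto
 have pqc: "p + q = ?c" "fi p + fi q = fi a + fi b" using pq by(auto simp: doubleton_eq_iff add.commute)
 note u = f(2)[OF A(1)]
 let ?X' = "insert (p + q) (A - {p})"
 have rc: "r ~= ?c" "r : Union Fa" "r : V" using r pqc RV by auto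
 have "pl fi' ?X' r = N * pl fi A r - cf A p r"
 proof(rule pl_unique[OF unimod_star(2)[OF u A(2,3) \<open>p ~= q\<close>] rc(3)])
  show "lin (%r. N * pl fi A r - cf A p r)" by(intro lin_minus lin_times lin_pl lin_cf u A)
  fix s assume s: "s : ?X'"
  show "N * pl fi A s - cf A p s = fi' s"
  proof(cases "s = ?c")
   case True
   have "cf A p ?c = 1" using lin_add[OF lin_cf[OF u A(2)], of p q] cf_ray[OF u A(2)] A \<open>p ~= q\<close> by(simp add: pqc(1))
   moreover have "pl fi A ?c = fi a + fi b" using lin_add[OF lin_pl[OF u], of fi p q] pl_ray[OF u] A pqc by simp
   ultimately show ?thesis using True by(simp add: fi'_def)
  next
   case False
   thus ?thesis using s pqc(1) pl_ray[OF u, of s fi] cf_ray[OF u A(2), of s] by(auto simp: fi'_def)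
  qed
 qed
 moreover have "N * pl fi A r - cf A p r < N * fi r"
 proof(cases "r = p")
  case True
  thus ?thesis using pl_ray[OF u A(2)] cf_ray[OF u A(2,2)] by simp
 next
  case False
  hence "r ~: A" using r(2) by auto
  hence "pl fi A r <= fi r - 1" using f(5)[OF A(1) rc(2)] by simp
  hence "N * pl fi A r <= N * (fi r - 1)" using N2 by simp
  moreover have "abs(cf A p r) < N" using Nb[OF A(1) rc(2)] pq by(auto simp: doubleton_eq_iff)
  ultimately show ?thesis by(simp add: right_diff_distrib)
 qed
 ultimately show ?thesis using rc by(simp add: fi'_def)
qed
have st: "insert ?c (A - {b}) = insert (b + a) (A - {b})" for A by(simp add: add.commute)
have "fan n C (star a b Fa) fi'"
 unfolding fan_def
proof(intro conjI)
 show "finite (star a b Fa)" unfolding star_def using f(1) by auto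
 show "ALL A:star a b Fa. unimod A & card A = n & cone A <= C"
 proof
  fix A assume "A : star a b Fa"
  then consider "A : Fa" | Y where "Y : Fa" "a : Y" "b : Y" "A = insert (a + b) (Y - {a})"
   | Y where "Y : Fa" "a : Y" "b : Y" "A = insert (b + a) (Y - {b})"
   unfolding star_def st by auto
  thus "unimod A & card A = n & cone A <= C"
  proof cases
   case 2
   thus ?thesis using unimod_star(2-4)[OF f(2)[OF 2(1)] 2(2,3) ab] f(3,4)[OF 2(1)] by auto
  next
   case 3
   thus ?thesis using unimod_star(2-4)[OF f(2)[OF 3(1)] 3(3,2) ab[symmetric]] f(3,4)[OF 3(1)] by auto
  qed (use f in auto)
 qed
 show "ALL A:star a b Fa. ALL r:Union (star a b Fa) - A. pl fi' A r < fi' r"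
 proof(intro ballI)
  fix A r assume A: "A : star a b Fa" and "r : Union (star a b Fa) - A"
  hence r: "r : insert ?c (Union Fa)" "r ~: A" using R' by auto
  from A consider "A : Fa" "~ {a, b} <= A" | Y where "Y : Fa" "a : Y" "b : Y" "A = insert (a + b) (Y - {a})"
   | Y where "Y : Fa" "a : Y" "b : Y" "A = insert (b + a) (Y - {b})"
   unfolding star_def st by auto
  thus "pl fi' A r < fi' r"
   by cases (use old[OF _ _ r] new[of _ a b r] new[of _ b a r] r in auto)
 qed
 show "C <= (UN A:star a b Fa. cone A)"
 proof
  fix u assume "u : C"
  then obtain A where A: "A : Fa" "u : cone A" using f(6) by blast
  show "u : (UN A:star a b Fa. cone A)"
  proof(cases "{a, b} <= A")
   case False
   thus ?thesis using A by(auto simp: star_def)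
  next
   case True
   hence ab': "a : A" "b : A" by auto
   note 1 = unimod_star(4)[OF f(2)[OF A(1)] ab' ab] and 2 = unimod_star(4)[OF f(2)[OF A(1)] ab'(2,1) ab[symmetric]]
   have "insert ?c (A - {a}) : star a b Fa" "insert (b + a) (A - {b}) : star a b Fa"
    using A True unfolding star_def st by auto
   thus ?thesis using 1 2 A(2) by(smt (verit) UN_I mem_Collect_eq)
  qed
 qed
qed
thus "EX fi'. fan n C (star a b Fa) fi'" by blast
qed

section \<open>Cutting fans along hyperplanes\<close>

definition sgn_const :: "(vec => int) => vec set => bool" where
"sgn_const h A <-> (ALL r:A. 0 <= h r) | (ALL r:A. h r <= 0)"

lemma sgn_const_refine:
assumes "unimod Y" "A <= cone Y" "lin h" "sgn_const h Y"
shows "sgn_const h A"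
proof -
have "0 <= h r" if "ALL r:Y. 0 <= h r" "r : A" for r
 using lin_nn[OF assms(1) _ assms(3)] that assms(2) by blast
moreover have "h r <= 0" if "ALL r:Y. h r <= 0" "r : A" for r
 using lin_nn[OF assms(1) _ lin_uminus[OF assms(3)], of r] that assms(2) by auto
ultimately show ?thesis using assms(4) unfolding sgn_const_def by blast
qed
definition bad :: "(vec => int) => vec set set => (vec \<times> vec) set" where
"bad h Fa = {(a, b). 0 < h a & h b < 0 & (EX A:Fa. a : A & b : A)}"

text \<open>Cut an edge a, b of the largest width W = h a - h b. Since h a + h b lies strictly
  between h b and h a, every crossed edge at the new ray is narrower than W. So the number of edges
  of width W drops, and once there are none W itself drops.\<close>

lemma refine_hyperplane:
assumes h: "lin h"
shows "fan n C Fa fi ==> (!!a b. (a, b) : bad h Fa ==> h a - h b <= int W) ==>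
 EX Fa' fi'. fan n C Fa' fi' & (ALL A:Fa'. EX Y:Fa. A <= cone Y) & (ALL A:Fa'. sgn_const h A)"
proof(induction W arbitrary: Fa fi rule: less_induct)
case (less W)
define top where "top Fa = {(a, b). (a, b) : bad h Fa & h a - h b = int W}" for Fa :: "vec set set"
show ?case using less.prems
proof(induction "card (top Fa)" arbitrary: Fa fi rule: less_induct)
 case inner: less
 note F = inner.prems(1) and W = inner.prems(2)
 note f = fanD[OF F]
 have fb: "finite (bad h Fa)"
  by(rule finite_subset[of _ "Union Fa \<times> Union Fa"]) (use f(1,2) umfin in "auto simp: bad_def")
 consider "bad h Fa = {}" | "bad h Fa ~= {}" "top Fa = {}" | "top Fa ~= {}" by blast
 thus ?case
 proof cases
  case 1
  hence "sgn_const h A" if "A : Fa" for A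
   using that unfolding bad_def sgn_const_def by(smt (verit) Collect_empty_eq case_prodI)
  thus ?thesis using F f(2) ray_cone by(meson subsetI)
 next
  case 2
  have lt: "h a - h b < int W" if "(a, b) : bad h Fa" for a b
   using W[OF that] 2(2) that unfolding top_def by fastforce
  obtain p q where pq: "(p, q) : bad h Fa" using 2(1) by auto
  hence "W > 0" using lt[OF pq] by(auto simp: bad_def)
  hence "h a - h b <= int (W - 1)" if "(a, b) : bad h Fa" for a b
   using lt[OF that] by linarith
  thus ?thesis using less.IH[of "W - 1", OF _ F] \<open>W > 0\<close> by simp
 next
  case 3
  then obtain a b where ab: "(a, b) : bad h Fa" "h a - h b = int W" by(auto simp: top_def)
  then obtain X0 where X0: "X0 : Fa" "a : X0" "b : X0" and s: "0 < h a" "h b < 0" by(auto simp: bad_def)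
  hence "a ~= b" by auto
  note st = fan_star[OF F X0 this]
  obtain fi' where F': "fan n C (star a b Fa) fi'" using st(2) by blast
  have hc: "h (a + b) = h a + h b" by(rule lin_add[OF h])
  have key: "(p, q) : bad h Fa - {(a, b)} | h p - h q < int W" if pq: "(p, q) : bad h (star a b Fa)" for p q
  proof -
   obtain A where A: "A : star a b Fa" "p : A" "q : A" and s': "0 < h p" "h q < 0" using pq by(auto simp: bad_def)
   have nab: "~ (a : A & b : A)" using A(1) st(1) X0 \<open>a ~= b\<close> unfolding star_def by auto
   show ?thesis
   proof(cases "A : Fa")
    case True
    thus ?thesis using A s' nab by(auto simp: bad_def)
   next
    case False
    then obtain Y where Y: "Y : Fa" "a : Y" "b : Y" "A <= insert (a + b) Y" using A(1) unfolding star_def by auto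
    have ne: "~ (p = a + b & q = a + b)" using s' by auto
    have bY: "(a, k) : bad h Fa" if "k : Y" "h k < 0" for k using that Y s by(auto simp: bad_def)
    have bY': "(k, b) : bad h Fa" if "k : Y" "h k > 0" for k using that Y s by(auto simp: bad_def)
    show ?thesis
    proof(cases "p = a + b | q = a + b")
     case False
     hence "p : Y" "q : Y" using A Y by auto
     thus ?thesis using s' Y nab A by(auto simp: bad_def)
    next
     case True
     thus ?thesis
     proof
      assume p: "p = a + b"
      hence "q : Y" using ne A Y by auto
      thus ?thesis using W[OF bY[of q]] s' s hc p ab(2) by auto
     next
      assume q: "q = a + b"
      hence "p : Y" using ne A Y by auto
      thus ?thesis using W[OF bY'[of p]] s' s hc q ab(2) by auto
     qed
    qed
   qed
  qed
  have ft: "finite (top Fa)" unfolding top_def by(rule finite_subset[OF _ fb]) auto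
  have "top (star a b Fa) <= top Fa - {(a, b)}" using key unfolding top_def by fastforce
  moreover have "(a, b) : top Fa" using ab by(simp add: top_def)
  ultimately have "card (top (star a b Fa)) < card (top Fa)"
   using ft by(metis Diff_subset card_mono card_Diff1_less finite_Diff le_less_trans)
  moreover have "h p - h q <= int W" if "(p, q) : bad h (star a b Fa)" for p q
   using key[OF that] W[of p q] by auto
  ultimately obtain Fa' fi'' where S: "fan n C Fa' fi''" "ALL A:Fa'. EX Y:star a b Fa. A <= cone Y" "ALL A:Fa'. sgn_const h A"
   using inner.hyps[OF _ F'] by meson
  have "EX Z:Fa. cone Y <= cone Z" if "Y : star a b Fa" for Y
  proof -
   from that consider "Y : Fa" | Z where "Z : Fa" "a : Z" "b : Z" "Y = insert (a + b) (Z - {a})"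
    | Z where "Z : Fa" "a : Z" "b : Z" "Y = insert (b + a) (Z - {b})"
    unfolding star_def by(auto simp: add.commute)
   thus ?thesis
    by cases (use unimod_star(4)[OF f(2) _ _ \<open>a ~= b\<close>] unimod_star(4)[OF f(2) _ _ \<open>a ~= b\<close>[symmetric]] in blast)+
  qed
  thus ?thesis using S by(meson order_trans)
 qed
qed
qed

text \<open>The coordinate orthants. Height 1 on all rays gives the l1 norm as support function: on
  a cone that lacks r but contains -r the linear piece takes the value -1 at r.\<close>

lemma orthant_fan:
assumes A: "unimod A"
shows "EX Fa. fan (card A) V Fa (%_. 1)"
proof -
note fin = umfin[OF A] and ray = cf_ray[OF A] and lin = lin_cf[OF A]
define O' where "O' S = (A - S) Un uminus ` S" for S
have nz: "r ~= 0" if "r : A" for r using ray[OF that that] lin_0[OF lin[OF that]] by auto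
have neq: "r ~= - s" if "r : A" "s : A" for r s
 using ray[OF that(2,1)] ray[OF that(2,2)] lin_neg[OF lin[OF that(2)], of s] by(auto split: if_splits)
have dj: "(A - S) Int uminus ` S = {}" if "S <= A" for S using that neq by fastforce
have U: "unimodD (O' S) (%r. if r : A - S then cf A r else (%u. - cf A (- r) u))" (is "unimodD _ ?D") if S: "S <= A" for S
 unfolding unimodD_def
proof(intro conjI ballI)
 have fS: "finite S" using S fin finite_subset by blast
 show "finite (O' S)" using fin fS by(simp add: O'_def)
 show "O' S <= V" using um_sub[OF A] S V_neg by(auto simp: O'_def)
 show "lin (?D r)" if "r : O' S" for r
 proof(cases "r : A - S")
  case False
  hence "- r : A" using that S by(auto simp: O'_def)
  hence "lin (%u. - cf A (- r) u)" by(intro lin_uminus lin)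
  thus ?thesis by(simp only: False if_False)
 qed (use lin in auto)
 show "?D r s = (if r = s then 1 else 0)" if "r : O' S" "s : O' S" for r s
  using that S neq ray lin_neg[OF lin] by(auto simp: O'_def subset_iff)
 fix u assume u: "u : V"
 have "(SUM r:O' S. ?D r u ** r) = (SUM r:A - S. ?D r u ** r) + (SUM r:uminus ` S. ?D r u ** r)"
  unfolding O'_def by(rule sum.union_disjoint) (use fin fS dj[OF S] in auto)
 also have "(SUM r:uminus ` S. ?D r u ** r) = (SUM r:S. cf A r u ** r)"
 proof(subst sum.reindex)
  show "sum ((%r. ?D r u ** r) \<circ> uminus) S = (SUM r:S. cf A r u ** r)"
  proof(rule sum.cong)
   fix r assume "r : S"
   hence "- r ~: A - S" using neq[of r "- r"] S by auto
   thus "((%r. ?D r u ** r) \<circ> uminus) r = cf A r u ** r"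
    by(simp only: comp_def if_False minus_minus sc_neg_neg)
  qed simp
 qed (auto simp: inj_on_def)
 also have "(SUM r:A - S. ?D r u ** r) = (SUM r:A - S. cf A r u ** r)" by(rule sum.cong) auto
 also have "... + (SUM r:S. cf A r u ** r) = (SUM r:A. cf A r u ** r)"
  by(rule sum.subset_diff[OF S fin, symmetric])
 finally show "u = (SUM r:O' S. ?D r u ** r)" using cf_expand[OF A u] by simp
qed
have UU: "unimod (O' S)" if "S <= A" for S using U[OF that] unfolding unimod_def by blast
have cfO: "cf (O' S) r u = (if r : A - S then cf A r u else - cf A (- r) u)" if "S <= A" "r : O' S" "u : V" for S r u
proof -
 have "cf (O' S) r u = (if r : A - S then cf A r else (%u. - cf A (- r) u)) u"
 proof(rule cf_unique[OF UU[OF that(1)] that(2,3)])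
  note U' = U[OF that(1), unfolded unimodD_def]
  show "lin (if r : A - S then cf A r else (%u. - cf A (- r) u))" using U' that(2) by blast
  show "(if r : A - S then cf A r else (%u. - cf A (- r) u)) s = (if r = s then 1 else 0)" if "s : O' S" for s
   using U' that \<open>r : O' S\<close> by blast
 qed
 thus ?thesis by simp
qed
have "fan (card A) V (O' ` Pow A) (%_. 1)"
 unfolding fan_def
proof(intro conjI)
 show "finite (O' ` Pow A)" using fin by simp
 show "ALL Y:O' ` Pow A. unimod Y & card Y = card A & cone Y <= V"
 proof
  fix Y assume "Y : O' ` Pow A"
  then obtain S where S: "S <= A" "Y = O' S" by auto
  have "card (O' S) = card (A - S) + card (uminus ` S)" unfolding O'_def
   by(rule card_Un_disjoint) (use fin S dj[OF S(1)] finite_subset[OF S(1) fin] in auto)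
  also have "card (uminus ` S) = card S" by(rule card_image) auto
  also have "card (A - S) + card S = card A" using S fin by(metis add.commute card_Diff_subset card_mono finite_subset le_add_diff_inverse)
  finally show "unimod Y & card Y = card A & cone Y <= V" using S UU by(auto simp: cone_def)
 qed
 show "ALL Y:O' ` Pow A. ALL r:Union (O' ` Pow A) - Y. pl (%_. 1) Y r < 1"
 proof(intro ballI)
  fix Y r assume "Y : O' ` Pow A" "r : Union (O' ` Pow A) - Y"
  then obtain S T where S: "S <= A" "Y = O' S" and T: "T <= A" "r : O' T" and nr: "r ~: O' S" by blast
  have r: "r : A Un uminus ` A" "r ~: O' S" using T nr by(auto simp: O'_def)
  have mr: "- r : O' S" using r S by(auto simp: O'_def)
  have "pl (%_. 1) Y (- (- r)) = - pl (%_. 1) Y (- r)" using lin_neg[OF lin_pl[OF UU[OF S(1)]]] S by simp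
  also have "pl (%_. 1) Y (- r) = 1" using pl_ray[OF UU[OF S(1)] mr] S by simp
  finally show "pl (%_. 1) Y r < 1" by simp
 qed
 show "V <= (UN Y:O' ` Pow A. cone Y)"
 proof
  fix u assume u: "u : V"
  define S where "S = {r : A. cf A r u < 0}"
  have S: "S <= A" by(auto simp: S_def)
  have "0 <= cf (O' S) r u" if "r : O' S" for r
   using cfO[OF S that u] that neq by(auto simp: O'_def S_def)
  hence "u : cone (O' S)" using u by(simp add: cone_def)
  thus "u : (UN Y:O' ` Pow A. cone Y)" using S by blast
 qed
qed
thus ?thesis by blast
qed

lemma fan_hyperplanes:
assumes "unimod A" "finite H" "!!h. h : H ==> lin h"
shows "EX Fa fi. fan (card A) V Fa fi & (ALL h:H. ALL Y:Fa. sgn_const h Y)"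
using assms(2,3)
proof(induction H rule: finite_induct)
case empty
thus ?case using orthant_fan[OF assms(1)] by auto
next
case (insert h H)
then obtain Fa fi where F: "fan (card A) V Fa fi" and s: "ALL h:H. ALL Y:Fa. sgn_const h Y" by auto
note f = fanD[OF F]
have fb: "finite (bad h Fa)"
 by(rule finite_subset[of _ "Union Fa \<times> Union Fa"]) (use f(1,2) umfin in "auto simp: bad_def")
define W where "W = nat (SUM p:bad h Fa. abs(h (fst p) - h (snd p)))"
have "h a - h b <= int W" if "(a, b) : bad h Fa" for a b
proof -
 have "abs(h (fst (a, b)) - h (snd (a, b))) <= (SUM p:bad h Fa. abs(h (fst p) - h (snd p)))"
  by(rule member_le_sum[OF that, of "%p. abs(h (fst p) - h (snd p))"]) (simp_all add: fb)
 thus ?thesis unfolding W_def by simp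
qed
then obtain Fa' fi' where F': "fan (card A) V Fa' fi'" "ALL A:Fa'. EX Y:Fa. A <= cone Y" "ALL A:Fa'. sgn_const h A"
 using refine_hyperplane[OF insert.prems[of h] F, of W] by auto
have "sgn_const g Y" if "g : H" "Y : Fa'" for g Y
 using F'(2) that sgn_const_refine[OF f(2), of _ Y g] s insert.prems by blast
thus ?case using F' by blast
qed

text \<open>Of a fan of the whole lattice cut by all of \<open>H\<close>, keep the cones on the
  nonnegative side. They still cover the region: some cone contains k u + m for infinitely many k,
  hence u, and as each h is positive at k u + m this cone lies on the right side.\<close>

theorem region_fan:
assumes A: "unimod A" and H: "finite H" "!!h. h : H ==> lin h"
 and m: "m : V" "!!h. h : H ==> 0 < h m"
shows "EX Fa fi. fan (card A) {u : V. ALL h:H. 0 <= h u} Fa fi"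
proof -
let ?C = "{u : V. ALL h:H. 0 <= h u}"
obtain Fa fi where F: "fan (card A) V Fa fi" and s: "ALL h:H. ALL Y:Fa. sgn_const h Y"
 using fan_hyperplanes[OF A H] by blast
note f = fanD[OF F]
define Fa' where "Fa' = {Y : Fa. ALL h:H. ALL r:Y. 0 <= h r}"
have "fan (card A) ?C Fa' fi"
 unfolding fan_def
proof(intro conjI)
 show "finite Fa'" using f(1) by(simp add: Fa'_def)
 show "ALL A:Fa'. ALL r:Union Fa' - A. pl fi A r < fi r" using f(5) unfolding Fa'_def by blast
 show "ALL Y:Fa'. unimod Y & card Y = card A & cone Y <= ?C"
 proof(intro ballI conjI subsetI)
  fix Y u assume Y: "Y : Fa'" and u: "u : cone Y"
  have "0 <= h u" if "h : H" for h
   by(rule lin_nn[OF f(2) u H(2)[OF that]]) (use Y that in "auto simp: Fa'_def")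
  thus "u : ?C" using u by(auto simp: cone_def)
 qed (use f in "auto simp: Fa'_def")
 show "?C <= (UN Y:Fa'. cone Y)"
 proof
  fix u assume u: "u : ?C"
  have "ALL k::nat. EX Y:Fa. int k ** u + m : cone Y" using f(6) u m V_add V_sc by auto
  then obtain Y where Y: "!!k. Y k : Fa" "!!k::nat. int k ** u + m : cone (Y k)" by metis
  have "finite (range Y)" using Y(1) f(1) by(meson finite_subset image_subsetI)
  then obtain k0 where "infinite {k. Y k = Y k0}"
   using pigeonhole_infinite[of "UNIV :: nat set" Y] by auto
  define Z where "Z = Y k0"
  have inf: "infinite {k. Y k = Z}" using \<open>infinite {k. Y k = Y k0}\<close> Z_def by simp
  have Z: "Z : Fa" using Y Z_def by auto
  note uZ = f(2)[OF Z]
  have "0 <= h r" if "h : H" "r : Z" for h r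
  proof -
   have "0 < h (int k0 ** u + m)"
    using u m(2)[OF that(1)] that H(2) by(simp add: lin_add lin_sc add_nonneg_pos)
   moreover have "h (int k0 ** u + m) <= 0" if "ALL r:Z. h r <= 0"
    using lin_nn[OF uZ _ lin_uminus[OF H(2)[OF \<open>h : H\<close>]], of "int k0 ** u + m"] Y(2)[of k0] that Z_def by auto
   ultimately show ?thesis using s Z that unfolding sgn_const_def by force
  qed
  hence "Z : Fa'" using Z by(auto simp: Fa'_def)
  moreover have "0 <= cf Z r u" if "r : Z" for r
  proof(rule nonneg_limit[OF inf])
   fix k assume "k : {k. Y k = Z}"
   hence "0 <= cf Z r (int k ** u + m)" using Y(2)[of k] that by(auto simp: cone_def)
   thus "0 <= int k * cf Z r u + cf Z r m" by(simp add: lin_add[OF lin_cf[OF uZ that]] lin_sc[OF lin_cf[OF uZ that]])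
  qed
  ultimately show "u : (UN Y:Fa'. cone Y)" using u by(auto simp: cone_def)
 qed
qed
thus ?thesis by blast
qed
end

section \<open>Barycentric refinement\<close>

text \<open>The initial segment has the least sum of all sets of its size; this is the source of
  strict convexity inside one cone of the barycentric subdivision.\<close>

lemma sum_distinct_nat_less:
assumes "finite K" "K ~= {..<card K}"
shows "(SUM k<card K. k) < (SUM k:K. k)"
proof -
define m where "m = card K"
let ?P = "K - {..<m}" and ?Q = "{..<m} - K"
have fin: "finite ?P" "finite ?Q" using assms(1) by auto
have "card K = card (K Int {..<m}) + card ?P" using assms(1) by(simp add: card_Int_Diff)
moreover have "card {..<m} = card ({..<m} Int K) + card ?Q" by(rule card_Int_Diff) simp
ultimately have c: "card ?P = card ?Q" by(simp add: m_def Int_commute)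
have ne: "card ?Q > 0"
proof(rule ccontr)
 assume "~ card ?Q > 0"
 hence "{..<m} <= K" using fin(2) by auto
 hence "{..<m} = K" by(rule card_subset_eq[OF assms(1)]) (simp add: m_def)
 thus False using assms(2) m_def by simp
qed
hence "m > 0" by(cases m) auto
have "(SUM k:?Q. k) <= of_nat (card ?Q) * (m - 1)" by(rule sum_bounded_above) auto
moreover have "card ?Q * (m - 1) < card ?Q * m" using ne \<open>m > 0\<close> by simp
moreover have "of_nat (card ?P) * m <= (SUM k:?P. k)" by(rule sum_bounded_below) auto
ultimately have "(SUM k:?Q. k) < (SUM k:?P. k)" unfolding c of_nat_id by linarith
moreover have "(SUM k:K. k) = (SUM k:K Int {..<m}. k) + (SUM k:?P. k)"
 using assms(1) by(subst sum.Int_Diff[of K _ "{..<m}"]) auto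
moreover have "(SUM k<m. k) = (SUM k:{..<m} Int K. k) + (SUM k:?Q. k)"
 by(subst sum.Int_Diff[of "{..<m}" _ K]) auto
ultimately show ?thesis by(simp add: m_def[symmetric] Int_commute)
qed
context lattice_vec
begin

lemma unimod_indexed:
assumes b: "!!k. k < n ==> b k : V" and D: "!!k. k < n ==> lin (D k)"
 "!!j k. j < n ==> k < n ==> D k (b j) = (if k = j then 1 else 0)"
 "!!u. u : V ==> u = (SUM k<n. D k u ** b k)"
shows "unimod (b ` {..<n})" "card (b ` {..<n}) = n"
 "k < n ==> u : V ==> cf (b ` {..<n}) (b k) u = D k u"
proof -
have inj: "inj_on b {..<n}"
proof(rule inj_onI)
 fix j k assume h: "j : {..<n}" "k : {..<n}" "b j = b k"
 hence "D k (b j) = 1" using D(2)[of k k] by auto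
 thus "j = k" using D(2)[of j k] h by(auto split: if_splits)
qed
thus "card (b ` {..<n}) = n" by(simp add: card_image)
define E where "E r = D (the_inv_into {..<n} b r)" for r
have E: "E (b k) = D k" if "k < n" for k using the_inv_into_f_f[OF inj, of k] that by(simp add: E_def)
have "unimodD (b ` {..<n}) E"
 unfolding unimodD_def
proof(intro conjI ballI)
 show "b ` {..<n} <= V" using b by auto
 show "lin (E r)" if "r : b ` {..<n}" for r using that E D(1) by auto
 show "E r s = (if r = s then 1 else 0)" if "r : b ` {..<n}" "s : b ` {..<n}" for r s
  using that E D(2) inj by(auto simp: inj_on_eq_iff)
 show "u = (SUM r:b ` {..<n}. E r u ** r)" if "u : V" for u
  using D(3)[OF that] E by(simp add: sum.reindex[OF inj])
qed simp
thus u: "unimod (b ` {..<n})" unfolding unimod_def by blast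
show "cf (b ` {..<n}) (b k) u = D k u" if "k < n" "u : V"
 by(rule cf_unique[OF u]) (use that D inj in "auto simp: inj_on_eq_iff")
qed

text \<open>As b k is the sum of the first k + 1 rays, its dual coordinate is the difference of two
  consecutive coordinates, and the cone is the chamber of weakly decreasing coordinates. Extending
  \<open>e\<close> by 0 beyond the list lets the last coordinate obey the same formula.\<close>

lemma bary_cone:
assumes A: "unimod A" and xs: "distinct xs" "set xs = A"
defines "n == length xs" and "b == %k. SUM l<Suc k. xs ! l"
 and "e == %k u. if k < length xs then cf A (xs ! k) u else 0"
shows "unimod (b ` {..<n})" "card (b ` {..<n}) = n" "b ` {..<n} <= cone A"
 "!!k u. k < n ==> u : V ==> cf (b ` {..<n}) (b k) u = e k u - e (Suc k) u"
 "!!k j. k < n ==> j < n ==> e k (b j) = (if k <= j then 1 else 0)"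
proof -
have mem: "xs ! k : A" if "k < n" for k using that xs n_def by auto
have le: "lin (e k)" for k
 unfolding e_def using lin_cf[OF A, of "xs ! k"] mem[of k] n_def by(cases "k < length xs") (auto simp: lin_def)
have e1: "e k (xs ! l) = (if k = l then 1 else 0)" if "k < n" "l < n" for k l
 using that cf_ray[OF A mem mem] xs by(auto simp: e_def n_def nth_eq_iff_index_eq)
show e2: "e k (b j) = (if k <= j then 1 else 0)" if "k < n" "j < n" for k j
proof -
 have "e k (b j) = (SUM l<Suc j. e k (xs ! l))" unfolding b_def by(rule lin_sum[OF le])
 also have "... = (SUM l<Suc j. if l = k then 1 else 0)" by(rule sum.cong) (use that e1 in auto)
 also have "... = (if k <= j then 1 else 0)" by(subst sum.delta) auto
 finally show ?thesis .
qed
have e2n: "e n u = 0" for u by(simp add: e_def n_def)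
have bV: "b k : V" if "k < n" for k
 unfolding b_def using that um_sub[OF A] mem by(intro V_sum) auto
have Dl: "lin (%u. e k u - e (Suc k) u)" for k by(intro lin_minus le)
have Db: "e k (b j) - e (Suc k) (b j) = (if k = j then 1 else 0)" if "j < n" "k < n" for j k
 using e2[OF that(2,1)] e2[of "Suc k" j] that e2n by(cases "Suc k = n") auto
have ex: "u = (SUM k<n. (e k u - e (Suc k) u) ** b k)" if "u : V" for u
proof -
 have P: "m <= n ==> (SUM k<m. (e k u - e (Suc k) u) ** b k) = (SUM k<m. e k u ** xs ! k) - e m u ** (SUM l<m. xs ! l)" for m
 proof(induction m)
  case (Suc m)
  thus ?case by(simp add: b_def frag_cmul_diff_distrib frag_cmul_distrib2 del: minus_frag_cmul)
 qed simp
 have "(SUM k<n. e k u ** xs ! k) = (SUM k<n. cf A (xs ! k) u ** xs ! k)"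
  by(rule sum.cong) (auto simp: e_def n_def)
 also have "... = (SUM r:A. cf A r u ** r)"
  unfolding xs(2)[symmetric] n_def lessThan_atLeast0
  by(rule sum.reindex_bij_betw[OF bij_betw_nth[OF xs(1)], of "{0..<length xs}" "set xs" "%r. cf (set xs) r u ** r"]) auto
 finally show ?thesis using P[of n] e2n cf_expand[OF A that] by simp
qed
note U = unimod_indexed[of n b "%k u. e k u - e (Suc k) u", OF bV Dl Db ex]
show "unimod (b ` {..<n})" "card (b ` {..<n}) = n" using U(1,2) by auto
show "cf (b ` {..<n}) (b k) u = e k u - e (Suc k) u" if "k < n" "u : V" for k u by(rule U(3)) (use that in auto)
show "b ` {..<n} <= cone A"
proof
 fix r assume "r : b ` {..<n}"
 then obtain j where j: "j < n" "r = b j" by auto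
 have "0 <= cf A s r" if "s : A" for s
 proof -
  from \<open>s : A\<close> obtain k where k: "k < n" "s = xs ! k" unfolding n_def xs(2)[symmetric] by(auto simp: in_set_conv_nth)
  thus ?thesis using e2[OF k(1) j(1)] j(2) by(auto simp: e_def n_def split: if_splits)
 qed
 thus "r : cone A" using bV j by(simp add: cone_def)
qed
qed

text \<open>The sum of the rays of a face lies in its relative interior, so strict convexity gives
  it the same support in every cone that contains it. Hence the face can be read off from the
  vector, whichever cone is used.\<close>

lemma face_support:
assumes F: "fan n C Fa fi" and A: "A : Fa" "G <= A" and B: "B : Fa" "\<Sum>G : cone B"
shows "{r : B. 0 < cf B r (\<Sum>G)} = G"
proof -
note f = fanD[OF F] and uA = fanD(2)[OF F A(1)] and uB = fanD(2)[OF F B(1)]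
have cfG: "cf Z r (\<Sum>G) = (if r : G then 1 else 0)" if "unimod Z" "r : Z" "G <= Z" for Z r
proof -
 have "cf Z r (\<Sum>G) = (SUM s:G. cf Z r s)" using lin_sum[OF lin_cf[OF that(1,2)], of id G] by simp
 also have "... = (SUM s:G. if s = r then 1 else 0)" by(rule sum.cong) (use that cf_ray[OF that(1,2)] in auto)
 also have "... = (if r : G then 1 else 0)" using finite_subset[OF that(3) umfin[OF that(1)]] by simp
 finally show ?thesis .
qed
have GV: "\<Sum>G : V" using B(2) by(simp add: cone_def)
have GA: "\<Sum>G : cone A" using GV cfG[OF uA _ A(2)] by(auto simp: cone_def)
have e: "pl fi B (\<Sum>G) = pl fi A (\<Sum>G)"
 using fan_convex(1)[OF F A(1) B(1) B(2)] fan_convex(1)[OF F B(1) A(1) GA] by simp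
have "G <= B"
 using fan_convex(3)[OF F B(1) A(1) GA e] cfG[OF uA _ A(2)] A(2) by fastforce
hence "0 < cf B r (\<Sum>G) <-> r : G" if "r : B" for r using cfG[OF uB that] by simp
thus ?thesis using \<open>G <= B\<close> by blast
qed

text \<open>The rays are the sums of faces, coloured by the number of rays of the face minus 1. A
  maximal chain of faces has each number once, so every cone gets each colour once; this is what
  makes the elements \<open>tht\<close> below a system of parameters.\<close>

theorem barycentric_fan:
assumes F: "fan n C Fa fi"
shows "EX Fa' fi' col. fan n C Fa' fi' & (ALL A:Fa'. bij_betw col A {..<n})"
proof -
note f = fanD[OF F]
define L where "L = {xs. distinct xs & set xs : Fa}"
define b where "b = (%xs k. SUM l<Suc k. xs ! l :: vec)"
define e where "e = (%xs k u. if k < length xs then cf (set xs) (xs ! k) u else 0)"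
have len: "length xs = n" if "xs : L" for xs
 using that f(3)[of "set xs"] distinct_card[of xs] by(auto simp: L_def)
have L: "distinct xs" "set xs : Fa" "unimod (set xs)" if "xs : L" for xs using that f(2) by(auto simp: L_def)
have finR: "finite (Union Fa)" using f(1,2) umfin by auto
have finL: "finite L"
 by(rule finite_subset[OF _ finite_lists_length_eq[OF finR, of n]]) (use len L(2) in blast)
define T where "T xs = b xs ` {..<n}" for xs
note bc = bary_cone[OF L(3) L(1) refl, unfolded len, folded b_def e_def]
have bc: "unimod (T xs)" "card (T xs) = n" "T xs <= cone (set xs)"
 "!!k u. k < n ==> u : V ==> cf (T xs) (b xs k) u = e xs k u - e xs (Suc k) u"
 "!!k j. k < n ==> j < n ==> e xs k (b xs j) = (if k <= j then 1 else 0)" if "xs : L" for xs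
 using bary_cone[OF L(3)[OF that] L(1)[OF that] refl] len[OF that] unfolding T_def b_def e_def by auto
define supp where "supp u = {r. EX A:Fa. u : cone A & r : A & 0 < cf A r u}" for u
have bsum: "b xs k = \<Sum>(set (take (Suc k) xs))" if "xs : L" "k < n" for xs k
proof -
 have "b xs k = sum_list (take (Suc k) xs)" unfolding b_def using that len[OF that(1)]
  by(simp add: sum_list_sum_nth atLeast0LessThan)
 also have "... = \<Sum>(set (take (Suc k) xs))"
  using sum_list_distinct_conv_sum_set[of "take (Suc k) xs" id] distinct_take[OF L(1)[OF that(1)], of "Suc k"] by simp
 finally show ?thesis .
qed
have supp: "supp (\<Sum>G) = G" if "A : Fa" "G <= A" "\<Sum>G : cone A" for A G
 using face_support[OF F that(1,2)] that(1,3) unfolding supp_def by blast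
have bcone: "b xs k : cone (set xs)" if "xs : L" "k < n" for xs k using bc(3)[OF that(1)] that(2) T_def by auto
have suppb: "supp (b xs k) = set (take (Suc k) xs)" if "xs : L" "k < n" for xs k
 using supp[OF L(2)[OF that(1)] set_take_subset[of "Suc k"]] bcone[OF that] bsum[OF that] by metis
have cardb: "card (supp (b xs k)) = Suc k" if "xs : L" "k < n" for xs k
 unfolding suppb[OF that] using L(1)[OF that(1)] len[OF that(1)] that(2) by(simp add: distinct_card)
\<comment> \<open>Decreasing weights bend the function inside one cone: \<open>g xs\<close> is
  linear with values \<open>wt\<close> on the ordered rays, and prefixes of the order have the
  largest total weight for their size. The factor \<open>N\<close> in \<open>fi'\<close> lets the
  old support function decide between different cones.\<close>
define wt where "wt k = int n - int k" for k
define g where "g xs u = (SUM k<n. wt k * e xs k u)" for xs u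
define N where "N = 1 + (SUM xs:L. SUM r:Union Fa. abs(g xs r))"
define fi' where "fi' u = N * (SUM r:supp u. fi r) + (SUM k<card (supp u). wt k)" for u
have le: "lin (e xs k)" if "xs : L" for xs k
 unfolding e_def using lin_cf[OF L(3)[OF that]] by(cases "k < length xs") (auto simp: lin_def)
have lg: "lin (g xs)" if "xs : L" for xs unfolding g_def using le[OF that] by(intro lin_Sum lin_times) auto
have gr: "g xs (xs ! k) = wt k" if "xs : L" "k < n" for xs k
proof -
 have "g xs (xs ! k) = (SUM j<n. if j = k then wt j else 0)" unfolding g_def e_def
  by(rule sum.cong) (use that len[OF that(1)] cf_ray[OF L(3)[OF that(1)]] L(1)[OF that(1)] in "auto simp: nth_eq_iff_index_eq")
 thus ?thesis using that by simp
qed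
have pl': "pl fi' (T xs) u = N * pl fi (set xs) u + g xs u" if "xs : L" "u : V" for xs u
proof(rule pl_unique[OF bc(1)[OF that(1)] that(2)])
 show "lin (%u. N * pl fi (set xs) u + g xs u)" by(intro lin_plus lin_times lin_pl L(3) lg that(1))
 fix r assume "r : T xs"
 then obtain k where k: "k < n" "r = b xs k" by(auto simp: T_def)
 have tk: "set (take (Suc k) xs) <= set xs" by(rule set_take_subset)
 have s: "r = \<Sum>(supp r)" using bsum[OF that(1) k(1)] suppb[OF that(1) k(1)] k by simp
 have "pl fi (set xs) r = (SUM s:supp r. pl fi (set xs) s)"
  using lin_sum[OF lin_pl[OF L(3)[OF that(1)]], of fi id "supp r"] s by simp
 also have "... = (SUM s:supp r. fi s)"
  by(rule sum.cong) (use pl_ray[OF L(3)[OF that(1)]] suppb[OF that(1) k(1)] k tk in auto)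
 finally have 1: "pl fi (set xs) r = (SUM s:supp r. fi s)" .
 have "g xs r = (SUM l<Suc k. g xs (xs ! l))" unfolding k b_def by(rule lin_sum[OF lg[OF that(1)]])
 also have "... = (SUM l<Suc k. wt l)" by(rule sum.cong) (use gr that k in auto)
 finally have 2: "g xs r = (SUM l<Suc k. wt l)" .
 show "N * pl fi (set xs) r + g xs r = fi' r" unfolding fi'_def 1 2 using cardb[OF that(1) k(1)] k by simp
qed
have strict: "pl fi' (T xs) r < fi' r" if xs: "xs : L" and ys: "ys : L" "j < n" and r: "r = b ys j" "r ~: T xs" for xs ys j r
proof -
 let ?G = "set (take (Suc j) ys)"
 have Gs: "supp r = ?G" "r = \<Sum>?G" using suppb[OF ys] bsum[OF ys] r by auto
 have Gy: "?G <= set ys" by(rule set_take_subset)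
 hence GR: "?G <= Union Fa" using L(2)[OF ys(1)] by auto
 have rV: "r : V" using bcone[OF ys] r by(simp add: cone_def)
 have cG: "card ?G = Suc j" using cardb[OF ys] suppb[OF ys] by simp
 have plr: "pl fi (set xs) r = (SUM s:?G. pl fi (set xs) s)"
  using lin_sum[OF lin_pl[OF L(3)[OF xs]], of fi id ?G] Gs(2) by simp
 have gG: "g xs r = (SUM s:?G. g xs s)" using lin_sum[OF lg[OF xs], of id ?G] Gs(2) by simp
 have ph: "fi' r = N * (SUM s:?G. fi s) + (SUM k<Suc j. wt k)" unfolding fi'_def Gs(1) cG by simp
 have N1: "N >= 1" unfolding N_def by(simp add: sum_nonneg)
 show ?thesis
 proof(cases "?G <= set xs")
  case True
  define K where "K = {k. k < n & xs ! k : ?G}"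
  have KG: "(%k. xs ! k) ` K = ?G" unfolding K_def using True len[OF xs] by(force simp: in_set_conv_nth[of _ xs])
  have inj: "inj_on (%k. xs ! k) K" unfolding inj_on_def K_def
   using L(1)[OF xs] len[OF xs] by(auto simp: nth_eq_iff_index_eq)
  have cK: "card K = Suc j" using card_image[OF inj] KG cG by simp
  have fK: "finite K" by(simp add: K_def)
  have "K ~= {..<Suc j}"
  proof
   assume "K = {..<Suc j}"
   hence "r = b xs j" unfolding Gs(2) KG[symmetric] b_def by(subst sum.reindex[OF inj]) (simp_all)
   thus False using r(2) ys(2) by(simp add: T_def)
  qed
  hence "(SUM k<Suc j. k) < (SUM k:K. k)" using sum_distinct_nat_less[OF fK] cK by simp
  hence "int (SUM k<Suc j. k) < int (SUM k:K. k)" by(simp only: of_nat_less_iff)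
  hence "(SUM k:K. wt k) < (SUM k<Suc j. wt k)" using cK
   by(simp add: wt_def sum_subtractf int_sum del: sum.lessThan_Suc)
  moreover have "g xs r = (SUM k:K. wt k)" unfolding gG KG[symmetric]
   by(subst sum.reindex[OF inj]) (use gr xs in "auto simp: K_def intro!: sum.cong")
  moreover have "(SUM s:?G. pl fi (set xs) s) = (SUM s:?G. fi s)"
   by(rule sum.cong) (use pl_ray[OF L(3)[OF xs]] True in auto)
  ultimately show ?thesis unfolding pl'[OF xs rV] plr ph by simp
 next
  case False
  then obtain s where s: "s : ?G" "s ~: set xs" by auto
  have "(SUM s:?G. pl fi (set xs) s) < (SUM s:?G. fi s)"
  proof(rule sum_strict_mono_ex1)
   show "ALL s:?G. pl fi (set xs) s <= fi s" using f(7)[OF L(2)[OF xs]] GR by blast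
   show "EX s:?G. pl fi (set xs) s < fi s" using f(5)[OF L(2)[OF xs]] s GR by blast
  qed simp
  hence "N * (SUM s:?G. pl fi (set xs) s) <= N * ((SUM s:?G. fi s) - 1)" using N1 by(intro mult_left_mono) auto
  moreover have "abs(g xs r) < N"
  proof -
   have "abs(g xs r) <= (SUM s:?G. abs(g xs s))" unfolding gG by(rule sum_abs)
   moreover have "(SUM s:?G. abs(g xs s)) <= (SUM s:Union Fa. abs(g xs s))" by(rule sum_mono2[OF finR GR]) auto
   moreover have "(SUM s:Union Fa. abs(g xs s)) <= (SUM xs:L. SUM r:Union Fa. abs(g xs r))"
    by(rule member_le_sum[OF xs, of "%xs. SUM r:Union Fa. abs(g xs r)"]) (simp_all add: finL sum_nonneg)
   ultimately show ?thesis unfolding N_def by linarith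
  qed
  moreover have "0 <= (SUM k<Suc j. wt k)" using ys(2) by(intro sum_nonneg) (auto simp: wt_def)
  ultimately show ?thesis unfolding pl'[OF xs rV] plr ph by(simp add: right_diff_distrib)
 qed
qed
have "fan n C (T ` L) fi'"
 unfolding fan_def
proof(intro conjI)
 show "finite (T ` L)" using finL by simp
 show "ALL A:T ` L. unimod A & card A = n & cone A <= C"
  using bc(1,2) cone_trans[OF bc(1) L(3) bc(3)] f(4)[OF L(2)] by fastforce
 show "ALL A:T ` L. ALL r:Union (T ` L) - A. pl fi' A r < fi' r"
  using strict unfolding T_def by blast
 show "C <= (UN A:T ` L. cone A)"
 proof
  fix u assume "u : C"
  then obtain A where A: "A : Fa" "u : cone A" using f(6) by blast
  obtain as where as: "set as = A" "distinct as" using finite_distinct_list[OF umfin[OF f(2)[OF A(1)]]] by blast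
  define xs where "xs = sort_key (%r. - cf A r u) as"
  have xs: "set xs = A" "distinct xs" "sorted (map (%r. - cf A r u) xs)" using as by(auto simp: xs_def)
  have xL: "xs : L" using xs A by(simp add: L_def)
  have uV: "u : V" using A by(simp add: cone_def)
  have "0 <= cf (T xs) r u" if "r : T xs" for r
  proof -
   from \<open>r : T xs\<close> obtain k where k: "k < n" "r = b xs k" unfolding T_def by auto
   show ?thesis
   proof(cases "Suc k < n")
    case True
    have "- cf A (xs ! k) u <= - cf A (xs ! Suc k) u"
     using sorted_nth_mono[OF xs(3), of k "Suc k"] True len[OF xL] by simp
    thus ?thesis using bc(4)[OF xL k(1) uV] k True len[OF xL] xs by(simp add: e_def)
   next
    case False
    have "xs ! k : A" using k(1) len[OF xL] xs(1) by(metis nth_mem)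
    hence "0 <= cf A (xs ! k) u" using A(2) by(simp add: cone_def)
    thus ?thesis using bc(4)[OF xL k(1) uV] k False len[OF xL] xs by(simp add: e_def)
   qed
  qed
  thus "u : (UN A:T ` L. cone A)" using xL uV by(auto simp: cone_def)
 qed
qed
moreover have "ALL A:T ` L. bij_betw (%u. card (supp u) - 1) A {..<n}"
proof
 fix A assume "A : T ` L"
 then obtain xs where xs: "xs : L" "A = b xs ` {..<n}" by(auto simp: T_def)
 show "bij_betw (%u. card (supp u) - 1) A {..<n}"
  unfolding bij_betw_def
 proof
  show "inj_on (%u. card (supp u) - 1) A" unfolding xs(2) inj_on_def using cardb[OF xs(1)] by auto
  show "(%u. card (supp u) - 1) ` A = {..<n}" unfolding xs(2) image_image
   using cardb[OF xs(1)] by simp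
 qed
qed
ultimately show ?thesis by blast
qed

text \<open>If q vanishes at w, pass to N w + r for a ray r with q r nonzero. The values p w are
  nonzero integers, so N larger than all |p r| keeps the other functionals nonzero.\<close>

lemma generic_vector:
assumes A: "unimod A" and Q: "finite Q" "!!q. q : Q ==> lin q" "!!q. q : Q ==> EX u:V. q u ~= 0"
shows "EX w:cone A. ALL q:Q. q w ~= 0"
using Q
proof(induction Q rule: finite_induct)
case empty
have "0 : cone A" using V_0 lin_0[OF lin_cf[OF A]] by(simp add: cone_def)
thus ?case by blast
next
case (insert q Q)
then obtain w where w: "w : cone A" "ALL q:Q. q w ~= 0" by auto
show ?case
proof(cases "q w = 0")
 case True
 obtain u where u: "u : V" "q u ~= 0" using insert.prems(2)[of q] by auto
 have "EX r:A. q r ~= 0"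
 proof(rule ccontr)
  assume "~ ?thesis"
  thus False using lin_expand[OF A u(1) insert.prems(1)[of q]] u(2) by simp
 qed
 then obtain r where r: "r : A" "q r ~= 0" by blast
 define N where "N = 1 + (SUM p:Q. abs(p r))"
 have N0: "N >= 1" by(simp add: N_def sum_nonneg)
 have "p (N ** w + r) ~= 0" if p: "p : Q" for p
 proof -
  have "abs(p r) < N" unfolding N_def using member_le_sum[OF p, of "%p. abs(p r)"] insert.hyps(1) by simp
  moreover have "N <= abs(N * p w)"
  proof -
   have "1 <= abs(p w)" using w(2) p by(metis abs_ge_zero abs_zero int_one_le_iff_zero_less order_le_less abs_eq_0)
   thus ?thesis using N0 mult_left_mono[of 1 "abs(p w)" N] by(simp add: abs_mult)
  qed
  ultimately show ?thesis using insert.prems(1)[of p] p by(simp add: lin_add lin_sc)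
 qed
 moreover have "q (N ** w + r) ~= 0" using True r(2) insert.prems(1)[of q] by(simp add: lin_add lin_sc)
 moreover have "N ** w : cone A" using w(1) N0 unfolding cone_def by(auto simp: V_sc lin_sc[OF lin_cf[OF A]])
 hence "N ** w + r : cone A" using cone_add[OF A _ ray_cone[OF A r(1)]] by blast
 ultimately show ?thesis by blast
qed (use w in auto)
qed
end

section \<open>Monoid algebras and evaluation\<close>
abbreviation "lk == Poly_Mapping.lookup"
abbreviation "keys == Poly_Mapping.keys"
abbreviation mon :: "'a => ('a \<Rightarrow>\<^sub>0 'k::zero_neq_one)" where
"mon u == sng u 1"
abbreviation cst :: "'k => ('a::zero \<Rightarrow>\<^sub>0 'k::zero)" where
"cst c == sng 0 c"
text \<open>For a submonoid this is the monoid algebra, for an upward closed set of exponents a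
  monomial ideal; both are subsets of one fixed type.\<close>

definition KM :: "'a set => ('a \<Rightarrow>\<^sub>0 'k::zero) set" where
"KM M = {f. keys f <= M}"

lemma sum_sng: "(SUM q:keys p. sng q (lk p q)) = p"
by(rule pmI) (simp add: lk_sum lk_sng when_def ik)

lemma KM_0 [simp]: "0 : KM M"
and KM_sng: "u : M ==> sng u c : KM M"
and KM_add: "f : KM M ==> g : KM M ==> f + g : KM M"
by(use keys_add[of f g] in "auto simp: KM_def")

lemma KM_uminus: "f : KM M ==> - f : KM M"
for f :: "'a \<Rightarrow>\<^sub>0 'k::ab_group_add"
by(auto simp: KM_def ik subset_iff)

lemma KM_diff: "f : KM M ==> g : KM M ==> f - g : KM M"
for f g :: "'a \<Rightarrow>\<^sub>0 'k::ab_group_add"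
using KM_add[of f M "- g"] KM_uminus[of g M] by simp

lemma KM_sum: "(!!i. i : I ==> f i : KM M) ==> sum f I : KM M"
by(induction I rule: fin_ind) (auto intro: KM_add)

lemma KM_mult:
assumes "!!u v. u : M ==> v : M ==> u + v : M" "f : KM M" "g : KM M"
shows "f * g : KM M"
using keys_mult[of f g] assms unfolding KM_def by fastforce

section \<open>Substitution into polynomials and leading exponents\<close>

definition tpow :: "(nat => 'a::comm_monoid_mult) => (nat \<Rightarrow>\<^sub>0 nat) => 'a" where
"tpow th q = (PROD k:keys q. th k ^ lk q k)"

lemma tpow_superset: "finite S ==> keys q <= S ==> tpow th q = (PROD k:S. th k ^ lk q k)"
unfolding tpow_def by(rule prod.mono_neutral_left) (auto simp: ik)

lemma tpow_0 [simp]: "tpow th 0 = 1"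
by(simp add: tpow_def)

lemma tpow_single [simp]: "tpow th (sng k m) = th k ^ m"
by(subst tpow_superset[of "{k}"]) (auto split: if_splits)

lemma tpow_add: "tpow th (p + q) = tpow th p * tpow th q"
proof -
let ?S = "keys p Un keys q"
have "tpow th (p + q) = (PROD k:?S. th k ^ lk (p + q) k)"
 by(rule tpow_superset) (use keys_add[of p q] in auto)
also have "... = (PROD k:?S. th k ^ lk p k) * (PROD k:?S. th k ^ lk q k)"
 by(simp add: lk_add power_add prod.distrib)
also have "... = tpow th p * tpow th q"
 by(simp add: tpow_superset[of ?S p] tpow_superset[of ?S q])
finally show ?thesis .
qed
definition ev :: "(nat => ('a::comm_monoid_add \<Rightarrow>\<^sub>0 'k::comm_ring_1)) => ((nat \<Rightarrow>\<^sub>0 nat) \<Rightarrow>\<^sub>0 'k) => ('a \<Rightarrow>\<^sub>0 'k)" where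
"ev th p = (SUM q:keys p. cst (lk p q) * tpow th q)"

lemma ev_superset: "finite S ==> keys p <= S ==> ev th p = (SUM q:S. cst (lk p q) * tpow th q)"
unfolding ev_def by(rule sum.mono_neutral_left) (auto simp: ik)

lemma ev_0 [simp]: "ev th 0 = 0"
by(simp add: ev_def)

lemma ev_single [simp]: "ev th (sng q c) = cst c * tpow th q"
by(subst ev_superset[of "{q}"]) auto

lemma ev_1 [simp]: "ev th 1 = 1"
using ev_single[of th 0 1] by simp

lemma ev_add: "ev th (p + q) = ev th p + ev th q"
proof -
let ?S = "keys p Un keys q"
have "ev th (p + q) = (SUM k:?S. cst (lk (p + q) k) * tpow th k)"
 by(rule ev_superset) (use keys_add[of p q] in auto)
also have "... = (SUM k:?S. cst (lk p k) * tpow th k) + (SUM k:?S. cst (lk q k) * tpow th k)"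
 by(simp add: lk_add single_add distrib_right sum.distrib)
also have "... = ev th p + ev th q"
 by(simp add: ev_superset[of ?S p] ev_superset[of ?S q])
finally show ?thesis .
qed

lemma ev_sum: "ev th (sum f A) = (SUM x:A. ev th (f x))"
by(induction A rule: fin_ind) (simp_all add: ev_add)

lemma ev_uminus: "ev th (- p) = - ev th p"
using ev_add[of th p "- p"] by(simp add: eq_neg_iff_add_eq_0 add.commute)

lemma ev_diff: "ev th (p - q) = ev th p - ev th q"
using ev_add[of th p "- q"] ev_uminus[of th q] by simp

lemma ev_mult: "ev th (p * q) = ev th p * ev th q"
proof -
have "p * q = (SUM a:keys p. SUM b:keys q. sng (a + b) (lk p a * lk q b))"
 by(subst (1) sum_sng[of p, symmetric], subst (1) sum_sng[of q, symmetric])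
  (simp add: sum_product mult_single)
hence "ev th (p * q) = (SUM a:keys p. SUM b:keys q. cst (lk p a * lk q b) * tpow th (a + b))"
 by(simp add: ev_sum)
also have "... = ev th p * ev th q"
 unfolding ev_def sum_product
 by(intro sum.cong refl) (simp add: tpow_add mult_ac flip: mult_single[of 0 _ 0, simplified])
finally show ?thesis .
qed
definition tv :: "nat set => (nat \<Rightarrow>\<^sub>0 nat) set" where
"tv T = {q. keys q <= T}"
abbreviation "vpw n == tv {..<n}"
definition lead :: "('a => nat) => 'a set => ('a \<Rightarrow>\<^sub>0 'k::zero_neq_one) => 'a => bool" where
"lead ka C f u <-> lk f u = 1 & keys f <= C & (ALL v:keys f. v ~= u --> ka v < ka u)"

lemma lead_sum:
fixes c :: "'i => 'k::comm_ring_1"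
assumes "finite I" "i0 : I" "c i0 = 1" "!!i. i : I ==> a i : C" "!!i. i : I ==> i ~= i0 ==> ka (a i) < ka (a i0)"
shows "lead ka C (SUM i:I. sng (a i) (c i)) (a i0)"
proof -
have l: "lk (SUM i:I. sng (a i) (c i)) (a i0) = (SUM i:I. if i = i0 then 1 else 0)"
 unfolding lk_sum by(rule sum.cong) (use assms(3,5) in "force simp: lk_sng when_def")+
have k: "keys (SUM i:I. sng (a i) (c i)) <= a ` I"
 using keys_sum[of "%i. sng (a i) (c i)" I] by(auto split: if_splits)
show ?thesis unfolding lead_def using l k assms by force
qed

text \<open>Unitriangularity: the products of a basis monomial b with a power product of
  \<open>tht\<close> have leading exponents that run through \<open>C\<close> exactly once. They are
  thus a K-basis, and K[C] is free over the polynomials in \<open>tht\<close>. The rank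
  \<open>kap\<close> only has to drop strictly below the leading exponent; ties among other
  exponents are harmless.\<close>

locale triangular =
fixes Bx :: "'a::comm_monoid_add set" and n :: nat and tht :: "nat => ('a \<Rightarrow>\<^sub>0 'k::field)"
 and PP :: "'a => (nat \<Rightarrow>\<^sub>0 nat) => 'a" and C :: "'a set" and kap :: "'a => nat"
assumes finite_Bx: "finite Bx" and bij_PP: "bij_betw (%(b, q). PP b q) (Bx \<times> vpw n) C"
 and lead_pow: "b : Bx ==> q : vpw n ==> lead kap C (mon b * tpow tht q) (PP b q)"
begin

theorem triangular_free_span:
assumes "x : KM C"
shows "EX c. (ALL b:Bx. c b : KM (vpw n)) & x = (SUM b:Bx. mon b * ev tht (c b))"
proof -
define S where "S = {x. EX c. (ALL b:Bx. c b : KM (vpw n)) & x = (SUM b:Bx. mon b * ev tht (c b))}"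
have S_add: "x + y : S" if xy: "x : S" "y : S" for x y
proof -
 from xy obtain c d where "ALL b:Bx. c b : KM (vpw n)" "x = (SUM b:Bx. mon b * ev tht (c b))"
  "ALL b:Bx. d b : KM (vpw n)" "y = (SUM b:Bx. mon b * ev tht (d b))" unfolding S_def by blast
 thus ?thesis unfolding S_def mem_Collect_eq
  by(intro exI[of _ "%b. c b + d b"]) (auto simp: ev_add distrib_left sum.distrib intro: KM_add)
qed
have "0 : S" unfolding S_def by(auto intro!: exI[of _ "%_. 0"])
hence S_sum: "sum g A : S" if "!!i. i : A ==> g i : S" for g and A :: "'a set"
 using that by(induction A rule: fin_ind) (auto intro: S_add)
have mS: "sng u a : S" if "u : C" for u a
 using that
proof(induction "kap u" arbitrary: u a rule: less_induct)
 case less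
 have "u : (%(b, q). PP b q) ` (Bx \<times> vpw n)" using bij_PP less.prems by(simp add: bij_betw_def)
 then obtain b q where bq: "b : Bx" "q : vpw n" "PP b q = u" by auto
 let ?f = "mon b * tpow tht q"
 have l: "lk ?f u = 1" "keys ?f <= C" "!!v. v : keys ?f ==> v ~= u ==> kap v < kap u"
  using lead_pow[OF bq(1,2)] bq(3) by(auto simp: lead_def)
 have "(SUM v:keys ?f. sng v (a * lk ?f v)) = cst a * (SUM v:keys ?f. sng v (lk ?f v))"
  by(simp only: sum_distrib_left mult_single add_0)
 hence "cst a * ?f = (SUM v:keys ?f. sng v (a * lk ?f v))" by(simp only: sum_sng)
 also have "... = sng u a + (SUM v:keys ?f - {u}. sng v (a * lk ?f v))"
  using sum.remove[OF finite_keys, of u ?f "%v. sng v (a * lk ?f v)"] l(1) by(simp add: ik)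
 finally have "sng u a = cst a * ?f + (SUM v:keys ?f - {u}. sng v (- (a * lk ?f v)))"
  by(simp add: single_uminus sum_negf)
 also have "... : S"
 proof(intro S_add S_sum less.hyps)
  have "(SUM b':Bx. mon b' * ev tht (if b' = b then sng q a else 0)) = (SUM b':Bx. if b' = b then cst a * ?f else 0)"
   by(rule sum.cong) (auto simp: mult_ac)
  thus "cst a * ?f : S" unfolding S_def mem_Collect_eq using finite_Bx bq(1,2)
   by(intro exI[of _ "%b'. if b' = b then sng q a else 0"]) (auto intro: KM_sng)
 qed (use l in auto)
 finally show ?case .
qed
have "x : S" by(subst sum_sng[symmetric]) (use assms in "auto simp: KM_def intro!: S_sum mS")
thus ?thesis by(simp add: S_def)
qed

theorem triangular_free_indep:
assumes c: "!!b. b : Bx ==> c b : KM (vpw n)" and z: "(SUM b:Bx. mon b * ev tht (c b)) = 0" and b: "b : Bx"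
shows "c b = 0"
proof(rule ccontr)
let ?F = "SIGMA b:Bx. keys (c b)" and ?P = "%(b, q). PP b q" and ?f = "%(b, q). mon b * tpow tht q" and ?l = "%(b, q). lk (c b) q"
assume "c b ~= 0"
hence "?F ~= {}" using b keys_eq_empty[of "c b"] by blast
moreover have fin: "finite ?F" using finite_Bx by simp
\<comment> \<open>Among the pairs (b, q) that occur take one of largest \<open>kap\<close>. Its
  leading exponent appears in no other product of the sum, so it cannot cancel.\<close>
define g where "g j = kap (?P j)" for j
ultimately have "Max (g ` ?F) : g ` ?F" by(intro Max_in finite_imageI fin) blast
then obtain i where i: "Max (g ` ?F) = g i" "i : ?F" by(rule imageE)
have im: "g j <= g i" if "j : ?F" for j unfolding i(1)[symmetric] using that fin by(intro Max_ge) simp_all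
have FB: "j : Bx \<times> vpw n" if "j : ?F" for j using c that by(auto simp: KM_def)
hence lead: "lead kap C (?f j) (?P j)" if "j : ?F" for j using lead_pow that by fastforce
have "(SUM b:Bx. mon b * ev tht (c b)) = (SUM b:Bx. SUM q:keys (c b). cst (lk (c b) q) * (mon b * tpow tht q))"
 by(simp add: ev_def sum_distrib_left mult.left_commute)
also have "... = (SUM j:?F. cst (?l j) * ?f j)" using finite_Bx by(subst sum.Sigma) (auto intro: sum.cong)
finally have "0 = lk (SUM j:?F. cst (?l j) * ?f j) (?P i)" using z by simp
also have "... = (SUM j:?F. if j = i then ?l i else 0)"
 unfolding lk_sum
proof(rule sum.cong)
 fix j assume j: "j : ?F"
 have "lk (cst (?l j) * ?f j) (?P i) = ?l j * lk (?f j) (?P i)"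
  by(auto simp: Poly_Mapping.map.rep_eq when_def simp flip: mult_map_scale_conv_mult)
 moreover have "lk (?f i) (?P i) = 1" using lead[OF i(2)] by(simp add: lead_def)
 moreover have "lk (?f j) (?P i) = 0" if "j ~= i"
 proof(rule ccontr)
  assume "lk (?f j) (?P i) ~= 0"
  moreover have "?P i ~= ?P j" using that bij_PP FB[OF i(2)] FB[OF j] unfolding bij_betw_def inj_on_def by blast
  ultimately have "kap (?P i) < kap (?P j)" using lead[OF j] by(auto simp: lead_def ik)
  thus False using im[OF j] by(simp add: g_def)
 qed
 ultimately show "lk (cst (?l j) * ?f j) (?P i) = (if j = i then ?l i else 0)" by auto
qed simp
also have "... = ?l i" using i(2) fin by simp
finally show False using i(2) by(auto simp: ik)
qed
end

section \<open>Freeness of the monoid algebra of a coloured fan\<close>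

text \<open>The pieces of the support function take different values at w, and these values order
  the cones. By the colouring each cone has exactly one ray of each colour.\<close>

locale colored_fan = lattice_vec V for V +
fixes n :: nat and C :: "vec set" and Fa :: "vec set set" and fi :: "vec => int" and col :: "vec => nat" and w :: vec
assumes F: "fan n C Fa fi" and col: "A : Fa ==> bij_betw col A {..<n}"
 and pos: "r : Union Fa ==> 0 < fi r" and wC: "w : C"
 and val_inj: "inj_on (%A. pl fi A w) Fa"
 and C_add: "u : C ==> v : C ==> u + v : C" and C_V: "C <= V"
begin
lemmas f = fanD[OF F]
abbreviation val where "val A == pl fi A w"

lemma ray_C: "r : Union Fa ==> r : C"
using f(2,4) ray_cone by blast

lemma C_sc: "u : C ==> int (Suc k) ** u : C"
proof(induction k)
case (Suc k)
have "int (Suc (Suc k)) ** u = int (Suc k) ** u + u"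
 using frag_cmul_distrib[of "int (Suc k)" 1 u] by simp
thus ?case using Suc C_add by simp
qed simp
text \<open>Of the cones through u the one with the largest value at w. Values are distinct by
  \<open>val_inj\<close>, so this partitions \<open>C\<close>.\<close>

definition best :: "vec => vec set" where
"best u = (SOME A. A : Fa & u : cone A & (ALL B:Fa. u : cone B --> val B <= val A))"

lemma best:
assumes "u : C"
shows "best u : Fa" "u : cone (best u)" "!!B. B : Fa ==> u : cone B ==> val B <= val (best u)"
proof -
let ?S = "{A : Fa. u : cone A}"
have "finite ?S" "?S ~= {}" using f(1) f(6)[OF assms] by auto
hence "Max (val ` ?S) : val ` ?S" by(intro Max_in) auto
then obtain A where A: "A : ?S" "val A = Max (val ` ?S)" by auto
have "val B <= val A" if "B : ?S" for B unfolding A(2) using \<open>finite ?S\<close> that by(intro Max_ge) auto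
with A have "EX A. A : Fa & u : cone A & (ALL B:Fa. u : cone B --> val B <= val A)" by blast
from someI_ex[OF this] show "best u : Fa" "u : cone (best u)" "!!B. B : Fa ==> u : cone B ==> val B <= val (best u)"
 unfolding best_def by auto
qed

lemma best_eq:
assumes "u : C" "A : Fa" "u : cone A" "!!B. B : Fa ==> u : cone B ==> val B <= val A"
shows "best u = A"
proof -
have "val (best u) <= val A" "val A <= val (best u)" using best[OF assms(1)] assms by blast+
thus ?thesis using inj_onD[OF val_inj _ best(1)[OF assms(1)] assms(2)] by simp
qed
text \<open>Marks the facets of \<open>A\<close> with w on their negative side. \<open>hop A\<close>
  is the cone with these facets removed, where for lattice points positive means at least 1; it is
  exactly the set of u with \<open>best u = A\<close>.\<close>

definition eps :: "vec set => vec => int" where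
"eps A r = (if cf A r w < 0 then 1 else 0)"
definition hop :: "vec set => vec set" where
"hop A = {u : V. ALL r:A. eps A r <= cf A r u}"

text \<open>Line shelling: among the cones containing a point \<open>u\<close> on a facet, one beyond a facet visible
  from \<open>w\<close> comes earlier, because \<open>N u + w\<close> stays in the region.\<close>
lemma visible_facet:
assumes A: "A : Fa" "u : cone A" and r: "r : A" "cf A r u = 0" "cf A r w < 0"
shows "EX B:Fa. u : cone B & val A < val B"
proof -
note uA = f(2)[OF A(1)]
have uC: "u : C" using f(4)[OF A(1)] A(2) by auto
have uV: "u : V" "w : V" using uC wC C_V by auto
have "ALL k::nat. EX B:Fa. int (Suc k) ** u + w : cone B" using f(6) C_add C_sc uC wC by blast
then obtain Y where Y: "!!k. Y k : Fa" "!!k::nat. int (Suc k) ** u + w : cone (Y k)" by metis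
have "finite (range Y)" using Y(1) f(1) by(meson finite_subset image_subsetI)
then obtain k0 where "infinite {k. Y k = Y k0}"
 using pigeonhole_infinite[of "UNIV :: nat set" Y] by auto
then obtain B where inf: "infinite {k. Y k = B}" and B: "B : Fa" using Y(1) by blast
have c: "int (Suc k) ** u + w : cone B" if "Y k = B" for k using Y(2)[of k] that by simp
obtain k1 where k1: "Y k1 = B" using inf not_finite_existsD by auto
note uB = f(2)[OF B]
have cv: "cf Z s (int (Suc k) ** u + w) = int k * cf Z s u + (cf Z s u + cf Z s w)" if "unimod Z" "s : Z" for k Z s
 using lin_cf[OF that] by(simp add: lin_add lin_sc algebra_simps)
have "0 <= cf B s u" if "s : B" for s
proof(rule nonneg_limit[OF inf])
 fix k assume "k : {k. Y k = B}"
 hence "0 <= cf B s (int (Suc k) ** u + w)" using c[of k] that by(auto simp: cone_def)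
 thus "0 <= int k * cf B s u + (cf B s u + cf B s w)" using cv[OF uB that, of k] by simp
qed
hence uB': "u : cone B" using uV by(simp add: cone_def)
have e: "pl fi B u = pl fi A u" using fan_convex(1)[OF F A(1) B uB'] fan_convex(1)[OF F B A(1) A(2)] by simp
let ?z = "int (Suc k1) ** u + w"
have plz: "pl fi Z ?z = int (Suc k1) * pl fi Z u + val Z" if "Z : Fa" for Z
 using lin_pl[OF f(2)[OF that], of fi] by(simp add: lin_add lin_sc)
have "val A ~= val B"
proof
 assume "val A = val B"
 hence "?z : cone A" using fan_convex(2)[OF F A(1) B c[OF k1]] plz[OF A(1)] plz[OF B] e by simp
 hence "0 <= cf A r ?z" using r(1) by(simp add: cone_def)
 thus False using cv[OF uA r(1), of k1] r(2,3) by(simp del: of_nat_Suc)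
qed
moreover have "val A <= val B" using fan_convex(1)[OF F A(1) B c[OF k1]] plz[OF A(1)] plz[OF B] e by simp
ultimately show ?thesis using B uB' by force
qed

lemma best_hop:
assumes "u : C"
shows "u : hop (best u)"
proof -
note b = best[OF assms]
have "eps (best u) r <= cf (best u) r u" if "r : best u" for r
proof -
 have "0 <= cf (best u) r u" using b(2) that by(simp add: cone_def)
 moreover have "~ (cf (best u) r u = 0 & cf (best u) r w < 0)"
  using visible_facet[OF b(1,2) that] b(3) by force
 ultimately show ?thesis unfolding eps_def by(cases "cf (best u) r w < 0") auto
qed
thus ?thesis using assms C_V by(auto simp: hop_def)
qed

text \<open>Suppose B also contains u and has a larger value at w. Expanding the difference of the
  values in the basis \<open>A\<close> produces a ray r with \<open>cf A r w < 0\<close> outside B.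
  As u lies in the common face, its coordinate at r vanishes, which \<open>eps\<close>
  forbids.\<close>

lemma hop_best:
assumes "A : Fa" "u : hop A"
shows "u : C" "best u = A"
proof -
note uA = f(2)[OF assms(1)]
have uA': "u : cone A" using assms(2) unfolding hop_def cone_def eps_def
 by(auto split: if_splits)
thus uC: "u : C" using f(4)[OF assms(1)] by auto
show "best u = A"
proof(rule best_eq[OF uC assms(1) uA'], rule ccontr)
 fix B assume B: "B : Fa" "u : cone B" "~ val B <= val A"
 have e: "pl fi B u = pl fi A u"
  using fan_convex(1)[OF F assms(1) B(1,2)] fan_convex(1)[OF F B(1) assms(1) uA'] by simp
 have wV: "w : V" using wC C_V by auto
 have "val B - val A = (SUM r:A. cf A r w * (pl fi B r - fi r))"
  using lin_expand[OF uA wV lin_pl[OF f(2)[OF B(1)], of fi]]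
  by(simp add: pl_def[of fi A w] sum_subtractf right_diff_distrib)
 moreover have "val B - val A > 0" using B(3) by simp
 ultimately have "~ (SUM r:A. cf A r w * (pl fi B r - fi r)) <= 0" by simp
 then obtain r where r: "r : A" "cf A r w * (pl fi B r - fi r) > 0"
  using sum_nonpos[of A "%r. cf A r w * (pl fi B r - fi r)"] by force
 have "pl fi B r <= fi r" using f(7)[OF B(1), of r] assms(1) r(1) by blast
 hence "pl fi B r - fi r < 0" "cf A r w < 0"
  using r(2) by(auto simp: zero_less_mult_iff)
 hence "r ~: B" using pl_ray[OF f(2)[OF B(1)], of r fi] by auto
 hence "~ 0 < cf A r u" using fan_convex(3)[OF F B(1) assms(1) uA' e r(1)] by blast
 thus False using assms(2) r(1) \<open>cf A r w < 0\<close> by(auto simp: hop_def eps_def)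
qed
qed
text \<open>Multiples that bring all rays to the common height \<open>lam\<close>, the product of
  all ray heights, so that every term of \<open>tht k\<close> raises the height equally.\<close>

definition nn :: "vec => nat" where
"nn r = nat ((PROD s:Union Fa. fi s) div fi r)"
definition lam :: int where "lam = (PROD s:Union Fa. fi s)"

lemma finR: "finite (Union Fa)" using f(1,2) umfin by auto

lemma nn:
assumes "r : Union Fa"
shows "int (nn r) * fi r = lam" "0 < nn r"
proof -
have lp: "lam > 0" unfolding lam_def using pos by(intro prod_pos) auto
have "fi r dvd lam" unfolding lam_def by(rule dvd_prodI[OF finR assms])
hence e: "lam div fi r * fi r = lam" by simp
have "lam div fi r > 0" using e lp pos[OF assms] by(metis zero_less_mult_pos2)
thus "0 < nn r" "int (nn r) * fi r = lam" using e by(simp_all add: nn_def lam_def)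
qed

lemma nn_ray_C: "r : Union Fa ==> int (nn r) ** r : C"
using nn(2)[of r] C_sc[OF ray_C, of r "nn r - 1"] by simp
definition hgt :: "vec => nat" where "hgt u = nat (pl fi (best u) u)"
definition rk :: "vec => nat" where "rk u = card {B : Fa. val B < val (best u)}"
text \<open>Height first, position of the cone second. The position is at most
  \<open>card Fa\<close>, so this number encodes the lexicographic order.\<close>

definition kap :: "vec => nat" where "kap u = hgt u * Suc (card Fa) + rk u"

lemma hgt: "u : C ==> int (hgt u) = pl fi (best u) u"
proof -
assume u: "u : C"
have "0 <= pl fi (best u) u" unfolding pl_def
 using best(1,2)[OF u] pos by(intro sum_nonneg mult_nonneg_nonneg) (auto simp: cone_def intro: less_imp_le)
thus ?thesis by(simp add: hgt_def)
qed

lemma rk_le: "rk u <= card Fa"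
unfolding rk_def using f(1) by(intro card_mono) auto

text \<open>Inside the cone of u a ray raises the height by exactly \<open>lam\<close>. For another
  ray convexity gives at most that. If the height is smaller, the rank cannot compensate; if it is
  equal, u and r lie in the new cone, which differs from \<open>best u\<close> and so has a smaller
  value at w.\<close>

lemma kap_step:
assumes u: "u : C" and r: "r : Union Fa"
defines "z == u + int (nn r) ** r" and "c == nat lam * Suc (card Fa)"
shows "z : C" "r : best u ==> best z = best u & kap z = kap u + c" "r ~: best u ==> kap z < kap u + c"
proof -
show zC: "z : C" unfolding z_def using u nn_ray_C[OF r] C_add by blast
have lam0: "lam > 0" unfolding lam_def using pos by(intro prod_pos) auto
have plz: "pl fi B z = pl fi B u + int (nn r) * pl fi B r" if "B : Fa" for B
 unfolding z_def using lin_pl[OF f(2)[OF that], of fi] by(simp add: lin_add lin_sc)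
note bz = best[OF zC] and bu = best[OF u]
show "best z = best u & kap z = kap u + c" if ru: "r : best u"
proof -
 note uu = f(2)[OF bu(1)]
 have "eps (best u) s <= cf (best u) s z" if s: "s : best u" for s
 proof -
  have "cf (best u) s z = cf (best u) s u + int (nn r) * cf (best u) s r"
   unfolding z_def using lin_cf[OF uu s] by(simp add: lin_add lin_sc)
  also have "... >= cf (best u) s u" using cf_ray[OF uu s ru] by simp
  finally show ?thesis using best_hop[OF u] s by(auto simp: hop_def)
 qed
 hence "z : hop (best u)" using zC C_V by(auto simp: hop_def)
 hence b: "best z = best u" using hop_best(2)[OF bu(1)] by blast
 have "int (hgt z) = int (hgt u) + lam"
  using hgt[OF zC] hgt[OF u] plz[OF bu(1)] pl_ray[OF uu ru, of fi] nn(1)[OF r] b by simp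
 hence "hgt z = hgt u + nat lam" using lam0 by linarith
 thus ?thesis using b by(simp add: kap_def rk_def c_def algebra_simps)
qed
show "kap z < kap u + c" if ru: "r ~: best u"
proof -
 have 1: "pl fi (best z) u <= pl fi (best u) u" using fan_convex(1)[OF F bz(1) bu(1,2)] .
 have 2: "pl fi (best z) r <= fi r" using f(7)[OF bz(1) r] .
 have 3: "int (nn r) * pl fi (best z) r <= lam" using mult_left_mono[OF 2, of "int (nn r)"] nn(1)[OF r] by simp
 have hz: "int (hgt z) = pl fi (best z) u + int (nn r) * pl fi (best z) r" using hgt[OF zC] plz[OF bz(1)] by simp
 show ?thesis
 proof(cases "hgt z < hgt u + nat lam")
  case True
  hence "Suc (hgt z) * Suc (card Fa) <= (hgt u + nat lam) * Suc (card Fa)" by(intro mult_right_mono) auto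
  hence "hgt z * Suc (card Fa) + Suc (card Fa) <= hgt u * Suc (card Fa) + c" by(simp add: c_def algebra_simps)
  thus ?thesis using rk_le[of z] unfolding kap_def by linarith
 next
  case False
  hence "int (hgt z) >= int (hgt u) + lam" using lam0 by linarith
  hence e: "pl fi (best z) u = pl fi (best u) u" "int (nn r) * pl fi (best z) r = int (nn r) * fi r" "int (hgt z) = int (hgt u) + lam"
   using 1 3 hz hgt[OF u] nn(1)[OF r] by linarith+
  have uz: "u : cone (best z)" using fan_convex(2)[OF F bz(1) bu(1,2) e(1)] .
  have rz: "r : best z" using e(2) nn(2)[OF r] f(5)[OF bz(1) r] by fastforce
  have "best z ~= best u" using rz ru by auto
  hence lt: "val (best z) < val (best u)" using bu(3)[OF bz(1) uz] val_inj bz(1) bu(1)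
   by(metis inj_on_eq_iff order_le_less)
  have "{B : Fa. val B < val (best z)} < {B : Fa. val B < val (best u)}" using lt bz(1) by force
  hence "rk z < rk u" unfolding rk_def using f(1) by(intro psubset_card_mono) auto
  moreover have "hgt z = hgt u + nat lam" using e(3) lam0 by linarith
  ultimately show ?thesis by(simp add: kap_def c_def algebra_simps)
 qed
qed
qed
text \<open>One parameter for each colour. At a point u exactly one summand uses a ray of
  \<open>best u\<close>, and by \<open>kap_step\<close> it supplies the leading exponent.\<close>

definition tht :: "nat => ('k::field) lau" where
"tht k = (SUM r | r : Union Fa & col r = k. mon (int (nn r) ** r))"
definition ray :: "vec set => nat => vec" where "ray A k = the_inv_into A col k"

lemma ray:
assumes "A : Fa" "k < n"
shows "ray A k : A" "col (ray A k) = k" "r : A ==> ray A (col r) = r"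
 "r : A ==> col r < n"
using col[OF assms(1)] assms(2) unfolding ray_def
by(auto simp: bij_betw_def the_inv_into_f_f intro: the_inv_into_into f_the_inv_into_f)

lemma lead_theta:
assumes l: "lead kap C g u" and u: "u : C" and k: "k < n"
defines "z == u + int (nn (ray (best u) k)) ** ray (best u) k"
shows "lead kap C (g * tht k :: vec \<Rightarrow>\<^sub>0 'k::field) z" "best z = best u" "z : C"
proof -
note bu = best[OF u] note rr = ray[OF bu(1) k]
let ?r = "ray (best u) k"
have rR: "?r : Union Fa" using rr(1) bu(1) by auto
show b: "best z = best u" "z : C" unfolding z_def using kap_step(1,2)[OF u rR] rr(1) by auto
let ?I = "keys g \<times> {r : Union Fa. col r = k}"
have "finite {r : Union Fa. col r = k}" by(rule finite_subset[OF _ finR]) auto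
hence fI: "finite ?I" by simp
have "g * tht k = (SUM v:keys g. sng v (lk g v)) * tht k" by(simp add: sum_sng)
also have "... = (SUM (v, r):?I. sng (v + int (nn r) ** r) (lk g v))"
 unfolding tht_def sum_product by(simp add: mult_single sum.cartesian_product)
finally have e: "g * tht k = (SUM i:?I. sng (fst i + int (nn (snd i)) ** snd i) (lk g (fst i)))"
 by(simp add: case_prod_unfold)
have kz: "kap z = kap u + nat lam * Suc (card Fa)" unfolding z_def using kap_step(2)[OF u rR rr(1)] by simp
have "lead kap C (SUM i:?I. sng (fst i + int (nn (snd i)) ** snd i) (lk g (fst i)))
 (fst (u, ?r) + int (nn (snd (u, ?r))) ** snd (u, ?r))"
proof(rule lead_sum[OF fI])
 show "(u, ?r) : ?I" using l rR rr(2) by(auto simp: lead_def ik)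
 show "lk g (fst (u, ?r)) = 1" using l by(simp add: lead_def)
 show "fst i + int (nn (snd i)) ** snd i : C" if "i : ?I" for i
  using that l by(intro kap_step(1)) (auto simp: lead_def)
 fix i assume i: "i : ?I" "i ~= (u, ?r)"
 obtain v r where vr: "i = (v, r)" by(cases i)
 have v: "v : keys g" "v : C" "r : Union Fa" "col r = k" using i(1) vr l by(auto simp: lead_def)
 have "kap (v + int (nn r) ** r) < kap z"
 proof(cases "v = u")
  case True
  hence "r ~= ?r" using i(2) vr by auto
  hence "r ~: best u" using rr(3)[of r] v(4) by auto
  thus ?thesis using kap_step(3)[OF u v(3)] kz True by simp
 next
  case False
  hence "kap v < kap u" using l v(1) by(auto simp: lead_def)
  moreover have "kap (v + int (nn r) ** r) <= kap v + nat lam * Suc (card Fa)"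
   using kap_step(2,3)[OF v(2,3)] by fastforce
  ultimately show ?thesis using kz by simp
 qed
 thus "kap (fst i + int (nn (snd i)) ** snd i) < kap (fst (u, ?r) + int (nn (snd (u, ?r))) ** snd (u, ?r))"
  by(simp add: vr z_def)
qed
thus "lead kap C (g * tht k) z" unfolding e[symmetric] z_def by simp
qed
text \<open>The lattice points of the half-open boxes spanned by the vectors
  \<open>int (nn r) ** r\<close> of one cone, shifted by \<open>eps\<close>.\<close>

definition Bx :: "vec set" where
"Bx = {b : C. ALL r:best b. cf (best b) r b - eps (best b) r < int (nn r)}"
definition PP :: "vec => (nat \<Rightarrow>\<^sub>0 nat) => vec" where
"PP b q = b + (SUM k<n. (int (lk q k) * int (nn (ray (best b) k))) ** ray (best b) k)"

lemma lead_pow: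
assumes b: "b : C" and q: "q : vpw n"
shows "lead kap C (mon b * tpow tht q :: vec \<Rightarrow>\<^sub>0 'k::field) (PP b q)" "best (PP b q) = best b" "PP b q : C"
proof -
let ?t = "%m. (SUM k<m. (int (lk q k) * int (nn (ray (best b) k))) ** ray (best b) k)"
have "m <= n ==> lead kap C (mon b * (PROD k<m. tht k ^ lk q k) :: 'k lau) (b + ?t m) & best (b + ?t m) = best b & b + ?t m : C" for m
proof(induction m)
 case 0
 thus ?case using b by(simp add: lead_def)
next
 case (Suc m)
 let ?a = "%j. b + ?t m + (int j * int (nn (ray (best b) m))) ** ray (best b) m"
 have mn: "m < n" using Suc.prems by simp
 have "lead kap C (mon b * (PROD k<m. tht k ^ lk q k) * tht m ^ j :: 'k lau) (?a j) & best (?a j) = best b & ?a j : C" for j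
 proof(induction j)
  case 0
  thus ?case using Suc by simp
 next
  case (Suc j)
  hence l: "lead kap C (mon b * (PROD k<m. tht k ^ lk q k) * tht m ^ j :: 'k lau) (?a j)"
   and bb: "best (?a j) = best b" and c: "?a j : C" by auto
  have e1: "?a (Suc j) = ?a j + int (nn (ray (best b) m)) ** ray (best b) m"
   by(simp add: distrib_right frag_cmul_distrib add.assoc add.commute)
  have e2: "mon b * (PROD k<m. tht k ^ lk q k) * tht m ^ Suc j = mon b * (PROD k<m. tht k ^ lk q k) * tht m ^ j * (tht m :: 'k lau)"
   by(simp only: power_Suc2 mult.assoc)
  show ?case unfolding e1 e2 using lead_theta[OF l c mn] unfolding bb by blast
 qed
 from this[of "lk q m"] show ?case by(simp add: mult.assoc add.assoc)
qed
from this[of n] have "lead kap C (mon b * (PROD k<n. tht k ^ lk q k) :: 'k lau) (PP b q) & best (PP b q) = best b & PP b q : C"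
 by(simp add: PP_def)
moreover have "tpow tht q = (PROD k<n. tht k ^ lk q k :: 'k lau)"
 by(rule tpow_superset) (use q in "auto simp: tv_def")
ultimately show "lead kap C (mon b * tpow tht q :: vec \<Rightarrow>\<^sub>0 'k::field) (PP b q)" "best (PP b q) = best b" "PP b q : C" by auto
qed

lemma cf_PP:
assumes b: "b : C" and k: "k < n"
shows "cf (best b) (ray (best b) k) (PP b q) = cf (best b) (ray (best b) k) b + int (lk q k) * int (nn (ray (best b) k))"
proof -
note bb = best[OF b] note uu = f(2)[OF bb(1)]
let ?r = "ray (best b)"
have inj: "?r j = ?r k <-> j = k" if "j < n" for j using ray(2)[OF bb(1)] that k by metis
have "cf (best b) (?r k) (PP b q) = cf (best b) (?r k) b + (SUM j<n. int (lk q j) * int (nn (?r j)) * cf (best b) (?r k) (?r j))"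
 unfolding PP_def using lin_cf[OF uu ray(1)[OF bb(1) k]] by(simp add: lin_add lin_sum lin_sc)
also have "(SUM j<n. int (lk q j) * int (nn (?r j)) * cf (best b) (?r k) (?r j)) = (SUM j<n. if j = k then int (lk q k) * int (nn (?r k)) else 0)"
 by(rule sum.cong) (use cf_ray[OF uu ray(1)[OF bb(1) k] ray(1)[OF bb(1)]] inj in "simp_all, metis")
finally show ?thesis using k by simp
qed

lemma V_eqI:
assumes "A : Fa" "u : V" "v : V" "!!k. k < n ==> cf A (ray A k) u = cf A (ray A k) v"
shows "u = v"
proof -
have "cf A r u = cf A r v" if "r : A" for r
proof -
 have "col r < n" using col[OF assms(1)] that by(auto simp: bij_betw_def)
 thus ?thesis using assms(4)[of "col r"] ray(3)[OF assms(1) _ that] by auto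
qed
hence "(SUM r:A. cf A r u ** r) = (SUM r:A. cf A r v ** r)" by(intro sum.cong) auto
thus ?thesis by(simp only: cf_expand[OF f(2)[OF assms(1)]] assms(2,3))
qed

text \<open>Division with remainder in every coordinate: b and q are remainder and quotient of
  \<open>cf - eps\<close> by \<open>nn\<close>.\<close>

lemma bij_PP: "bij_betw (%(b, q). PP b q) (Bx \<times> vpw n) C"
unfolding bij_betw_def
proof
show "inj_on (%(b, q). PP b q) (Bx \<times> vpw n)"
proof(rule inj_onI, clarify)
 fix b q b' q' assume h: "b : Bx" "q : vpw n" "b' : Bx" "q' : vpw n" and e: "PP b q = PP b' q'"
 have bC: "b : C" "b' : C" using h by(auto simp: Bx_def)
 let ?A = "best b"
 have A: "best b' = ?A" using lead_pow(2)[OF bC(1) h(2)] lead_pow(2)[OF bC(2) h(4)] e by simp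
 note bb = best[OF bC(1)]
 have k: "cf ?A (ray ?A k) b = cf ?A (ray ?A k) b' & lk q k = lk q' k" if k: "k < n" for k
 proof -
  let ?r = "ray ?A k" let ?e = "eps ?A ?r" let ?n = "int (nn ?r)"
  have r: "?r : ?A" using ray(1)[OF bb(1) k] .
  have eq: "cf ?A ?r b - ?e + int (lk q k) * ?n = cf ?A ?r b' - ?e + int (lk q' k) * ?n"
   using cf_PP[OF bC(1) k, of q] cf_PP[OF bC(2) k, of q'] e A by simp
  have b1: "0 <= cf ?A ?r b - ?e" "cf ?A ?r b - ?e < ?n" using best_hop[OF bC(1)] h(1) r by(auto simp: hop_def Bx_def)
  have b2: "0 <= cf ?A ?r b' - ?e" "cf ?A ?r b' - ?e < ?n" using best_hop[OF bC(2)] h(3) r A by(auto simp: hop_def Bx_def)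
  have "(cf ?A ?r b - ?e + int (lk q k) * ?n) mod ?n = cf ?A ?r b - ?e" using b1 by simp
  moreover have "(cf ?A ?r b' - ?e + int (lk q' k) * ?n) mod ?n = cf ?A ?r b' - ?e" using b2 by simp
  ultimately have "cf ?A ?r b = cf ?A ?r b'" using eq by simp
  moreover have "?n > 0" using b1 by simp
  ultimately show ?thesis using eq by simp
 qed
 have "b = b'" by(rule V_eqI[OF bb(1)]) (use k bC C_V in auto)
 moreover have "q = q'"
 proof(rule pmI)
  fix j show "lk q j = lk q' j"
   using k[of j] h(2,4) by(cases "j < n") (auto simp: tv_def subset_iff ik simp flip: neq0_conv, metis)
 qed
 ultimately show "b = b' & q = q'" by simp
qed
show "(%(b, q). PP b q) ` (Bx \<times> vpw n) = C"
proof(intro equalityI subsetI)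
 fix u assume "u : (%(b, q). PP b q) ` (Bx \<times> vpw n)"
 thus "u : C" using lead_pow(3) by(auto simp: Bx_def)
next
 fix u assume u: "u : C"
 note bb = best[OF u] note uu = f(2)[OF bb(1)]
 let ?A = "best u"
 define t where "t r = cf ?A r u - eps ?A r" for r
 have t0: "0 <= t r" if "r : ?A" for r using best_hop[OF u] that by(auto simp: t_def hop_def)
 define b where "b = (SUM r:?A. (eps ?A r + t r mod int (nn r)) ** r)"
 have bV: "b : V" unfolding b_def using um_sub[OF uu] by(intro V_sum V_sc) auto
 have cb: "cf ?A r b = eps ?A r + t r mod int (nn r)" if "r : ?A" for r
 proof -
  have "cf ?A r b = (SUM s:?A. (eps ?A s + t s mod int (nn s)) * cf ?A r s)"
   unfolding b_def using lin_cf[OF uu that] by(simp add: lin_sum lin_sc)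
  also have "... = (SUM s:?A. if s = r then eps ?A r + t r mod int (nn r) else 0)"
   by(rule sum.cong) (use cf_ray[OF uu that] in auto)
  finally show ?thesis using that umfin[OF uu] by simp
 qed
 have np: "0 < int (nn r)" if "r : ?A" for r using nn(2)[of r] that bb(1) by auto
 have "b : hop ?A" using bV cb np by(auto simp: hop_def)
 hence bC: "b : C" and bA: "best b = ?A" using hop_best[OF bb(1)] by auto
 have bB: "b : Bx" using bC cb np by(simp add: Bx_def bA)
 define q where "q = Abs_poly_mapping (%k. if k < n then nat (t (ray ?A k) div int (nn (ray ?A k))) else 0)"
 have lq: "lk q k = (if k < n then nat (t (ray ?A k) div int (nn (ray ?A k))) else 0)" for k
  unfolding q_def by(subst lookup_Abs_poly_mapping) auto
 have qV: "q : vpw n" by(auto simp: tv_def ik lq split: if_splits)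
 have "PP b q = u"
 proof(rule V_eqI[OF bb(1)])
  show "PP b q : V" "u : V" using lead_pow(3)[OF bC qV] u C_V by auto
  fix k assume k: "k < n"
  let ?r = "ray ?A k"
  have r: "?r : ?A" using ray(1)[OF bb(1) k] .
  have "cf ?A ?r (PP b q) = eps ?A ?r + t ?r mod int (nn ?r) + int (lk q k) * int (nn ?r)"
   using cf_PP[OF bC k, of q] bA cb[OF r] by simp
  also have "int (lk q k) = t ?r div int (nn ?r)" using lq k t0[OF r] np[OF r] by(simp add: pos_imp_zdiv_nonneg_iff)
  finally show "cf ?A ?r (PP b q) = cf ?A ?r u" by(simp add: t_def)
 qed
 thus "u : (%(b, q). PP b q) ` (Bx \<times> vpw n)" using bB qV by(auto intro!: image_eqI[of _ _ "(b, q)"])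
qed
qed

lemma finite_Bx: "finite Bx"
proof -
have "Bx <= (%(A, c). SUM r:A. c r ** r) ` (SIGMA A:Fa. PiE A (%r. {0..1 + int (nn r)}))"
proof
 fix b assume b: "b : Bx"
 hence bC: "b : C" by(simp add: Bx_def)
 note bb = best[OF bC] note uu = f(2)[OF bb(1)]
 let ?c = "restrict (%r. cf (best b) r b) (best b)"
 have "cf (best b) r b : {0..1 + int (nn r)}" if "r : best b" for r
  using best_hop[OF bC] b that unfolding hop_def Bx_def eps_def by(auto split: if_splits)
 hence "?c : PiE (best b) (%r. {0..1 + int (nn r)})" by auto
 moreover have "b = (SUM r:best b. ?c r ** r)" using cf_expand[OF uu, of b] bC C_V by auto
 ultimately show "b : (%(A, c). SUM r:A. c r ** r) ` (SIGMA A:Fa. PiE A (%r. {0..1 + int (nn r)}))"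
  using bb(1) by(intro image_eqI[of _ _ "(best b, ?c)"]) auto
qed
thus ?thesis by(rule finite_subset) (use f(1,2) umfin in "auto intro!: finite_SigmaI finite_PiE")
qed

lemma Bx_C: "Bx <= C" by(auto simp: Bx_def)

lemma theta_KM: "tht k : KM C"
unfolding tht_def by(intro KM_sum KM_sng) (use nn_ray_C in auto)

lemma triangular_fan: "triangular Bx n (tht :: nat => ('k::field) lau) PP C kap"
by unfold_locales (use finite_Bx bij_PP lead_pow(1) Bx_C in auto)
end

section \<open>Prime ideals of an algebra that is free over a polynomial ring\<close>

lemma tv_add: "p : tv T ==> q : tv T ==> p + q : tv T"
unfolding tv_def using keys_add[of p q] by auto

lemma tv_0 [simp]: "0 : tv T" by(simp add: tv_def)

lemma tv_mono: "S <= T ==> tv S <= tv T" by(auto simp: tv_def)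

lemma KM_mono: "S <= T ==> KM S <= KM T" by(auto simp: KM_def)
abbreviation TP :: "nat set => ((nat \<Rightarrow>\<^sub>0 nat) \<Rightarrow>\<^sub>0 'k::field) set" where
"TP T == KM (tv T)"

lemma TP_mono: "S <= T ==> TP S <= TP T"
by(intro KM_mono tv_mono)

lemma TP_mult: "f : TP T ==> g : TP T ==> f * g : TP T"
by(rule KM_mult[OF tv_add])

lemma TP_1 [simp]: "1 : TP T"
by(simp add: KM_def)

lemma TP_power: "f : TP T ==> f ^ k : TP T"
by(induction k) (auto intro: TP_mult)

lemma TP_prod: "(!!i. i : I ==> f i : TP T) ==> prod f I : TP T"
by(induction I rule: fin_ind) (auto intro: TP_mult)
text \<open>The coefficient of the m-th power of variable j, free of that variable. It allows
  arguments on polynomials in one variable without leaving the type.\<close>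

definition cin :: "nat => nat => ((nat \<Rightarrow>\<^sub>0 nat) \<Rightarrow>\<^sub>0 'k::field) => ((nat \<Rightarrow>\<^sub>0 nat) \<Rightarrow>\<^sub>0 'k)" where
"cin j m s = Abs_poly_mapping (%q. if lk q j = 0 then lk s (q + sng j m) else 0)"
abbreviation yv :: "nat => nat => ((nat \<Rightarrow>\<^sub>0 nat) \<Rightarrow>\<^sub>0 'k::field)" where
"yv j m == mon (sng j m)"

lemma lk_cin: "lk (cin j m s) q = (if lk q j = 0 then lk s (q + sng j m) else 0)"
proof -
have "{q. (if lk q j = 0 then lk s (q + sng j m) else 0) ~= 0} <= (%q. q - sng j m) ` keys s"
 by(auto simp: ik image_iff intro!: bexI[of _ "_ + sng j m"] split: if_splits)
hence "finite {q. (if lk q j = 0 then lk s (q + sng j m) else 0) ~= 0}"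
 by(rule finite_subset) simp
thus ?thesis unfolding cin_def by(subst lookup_Abs_poly_mapping) auto
qed

lemma cin_0 [simp]: "cin j m 0 = 0"
by(rule pmI) (simp add: lk_cin)

lemma cin_add: "cin j m (s + t) = cin j m s + cin j m t"
by(rule pmI) (simp add: lk_cin lk_add)

lemma cin_diff: "cin j m (s - t) = cin j m s - cin j m t"
by(rule pmI) (simp add: lk_cin lk_diff)

lemma cin_sum: "cin j m (sum f A) = (SUM x:A. cin j m (f x))"
by(induction A rule: fin_ind) (simp_all add: cin_add)

lemma cin_single: "cin j m (sng q c) =
 (if lk q j = m then sng (q - sng j m) c else 0)"
proof(rule pmI)
fix r
have *: "lk q j = m ==> q = q - sng j m + sng j m"
 by(rule pmI) (auto simp: lk_add lk_diff lk_sng when_def)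
have "(q = r + sng j m & lk r j = 0) <-> (lk q j = m & q - sng j m = r)"
 using * by(auto simp: lk_add lk_diff lk_sng)
thus "lk (cin j m (sng q c)) r =
  lk (if lk q j = m then sng (q - sng j m) c else 0) r"
 by(auto simp: lk_cin lk_sng when_def)
qed

lemma additive_eqI:
assumes "!!x y. S (x + y) = S x + (S y :: 'c::ab_group_add)" "!!x y. T (x + y) = T x + T y"
 and "!!q c. S (sng q c) = T (sng q c)"
shows "S (s :: 'a \<Rightarrow>\<^sub>0 'k::field) = T s"
proof -
have z: "S 0 = 0" "T 0 = 0" using assms(1,2)[of 0 0] by auto
have "S (sum f A) = (SUM x:A. S (f x))" "T (sum f A) = (SUM x:A. T (f x))" for f and A :: "'a set"
 by(induction A rule: fin_ind) (simp_all add: z assms(1,2))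
hence "S (SUM q:keys s. sng q (lk s q)) = T (SUM q:keys s. sng q (lk s q))"
 using assms(3) by simp
thus ?thesis by(simp add: sum_sng)
qed

lemma cin_mult:
assumes "!!q. q : keys g ==> lk q j = 0"
shows "cin j m (g * s) = g * cin j m s"
proof -
have 1: "cin j m (sng q c * s) = sng q c * cin j m s" if "lk q j = 0" for q c
proof(rule additive_eqI[where S = "%s. cin j m (sng q c * s)" and T = "%s. sng q c * cin j m s"])
 fix q' c'
 have "lk q' j = m ==> q + q' - sng j m = q + (q' - sng j m)"
  by(rule pmI) (auto simp: lk_add lk_diff lk_sng when_def that)
 thus "cin j m (sng q c * sng q' c') = sng q c * cin j m (sng q' c')"
  by(simp add: mult_single cin_single lk_add that)
qed (simp_all add: cin_add distrib_left)
have "cin j m (g * s) = cin j m (SUM q:keys g. sng q (lk g q) * s)"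
 by(simp add: sum_distrib_right[symmetric] sum_sng)
also have "... = (SUM q:keys g. sng q (lk g q) * cin j m s)"
 unfolding cin_sum by(rule sum.cong) (use 1 assms in auto)
also have "... = g * cin j m s" by(simp add: sum_distrib_right[symmetric] sum_sng)
finally show ?thesis .
qed

lemma cin_yv: "cin j m (yv j l * s) = (if l <= m then cin j (m - l) s else 0)"
proof(rule additive_eqI[where S = "%s. cin j m (yv j l * s)" and T = "%s. if l <= m then cin j (m - l) s else 0"])
fix q c
have "l + lk q j = m ==> sng j l + q - sng j m = q - sng j (m - l)"
 by(rule pmI) (auto simp: lk_add lk_diff lk_sng when_def)
thus "cin j m (yv j l * sng q c) = (if l <= m then cin j (m - l) (sng q c) else 0)"
 by(auto simp: mult_single cin_single lk_add)
qed (simp_all add: cin_add distrib_left)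

lemma keys_cin: "s : TP T ==> cin j m s : TP (T - {j})"
unfolding KM_def tv_def
proof clarify
fix q k assume h: "keys s <= {q. keys q <= T}" "q : keys (cin j m s)" "k : keys q"
hence q: "lk q j = 0" "q + sng j m : keys s"
 by(auto simp: ik lk_cin split: if_splits)
have "k : keys (q + sng j m)" using h(3) by(auto simp: ik lk_add)
moreover have "keys (q + sng j m) <= T" using h(1) q(2) by blast
ultimately show "k : T - {j}" using h(3) q(1) by(auto simp: ik)
qed

lemma free_cin: "q : keys (cin j m s) ==> lk q j = 0"
by(auto simp: ik lk_cin split: if_splits)

lemma free_TP: "s : TP T ==> j ~: T ==> q : keys s ==> lk q j = 0"
by(auto simp: KM_def tv_def ik subset_iff)

lemma cin_bound: "EX N. ALL m>=N. cin j m s = 0"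
proof -
have "finite ((%q. lk q j) ` keys s)" by simp
then obtain N where N: "!!q. q : keys s ==> lk q j < N"
 using finite_nat_set_iff_bounded by(metis imageI)
have "cin j m s = 0" if "m >= N" for m
proof(rule pmI)
 fix q
 have "lk (q + sng j m) j >= N" using that by(simp add: lk_add)
 hence "q + sng j m ~: keys s" using N by fastforce
 thus "lk (cin j m s) q = lk 0 q" by(simp add: lk_cin ik)
qed
thus ?thesis by blast
qed

lemma cin_expand:
assumes "!!m. m >= N ==> cin j m s = 0"
shows "s = (SUM m<N. yv j m * cin j m s)"
proof -
have N: "lk q j < N" if "q : keys s" for q
proof(rule ccontr)
 assume "~ ?thesis"
 hence "lk (cin j (lk q j) s) (q - sng j (lk q j)) = 0" using assms[of "lk q j"] by simp
 moreover have "q - sng j (lk q j) + sng j (lk q j) = q"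
  by(rule pmI) (auto simp: lk_add lk_diff lk_sng when_def)
 ultimately show False using that by(simp add: lk_cin lk_diff ik)
qed
have 1: "(SUM m<N. yv j m * cin j m (sng q c)) = sng q c" if "lk q j < N" for q c
proof -
 have "sng j (lk q j) + (q - sng j (lk q j)) = q"
  by(rule pmI) (auto simp: lk_add lk_diff lk_sng when_def)
 hence "(SUM m<N. yv j m * cin j m (sng q c)) = (SUM m<N. if m = lk q j then sng q c else 0)"
  by(intro sum.cong) (auto simp: cin_single mult_single)
 thus ?thesis using that by simp
qed
have "(SUM m<N. yv j m * cin j m s) = (SUM m<N. yv j m * cin j m (SUM q:keys s. sng q (lk s q)))"
 by(simp add: sum_sng)
also have "... = (SUM q:keys s. SUM m<N. yv j m * cin j m (sng q (lk s q)))"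
 unfolding cin_sum sum_distrib_left by(rule sum.swap)
also have "... = (SUM q:keys s. sng q (lk s q))" by(rule sum.cong) (use 1 N in auto)
finally show ?thesis by(simp add: sum_sng)
qed

section \<open>Subrings, generated ideals and division with remainder\<close>

definition gen :: "'a::comm_ring_1 set => 'a set => 'a set" where
"gen D G = {SUM g:G. r g * g | r. ALL g:G. r g : D}"
definition sbr :: "'a::comm_ring_1 set => bool" where
"sbr D <-> 0 : D & 1 : D & (ALL x:D. - x : D) & (ALL x:D. ALL y:D. x + y : D & x * y : D)"

lemma sbr:
assumes "sbr D"
shows "0 : D" "1 : D" "x : D ==> - x : D" "x : D ==> y : D ==> x + y : D"
 "x : D ==> y : D ==> x * y : D" "x : D ==> y : D ==> x - y : D" "x : D ==> x ^ k : D"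
proof -
show d: "0 : D" "1 : D" "x : D ==> - x : D" "x : D ==> y : D ==> x + y : D" "x : D ==> y : D ==> x * y : D" for x y
 using assms by(auto simp: sbr_def)
show "x : D ==> y : D ==> x - y : D" using d(4)[of x "- y"] d(3)[of y] by simp
show "x : D ==> x ^ k : D" by(induction k) (auto intro: d)
qed

lemma sbr_sum: "sbr D ==> (!!i. i : I ==> f i : D) ==> sum f I : D"
by(induction I rule: fin_ind) (auto intro: sbr)

lemma sbr_KMI:
assumes "0 : C" "!!u v. u : C ==> v : C ==> u + v : C"
shows "sbr (KM C :: ('a::comm_monoid_add \<Rightarrow>\<^sub>0 'k::field) set)"
unfolding sbr_def using assms by(auto intro: KM_uminus KM_add KM_mult[OF assms(2)] KM_sng simp flip: single_one)

lemma sbr_TP: "sbr (TP T)"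
by(rule sbr_KMI[OF tv_0 tv_add])

lemma gen_0: "sbr D ==> 0 : gen D G"
unfolding gen_def mem_Collect_eq by(rule exI[of _ "%_. 0"]) (auto intro: sbr)

lemma gen_add: "sbr D ==> x : gen D G ==> y : gen D G ==> x + y : gen D G"
proof -
assume D: "sbr D" and "x : gen D G" "y : gen D G"
then obtain r s where "ALL g:G. r g : D" "ALL g:G. s g : D" "x = (SUM g:G. r g * g)" "y = (SUM g:G. s g * g)"
 unfolding gen_def by blast
thus ?thesis unfolding gen_def mem_Collect_eq
 by(intro exI[of _ "%g. r g + s g"]) (auto simp: sum.distrib distrib_right intro: sbr[OF D])
qed

lemma gen_mult: "sbr D ==> x : gen D G ==> d : D ==> d * x : gen D G"
proof -
assume D: "sbr D" and "x : gen D G" and d: "d : D"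
then obtain r where "ALL g:G. r g : D" "x = (SUM g:G. r g * g)" unfolding gen_def by blast
thus ?thesis unfolding gen_def mem_Collect_eq
 by(intro exI[of _ "%g. d * r g"]) (auto simp: sum_distrib_left mult.assoc intro: sbr[OF D] d)
qed

lemma gen_diff: "sbr D ==> x : gen D G ==> y : gen D G ==> x - y : gen D G"
using gen_add[of D x G "- y"] gen_mult[of D y G "- 1"] by(simp add: sbr)

lemma gen_sum: "sbr D ==> (!!i. i : I ==> f i : gen D G) ==> sum f I : gen D G"
by(induction I rule: fin_ind) (auto intro: gen_0 gen_add)

lemma gen_mono: "sbr D ==> finite H ==> G <= H ==> x : gen D G ==> x : gen D H"
proof -
assume D: "sbr D" and "finite H" "G <= H" "x : gen D G"
then obtain r where r: "ALL g:G. r g : D" "x = (SUM g:G. r g * g)" unfolding gen_def by blast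
have "x = (SUM g:H. (if g : G then r g else 0) * g)" unfolding r(2)
 by(rule sum.mono_neutral_cong_left) (use \<open>finite H\<close> \<open>G <= H\<close> in auto)
thus ?thesis unfolding gen_def mem_Collect_eq
 by(intro exI[of _ "%g. if g : G then r g else 0"]) (use r(1) sbr(1)[OF D] in auto)
qed

lemma gen_base: "sbr D ==> finite G ==> g : G ==> g : gen D G"
proof -
assume D: "sbr D" and G: "finite G" "g : G"
have "g = (SUM h:G. (if h = g then 1 else 0) * h)" using G by(simp add: if_distrib[of "%c. c * _"] cong: if_cong)
thus ?thesis unfolding gen_def mem_Collect_eq
 by(intro exI[of _ "%h. if h = g then 1 else 0"]) (auto intro: sbr[OF D])
qed

text \<open>If the generators \<open>G\<close> and the coefficients of \<open>g\<close> do not involve \<open>y\<^sub>j\<close>, comparing top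
  coefficients in \<open>y\<^sub>j\<close> shows that \<open>g\<close> is a nonzerodivisor modulo \<open>G\<close> once its leading
  coefficient is inverted.\<close>
lemma regular_step:
fixes g :: "(nat \<Rightarrow>\<^sub>0 nat) \<Rightarrow>\<^sub>0 'k::field"
assumes jS: "j : S" and G: "finite G" "G <= TP (S - {j})" and g: "g : TP S" "!!m. m > e ==> cin j m g = 0"
shows "s : TP S ==> (!!m. m >= N ==> cin j m s = 0) ==> g * s : gen (TP S) G ==>
 EX k. cin j e g ^ k * s : gen (TP S) G"
proof(induction N arbitrary: s)
case 0
hence "s = 0" using cin_expand[of 0 j s] by simp
thus ?case using gen_0[OF sbr_TP] by auto
next
case (Suc N)
let ?I = "gen (TP S) G" and ?c = "cin j e g"
have cS: "?c : TP S" using keys_cin[OF g(1)] TP_mono[of "S - {j}" S] by blast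
have coeffI: "cin j m x : ?I" if "x : ?I" for x m
proof -
 from that obtain r where r: "ALL h:G. r h : TP S" "x = (SUM h:G. r h * h)" unfolding gen_def by blast
 have "cin j m x = (SUM h:G. cin j m (r h) * h)"
  unfolding r(2) cin_sum
 proof(rule sum.cong)
  fix h assume "h : G"
  hence "!!q. q : keys h ==> lk q j = 0" using free_TP[of h "S - {j}" j] G(2) by auto
  from cin_mult[OF this, where m = m and s = "r h"] show "cin j m (r h * h) = cin j m (r h) * h" by(simp add: mult.commute)
 qed simp
 moreover have "ALL h:G. cin j m (r h) : TP S" using r(1) keys_cin TP_mono[of "S - {j}" S] by blast
 ultimately show ?thesis unfolding gen_def mem_Collect_eq by(intro exI[of _ "%h. cin j m (r h)"]) simp
qed
have gexp: "g = (SUM m<Suc e. yv j m * cin j m g)" by(rule cin_expand) (use g(2) in auto)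
\<comment> \<open>In degree N + e only the product of the two top coefficients survives. The ideal
  is closed under taking coefficients because \<open>G\<close> is free of y_j, so this product lies
  in it.\<close>
have "cin j (N + e) (g * s) = (SUM m<Suc e. cin j (N + e) (yv j m * (cin j m g * s)))"
 by(subst (1) gexp) (simp only: sum_distrib_right cin_sum mult.assoc)
also have "... = (SUM m<Suc e. cin j m g * cin j (N + e - m) s)"
proof(rule sum.cong)
 fix m assume "m : {..<Suc e}"
 thus "cin j (N + e) (yv j m * (cin j m g * s)) = cin j m g * cin j (N + e - m) s"
  by(simp add: cin_yv cin_mult free_cin)
qed simp
also have "... = ?c * cin j N s" using Suc.prems(2) by simp
finally have top: "?c * cin j N s : ?I" using coeffI[OF Suc.prems(3), of "N + e"] by simp
\<comment> \<open>Removing the top term from c s lowers the degree in y_j, so induction applies to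
  the difference; the removed term is already in the ideal.\<close>
let ?s = "?c * s - yv j N * (?c * cin j N s)"
have yS: "yv j N : TP S" using jS by(intro KM_sng) (auto simp: tv_def)
have nS: "cin j N s : TP S" using keys_cin[OF Suc.prems(1)] TP_mono[of "S - {j}" S] by blast
have 1: "?s : TP S" by(intro KM_diff TP_mult cS Suc.prems(1) yS nS)
have fc: "cin j m (?c * x) = ?c * cin j m x" for m x
 by(rule cin_mult) (use free_TP[OF keys_cin[OF g(1)], of j] in auto)
have cc: "cin j m (cin j N s) = (if m = 0 then cin j N s else 0)" for m
 by(rule pmI) (auto simp: lk_cin lk_add)
have 2: "cin j m ?s = 0" if "m >= N" for m
 using Suc.prems(2)[of m] that by(cases "m = N") (auto simp: cin_diff cin_yv fc cc)
have "g * ?s = ?c * (g * s) - (g * yv j N) * (?c * cin j N s)" by(simp add: algebra_simps)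
also have "... : ?I" by(intro gen_diff gen_mult sbr_TP Suc.prems(3) cS top TP_mult g(1) yS)
finally obtain k where "?c ^ k * ?s : ?I" using Suc.IH[OF 1 2] by blast
moreover have "?c ^ k * (yv j N * (?c * cin j N s)) : ?I"
 by(intro gen_mult sbr_TP top TP_power cS yS)
ultimately have "?c ^ k * ?s + ?c ^ k * (yv j N * (?c * cin j N s)) : ?I" by(rule gen_add[OF sbr_TP])
hence "?c ^ Suc k * s : ?I" by(simp add: algebra_simps)
thus ?case by blast
qed

text \<open>The leading coefficient of g is in general no unit, so every division step multiplies s
  by it. Locally at a prime that avoids the coefficient this is harmless.\<close>

lemma pseudo_division:
fixes g :: "(nat \<Rightarrow>\<^sub>0 nat) \<Rightarrow>\<^sub>0 'k::field"
assumes jS: "j : S" and g: "g : TP S" "!!m. m > e ==> cin j m g = 0"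
shows "s : TP S ==> (!!m. m >= N ==> cin j m s = 0) ==>
 EX k q r. q : TP S & r : TP S & cin j e g ^ k * s = q * g + r & (ALL m>=e. cin j m r = 0)"
proof(induction N arbitrary: s)
case 0
hence "s = 0" using cin_expand[of 0 j s] by simp
thus ?case by(intro exI[of _ 0]) auto
next
case (Suc N)
let ?c = "cin j e g"
have cS: "?c : TP S" using keys_cin[OF g(1)] TP_mono[of "S - {j}" S] by blast
show ?case
proof(cases "N < e")
 case True
 hence "1 * s = 0 * g + s & (ALL m>=e. cin j m s = 0)" using Suc.prems(2) by auto
 thus ?thesis using Suc.prems(1) by(intro exI[of _ 0] exI[of _ 0] exI[of _ s]) simp
next
 case False
 let ?t = "yv j (N - e) * cin j N s"
 let ?s = "?c * s - ?t * g"
 have yS: "yv j (N - e) : TP S" using jS by(intro KM_sng) (auto simp: tv_def)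
 have nS: "cin j N s : TP S" using keys_cin[OF Suc.prems(1)] TP_mono[of "S - {j}" S] by blast
 have tS: "?t : TP S" by(intro TP_mult yS nS)
 have sS: "?s : TP S" by(intro KM_diff TP_mult cS Suc.prems(1) tS g(1))
 have fc: "cin j m (?c * x) = ?c * cin j m x" for m x
  by(rule cin_mult) (use free_TP[OF keys_cin[OF g(1)], of j] in auto)
 have fs: "cin j m (cin j N s * x) = cin j N s * cin j m x" for m x
  by(rule cin_mult) (use free_TP[OF keys_cin[OF Suc.prems(1)], of j] in auto)
 have "cin j m ?s = 0" if "m >= N" for m
 proof(cases "m = N")
  case True
  thus ?thesis using False
   by(simp add: cin_diff cin_yv fc fs mult.assoc)
 next
  case False
  hence "m - (N - e) > e" "m > N" using that \<open>~ N < e\<close> by auto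
  thus ?thesis using Suc.prems(2)[of m] g(2)[of "m - (N - e)"] by(simp add: cin_diff cin_yv fc fs mult.assoc)
 qed
 from Suc.IH[OF sS this] obtain k q r where h: "q : TP S" "r : TP S" "?c ^ k * ?s = q * g + r" "ALL m>=e. cin j m r = 0" by blast
 have "?c ^ Suc k * s = (q + ?c ^ k * ?t) * g + r" using h(3) by(simp add: algebra_simps)
 moreover have "q + ?c ^ k * ?t : TP S" by(intro KM_add h(1) TP_mult TP_power cS tS)
 ultimately show ?thesis using h(2,4) by blast
qed
qed

text \<open>Fraction-free Gaussian elimination: the pivot entry is multiplied in instead of being
  inverted, so that the coefficients stay in \<open>R\<close>.\<close>

lemma linear_dependence:
fixes v :: "'i => 'j => 'r::idom"
assumes R: "sbr R"
shows "finite J ==> finite I ==> card J < card I ==> (!!i j. i : I ==> j : J ==> v i j : R) ==>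
 EX d. (ALL i:I. d i : R) & (EX i:I. d i ~= 0) & (ALL j:J. (SUM i:I. d i * v i j) = 0)"
proof(induction J arbitrary: I v rule: finite_induct)
case empty
hence "I ~= {}" by auto
thus ?case by(intro exI[of _ "%_. 1"]) (auto simp: sbr[OF R])
next
case (insert j J)
show ?case
proof(cases "ALL i:I. v i j = 0")
 case True
 have "card J < card I" using insert.prems(2) insert.hyps by simp
 thus ?thesis using insert.IH[of I v] insert.prems True by auto
next
 case False
 then obtain i0 where i0: "i0 : I" "v i0 j ~= 0" by blast
 let ?I = "I - {i0}" and ?v = "%i k. v i0 j * v i k - v i j * v i0 k"
 have "card J < card ?I" using insert.prems(1,2) insert.hyps i0(1) by simp
 moreover have "?v i k : R" if "i : ?I" "k : J" for i k
  using that insert.prems(3) i0(1) by(intro sbr(5,6)[OF R]) auto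
 ultimately obtain d where d: "ALL i:?I. d i : R" "EX i:?I. d i ~= 0" "ALL k:J. (SUM i:?I. d i * ?v i k) = 0"
  using insert.IH[of ?I ?v] insert.prems(1) by auto
 define e where "e i = (if i = i0 then - (SUM i:?I. d i * v i j) else d i * v i0 j)" for i
 have s: "(SUM i:I. e i * v i k) = (SUM i:?I. d i * ?v i k)" for k
 proof -
  have "(SUM i:I. e i * v i k) = e i0 * v i0 k + (SUM i:?I. e i * v i k)"
   by(rule sum.remove[OF insert.prems(1) i0(1)])
  also have "(SUM i:?I. e i * v i k) = (SUM i:?I. d i * v i0 j * v i k)" by(rule sum.cong) (auto simp: e_def)
  also have "e i0 * v i0 k = - (SUM i:?I. d i * v i j * v i0 k)" by(simp add: e_def sum_distrib_right)
  finally show ?thesis by(simp add: right_diff_distrib sum_subtractf mult.assoc)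
 qed
 have "(SUM i:I. e i * v i k) = 0" if "k : insert j J" for k
 proof(cases "k = j")
  case True
  thus ?thesis unfolding s by(simp add: mult.commute)
 qed (use that d(3) s in auto)
 moreover have "e i : R" if "i : I" for i
  unfolding e_def using that d(1) insert.prems(3) i0(1)
  by(auto intro!: sbr(3,5)[OF R] sbr_sum[OF R])
 moreover have "EX i:I. e i ~= 0" using d(2) i0(2) by(auto simp: e_def)
 ultimately show ?thesis by blast
qed
qed

section \<open>Primes and regular sequences up to factors outside a prime\<close>

definition prm :: "'a::comm_ring_1 set => 'a set => bool" where
"prm D p <-> p <= D & 0 : p & (ALL x:p. ALL y:p. x + y : p) & (ALL x:p. ALL d:D. d * x : p) & 1 ~: p &
 (ALL x:D. ALL y:D. x * y : p --> x : p | y : p)"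

lemma prm:
assumes "prm D p"
shows "p <= D" "0 : p" "x : p ==> y : p ==> x + y : p" "x : p ==> d : D ==> d * x : p"
 "1 ~: p" "x : D ==> y : D ==> x * y : p ==> x : p | y : p"
using assms unfolding prm_def by blast+

lemma prm_diff: "sbr D ==> prm D p ==> x : p ==> y : p ==> x - y : p"
using prm(3)[of D p x "- y"] prm(4)[of D p y "- 1"] sbr(2,3)[of D] by auto

lemma prm_sum: "prm D p ==> (!!i. i : I ==> f i : p) ==> sum f I : p"
by(induction I rule: fin_ind) (auto intro: prm)

lemma prm_power: "sbr D ==> prm D p ==> x : D ==> x ^ k : p ==> x : p"
proof(induction k)
case (Suc k)
thus ?case using prm(6)[of D p x "x ^ k"] sbr(7)[of D x k] by auto
qed (use prm(5) in auto)

lemma prm_prod: "sbr D ==> prm D p ==> (!!i. i : I ==> f i : D - p) ==> prod f I : D - p"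
proof(induction I rule: fin_ind)
case (insert x F)
thus ?case using prm(6)[of D p "f x" "prod f F"] sbr(5)[of D "f x" "prod f F"] by auto
qed (auto simp: sbr prm(5))
text \<open>The Cohen--Macaulay property at p without fractions: regularity holds up to factors
  outside p, and the length bounds every chain of primes below p. In \<open>local_criterion\<close>
  depth and dimension meet at this length.\<close>

definition cm_at :: "'a::comm_ring_1 set => 'a set => 'a list => bool" where
"cm_at D p gs <-> set gs <= p &
 (ALL i<length gs. ALL a:D. gs ! i * a : gen D (set (take i gs)) --> (EX s:D - p. s * a : gen D (set (take i gs)))) &
 (ALL h Q. (ALL i<=h. prm D (Q i)) & (ALL i<h. Q i < Q (Suc i)) & Q h <= p --> h <= length gs)"
definition reg_at :: "'a::comm_ring_1 set => 'a set => 'a list => bool" where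
"reg_at D p gs <-> cm_at D p gs & (ALL x:p. EX s:D - p. s * x : gen D (set gs))"

locale free_alg =
fixes D :: "('k::field) lau set" and n :: nat and th :: "nat => 'k lau"
 and B :: "'b set" and bas :: "'b => 'k lau"
assumes D: "sbr D" and Dc: "cst a : D" and Dth: "k < n ==> th k : D" and finB: "finite B"
 and Db: "b : B ==> bas b : D"
 and span: "x : D ==> EX c. (ALL b:B. c b : TP {..<n}) & x = (SUM b:B. bas b * ev th (c b))"
 and indep: "(!!b. b : B ==> c b : TP {..<n}) ==> (SUM b:B. bas b * ev th (c b)) = 0 ==> b : B ==> c b = 0"
begin
abbreviation "e == ev th"
abbreviation "Pn == TP {..<n} :: ((nat \<Rightarrow>\<^sub>0 nat) \<Rightarrow>\<^sub>0 'k) set"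

lemma e_power: "e (s ^ k) = e s ^ k"
by(induction k) (simp_all add: ev_mult)

lemma e_D: "s : Pn ==> e s : D"
proof -
assume s: "s : Pn"
have "tpow th q : D" if "q : tv {..<n}" for q
proof -
 have "(PROD k:A. th k ^ lk q k) : D" if "A <= {..<n}" for A
  using finite_subset[OF that finite_lessThan] that
  by(induction A rule: finite_induct) (auto intro!: sbr[OF D] Dth)
 thus ?thesis using that by(simp add: tpow_def tv_def)
qed
thus ?thesis unfolding ev_def using s by(intro sbr_sum[OF D] sbr(5)[OF D] Dc) (auto simp: KM_def)
qed
definition coef :: "'k lau => 'b => ((nat \<Rightarrow>\<^sub>0 nat) \<Rightarrow>\<^sub>0 'k)" where
"coef x = (SOME c. (ALL b:B. c b : Pn) & x = (SUM b:B. bas b * e (c b)))"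

lemma coef: "x : D ==> b : B ==> coef x b : Pn" "x : D ==> (SUM b:B. bas b * e (coef x b)) = x"
using someI_ex[OF span, of x] unfolding coef_def by auto

lemma coef_eq:
assumes "x : D" "!!b. b : B ==> c b : Pn" "x = (SUM b:B. bas b * e (c b))" "b : B"
shows "coef x b = c b"
proof -
have "(SUM b:B. bas b * e (coef x b - c b)) = 0"
 using coef(2)[OF assms(1)] assms(3) by(simp add: ev_diff right_diff_distrib sum_subtractf)
hence "coef x b - c b = 0"
 using indep[of "%b. coef x b - c b" b] coef(1)[OF assms(1)] assms(2,4) by(auto intro: KM_diff)
thus ?thesis by simp
qed

lemma coef_mult: "x : D ==> s : Pn ==> b : B ==> coef (e s * x) b = s * coef x b"
proof(rule coef_eq)
assume h: "x : D" "s : Pn"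
show "e s * x = (SUM b:B. bas b * e (s * coef x b))"
 by(subst (1) coef(2)[OF h(1), symmetric]) (simp add: sum_distrib_left ev_mult mult.left_commute)
qed (auto intro: TP_mult coef sbr(5)[OF D] e_D)

lemma coef_sum: "(!!i. i : I ==> x i : D) ==> b : B ==> coef (sum x I) b = (SUM i:I. coef (x i) b)"
proof(rule coef_eq)
assume h: "!!i. i : I ==> x i : D"
show "sum x I = (SUM b:B. bas b * e (SUM i:I. coef (x i) b))"
 unfolding ev_sum sum_distrib_left by(subst sum.swap) (simp add: coef(2) h)
qed (auto intro: sbr_sum[OF D] KM_sum coef)

text \<open>Here freeness enters: membership in an ideal generated by elements of the polynomial
  subring is decided coordinate by coordinate, so regularity in \<open>D\<close> becomes a question
  about polynomials.\<close>

lemma gen_coef: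
assumes G: "finite G" "G <= Pn" and x: "x : D"
shows "x : gen D (e ` G) <-> (ALL b:B. coef x b : gen Pn G)"
proof
assume "x : gen D (e ` G)"
then obtain r where r: "ALL g:e ` G. r g : D" "x = (SUM g:e ` G. r g * g)" unfolding gen_def by blast
obtain H where H: "H <= G" "inj_on e H" "e ` G = e ` H" by(meson subset_image_inj order_refl)
have x2: "x = (SUM g:H. e g * r (e g))" unfolding r(2) H(3) by(simp add: sum.reindex[OF H(2)] mult.commute)
have "coef x b : gen Pn G" if b: "b : B" for b
proof -
 have "coef x b = (SUM g:H. coef (r (e g)) b * g)" unfolding x2
 proof(subst coef_sum[OF _ b])
  show "e i * r (e i) : D" if "i : H" for i using that H(1) G(2) r(1) by(intro sbr(5)[OF D] e_D) auto
  show "(SUM i:H. coef (e i * r (e i)) b) = (SUM g:H. coef (r (e g)) b * g)"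
   by(rule sum.cong) (use H(1) G(2) r(1) b in "auto simp: coef_mult subset_iff mult.commute")
 qed
 also have "... : gen Pn H" unfolding gen_def mem_Collect_eq
  by(intro exI[of _ "%g. coef (r (e g)) b"]) (use coef(1)[OF _ b] r(1) H(1) in auto)
 finally show ?thesis using gen_mono[OF sbr_TP G(1) H(1)] by blast
qed
thus "ALL b:B. coef x b : gen Pn G" ..
next
assume h: "ALL b:B. coef x b : gen Pn G"
have "bas b * e (coef x b) : gen D (e ` G)" if b: "b : B" for b
proof -
 obtain r where r: "ALL g:G. r g : Pn" "coef x b = (SUM g:G. r g * g)" using h b unfolding gen_def by blast
 have "e g : gen D (e ` G)" if "g : G" for g using gen_base[OF D, of "e ` G"] G(1) that by auto
 hence "(SUM g:G. e (r g) * e g) : gen D (e ` G)" using r(1) e_D by(intro gen_sum[OF D] gen_mult[OF D]) auto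
 thus ?thesis unfolding r(2) ev_sum ev_mult using Db[OF b] by(rule gen_mult[OF D])
qed
hence "(SUM b:B. bas b * e (coef x b)) : gen D (e ` G)" by(intro gen_sum[OF D])
thus "x : gen D (e ` G)" using coef(2)[OF x] by simp
qed
text \<open>Algebraic independence modulo p of the parameters with index in T.\<close>

definition indep_mod :: "'k lau set => nat set => bool" where
"indep_mod p T <-> (ALL s:TP T. s ~= 0 --> e s ~: p)"

text \<open>If every \<open>th\<^sub>j\<close> were algebraic over \<open>K[th\<^sub>T]\<close> modulo \<open>P'\<close>, so would be all of \<open>D\<close>, and an element of
  \<open>P - P'\<close> would have a nonzero multiple in \<open>K[th\<^sub>T]\<close> modulo \<open>P'\<close>.\<close>
lemma extend_indep:
assumes P: "prm D P" and P': "prm D P'" and lt: "P' < P" and T: "T <= {..<n}" "indep_mod P T"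
shows "EX j<n. j ~: T & indep_mod P' (insert j T)"
proof(rule ccontr)
assume neg: "~ ?thesis"
define J where "J = {..<n} - T"
hence finJ: "finite J" by simp
have "TP T <= Pn" by(rule TP_mono[OF T(1)])
hence eT: "e c : D" if "c : TP T" for c using e_D that by blast
have ex: "EX s d. s : TP (insert j T) & e s : P' & cin j d s ~= 0 & (ALL m>d. cin j m s = 0)" if j: "j : J" for j
proof -
 obtain s where s: "s : TP (insert j T)" "s ~= 0" "e s : P'" using neg j unfolding indep_mod_def J_def by blast
 obtain N where N: "ALL m>=N. cin j m s = 0" using cin_bound by blast
 let ?K = "{m. cin j m s ~= 0}"
 have ne: "?K ~= {}" using cin_expand[of 0 j s] s(2) by auto
 have fin: "finite ?K" by(rule finite_subset[of _ "{..<N}"]) (use N in "auto simp: not_le[symmetric]")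
 have "cin j m s = 0" if "m > Max ?K" for m using Max_ge[OF fin, of m] that by auto
 thus ?thesis using s Max_in[OF fin ne] by blast
qed
then obtain s d where sd: "!!j. j : J ==> s j : TP (insert j T)" "!!j. j : J ==> e (s j) : P'"
 "!!j. j : J ==> cin j (d j) (s j) ~= 0" "!!j m. j : J ==> m > d j ==> cin j m (s j) = 0" by metis
have cT: "cin j m (s j) : TP T" if "j : J" for j m
 using keys_cin[OF sd(1)[OF that], of j m] that by(simp add: J_def)
\<comment> \<open>The span of F over the fraction field of K[th_T] modulo P', with denominators c
  cleared.\<close>
define W where "W F = {x. EX c t. c : TP T & c ~= 0 & (ALL f:F. t f : TP T) & e c * x - (SUM f:F. e (t f) * f) : P'}" for F
have WI: "x : W F" if "c : TP T" "c ~= 0" "!!f. f : F ==> t f : TP T" "y : P'" "e c * x - (SUM f:F. e (t f) * f) = y" for c t x y F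
 unfolding W_def using that by blast
have W_add: "x + y : W F" if xy: "x : W F" "y : W F" for x y F
proof -
 from xy obtain c t c' t' where h: "c : TP T" "c ~= 0" "ALL f:F. t f : TP T" "e c * x - (SUM f:F. e (t f) * f) : P'"
  "c' : TP T" "c' ~= 0" "ALL f:F. t' f : TP T" "e c' * y - (SUM f:F. e (t' f) * f) : P'" unfolding W_def by blast
 show ?thesis
 proof(rule WI[of "c * c'" _ "%f. c' * t f + c * t' f"])
  show "e c' * (e c * x - (SUM f:F. e (t f) * f)) + e c * (e c' * y - (SUM f:F. e (t' f) * f)) : P'"
   by(intro prm(3,4)[OF P'] h eT)
 qed (use h in "auto simp: ev_mult ev_add algebra_simps sum.distrib sum_distrib_left intro: TP_mult KM_add")
qed
have W_mult: "e c * x : W F" if x: "x : W F" and c: "c : TP T" for x c F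
proof -
 from x obtain c' t where h: "c' : TP T" "c' ~= 0" "ALL f:F. t f : TP T" "e c' * x - (SUM f:F. e (t f) * f) : P'" unfolding W_def by blast
 show ?thesis by(rule WI[OF h(1,2) _ prm(4)[OF P' h(4) eT[OF c]], of _ "%f. c * t f"])
  (use h c in "auto simp: ev_mult algebra_simps sum_distrib_left intro: TP_mult")
qed
have W_div: "x : W F" if x: "e c * x : W F" and c: "c : TP T" "c ~= 0" for x c F
proof -
 from x obtain c' t where h: "c' : TP T" "c' ~= 0" "ALL f:F. t f : TP T" "e c' * (e c * x) - (SUM f:F. e (t f) * f) : P'" unfolding W_def by blast
 show ?thesis by(rule WI[OF _ _ _ h(4), of "c' * c"]) (use h c in "auto simp: ev_mult mult.assoc intro: TP_mult")
qed
have W_P: "x : W F" if "x : P'" for x F by(rule WI[OF TP_1 _ _ that, of _ "%_. 0"]) auto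
have W_gen: "f : W F" if "f : F" "finite F" for f F
proof(rule WI[OF TP_1 _ _ prm(2)[OF P'], of _ "%g. if g = f then 1 else 0"])
 have "(SUM g:F. e (if g = f then 1 else 0) * g) = (SUM g:F. if g = f then g else 0)" by(rule sum.cong) auto
 thus "e 1 * f - (SUM g:F. e (if g = f then 1 else 0) * g) = 0" using that by simp
qed auto
have W_sum: "sum f A : W F" if "!!i. i : A ==> f i : W F" for f and A :: "'z set" and F
 using that by(induction A rule: fin_ind) (auto intro: W_add W_P prm(2)[OF P'])
have "EX F. finite F & F <= D & (ALL b:B. ALL q:tv (T Un J'). bas b * tpow th q : W F)" if "J' <= J" for J'
 using finite_subset[OF that finJ] that
proof(induction J' rule: finite_induct)
 case empty
 have "bas b * tpow th q : W (bas ` B)" if "b : B" "q : tv T" for b q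
  using W_mult[OF W_gen[of "bas b" "bas ` B"] KM_sng[OF that(2), of 1]] that(1) finB by(simp add: mult.commute)
 thus ?case using finB Db by(intro exI[of _ "bas ` B"]) auto
next
 case (insert j J')
 then obtain F where F: "finite F" "F <= D" "ALL b:B. ALL q:tv (T Un J'). bas b * tpow th q : W F" by auto
 have j: "j : J" using insert.prems by simp
 have thD: "th j ^ m : D" for m using j Dth by(intro sbr(7)[OF D]) (simp add: J_def)
 \<comment> \<open>The relation for j expresses powers of \<open>th j\<close> from
   \<open>d j\<close> on by lower ones over that fraction field, so \<open>d j\<close> powers
   suffice.\<close>
 let ?F = "(%(f, m). f * th j ^ m) ` (F \<times> {..<d j})"
 have 1: "f * th j ^ l : W ?F" if f: "f : F" for f l
 proof(induction l rule: less_induct)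
  case (less l)
  show ?case
  proof(cases "l < d j")
   case True
   thus ?thesis using f F(1) by(intro W_gen) force+
  next
   case False
   let ?c = "%m. cin j m (s j)"
   have "s j = (SUM m<Suc (d j). yv j m * ?c m)" by(rule cin_expand) (use sd(4)[OF j] in auto)
   from arg_cong[OF this, of e] have r: "e (?c (d j)) * th j ^ d j = e (s j) + (SUM m<d j. e (- ?c m) * th j ^ m)"
    unfolding ev_sum ev_mult ev_uminus by(simp add: sum_negf mult.commute)
   have l: "th j ^ l = th j ^ (l - d j) * th j ^ d j" using False by(simp flip: power_add)
   have "e (?c (d j)) * (f * th j ^ l) = f * th j ^ (l - d j) * (e (?c (d j)) * th j ^ d j)" unfolding l by(simp add: mult_ac)
   also have "... = f * th j ^ (l - d j) * e (s j) + (SUM m<d j. e (- ?c m) * (f * th j ^ (m + (l - d j))))"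
    unfolding r by(simp add: distrib_left sum_distrib_left power_add mult_ac)
   also have "... : W ?F"
   proof(rule W_add[OF W_P W_sum[OF W_mult]])
    show "f * th j ^ (l - d j) * e (s j) : P'" using f F(2) by(intro prm(4)[OF P' sd(2)[OF j]] sbr(5)[OF D] thD) auto
    show "f * th j ^ (m + (l - d j)) : W ?F" if "m : {..<d j}" for m using that False by(intro less) simp
   qed (intro KM_uminus cT j)
   finally show ?thesis by(rule W_div[OF _ cT[OF j] sd(3)[OF j]])
  qed
 qed
 have 2: "x * th j ^ l : W ?F" if "x : W F" for x l
 proof -
  from that obtain c t where h: "c : TP T" "c ~= 0" "ALL f:F. t f : TP T" "e c * x - (SUM f:F. e (t f) * f) : P'" unfolding W_def by blast
  have "e c * (x * th j ^ l) = th j ^ l * (e c * x - (SUM f:F. e (t f) * f)) + (SUM f:F. e (t f) * (f * th j ^ l))"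
   by(simp add: algebra_simps sum_distrib_left)
  also have "... : W ?F" by(rule W_add[OF W_P[OF prm(4)[OF P' h(4) thD]] W_sum[OF W_mult[OF 1]]]) (use h(3) in auto)
  finally show ?thesis by(rule W_div[OF _ h(1,2)])
 qed
 have "bas b * tpow th q : W ?F" if b: "b : B" "q : tv (T Un insert j J')" for b q
 proof -
  let ?q = "q - sng j (lk q j)"
  have q: "?q + sng j (lk q j) = q" by(rule pmI) (auto simp: lk_add lk_diff lk_sng when_def)
  have "?q : tv (T Un J')" using b(2) by(auto simp: tv_def ik subset_iff lk_diff lk_sng when_def split: if_splits)
  hence "bas b * tpow th ?q * th j ^ lk q j : W ?F" using F(3) b(1) 2 by blast
  thus ?thesis using tpow_add[of th ?q "sng j (lk q j)"] unfolding q by(simp add: mult.assoc)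
 qed
 moreover have "?F <= D" using F(2) thD by(auto intro!: sbr(5)[OF D])
 ultimately show ?case using F(1) by(intro exI[of _ ?F]) auto
qed
from this[of J] obtain F where F: "finite F" "F <= D" "!!b q. b : B ==> q : tv {..<n} ==> bas b * tpow th q : W F"
 using T(1) by(auto simp: J_def Un_absorb1)
have W_D: "x : W F" if x: "x : D" for x
proof -
 have "x = (SUM b:B. SUM q:keys (coef x b). e (cst (lk (coef x b) q)) * (bas b * tpow th q))"
  by(subst (1) coef(2)[OF x, symmetric]) (simp add: ev_def[of th "coef x _"] sum_distrib_left mult.left_commute)
 also have "... : W F" by(intro W_sum W_mult F(3)) (use coef(1)[OF x] in "auto simp: KM_def")
 finally show ?thesis .
qed
obtain a where a: "a : P" "a ~: P'" using lt by blast
have aD: "a : D" using prm(1)[OF P] a by auto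
\<comment> \<open>No nonzero polynomial in a over K[th_T] lies in P'. As a is not in the prime P',
  powers of a can be cancelled until the constant coefficient is nonzero; since a lies in P, that
  coefficient lies in P as well, against independence modulo P.\<close>
have no: "ALL i<=N. u i : TP T ==> EX i<=N. u i ~= 0 ==> (SUM i<=N. e (u i) * a ^ i) ~: P'" for u and N :: nat
proof(induction N arbitrary: u)
 case 0
 thus ?case using T(2) lt unfolding indep_mod_def by auto
next
 case (Suc N)
 let ?v = "SUM i<=N. e (u (Suc i)) * a ^ i"
 have vD: "?v : D" using Suc.prems(1) by(intro sbr_sum[OF D] sbr(5,7)[OF D] eT aD) auto
 have eq: "(SUM i<=Suc N. e (u i) * a ^ i) = e (u 0) + a * ?v"
  unfolding sum.atMost_Suc_shift by(simp add: sum_distrib_left mult.left_commute)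
 show ?case
 proof
  assume h: "(SUM i<=Suc N. e (u i) * a ^ i) : P'"
  show False
  proof(cases "u 0 = 0")
   case True
   have "EX i<=N. u (Suc i) ~= 0" using Suc.prems(2) True by (metis Suc_le_mono not0_implies_Suc)
   moreover have "?v : P'" using h prm(6)[OF P' aD vD] a(2) unfolding eq True by simp
   ultimately show False using Suc.IH[of "%i. u (Suc i)"] Suc.prems(1) by simp
  next
   case False
   have "e (u 0) + a * ?v : P" "a * ?v : P" using h lt prm(4)[OF P a(1) vD] unfolding eq by(auto simp: mult.commute)
   from prm_diff[OF D P this] show False using T(2) False Suc.prems(1) unfolding indep_mod_def by simp
  qed
 qed
qed
\<comment> \<open>The powers of a up to \<open>card F\<close> outnumber \<open>F\<close>, so their
  expressions in \<open>F\<close> are linearly dependent, and this produces the forbidden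
  polynomial.\<close>
let ?I = "{..card F}"
have "ALL i. EX c t. c : TP T & c ~= 0 & (ALL f:F. t f : TP T) & e c * a ^ i - (SUM f:F. e (t f) * f) : P'"
 using W_D[OF sbr(7)[OF D aD]] unfolding W_def by blast
from choice[OF this] obtain c where "ALL i. EX t. c i : TP T & c i ~= 0 & (ALL f:F. t f : TP T) & e (c i) * a ^ i - (SUM f:F. e (t f) * f) : P'" ..
from choice[OF this] obtain t where ct: "!!i. c i : TP T" "!!i. c i ~= 0" "!!i f. f : F ==> t i f : TP T"
 "!!i. e (c i) * a ^ i - (SUM f:F. e (t i f) * f) : P'" by blast
obtain dd where dd: "ALL i:?I. dd i : TP T" "EX i:?I. dd i ~= 0" "ALL k:F. (SUM i:?I. dd i * t i k) = 0"
 using linear_dependence[OF sbr_TP F(1), of ?I t T] ct(3) by auto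
have "(SUM i:?I. e (dd i) * (SUM k:F. e (t i k) * k)) = (SUM k:F. e (SUM i:?I. dd i * t i k) * k)"
 unfolding ev_sum sum_distrib_left sum_distrib_right by(subst sum.swap) (simp add: ev_mult mult_ac)
hence "(SUM i:?I. e (dd i * c i) * a ^ i) = (SUM i:?I. e (dd i) * (e (c i) * a ^ i - (SUM k:F. e (t i k) * k)))"
 using dd(3) by(simp add: right_diff_distrib sum_subtractf ev_mult mult.assoc)
also have "... : P'" by(intro prm_sum[OF P'] prm(4)[OF P'] ct(4) eT) (use dd(1) in blast)
finally show False using no[of "card F" "%i. dd i * c i"] dd(1,2) ct(1,2) by(auto intro: TP_mult)
qed
end

lemma (in colored_fan) free_alg_KM:
assumes "0 : C"
shows "free_alg (KM C :: ('k::field) lau set) n tht Bx mon"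
proof -
interpret tr: triangular Bx n "tht :: nat => 'k lau" PP C kap by(rule triangular_fan)
show ?thesis
 by unfold_locales (use assms theta_KM Bx_C C_add finite_Bx tr.triangular_free_span tr.triangular_free_indep in "auto intro!: sbr_KMI KM_sng")
qed

lemma cin_cin: "cin j m (cin j l s) = (if m = 0 then cin j l s else 0)"
by(rule pmI) (auto simp: lk_cin lk_add)

lemma tv_empty: "tv {} = {0}"
by(auto simp: tv_def)
context free_alg
begin
context
fixes p :: "'k lau set"
assumes p: "prm D p"
begin

lemma unit_notin: "c ~= 0 ==> cst c ~: p"
proof
assume "c ~= 0" "cst c : p"
hence "cst (inverse c) * cst c : p" using prm(4)[OF p _ Dc] by blast
thus False using prm(5)[OF p] \<open>c ~= 0\<close> by(simp add: mult_single)
qed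

lemma TP_empty: "f : TP {} ==> e f : p ==> f = 0"
proof -
assume f: "f : TP {}" "e f : p"
hence "keys f <= {0}" by(simp add: KM_def tv_empty)
hence eq: "f = cst (lk f 0)" by(intro pmI) (auto simp: lk_sng when_def ik)
hence "e f = cst (lk f 0)" by(metis ev_single mult.right_neutral tpow_0)
thus "f = 0" using eq unit_notin f(2) by(metis single_zero)
qed
text \<open>\<open>th j\<close> is algebraic modulo p over the parameters before it; a coefficient
  outside p makes the relation nontrivial.\<close>

definition alg :: "nat => bool" where
"alg j <-> (EX g:TP {..<Suc j}. e g : p & (EX m. e (cin j m g) ~: p))"

lemma coeff_TP: "g : TP {..<Suc j} ==> cin j m g : TP {..<j}"
using keys_cin[of g "{..<Suc j}" j m] by(simp add: lessThan_Suc)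

lemma TP_n: "j <= n ==> TP {..<j} <= Pn"
by(rule TP_mono) auto

lemma yv_TP: "j : S ==> yv j m : TP S"
by(intro KM_sng) (auto simp: tv_def)

text \<open>Top terms with coefficients in p are themselves mapped into p, so they can be removed
  until the leading coefficient is outside p.\<close>

lemma strip:
assumes j: "j < n" and g: "g : TP {..<Suc j}" "e g : p" "e (cin j m g) ~: p" and N: "!!m. N <= m ==> cin j m g = 0"
shows "EX g' d. d < N & g' : TP {..<Suc j} & e g' : p & e (cin j d g') ~: p & (ALL m>d. cin j m g' = 0)"
proof -
let ?M = "{m. e (cin j m g) ~: p}"
have fin: "finite ?M" by(rule finite_subset[of _ "{..<N}"]) (use N prm(2)[OF p] in "force simp: not_le[symmetric]")+
define d where "d = Max ?M"
have d: "d : ?M" unfolding d_def using fin g(3) by(intro Max_in) auto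
have dN: "d < N" using d N prm(2)[OF p] by(force simp: not_le[symmetric])
let ?h = "SUM m:{Suc d..<N}. yv j m * cin j m g"
let ?g = "g - ?h"
have yS: "yv j m * cin j m g : TP {..<Suc j}" for m
 using TP_mono[of "{..<j}" "{..<Suc j}"] coeff_TP[OF g(1)] by(intro TP_mult yv_TP) auto
have cg: "cin j l ?g = (if l <= d then cin j l g else 0)" for l
proof -
 have "cin j l ?h = (SUM m:{Suc d..<N}. if m = l then cin j l g else 0)"
  unfolding cin_sum by(rule sum.cong) (auto simp: cin_yv cin_cin)
 thus ?thesis using N[of l] by(auto simp: cin_diff)
qed
have "e ?g : p"
 unfolding ev_diff ev_sum ev_mult
proof(intro prm_diff[OF D p] g(2) prm_sum[OF p] prm(4)[OF p])
 fix m assume "m : {Suc d..<N}"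
 hence "m ~: ?M" using Max_ge[OF fin, of m] by(auto simp: d_def)
 thus "e (cin j m g) : p" by simp
 show "e (yv j m) : D" by(intro e_D yv_TP) (use j in auto)
qed
moreover have "?g : TP {..<Suc j}" by(intro KM_diff KM_sum yS g(1))
ultimately show ?thesis using dN d cg by(intro exI[of _ ?g] exI[of _ d]) auto
qed
text \<open>Counterpart of the minimal polynomial of \<open>th j\<close> modulo p: any relation of
  smaller degree in y_j is trivial, that is, has all coefficients in p.\<close>

definition good :: "nat => ((nat \<Rightarrow>\<^sub>0 nat) \<Rightarrow>\<^sub>0 'k) => nat => bool" where
"good j g d <-> g : TP {..<Suc j} & e g : p & e (cin j d g) ~: p & (ALL m>d. cin j m g = 0) &
 (ALL r:TP {..<Suc j}. e r : p & (ALL m>=d. cin j m r = 0) --> (ALL m. e (cin j m r) : p))"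

lemma ex_good:
assumes j: "j < n" and "alg j"
shows "EX g d. good j g d"
proof -
define Q where "Q d <-> (EX g. g : TP {..<Suc j} & e g : p & e (cin j d g) ~: p & (ALL m>d. cin j m g = 0))" for d
obtain g m where g: "g : TP {..<Suc j}" "e g : p" "e (cin j m g) ~: p" using assms(2) unfolding alg_def by blast
obtain N where N: "!!m. N <= m ==> cin j m g = 0" using cin_bound by blast
from strip[OF j g N] have "EX d. Q d" unfolding Q_def by blast
hence L: "Q (LEAST d. Q d)" "!!d. d < (LEAST d. Q d) ==> ~ Q d" using LeastI_ex not_less_Least by blast+
let ?d = "LEAST d. Q d"
have "e (cin j m r) : p" if r: "r : TP {..<Suc j}" "e r : p" "ALL m>=?d. cin j m r = 0" for r m
proof(rule ccontr)
 assume c: "e (cin j m r) ~: p"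
 from strip[OF j r(1,2) this, of ?d] r(3) obtain d where "d < ?d" "Q d" unfolding Q_def by blast
 thus False using L(2) by blast
qed
thus ?thesis using L(1) unfolding Q_def good_def by blast
qed
definition gg :: "nat => ((nat \<Rightarrow>\<^sub>0 nat) \<Rightarrow>\<^sub>0 'k)" where "gg j = (SOME g. EX d. good j g d)"
definition dg :: "nat => nat" where "dg j = (SOME d. good j (gg j) d)"

lemma good: "j < n ==> alg j ==> good j (gg j) (dg j)"
using someI_ex[OF ex_good] unfolding gg_def dg_def by(rule someI_ex)
definition js :: "nat list" where "js = filter alg [0..<n]"

lemma js_take: "i < length js ==> set (take i js) <= {l. l < js ! i & alg l}" "i < length js ==> js ! i < n & alg (js ! i)"
proof -
assume i: "i < length js"
have "js ! i : set js" using i by simp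
thus "js ! i < n & alg (js ! i)" by(simp add: js_def)
have s: "sorted_wrt (<) js" unfolding js_def by(intro sorted_wrt_filter) (simp add: sorted_wrt_upt)
show "set (take i js) <= {l. l < js ! i & alg l}"
proof
 fix l assume "l : set (take i js)"
 then obtain k where k: "k < i" "l = js ! k" using i by(auto simp: in_set_conv_nth)
 hence "js ! k < js ! i" using s i by(simp add: sorted_wrt_nth_less)
 moreover have "js ! k : set js" using k i by simp
 ultimately show "l : {l. l < js ! i & alg l}" using k by(simp add: js_def)
qed
qed

lemma gg_TP: "l < n ==> alg l ==> gg l : TP {..<Suc l}" "l < n ==> alg l ==> e (gg l) : p"
using good unfolding good_def by auto

lemma regular_at:
assumes i: "i < length js" and a: "a : D" and ga: "e (gg (js ! i)) * a : gen D (e ` gg ` set (take i js))"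
shows "EX s:D - p. s * a : gen D (e ` gg ` set (take i js))"
proof -
let ?j = "js ! i" and ?G = "gg ` set (take i js)"
have j: "?j < n" "alg ?j" using js_take(2)[OF i] by auto
have G: "finite ?G" "?G <= TP ({..<n} - {?j})"
proof -
 show "?G <= TP ({..<n} - {?j})"
 proof
  fix x assume "x : ?G"
  then obtain l where l: "x = gg l" "l < ?j" "alg l" using js_take(1)[OF i] by auto
  have "TP {..<Suc l} <= TP ({..<n} - {?j})" by(rule TP_mono) (use l j in auto)
  thus "x : TP ({..<n} - {?j})" using gg_TP(1)[of l] l j by auto
 qed
qed simp
have Gn: "?G <= Pn" using G(2) TP_mono[of "{..<n} - {?j}" "{..<n}"] by auto
have gd: "good ?j (gg ?j) (dg ?j)" by(rule good[OF j])
let ?c = "cin ?j (dg ?j) (gg ?j)"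
have gn: "gg ?j : Pn" using gd TP_n[of "Suc ?j"] j by(auto simp: good_def)
have cn: "?c : Pn" using coeff_TP[of "gg ?j" ?j] gd TP_n[of ?j] j by(auto simp: good_def)
have "EX k. ?c ^ k * coef a b : gen Pn ?G" if b: "b : B" for b
proof -
 obtain N where N: "!!m. N <= m ==> cin ?j m (coef a b) = 0" using cin_bound by blast
 have "coef (e (gg ?j) * a) b : gen Pn ?G"
  using ga gen_coef[OF G(1) Gn sbr(5)[OF D e_D[OF gn] a]] b by auto
 hence "gg ?j * coef a b : gen Pn ?G" using coef_mult[OF a gn b] by simp
 thus ?thesis
  using regular_step[OF _ G gn, of "dg ?j" "coef a b" N] gd j coef(1)[OF a b] N by(auto simp: good_def)
qed
then obtain k where k: "!!b. b : B ==> ?c ^ k b * coef a b : gen Pn ?G" by metis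
\<comment> \<open>Each coordinate of a needs its own power of the leading coefficient; the sum of
  the exponents serves all of them.\<close>
define K where "K = (SUM b:B. k b)"
have "?c ^ K * coef a b : gen Pn ?G" if b: "b : B" for b
proof -
 have "k b <= K" unfolding K_def using finB b by(intro member_le_sum) auto
 hence eq: "?c ^ K * coef a b = ?c ^ (K - k b) * (?c ^ k b * coef a b)" by(simp flip: power_add mult.assoc)
 show ?thesis unfolding eq by(rule gen_mult[OF sbr_TP k[OF b] TP_power[OF cn]])
qed
moreover have "coef (e (?c ^ K) * a) b = ?c ^ K * coef a b" if "b : B" for b
 by(rule coef_mult[OF a TP_power[OF cn] that])
ultimately have "e (?c ^ K) * a : gen D (e ` ?G)"
 using gen_coef[OF G(1) Gn sbr(5)[OF D e_D[OF TP_power[OF cn]] a]] by auto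
moreover have "e (?c ^ K) : D - p"
 using prm_power[OF D p e_D[OF cn], of K] gd e_D[OF TP_power[OF cn]] by(auto simp: e_power good_def)
ultimately show ?thesis by blast
qed

lemma indep_T: "indep_mod p {j. j < n & ~ alg j}"
proof -
let ?T = "{j. j < n & ~ alg j}"
have "k <= n ==> s : TP (?T Int {..<k}) ==> e s : p ==> s = 0" for k s
proof(induction k arbitrary: s)
 case 0
 thus ?case using TP_empty by simp
next
 case (Suc k)
 show ?case
 proof(cases "k : ?T")
  case False
  hence "?T Int {..<Suc k} = ?T Int {..<k}" by(auto simp: less_Suc_eq)
  thus ?thesis using Suc by auto
 next
  case True
  have sk: "s : TP {..<Suc k}" using Suc.prems(2) TP_mono[of "?T Int {..<Suc k}" "{..<Suc k}"] by auto
  have "cin k m s = 0" for m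
  proof(rule Suc.IH)
   have "?T Int {..<Suc k} - {k} <= ?T Int {..<k}" by auto
   thus "cin k m s : TP (?T Int {..<k})" using keys_cin[OF Suc.prems(2), of k m] TP_mono by blast
   show "e (cin k m s) : p" using True sk Suc.prems(3) unfolding alg_def by blast
  qed (use Suc in simp)
  thus ?thesis using cin_expand[of 0 k s] by simp
 qed
qed
from this[of n] have "s : TP ?T ==> e s : p ==> s = 0" for s
 by(simp add: Int_absorb2 subset_iff)
thus ?thesis unfolding indep_mod_def by blast
qed

text \<open>The parameters that are not algebraic number n - \<open>length js\<close> and are
  independent modulo p. By \<open>extend_indep\<close> every step down the chain adds one
  independent parameter, and there are n in all.\<close>

lemma chain_bound:
assumes Q: "!!i. i <= h ==> prm D (Q i)" "!!i. i < h ==> Q i < Q (Suc i)" "Q h <= p"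
shows "h <= length js"
proof -
let ?T = "{j. j < n & ~ alg j}"
have "k <= h ==> EX T<={..<n}. indep_mod (Q (h - k)) T & card T = card ?T + k" for k
proof(induction k)
 case 0
 have "indep_mod (Q h) ?T" using indep_T Q(3) unfolding indep_mod_def by blast
 thus ?case by(intro exI[of _ ?T]) auto
next
 case (Suc k)
 then obtain T where T: "T <= {..<n}" "indep_mod (Q (h - k)) T" "card T = card ?T + k" by auto
 have "Q (h - Suc k) < Q (h - k)" using Q(2)[of "h - Suc k"] Suc.prems by(simp add: Suc_diff_Suc)
 then obtain j where j: "j < n" "j ~: T" "indep_mod (Q (h - Suc k)) (insert j T)"
  using extend_indep[OF Q(1) Q(1) _ T(1,2), of "h - Suc k"] by auto
 have "card (insert j T) = card ?T + Suc k" using j(2) T(3) finite_subset[OF T(1)] by simp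
 thus ?case using j T(1) by(intro exI[of _ "insert j T"]) auto
qed
then obtain T where "T <= {..<n}" "card T = card ?T + h" by(metis diff_self_eq_0 le_refl)
hence "card ?T + h <= n" using card_mono[of "{..<n}" T] by simp
moreover have "length js + card ?T = n"
proof -
 have "length js = card {j. j < n & alg j}"
  using distinct_card[of js] by(simp add: js_def)
 moreover have "{j. j < n & alg j} Un ?T = {..<n}" by auto
 hence "card {j. j < n & alg j} + card ?T = card {..<n}"
  by(subst card_Un_disjoint[symmetric]) auto
 ultimately show ?thesis by simp
qed
ultimately show ?thesis by simp
qed

lemma cm_at_js: "cm_at D p (map (e \<circ> gg) js)"
unfolding cm_at_def
proof(intro conjI allI impI ballI)
show "set (map (e \<circ> gg) js) <= p" using gg_TP(2) by(auto simp: js_def)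
have st: "set (take i (map (e \<circ> gg) js)) = e ` gg ` set (take i js)" for i by(simp add: take_map image_image)
fix i a assume "i < length (map (e \<circ> gg) js)" "a : D"
 "map (e \<circ> gg) js ! i * a : gen D (set (take i (map (e \<circ> gg) js)))"
thus "EX s:D - p. s * a : gen D (set (take i (map (e \<circ> gg) js)))"
 unfolding st using regular_at[of i a] by simp
next
fix h Q assume "(ALL i<=h. prm D (Q i)) & (ALL i<h. Q i < Q (Suc i)) & Q h <= p"
thus "h <= length (map (e \<circ> gg) js)" using chain_bound[of h Q] by simp
qed
abbreviation "Ga j == gg ` {l. l < j & alg l}"

lemma combine_coeffs:
assumes j: "j < n" and r: "r : TP {..<Suc j}" "!!m. e (cin j m r) : p"
 and IH: "!!f. f : TP {..<j} ==> e f : p ==> EX s:Pn. e s ~: p & s * f : gen Pn (Ga j)"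
shows "EX s:Pn. e s ~: p & s * r : gen Pn (Ga j)"
proof -
obtain N where N: "!!m. N <= m ==> cin j m r = 0" using cin_bound by blast
have "ALL m. EX s:Pn. e s ~: p & s * cin j m r : gen Pn (Ga j)"
 using IH[OF coeff_TP[OF r(1)] r(2)] by blast
hence "ALL m. EX s. s : Pn & e s ~: p & s * cin j m r : gen Pn (Ga j)" by blast
from choice[OF this] obtain s where s: "!!m. s m : Pn" "!!m. e (s m) ~: p" "!!m. s m * cin j m r : gen Pn (Ga j)" by blast
let ?s = "PROD m<N. s m"
have "e ?s = (PROD m<N. e (s m))" by(induction N) (simp_all add: ev_mult)
moreover have "(PROD m<N. e (s m)) : D - p" by(rule prm_prod[OF D p]) (use s e_D in auto)
ultimately have "e ?s ~: p" by(metis DiffD2)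
have "?s * r = ?s * (SUM m<N. yv j m * cin j m r)" by(rule arg_cong[OF cin_expand[OF N]])
hence eq: "?s * r = (SUM m<N. ?s * (yv j m * cin j m r))" by(simp only: sum_distrib_left)
have "(SUM m<N. ?s * (yv j m * cin j m r)) : gen Pn (Ga j)"
proof(rule gen_sum[OF sbr_TP])
 fix m assume "m : {..<N}"
 hence "?s = s m * prod s ({..<N} - {m})" by(intro prod.remove) auto
 hence "?s * (yv j m * cin j m r) = (prod s ({..<N} - {m}) * yv j m) * (s m * cin j m r)" by(simp add: mult_ac)
 also have "... : gen Pn (Ga j)" by(intro gen_mult[OF sbr_TP] s(3) TP_mult TP_prod s(1) yv_TP) (use j in auto)
 finally show "?s * (yv j m * cin j m r) : gen Pn (Ga j)" .
qed
hence "?s * r : gen Pn (Ga j)" unfolding eq .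
moreover have "?s : Pn" by(rule TP_prod[OF s(1)])
ultimately show ?thesis using \<open>e ?s ~: p\<close> by(intro bexI[of _ ?s] conjI)
qed

text \<open>Pseudo-division by the minimal relation leaves a remainder of smaller degree that is
  mapped into p. By minimality all its coefficients are mapped into p, and they involve one variable
  less.\<close>

lemma generates: "j <= n ==> f : TP {..<j} ==> e f : p ==> EX s:Pn. e s ~: p & s * f : gen Pn (Ga j)"
proof(induction j arbitrary: f)
case 0
hence "f = 0" using TP_empty by simp
thus ?case using prm(5)[OF p] by(intro bexI[of _ 1]) (auto simp: gen_0[OF sbr_TP])
next
case (Suc j)
hence j: "j < n" by simp
have fin: "finite (Ga (Suc j))" by simp
have sub: "x : gen Pn (Ga j) ==> x : gen Pn (Ga (Suc j))" for x
 by(rule gen_mono[OF sbr_TP fin]) auto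
note comb = combine_coeffs[OF j _ _ Suc.IH[OF less_imp_le[OF j]]]
show ?case
proof(cases "alg j")
 case False
 hence "e (cin j m f) : p" for m using Suc.prems unfolding alg_def by blast
 from comb[OF Suc.prems(2) this] show ?thesis using sub by blast
next
 case True
 have gd: "good j (gg j) (dg j)" by(rule good[OF j True])
 let ?c = "cin j (dg j) (gg j)"
 obtain N where N: "!!m. N <= m ==> cin j m f = 0" using cin_bound by blast
 obtain k q r where h: "q : TP {..<Suc j}" "r : TP {..<Suc j}" "?c ^ k * f = q * gg j + r" "ALL m>=dg j. cin j m r = 0"
  using pseudo_division[of j "{..<Suc j}" "gg j" "dg j" f N] gd Suc.prems(2) N by(auto simp: good_def)
 have n': "TP {..<Suc j} <= Pn" using TP_n j by simp
 have cn: "?c : Pn" using coeff_TP[of "gg j" j] gd TP_n[of j] j by(auto simp: good_def)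
 have "e r = e (?c ^ k) * e f - e q * e (gg j)" using arg_cong[OF h(3), of e] by(simp add: ev_mult ev_add)
 also have "... : p"
  by(intro prm_diff[OF D p] prm(4)[OF p] Suc.prems(3) gg_TP(2) j True e_D TP_power cn) (use h n' in auto)
 finally have "e (cin j m r) : p" for m using gd h(2,4) unfolding good_def by blast
 from comb[OF h(2) this] obtain s where s: "s : Pn" "e s ~: p" "s * r : gen Pn (Ga j)" by blast
 have "(s * ?c ^ k) * f = s * (q * gg j + r)" by(simp only: mult.assoc h(3))
 also have "... = (s * q) * gg j + s * r" by(simp add: distrib_left mult.assoc)
 also have "... : gen Pn (Ga (Suc j))"
  by(intro gen_add[OF sbr_TP] gen_mult[OF sbr_TP] sub s(3) gen_base[OF sbr_TP fin] TP_mult s(1))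
   (use True h(1) n' in auto)
 finally have "(s * ?c ^ k) * f : gen Pn (Ga (Suc j))" .
 moreover have "e (s * ?c ^ k) ~: p"
 proof
  assume "e (s * ?c ^ k) : p"
  hence "e s : p | e ?c ^ k : p"
   using prm(6)[OF p, of "e s" "e ?c ^ k"] e_D[OF s(1)] sbr(7)[OF D e_D[OF cn]] by(simp add: ev_mult e_power)
  thus False using s(2) prm_power[OF D p e_D[OF cn]] gd by(auto simp: good_def)
 qed
 moreover have "s * ?c ^ k : Pn" by(intro TP_mult s(1) TP_power cn)
 ultimately show ?thesis by blast
qed
qed

lemma reg_at_js:
assumes "B = {b}" "bas b = 1"
shows "reg_at D p (map (e \<circ> gg) js)"
unfolding reg_at_def
proof(intro conjI cm_at_js ballI)
fix x assume x: "x : p"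
hence xD: "x : D" using prm(1)[OF p] by auto
have "x = e (coef x b)" using coef(2)[OF xD] assms by simp
moreover have "coef x b : Pn" using coef(1)[OF xD] assms by simp
ultimately obtain s where s: "s : Pn" "e s ~: p" "s * coef x b : gen Pn (Ga n)" using generates[of n "coef x b"] x by auto
have G: "Ga n <= Pn" using gg_TP(1) TP_n[of "Suc _"] by(auto simp: Suc_le_eq)
have "e s * x : gen D (e ` Ga n)"
 using gen_coef[of "Ga n" "e s * x"] G s coef_mult[OF xD s(1), of b] assms(1) sbr(5)[OF D e_D[OF s(1)] xD] by simp
moreover have "set (map (e \<circ> gg) js) = e ` Ga n" by(auto simp: js_def image_image)
ultimately show "EX s:D - p. s * x : gen D (set (map (e \<circ> gg) js))" using s e_D by auto
qed
end

theorem ex_cm_at: "prm D p ==> EX gs. cm_at D p gs"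
using cm_at_js by blast

theorem ex_reg_at: "prm D p ==> B = {b} ==> bas b = 1 ==> EX gs. reg_at D p gs"
using reg_at_js by blast
end
text \<open>Every element of \<open>D'\<close> has a denominator that lies in \<open>D\<close> and
  is a unit of \<open>D'\<close>. The charts of the resolution are of this kind over polynomial
  rings.\<close>

definition is_local :: "'a::comm_ring_1 set => 'a set => bool" where
"is_local D D' <-> D <= D' & (ALL x:D'. EX u:D. EX v:D'. u * v = 1 & u * x : D)"

lemma gen_local:
assumes D: "sbr D" and D': "sbr D'" and l: "is_local D D'" and G: "finite G" "G <= D" and x: "x : gen D' G"
shows "EX u:D. EX v:D'. u * v = 1 & u * x : gen D G"
proof -
obtain r where r: "ALL g:G. r g : D'" "x = (SUM g:G. r g * g)" using x unfolding gen_def by blast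
have "ALL g:G. EX u v. u : D & v : D' & u * v = 1 & u * r g : D" using r(1) l unfolding is_local_def by blast
then obtain u v where uv: "!!g. g : G ==> u g : D" "!!g. g : G ==> v g : D'" "!!g. g : G ==> u g * v g = 1"
 "!!g. g : G ==> u g * r g : D" by metis
have P: "prod f A : E" if "sbr E" "!!i. i : A ==> f i : E" for f :: "'a => 'a" and A E
 using that by(induction A rule: fin_ind) (auto intro: sbr)
have "prod u G * x = (SUM g:G. (prod u (G - {g}) * (u g * r g)) * g)"
 unfolding r(2) sum_distrib_left by(rule sum.cong) (simp_all add: prod.remove[OF G(1)] mult_ac)
hence "prod u G * x : gen D G" unfolding gen_def mem_Collect_eq
 using uv(1,4) by(intro exI[of _ "%g. prod u (G - {g}) * (u g * r g)"] conjI ballI sbr(5)[OF D P[OF D]]) auto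
moreover have "prod u G * prod v G = 1" using uv(3) by(simp flip: prod.distrib)
ultimately show ?thesis using P[OF D, of G u] P[OF D', of G v] uv(1,2) by blast
qed

lemma prm_contr:
assumes D: "sbr D" and DD: "D <= D'" and q: "prm D' q"
shows "prm D (q Int D)"
unfolding prm_def
proof(intro conjI ballI impI)
show "0 : q Int D" "1 ~: q Int D" using prm(2,5)[OF q] sbr(1)[OF D] by auto
show "x + y : q Int D" if "x : q Int D" "y : q Int D" for x y using that prm(3)[OF q] sbr(4)[OF D] by auto
show "d * x : q Int D" if "x : q Int D" "d : D" for x d using that prm(4)[OF q] sbr(5)[OF D] DD by auto
show "x : q Int D | y : q Int D" if "x : D" "y : D" "x * y : q Int D" for x y
 using that prm(6)[OF q, of x y] DD by auto
qed auto

text \<open>Clearing a denominator moves every membership to \<open>D\<close>. Strict inclusions of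
  primes survive contraction, because a separating element can be multiplied by a unit into
  \<open>D\<close>.\<close>

lemma reg_at_local:
assumes D: "sbr D" and D': "sbr D'" and l: "is_local D D'" and p: "prm D' p" and h: "reg_at D (p Int D) gs"
shows "reg_at D' p gs"
proof -
have DD: "D <= D'" using l by(simp add: is_local_def)
have unit: "u ~: q" if "u : D" "v : D'" "u * v = 1" "prm D' q" for u v q
 using prm(4)[OF that(4) _ that(2), of u] prm(5)[OF that(4)] that(3) by(auto simp: mult.commute)
have gs: "set gs <= p Int D" using h by(simp add: reg_at_def cm_at_def)
have up: "x : gen D' G" if x: "x : gen D G" for x G using x DD unfolding gen_def by blast
show "reg_at D' p gs"
 unfolding reg_at_def cm_at_def
proof(intro conjI allI impI ballI)
 show "set gs <= p" using gs by auto
 fix i a assume i: "i < length gs" and a: "a : D'" and ga: "gs ! i * a : gen D' (set (take i gs))"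
 let ?G = "set (take i gs)"
 have G: "finite ?G" "?G <= D" using gs set_take_subset[of i gs] by auto
 obtain u v where u: "u : D" "v : D'" "u * v = 1" "u * a : D" using l a unfolding is_local_def by blast
 obtain u' v' where u': "u' : D" "v' : D'" "u' * v' = 1" "u' * (gs ! i * a) : gen D ?G"
  using gen_local[OF D D' l G ga] by blast
 have "gs ! i * (u' * (u * a)) = u * (u' * (gs ! i * a))" by(simp add: mult_ac)
 also have "... : gen D ?G" by(rule gen_mult[OF D u'(4) u(1)])
 finally have m: "gs ! i * (u' * (u * a)) : gen D ?G" .
 have "ALL i<length gs. ALL a:D. gs ! i * a : gen D (set (take i gs)) --> (EX s:D - p Int D. s * a : gen D (set (take i gs)))"
  using h unfolding reg_at_def cm_at_def by(elim conjE)
 from this[rule_format, OF i sbr(5)[OF D u'(1) u(4)] m]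
 obtain s where s: "s : D - p Int D" "s * (u' * (u * a)) : gen D ?G" by blast
 have "v * (v' * (s * (u' * (u * a)))) : gen D' ?G" by(intro gen_mult[OF D'] up s(2) u u')
 moreover have "v * (v' * (s * (u' * (u * a)))) = (u * v) * (u' * v') * (s * a)" by(simp add: mult_ac)
 ultimately have "s * a : gen D' ?G" using u(3) u'(3) by simp
 thus "EX s:D' - p. s * a : gen D' ?G" using s(1) DD by blast
next
 fix n Q assume Q: "(ALL i<=n. prm D' (Q i)) & (ALL i<n. Q i < Q (Suc i)) & Q n <= p"
 have "Q i Int D < Q (Suc i) Int D" if "i < n" for i
 proof -
  from Q \<open>i < n\<close> have "Q i < Q (Suc i)" by blast
  then obtain x where x: "x : Q (Suc i)" "x ~: Q i" by blast
  have q: "prm D' (Q i)" "prm D' (Q (Suc i))" using Q that by auto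
  obtain u v where u: "u : D" "v : D'" "u * v = 1" "u * x : D"
   using l prm(1)[OF q(2)] x(1) unfolding is_local_def by blast
  have "u * x : Q (Suc i)" using prm(4)[OF q(2) x(1)] u(1) DD by blast
  moreover have "u * x ~: Q i"
   using prm(6)[OF q(1), of u x] unit[OF u(1-3) q(1)] x prm(1)[OF q(2)] u(1) DD by blast
  ultimately show ?thesis using Q that u(4) by blast
 qed
 hence "(ALL i<=n. prm D (Q i Int D)) & (ALL i<n. Q i Int D < Q (Suc i) Int D) & Q n Int D <= p Int D"
  using Q prm_contr[OF D DD] by auto
 thus "n <= length gs" using h unfolding reg_at_def cm_at_def by(elim conjE) (drule spec[of _ n], drule spec[of _ "%i. Q i Int D"], blast)
next
 fix x assume x: "x : p"
 obtain u v where u: "u : D" "v : D'" "u * v = 1" "u * x : D"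
  using l prm(1)[OF p] x unfolding is_local_def by blast
 have "u * x : p Int D" using prm(4)[OF p x] u DD by blast
 then obtain s where s: "s : D - p Int D" "s * (u * x) : gen D (set gs)" using h unfolding reg_at_def by blast
 have "v * (s * (u * x)) : gen D' (set gs)" by(intro gen_mult[OF D'] up s(2) u)
 moreover have "v * (s * (u * x)) = (u * v) * (s * x)" by(simp add: mult_ac)
 ultimately have "s * x : gen D' (set gs)" using u(3) by simp
 thus "EX s:D' - p. s * x : gen D' (set gs)" using s(1) DD by blast
qed
qed

section \<open>Localizations and the local criterion\<close>

locale localization = cring R for R (structure) +
fixes S assumes S: "S <= cr R" and S1: "\<one> : S" and Sm: "s : S ==> t : S ==> s *. t : S"
begin
abbreviation L where "L == localize R S"
abbreviation mL (infixl "*:" 70) where "mL == monoid.mult L"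
abbreviation aL (infixl "+:" 65) where "aL == ring.add L"
abbreviation uL ("-: _" [81] 80) where "uL == a_inv L"
abbreviation oL where "oL == monoid.one L"
abbreviation zL where "zL == ring.zero L"
abbreviation fc where "fc == fract_class R S"

lemma S_carr: "s : S ==> s : cr R" using S by blast

lemma fract_rel_iff: "((a, s), (b, t)) : fract_rel R S <->
 a : cr R & s : S & b : cr R & t : S & (EX u:S. u *. t *. a = u *. s *. b)"
proof -
have "u *. (t *. a \<ominus> s *. b) = \<zero> <-> u *. t *. a = u *. s *. b"
 if "a : cr R" "s : S" "b : cr R" "t : S" "u : S" for u
proof -
 have c: "u : cr R" "s : cr R" "t : cr R" using that S_carr by auto
 have "u *. (t *. a \<ominus> s *. b) = u *. t *. a \<ominus> u *. s *. b" using that c by algebra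
 thus ?thesis using that c by(simp add: r_right_minus_eq)
qed
thus ?thesis unfolding fract_rel_def by auto
qed

lemma equiv_fract: "equiv (cr R \<times> S) (fract_rel R S)"
proof(rule equivI)
show "fract_rel R S <= (cr R \<times> S) \<times> cr R \<times> S" unfolding fract_rel_def by auto
show "refl_on (cr R \<times> S) (fract_rel R S)"
 by(rule refl_onI) (use S1 in "auto simp: fract_rel_iff")
show "sym (fract_rel R S)"
proof(rule symI)
 fix x y assume "(x, y) : fract_rel R S"
 moreover obtain a s b t where "x = (a, s)" "y = (b, t)" by(metis surj_pair)
 ultimately show "(y, x) : fract_rel R S" by(auto simp: fract_rel_iff) metis
qed
show "trans (fract_rel R S)"
proof(rule transI)
 fix x y z assume xy: "(x, y) : fract_rel R S" and yz: "(y, z) : fract_rel R S"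
 obtain a s b t c w where e: "x = (a, s)" "y = (b, t)" "z = (c, w)" by(metis surj_pair)
 from xy yz obtain u v where h: "a : cr R" "s : S" "b : cr R" "t : S" "c : cr R" "w : S"
  "u : S" "v : S" "u *. t *. a = u *. s *. b" "v *. w *. b = v *. t *. c"
  unfolding e fract_rel_iff by blast
 have c: "s : cr R" "t : cr R" "w : cr R" "u : cr R" "v : cr R" using h S_carr by auto
 have "u *. v *. t *. w *. a = v *. w *. (u *. t *. a)" using h(1) c by algebra
 also have "... = u *. s *. (v *. w *. b)" unfolding h(9) using h(3) c by algebra
 also have "... = u *. v *. t *. s *. c" unfolding h(10) using h(5) c by algebra
 finally show "(x, z) : fract_rel R S" unfolding e fract_rel_iff using h Sm by blast
qed
qed

lemma fc_eq: "a : cr R ==> s : S ==> b : cr R ==> t : S ==>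
 fc a s = fc b t <-> (EX u:S. u *. t *. a = u *. s *. b)"
unfolding fract_class_def by(subst eq_equiv_class_iff[OF equiv_fract]) (auto simp: fract_rel_iff)

lemma fc_eqI: "a : cr R ==> s : S ==> b : cr R ==> t : S ==> t *. a = s *. b ==> fc a s = fc b t"
by(subst fc_eq) (use S1 S_carr in \<open>auto intro!: bexI[of _ \<one>]\<close>)

lemma carrier_L: "cr L = {fc a s | a s. a : cr R & s : S}"
unfolding localize_def fract_class_def by(auto simp: quotient_def)

lemma fc_L [simp]: "a : cr R ==> s : S ==> fc a s : cr L"
unfolding carrier_L by blast

lemma L_cases: "x : cr L ==> (!!a s. a : cr R ==> s : S ==> x = fc a s ==> thesis) ==> thesis"
unfolding carrier_L by blast

lemma mult_L:
assumes "a : cr R" "s : S" "b : cr R" "t : S"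
shows "fc a s *: fc b t = fc (a *. b) (s *. t)"
proof -
have "congruent2 (fract_rel R S) (fract_rel R S) (%x y. case x of (a, s) => case y of (b, t) => fc (a *. b) (s *. t))"
proof(rule congruent2I')
 fix y1 z1 y2 z2 assume 1: "(y1, z1) : fract_rel R S" and 2: "(y2, z2) : fract_rel R S"
 obtain a s b t a' s' b' t' where e: "y1 = (a, s)" "z1 = (b, t)" "y2 = (a', s')" "z2 = (b', t')" by(metis surj_pair)
 from 1 2 obtain u v where h: "a : cr R" "s : S" "b : cr R" "t : S" "a' : cr R" "s' : S" "b' : cr R" "t' : S"
  "u : S" "v : S" "u *. t *. a = u *. s *. b" "v *. t' *. a' = v *. s' *. b'"
  unfolding e fract_rel_iff by blast
 have c: "s : cr R" "t : cr R" "s' : cr R" "t' : cr R" "u : cr R" "v : cr R" using h S_carr by auto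
 have "u *. v *. (t *. t') *. (a *. a') = (u *. t *. a) *. (v *. t' *. a')" using h(1,5) c by algebra
 also have "... = u *. v *. (s *. s') *. (b *. b')" unfolding h(11,12) using h(3,7) c by algebra
 finally have "fc (a *. a') (s *. s') = fc (b *. b') (t *. t')"
  using h Sm by(subst fc_eq) (auto intro: bexI[of _ "u *. v"])
 thus "(case y1 of (a, s) => case y2 of (b, t) => fc (a *. b) (s *. t)) = (case z1 of (a, s) => case z2 of (b, t) => fc (a *. b) (s *. t))"
  by(simp add: e)
qed
from UN_equiv_class2[OF equiv_fract equiv_fract this, of "(a, s)" "(b, t)"] assms
show ?thesis unfolding localize_def fract_class_def by(simp add: case_prod_unfold)
qed

lemma add_L:
assumes "a : cr R" "s : S" "b : cr R" "t : S"
shows "fc a s +: fc b t = fc (a *. t +. b *. s) (s *. t)"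
proof -
have "congruent2 (fract_rel R S) (fract_rel R S) (%x y. case x of (a, s) => case y of (b, t) => fc (a *. t +. b *. s) (s *. t))"
proof(rule congruent2I')
 fix y1 z1 y2 z2 assume 1: "(y1, z1) : fract_rel R S" and 2: "(y2, z2) : fract_rel R S"
 obtain a s b t a' s' b' t' where e: "y1 = (a, s)" "z1 = (b, t)" "y2 = (a', s')" "z2 = (b', t')" by(metis surj_pair)
 from 1 2 obtain u v where h: "a : cr R" "s : S" "b : cr R" "t : S" "a' : cr R" "s' : S" "b' : cr R" "t' : S"
  "u : S" "v : S" "u *. t *. a = u *. s *. b" "v *. t' *. a' = v *. s' *. b'"
  unfolding e fract_rel_iff by blast
 have c: "s : cr R" "t : cr R" "s' : cr R" "t' : cr R" "u : cr R" "v : cr R" using h S_carr by auto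
 have "u *. v *. (t *. t') *. (a *. s' +. a' *. s) = (v *. t' *. s') *. (u *. t *. a) +. (u *. t *. s) *. (v *. t' *. a')" using h(1,5) c by algebra
 also have "... = u *. v *. (s *. s') *. (b *. t' +. b' *. t)" unfolding h(11,12) using h(3,7) c by algebra
 finally have "fc (a *. s' +. a' *. s) (s *. s') = fc (b *. t' +. b' *. t) (t *. t')"
  using h c Sm by(subst fc_eq) (auto intro: bexI[of _ "u *. v"])
 thus "(case y1 of (a, s) => case y2 of (b, t) => fc (a *. t +. b *. s) (s *. t)) = (case z1 of (a, s) => case z2 of (b, t) => fc (a *. t +. b *. s) (s *. t))"
  by(simp add: e)
qed
from UN_equiv_class2[OF equiv_fract equiv_fract this, of "(a, s)" "(b, t)"] assms
show ?thesis unfolding localize_def fract_class_def by(simp add: case_prod_unfold)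
qed

lemma one_L: "oL = fc \<one> \<one>" and zero_L: "zL = fc \<zero> \<one>"
by(simp_all add: localize_def)

lemma cring_L: "cring L"
proof(rule cringI)
show "abelian_group L"
proof(rule abelian_groupI)
 fix x y assume "x : cr L" "y : cr L"
 then obtain a s b t where h: "a : cr R" "s : S" "x = fc a s" "b : cr R" "t : S" "y = fc b t" by(metis L_cases)
 hence c: "s : cr R" "t : cr R" using S_carr by auto
 show "x +: y : cr L" using h c Sm by(simp add: add_L)
 have "fc (a *. t +. b *. s) (s *. t) = fc (b *. s +. a *. t) (t *. s)"
  by(rule fc_eqI) (use h c Sm in "auto simp: a_comm m_comm")
 thus "x +: y = y +: x" using h by(simp add: add_L)
 fix z assume "z : cr L"
 then obtain d w where h': "d : cr R" "w : S" "z = fc d w" by(metis L_cases)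
 hence cw: "w : cr R" using S_carr by auto
 show "(x +: y) +: z = x +: (y +: z)"
 proof -
  have e: "s *. (t *. w) *. ((a *. t +. b *. s) *. w +. d *. (s *. t)) = s *. t *. w *. (a *. (t *. w) +. (b *. w +. d *. t) *. s)"
   using h(1,4) h'(1) c cw by algebra
  show ?thesis unfolding h(3,6) h'(3) using h h' c cw Sm
   by(simp add: add_L) (rule fc_eqI; simp add: Sm e)
 qed
next
 show "zL : cr L" using S1 by(simp add: zero_L)
 fix x assume "x : cr L"
 then obtain a s where h: "a : cr R" "s : S" "x = fc a s" by(metis L_cases)
 hence c: "s : cr R" using S_carr by auto
 show "zL +: x = x" using h c S1 by(simp add: add_L zero_L)
 have e: "\<ominus> a *. s +. a *. s = \<zero>" using h(1) c by algebra
 have "fc (\<ominus> a) s +: x = zL" unfolding h(3) zero_L using h c S1 Sm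
  by(simp add: add_L) (rule fc_eqI; simp add: Sm e)
 thus "EX y:cr L. y +: x = zL" using h by(intro bexI[of _ "fc (\<ominus> a) s"]) auto
qed
show "Group.comm_monoid L"
proof(rule comm_monoidI)
 show "oL : cr L" using S1 by(simp add: one_L)
 fix x y assume "x : cr L" "y : cr L"
 then obtain a s b t where h: "a : cr R" "s : S" "x = fc a s" "b : cr R" "t : S" "y = fc b t" by(metis L_cases)
 hence c: "s : cr R" "t : cr R" using S_carr by auto
 show "x *: y : cr L" using h Sm by(simp add: mult_L)
 show "x *: y = y *: x" using h c by(simp add: mult_L m_comm)
 show "oL *: x = x" using h c S1 by(simp add: mult_L one_L)
 fix z assume "z : cr L"
 then obtain d w where h': "d : cr R" "w : S" "z = fc d w" by(metis L_cases)
 thus "(x *: y) *: z = x *: (y *: z)" using h c S_carr Sm by(simp add: mult_L m_assoc)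
qed
fix x y z assume "x : cr L" "y : cr L" "z : cr L"
then obtain a s b t d w where h: "a : cr R" "s : S" "x = fc a s" "b : cr R" "t : S" "y = fc b t"
 "d : cr R" "w : S" "z = fc d w" by(metis L_cases)
hence c: "s : cr R" "t : cr R" "w : cr R" using S_carr by auto
show "(x +: y) *: z = x *: z +: y *: z"
proof -
 have e: "s *. w *. (t *. w) *. ((a *. t +. b *. s) *. d) = s *. t *. w *. (a *. d *. (t *. w) +. b *. d *. (s *. w))"
  using h(1,4,7) c by algebra
 show ?thesis unfolding h(3,6,9) using h c Sm by(simp add: add_L mult_L) (rule fc_eqI; simp add: Sm e)
qed
qed
text \<open>The extended ideal. The factor u makes membership independent of the fraction chosen to
  represent a class.\<close>

definition ext where "ext I = {fc a s | a s. a : cr R & s : S & (EX u:S. u *. a : I)}"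

lemma ext_iff:
assumes "ideal I R" "a : cr R" "s : S"
shows "fc a s : ext I <-> (EX u:S. u *. a : I)"
proof
assume "fc a s : ext I"
then obtain b t u where h: "fc a s = fc b t" "b : cr R" "t : S" "u : S" "u *. b : I" unfolding ext_def by auto
then obtain v where v: "v : S" "v *. t *. a = v *. s *. b" using fc_eq[of a s b t] assms by auto
have c: "u : cr R" "v : cr R" "s : cr R" "t : cr R" using h v assms S_carr by auto
have "(u *. (v *. t)) *. a = u *. (v *. t *. a)" using c assms by algebra
also have "... = (v *. s) *. (u *. b)" unfolding v(2) using c h(2) by algebra
also have "... : I" using ideal.I_l_closed[OF assms(1) h(5)] c by simp
finally show "EX u:S. u *. a : I" using h v Sm by blast
qed (use assms in "auto simp: ext_def")

lemma ideal_ext: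
assumes I: "ideal I R"
shows "ideal (ext I) L"
proof(rule idealI[OF cring.axioms(1)[OF cring_L]])
interpret L: cring L by(rule cring_L)
have addc: "x +: y : ext I" if "x : ext I" "y : ext I" for x y
proof -
 obtain a s u b t v where h: "x = fc a s" "a : cr R" "s : S" "u : S" "u *. a : I"
  "y = fc b t" "b : cr R" "t : S" "v : S" "v *. b : I" using \<open>x : ext I\<close> \<open>y : ext I\<close> unfolding ext_def by blast
 have c: "u : cr R" "v : cr R" "s : cr R" "t : cr R" using h S_carr by auto
 have "(u *. v) *. (a *. t +. b *. s) = (v *. t) *. (u *. a) +. (u *. s) *. (v *. b)" using c h(2,7) by algebra
 also have "... : I" using c h(5,10) ideal.I_l_closed[OF I] additive_subgroup.a_closed[OF ideal.axioms(1)[OF I]] by simp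
 finally show ?thesis unfolding h(1,6) using h c Sm by(auto simp: add_L ext_iff[OF I])
qed
have multc: "z *: x : ext I" if "x : ext I" "z : cr L" for x z
proof -
 obtain a s u where h: "x = fc a s" "a : cr R" "s : S" "u : S" "u *. a : I" using \<open>x : ext I\<close> unfolding ext_def by blast
 obtain b t where z: "z = fc b t" "b : cr R" "t : S" using \<open>z : cr L\<close> by(metis L_cases)
 have c: "u : cr R" using h S_carr by auto
 have "u *. (b *. a) = b *. (u *. a)" using c h(2) z(2) by algebra
 also have "... : I" using h(5) ideal.I_l_closed[OF I] z(2) by simp
 finally show ?thesis unfolding h(1) z(1) using h z Sm by(auto simp: mult_L ext_iff[OF I])
qed
have sub: "ext I <= cr L" unfolding ext_def by auto
show "subgroup (ext I) (add_monoid L)"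
proof(rule L.add.subgroupI)
 show "ext I <= cr L" by(rule sub)
 have "fc \<zero> \<one> : ext I" using S1 additive_subgroup.zero_closed[OF ideal.axioms(1)[OF I]] S_carr by(auto simp: ext_iff[OF I])
 thus "ext I ~= {}" by blast
 fix x assume x: "x : ext I"
 hence xc: "x : cr L" using sub by blast
 have "-: x = (-: oL) *: x" using xc by(simp add: L.l_minus)
 thus "-: x : ext I" using multc[OF x, of "-: oL"] by simp
 show "x +: y : ext I" if "y : ext I" for y by(rule addc[OF x that])
qed
fix a x assume "a : ext I" "x : cr L"
thus "x *: a : ext I" "a *: x : ext I" using multc L.m_comm sub by(auto simp: subset_iff)
qed
definition contr where "contr J = {a : cr R. fc a \<one> : J}"

lemma contr_iff:
assumes J: "ideal J L" and a: "a : cr R" "s : S"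
shows "fc a s : J <-> a : contr J"
proof -
have c: "s : cr R" using a S_carr by auto
have "fc s \<one> *: fc a s = fc (s *. a) (\<one> *. s)" using a c S1 by(simp add: mult_L)
also have "... = fc a \<one>" by(rule fc_eqI) (use a c S1 Sm in auto)
finally have 1: "fc s \<one> *: fc a s = fc a \<one>" .
have 2: "fc \<one> s *: fc a \<one> = fc a s" using a c S1 by(simp add: mult_L)
show ?thesis using ideal.I_l_closed[OF J, of "fc a s" "fc s \<one>"] ideal.I_l_closed[OF J, of "fc a \<one>" "fc \<one> s"]
 1 2 a c S1 by(auto simp: contr_def)
qed

lemma ideal_contr:
assumes J: "ideal J L"
shows "ideal (contr J) R"
proof(rule idealI[OF ring_axioms])
interpret L: cring L by(rule cring_L)
have mc: "b *. a : contr J" if "a : contr J" "b : cr R" for a b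
proof -
 have "fc b \<one> *: fc a \<one> : J" using that ideal.I_l_closed[OF J] S1 by(auto simp: contr_def)
 thus ?thesis using that S1 by(auto simp: contr_def mult_L)
qed
show "subgroup (contr J) (add_monoid R)"
proof(rule add.subgroupI)
 show "contr J <= cr R" by(auto simp: contr_def)
 show "contr J ~= {}" using additive_subgroup.zero_closed[OF ideal.axioms(1)[OF J]] by(auto simp: contr_def zero_L)
 fix a assume a: "a : contr J"
 hence ac: "a : cr R" by(auto simp: contr_def)
 have "\<ominus> a = (\<ominus> \<one>) *. a" using ac by(simp add: l_minus)
 thus "\<ominus> a : contr J" using mc[OF a, of "\<ominus> \<one>"] by simp
 fix b assume b: "b : contr J"
 have "fc a \<one> +: fc b \<one> : J" using a b additive_subgroup.a_closed[OF ideal.axioms(1)[OF J]] by(auto simp: contr_def)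
 thus "a +. b : contr J" using a b S1 by(auto simp: contr_def add_L)
qed
fix a x assume "a : contr J" "x : cr R"
thus "x *. a : contr J" "a *. x : contr J" using mc[of a x] m_comm[of a x] by(auto simp: contr_def)
qed

lemma contr_strict:
assumes "ideal J L" "ideal J' L" "J < J'"
shows "contr J < contr J'"
proof -
obtain x where "x : J'" "x ~: J" using assms(3) by blast
moreover hence "x : cr L" using ideal.Icarr[OF assms(2)] by blast
ultimately obtain a s where h: "a : cr R" "s : S" "fc a s : J'" "fc a s ~: J" by(metis L_cases)
thus ?thesis using contr_iff[OF assms(1) h(1,2)] contr_iff[OF assms(2) h(1,2)] assms(3) by(auto simp: contr_def)
qed

lemma prime_contr:
assumes J: "primeideal J L"
shows "primeideal (contr J) R"
proof(rule primeidealI)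
have I: "ideal J L" using J by(simp add: primeideal.axioms)
interpret L: cring L by(rule cring_L)
show "ideal (contr J) R" by(rule ideal_contr[OF I])
show "cring R" by(rule is_cring)
show "cr R ~= contr J"
proof
 assume "cr R = contr J"
 hence "oL : J" by(auto simp: one_L contr_def)
 thus False using primeideal.I_notcarr[OF J] ideal.one_imp_carrier[OF I] by simp
qed
fix a b assume h: "a : cr R" "b : cr R" "a *. b : contr J"
hence "fc a \<one> *: fc b \<one> : J" using S1 by(auto simp: contr_def mult_L)
thus "a : contr J | b : contr J" using primeideal.I_prime[OF J] h S1 by(auto simp: contr_def)
qed

lemma Idl_ext:
assumes G: "G <= cr R"
shows "Idl\<^bsub>L\<^esub> ((%g. fc g \<one>) ` G) = ext (Idl G)"
proof -
interpret L: cring L by(rule cring_L)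
have I: "ideal (Idl G) R" by(rule genideal_ideal[OF G])
have GL: "(%g. fc g \<one>) ` G <= cr L" using G S1 by auto
have IL: "ideal (Idl\<^bsub>L\<^esub> ((%g. fc g \<one>) ` G)) L" by(rule L.genideal_ideal[OF GL])
have one: "a : cr R ==> fc a \<one> : ext (Idl G)" if "a : Idl G" for a
 using that S1 by(subst ext_iff[OF I]) (auto intro!: bexI[of _ \<one>])
show ?thesis
proof
 show "Idl\<^bsub>L\<^esub> ((%g. fc g \<one>) ` G) <= ext (Idl G)"
  by(rule L.genideal_minimal[OF ideal_ext[OF I]]) (use one genideal_self[OF G] G in blast)
 have "G <= contr (Idl\<^bsub>L\<^esub> ((%g. fc g \<one>) ` G))"
  using L.genideal_self[OF GL] G by(auto simp: contr_def)
 hence sub: "Idl G <= contr (Idl\<^bsub>L\<^esub> ((%g. fc g \<one>) ` G))" by(rule genideal_minimal[OF ideal_contr[OF IL]])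
 show "ext (Idl G) <= Idl\<^bsub>L\<^esub> ((%g. fc g \<one>) ` G)"
 proof
  fix x assume "x : ext (Idl G)"
  then obtain a s u where h: "x = fc a s" "a : cr R" "s : S" "u : S" "u *. a : Idl G" unfolding ext_def by blast
  have uc: "u : cr R" "s : cr R" using h S_carr by auto
  have "fc (u *. a) (u *. s) : Idl\<^bsub>L\<^esub> ((%g. fc g \<one>) ` G)"
   by(subst contr_iff[OF IL]) (use h uc Sm sub in auto)
  moreover have "fc (u *. a) (u *. s) = fc a s"
   by(rule fc_eqI) (use h uc Sm in "auto simp: m_ac")
  ultimately show "x : Idl\<^bsub>L\<^esub> ((%g. fc g \<one>) ` G)" using h by simp
 qed
qed
qed

lemma noetherian_L:
assumes "noetherian_ring R"
shows "noetherian_ring L"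
proof -
interpret L: cring L by(rule cring_L)
show ?thesis
proof(rule L.noetherian_ringI)
 fix J assume J: "ideal J L"
 obtain G where G: "G <= cr R" "finite G" "contr J = Idl G"
  using noetherian_ring.finetely_gen[OF assms ideal_contr[OF J]] by blast
 have "Idl\<^bsub>L\<^esub> ((%g. fc g \<one>) ` G) = J"
 proof -
  have "ext (contr J) = J"
  proof(intro equalityI subsetI)
   fix x assume "x : ext (contr J)"
   then obtain a s u where h: "x = fc a s" "a : cr R" "s : S" "u : S" "u *. a : contr J" unfolding ext_def by blast
   have uc: "u : cr R" "s : cr R" using h S_carr by auto
   have "fc (u *. a) (u *. s) : J" by(subst contr_iff[OF J]) (use h uc Sm in auto)
   moreover have "fc (u *. a) (u *. s) = fc a s" by(rule fc_eqI) (use h uc Sm in "auto simp: m_ac")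
   ultimately show "x : J" using h by simp
  next
   fix x assume x: "x : J"
   hence "x : cr L" using ideal.Icarr[OF J] by blast
   then obtain a s where h: "a : cr R" "s : S" "x = fc a s" by(metis L_cases)
   hence "a : contr J" using contr_iff[OF J h(1,2)] x by simp
   thus "x : ext (contr J)" unfolding h(3) using h S1 by(subst ext_iff[OF ideal_contr[OF J]]) (auto intro!: bexI[of _ \<one>])
  qed
  thus ?thesis using Idl_ext[OF G(1)] G(3) by simp
 qed
 thus "EX A<=cr L. finite A & J = Idl\<^bsub>L\<^esub> A"
  using G S1 by(intro exI[of _ "(%g. fc g \<one>) ` G"]) auto
qed
qed
end

text \<open>Krull's argument: an ideal M maximal among those that contain J and avoid W is prime,
  since for a and b outside M both M + (a) and M + (b) meet W. The Noetherian property provides the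
  upper bounds for Zorn's lemma.\<close>

lemma (in noetherian_ring) ex_prime_disjoint:
assumes R: "cring R" and J: "ideal J R" and W: "W <= cr R" "\<one> : W" "!!x y. x : W ==> y : W ==> x *. y : W" and JW: "J Int W = {}"
shows "EX Q. primeideal Q R & J <= Q & Q Int W = {}"
proof -
interpret cring R by fact
define F where "F = {I. ideal I R & J <= I & I Int W = {}}"
have "EX M:F. ALL X':F. M <= X' --> X' = M"
proof(rule subset_Zorn)
 fix c assume c: "subset.chain F c"
 show "EX U:F. ALL X':c. X' <= U"
 proof(cases "c = {}")
  case True
  thus ?thesis using J JW by(auto simp: F_def)
 next
  case False
  have "subset.chain {I. ideal I R} c" using c by(auto simp: pred_on.chain_def F_def)
  hence "Union c : c" by(rule ideal_chain_is_trivial[OF False])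
  thus ?thesis using c by(intro bexI[of _ "Union c"]) (auto simp: pred_on.chain_def)
 qed
qed
then obtain M where MF: "M : F" "!!I. I : F ==> M <= I ==> I = M" by blast
hence M: "ideal M R" "J <= M" "M Int W = {}" by(auto simp: F_def)
have max: "I = M" if "ideal I R" "I Int W = {}" "M <= I" for I using MF(2)[of I] that M(2) by(auto simp: F_def)
have meets: "EX w:W. EX m:M. EX r:cr R. w = m +. r *. a" if a: "a : cr R" "a ~: M" for a
proof -
 let ?I = "M <+>\<^bsub>R\<^esub> PIdl a"
 have I: "ideal ?I R" by(rule add_ideals[OF M(1) cgenideal_ideal[OF a(1)]])
 have "M <= ?I"
 proof
  fix m assume m: "m : M"
  have "\<zero> : PIdl a" using additive_subgroup.zero_closed[OF ideal.axioms(1)[OF cgenideal_ideal[OF a(1)]]] .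
  moreover have "m = m +. \<zero>" using ideal.Icarr[OF M(1) m] by simp
  ultimately show "m : ?I" using m unfolding set_add_def' by blast
 qed
 moreover have "a : ?I"
 proof -
  have "\<zero> : M" using additive_subgroup.zero_closed[OF ideal.axioms(1)[OF M(1)]] .
  moreover have "a = \<zero> +. a" using a by simp
  ultimately show ?thesis using cgenideal_self[OF a(1)] unfolding set_add_def' by blast
 qed
 ultimately have "?I Int W ~= {}" using max[OF I] a(2) by blast
 then obtain w m y where h: "w : W" "m : M" "y : PIdl a" "w = m +. y" unfolding set_add_def' by blast
 thus ?thesis unfolding cgenideal_def by blast
qed
have "primeideal M R"
proof(rule primeidealI[OF M(1) R])
 show "cr R ~= M" using M(3) W by blast
 fix a b assume h: "a : cr R" "b : cr R" "a *. b : M"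
 show "a : M | b : M"
 proof(rule ccontr)
  assume n: "~ (a : M | b : M)"
  from n obtain w m r where 1: "w : W" "m : M" "r : cr R" "w = m +. r *. a" using meets[OF h(1)] by blast
  from n obtain w' m' r' where 2: "w' : W" "m' : M" "r' : cr R" "w' = m' +. r' *. b" using meets[OF h(2)] by blast
  have mc: "m : cr R" "m' : cr R" using ideal.Icarr[OF M(1)] 1 2 by auto
  have "w *. w' = m' *. m +. (r' *. b) *. m +. (r *. a) *. m' +. (r *. r') *. (a *. b)"
   unfolding 1(4) 2(4) using mc h(1,2) 1(3) 2(3) by algebra
  also have "... : M"
  proof -
   note cl = ideal.I_l_closed[OF M(1)]
   have "m' *. m : M" "(r' *. b) *. m : M" "(r *. a) *. m' : M" "(r *. r') *. (a *. b) : M"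
    using cl[OF 1(2)] cl[OF 2(2)] cl[OF h(3)] mc h(1,2) 1(3) 2(3) by auto
   thus ?thesis by(intro additive_subgroup.a_closed[OF ideal.axioms(1)[OF M(1)]])
  qed
  finally show False using W(3)[OF 1(1) 2(1)] M(3) by blast
 qed
qed
thus ?thesis using M by blast
qed

text \<open>Every regular element allows a descent: below a prime Q that contains x there is a prime
  that contains the earlier elements but not x. This yields depth at most dimension.\<close>

lemma prime_chain_of_regular:
fixes R (structure)
assumes noeth: "noetherian_ring R" and R: "cring R" and xs: "set xs <= cr R"
 "!!i a. i < length xs ==> a : cr R ==> xs ! i *. a : Idl (set (take i xs)) ==> a : Idl (set (take i xs))"
shows "j <= length xs ==> primeideal Q R ==> set (take j xs) <= Q ==>
 EX P. (ALL i<=j. primeideal (P i) R) & (ALL i<j. P i < P (Suc i)) & P j = Q"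
proof(induction j arbitrary: Q)
case 0
thus ?case by(intro exI[of _ "%_. Q"]) auto
next
case (Suc j)
interpret noetherian_ring R by(rule noeth)
interpret cring R by(rule R)
interpret Q: primeideal Q R by(rule Suc.prems(2))
have j: "j < length xs" using Suc.prems(1) by simp
let ?x = "xs ! j" and ?J = "Idl (set (take j xs))"
have tk: "set (take j xs) <= cr R" using xs(1) set_take_subset by fast
have xc: "?x : cr R" using xs(1) j by auto
have ts: "set (take (Suc j) xs) = insert ?x (set (take j xs))" using j by(simp add: take_Suc_conv_app_nth)
have xQ: "?x : Q" using Suc.prems(3) ts by auto
have J: "ideal ?J R" by(rule genideal_ideal[OF tk])
have JQ: "?J <= Q" by(rule genideal_minimal[OF Q.is_ideal]) (use Suc.prems(3) ts in auto)
\<comment> \<open>Avoiding all s x^n with s outside Q forces the new prime into Q and keeps x out of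
  it. \<open>W\<close> misses the ideal of the earlier elements because x can be cancelled modulo
  it.\<close>
define W where "W = {s *. ?x [^] (n::nat) | s n. s : cr R - Q}"
have oneQ: "\<one> : cr R - Q" using Q.one_imp_carrier Q.I_notcarr by auto
have "EX Q'. primeideal Q' R & ?J <= Q' & Q' Int W = {}"
proof(rule ex_prime_disjoint[OF R J])
 show "W <= cr R" using xc by(auto simp: W_def)
 show "\<one> : W" unfolding W_def using oneQ by(auto intro!: exI[of _ \<one>] exI[of _ "0::nat"])
 show "u *. v : W" if "u : W" "v : W" for u v
 proof -
  obtain s m t n where h: "u = s *. ?x [^] (m::nat)" "v = t *. ?x [^] (n::nat)" "s : cr R - Q" "t : cr R - Q"
   using \<open>u : W\<close> \<open>v : W\<close> unfolding W_def by blast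
  have "u *. v = (s *. t) *. (?x [^] m *. ?x [^] n)" unfolding h(1,2) using h(3,4) xc by(simp add: m_ac)
  hence "u *. v = (s *. t) *. ?x [^] (m + n)" using xc by(simp add: nat_pow_mult)
  moreover have "s *. t : cr R - Q" using h(3,4) Q.I_prime by auto
  ultimately show ?thesis unfolding W_def by blast
 qed
 have "s : cr R - Q ==> s *. ?x [^] n : ?J ==> s : ?J" for s and n :: nat
 proof(induction n)
  case (Suc n)
  have "?x *. (s *. ?x [^] n) = s *. ?x [^] Suc n" using Suc.prems(1) xc by(simp add: m_ac)
  hence "s *. ?x [^] n : ?J" using xs(2)[OF j, of "s *. ?x [^] n"] Suc.prems xc by simp
  thus ?case using Suc by simp
 qed simp
 thus "?J Int W = {}" using JQ unfolding W_def by blast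
qed
then obtain Q' where Q': "primeideal Q' R" "?J <= Q'" "Q' Int W = {}" by blast
have sub: "Q' <= Q"
proof
 fix s assume s: "s : Q'"
 hence sc: "s : cr R" using ideal.Icarr[OF primeideal.axioms(1)[OF Q'(1)]] by blast
 show "s : Q"
 proof(rule ccontr)
  assume "s ~: Q"
  hence "s *. ?x [^] (0::nat) : W" unfolding W_def using sc by blast
  thus False using Q'(3) s sc by auto
 qed
qed
have "\<one> *. ?x [^] (1::nat) : W" unfolding W_def using oneQ by blast
hence "?x ~: Q'" using Q'(3) xc by auto
hence lt: "Q' < Q" using sub xQ by blast
have "set (take j xs) <= Q'" using genideal_self[OF tk] Q'(2) by blast
then obtain P where P: "ALL i<=j. primeideal (P i) R" "ALL i<j. P i < P (Suc i)" "P j = Q'"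
 using Suc.IH[OF less_imp_le[OF j] Q'(1)] by blast
show ?case
 by(rule exI[of _ "P(Suc j := Q)"]) (use P lt Suc.prems(2) in "auto simp: le_Suc_eq less_Suc_eq")
qed
definition cm_at_R :: "('a, 'b) ring_scheme => 'a set => 'a list => bool" where
"cm_at_R R p gs <-> set gs <= p &
 (ALL i<length gs. ALL a:cr R. gs ! i *.\<^bsub>R\<^esub> a : Idl\<^bsub>R\<^esub> (set (take i gs)) -->
   (EX s:cr R - p. s *.\<^bsub>R\<^esub> a : Idl\<^bsub>R\<^esub> (set (take i gs)))) &
 (ALL h Q. (ALL i<=h. primeideal (Q i) R) & (ALL i<h. Q i < Q (Suc i)) & Q h <= p --> h <= length gs)"
definition reg_at_R :: "('a, 'b) ring_scheme => 'a set => 'a list => bool" where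
"reg_at_R R p gs <-> cm_at_R R p gs & (ALL x:p. EX s:cr R - p. s *.\<^bsub>R\<^esub> x : Idl\<^bsub>R\<^esub> (set gs))"

text \<open>The image of gs is a regular sequence, so its length is at most the depth; depth is at
  most dimension by \<open>prime_chain_of_regular\<close>; and the chain condition, contracted to
  \<open>R\<close>, bounds the dimension by the length again.\<close>

lemma local_criterion:
fixes R (structure)
assumes noeth: "noetherian_ring R" and R: "cring R" and P: "primeideal P R" and gs: "cm_at_R R P gs"
shows "cm_local_ring (localize_at R P)" "reg_at_R R P gs ==> regular_local_ring (localize_at R P)"
proof -
interpret noetherian_ring R by(rule noeth)
interpret cring R by(rule R)
interpret P: primeideal P R by(rule P)
define S where "S = cr R - P"
have oneP: "\<one> ~: P" using P.one_imp_carrier P.I_notcarr by auto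
interpret localization R S
 by unfold_locales (use oneP P.I_prime in "auto simp: S_def")
interpret L: cring L by(rule cring_L)
have LL: "localize_at R P = L" by(simp add: localize_at_def S_def)
have gc: "set gs <= P" "set gs <= cr R" using gs P.Icarr by(auto simp: cm_at_R_def)
have extP: "fc a s : ext P <-> a : P" if "a : cr R" "s : S" for a s
proof -
 have "u *. a : P <-> a : P" if "u : S" for u
  using P.I_prime[of u a] P.I_l_closed[of a u] that \<open>a : cr R\<close> by(auto simp: S_def)
 thus ?thesis using ext_iff[OF P.is_ideal that] S1 by auto
qed
have mx: "J <= ext P" if J: "ideal J L" "J ~= cr L" for J
proof
 fix x assume x: "x : J"
 hence "x : cr L" using ideal.Icarr[OF J(1)] by blast
 then obtain a s where h: "a : cr R" "s : S" "x = fc a s" by(metis L_cases)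
 show "x : ext P"
 proof(rule ccontr)
  assume "x ~: ext P"
  hence aS: "a : S" using extP h by(auto simp: S_def)
  have "fc s a *.\<^bsub>L\<^esub> x = fc (s *. a) (a *. s)" unfolding h(3) using h aS S_carr by(simp add: mult_L)
  also have "... = oL" unfolding one_L by(rule fc_eqI) (use h aS S_carr S1 Sm in "auto simp: m_comm")
  finally have "oL : J" using ideal.I_l_closed[OF J(1) x, of "fc s a"] h aS S_carr by auto
  thus False using ideal.one_imp_carrier[OF J(1)] J(2) by simp
 qed
qed
have extI: "ideal (ext P) L" by(rule ideal_ext[OF P.is_ideal])
have extN: "ext P ~= cr L" using extP[OF one_closed S1] oneP L.one_closed unfolding one_L by blast
have maxext: "maximalideal (ext P) L"
proof(rule maximalidealI[OF extI])
 show "cr L ~= ext P" using extN by simp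
 fix J assume "ideal J L" "ext P <= J" "J <= cr L"
 thus "J = ext P | J = cr L" using mx by blast
qed
have uniq: "M = ext P" if "maximalideal M L" for M
proof -
 interpret M: maximalideal M L by fact
 have "M <= ext P" using mx[OF M.is_ideal] M.I_notcarr by auto
 thus ?thesis using M.I_maximal[OF extI] ideal.Icarr[OF extI] extN by blast
qed
have loc: "local_ring L" unfolding local_ring_def by(intro conjI cring_L ex1I[of _ "ext P"] maxext uniq)
have maxi: "max_ideal L = ext P" unfolding max_ideal_def by(intro the_equality maxext uniq)
have noL: "noetherian_ring L" by(rule noetherian_L[OF noeth])
define xs where "xs = map (%g. fc g \<one>) gs"
have xsL: "set xs <= cr L" using gc S1 by(auto simp: xs_def)
have Idl_xs: "Idl\<^bsub>L\<^esub> (set (take i xs)) = ext (Idl (set (take i gs)))" for i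
proof -
 have "set (take i xs) = (%g. fc g \<one>) ` set (take i gs)" by(simp add: xs_def take_map)
 moreover have "set (take i gs) <= cr R" using gc set_take_subset by fast
 ultimately show ?thesis using Idl_ext by simp
qed
have Ig: "ideal (Idl (set (take i gs))) R" for i
 by(rule genideal_ideal) (use gc set_take_subset in fast)
have IdlP: "Idl (set gs) <= P" by(rule genideal_minimal[OF P.is_ideal gc(1)])
have Idl_all: "Idl\<^bsub>L\<^esub> (set xs) = ext (Idl (set gs))" using Idl_xs[of "length gs"] by(simp add: xs_def)
have sub: "ext (Idl (set gs)) <= ext P" using IdlP unfolding ext_def by blast
have reg: "regular_sequence L xs"
 unfolding regular_sequence_def
proof(intro conjI allI impI ballI)
 show "set xs <= cr L" by(rule xsL)
 show "Idl\<^bsub>L\<^esub> (set xs) ~= cr L" unfolding Idl_all using sub extN ideal.Icarr[OF extI] by blast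
 fix i x assume i: "i < length xs" and x: "x : cr L" and m: "xs ! i *.\<^bsub>L\<^esub> x : Idl\<^bsub>L\<^esub> (set (take i xs))"
 have i': "i < length gs" using i by(simp add: xs_def)
 have gi: "gs ! i : cr R" using gc i' by auto
 obtain a s where h: "a : cr R" "s : S" "x = fc a s" using x by(metis L_cases)
 have sc: "s : cr R" using h S_carr by auto
 have "fc (gs ! i *. a) s : ext (Idl (set (take i gs)))"
  using m unfolding Idl_xs h(3) using i' gi h S1 sc by(simp add: xs_def mult_L)
 then obtain u where u: "u : S" "u *. (gs ! i *. a) : Idl (set (take i gs))" using ext_iff[OF Ig, of "gs ! i *. a" s] gi h by auto
 have uc: "u : cr R" using u S_carr by auto
 have "gs ! i *. (u *. a) : Idl (set (take i gs))" using u(2) gi h(1) uc by(simp add: m_lcomm)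
 then obtain t where t: "t : S" "t *. (u *. a) : Idl (set (take i gs))"
  using gs i' uc h(1) unfolding cm_at_R_def S_def by blast
 have "(t *. u) *. a : Idl (set (take i gs))" using t uc h(1) S_carr by(simp add: m_assoc)
 thus "x : Idl\<^bsub>L\<^esub> (set (take i xs))" unfolding Idl_xs h(3) using ext_iff[OF Ig h(1,2)] Sm[OF t(1) u(1)] by blast
qed
have le_dim: "enat (length ys) <= krull_dim L" if ys: "regular_sequence L ys" for ys
proof -
 have y: "set ys <= cr L" "Idl\<^bsub>L\<^esub> (set ys) ~= cr L" using ys by(auto simp: regular_sequence_def)
 have Iy: "ideal (Idl\<^bsub>L\<^esub> (set ys)) L" by(rule L.genideal_ideal[OF y(1)])
 have n1: "oL ~: Idl\<^bsub>L\<^esub> (set ys)" using y(2) ideal.one_imp_carrier[OF Iy] by blast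
 have "EX Q. primeideal Q L & Idl\<^bsub>L\<^esub> (set ys) <= Q & Q Int {oL} = {}"
  by(rule noetherian_ring.ex_prime_disjoint[OF noL cring_L Iy]) (use n1 in auto)
 then obtain Q where Q: "primeideal Q L" "set ys <= Q" using L.genideal_self[OF y(1)] by blast
 obtain P' where "(ALL i<=length ys. primeideal (P' i) L) & (ALL i<length ys. P' i < P' (Suc i)) & P' (length ys) = Q"
  using prime_chain_of_regular[OF noL cring_L y(1), of "length ys" Q] Q ys unfolding regular_sequence_def by auto
 hence "enat (length ys) : {enat k | k. EX P. (ALL i<=k. primeideal (P i) L) & (ALL i<k. P i < P (Suc i))}" by blast
 thus ?thesis unfolding krull_dim_def by(rule Sup_upper)
qed
have dim_le: "krull_dim L <= enat (length gs)"
 unfolding krull_dim_def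
proof(rule Sup_least, clarify)
 fix k Q assume Q: "ALL i<=k. primeideal (Q i) L" "ALL i<k. Q i < Q (Suc i)"
 have I: "ideal (Q i) L" if "i <= k" for i using Q(1) that by(auto intro: primeideal.axioms)
 have "contr (Q k) <= P"
 proof
  fix a assume a: "a : contr (Q k)"
  hence "fc a \<one> : ext P" using mx[OF I[of k]] primeideal.I_notcarr[of "Q k" L] Q(1) by(auto simp: contr_def)
  thus "a : P" using extP[of a \<one>] a S1 by(auto simp: contr_def)
 qed
 moreover have "ALL i<=k. primeideal (contr (Q i)) R" using Q(1) prime_contr by blast
 moreover have "ALL i<k. contr (Q i) < contr (Q (Suc i))" using Q(2) contr_strict I by auto
 ultimately have "k <= length gs" using gs unfolding cm_at_R_def by(elim conjE) (drule spec[of _ k], drule spec[of _ "%i. contr (Q i)"], blast)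
 thus "enat k <= enat (length gs)" by simp
qed
have len: "length xs = length gs" by(simp add: xs_def)
have xm: "set xs <= max_ideal L" unfolding maxi xs_def using gc extP S1 by auto
have dim: "krull_dim L = enat (length gs)" using dim_le le_dim[OF reg] len by simp
have "enat (length gs) : {enat (length xs) | xs. regular_sequence L xs & set xs <= max_ideal L}" using reg xm len by force
hence "enat (length gs) <= local_depth L" unfolding local_depth_def by(rule Sup_upper)
moreover have "local_depth L <= krull_dim L" unfolding local_depth_def by(rule Sup_least) (use le_dim in auto)
ultimately have "local_depth L = krull_dim L" using dim by simp
thus "cm_local_ring (localize_at R P)" unfolding LL cm_local_ring_def using noL loc by blast
show "regular_local_ring (localize_at R P)" if rg: "reg_at_R R P gs"
 unfolding LL regular_local_ring_def
proof(intro conjI exI[of _ "set xs"])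
 show "noetherian_ring L" "local_ring L" using noL loc .
 show "finite (set xs)" "set xs <= cr L" using xsL by auto
 show "Idl\<^bsub>L\<^esub> (set xs) = max_ideal L" unfolding Idl_all maxi
 proof(rule equalityI[OF sub], rule subsetI)
  fix x assume "x : ext P"
  then obtain a s where h: "x = fc a s" "a : cr R" "s : S" "fc a s : ext P" unfolding ext_def by blast
  hence "a : P" using extP by simp
  then obtain t where "t : S" "t *. a : Idl (set gs)" using rg unfolding reg_at_R_def S_def by blast
  thus "x : ext (Idl (set gs))" unfolding ext_def using h by blast
 qed
 \<comment> \<open>\<open>regular_local_ring\<close> counts a set of generators, so the entries must
   be distinct. A repeated entry would by regularity put 1 into the ideal of its
   predecessors.\<close>
 have neq: "xs ! i ~= xs ! j" if "i < j" "j < length xs" for i j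
 proof
  assume "xs ! i = xs ! j"
  hence ij: "i < j" "j < length xs" "xs ! i = xs ! j" using that by auto
  have tk: "set (take j xs) <= cr L" using xsL set_take_subset by fast
  have xj: "xs ! j : cr L" using ij xsL by auto
  have "take j xs ! i : set (take j xs)" using ij by(intro nth_mem) simp
  hence "xs ! i : set (take j xs)" using ij by simp
  hence "xs ! j *.\<^bsub>L\<^esub> oL : Idl\<^bsub>L\<^esub> (set (take j xs))" using L.genideal_self[OF tk] ij xj by auto
  hence "oL : Idl\<^bsub>L\<^esub> (set (take j xs))" using reg ij(2) unfolding regular_sequence_def by blast
  moreover have "Idl\<^bsub>L\<^esub> (set (take j xs)) <= ext P" unfolding Idl_xs
  proof -
   have "Idl (set (take j gs)) <= P" by(rule genideal_minimal[OF P.is_ideal]) (use gc set_take_subset in fast)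
   thus "ext (Idl (set (take j gs))) <= ext P" unfolding ext_def by blast
  qed
  ultimately show False using extN ideal.one_imp_carrier[OF extI] by blast
 qed
 hence "distinct xs" unfolding distinct_conv_nth by(metis linorder_neqE_nat)
 thus "enat (card (set xs)) = krull_dim L" using distinct_card[of xs] dim len by simp
qed
qed

theorem cohen_macaulayI:
assumes "noetherian_ring R" "cring R" "!!P. primeideal P R ==> EX gs. cm_at_R R P gs"
shows "cohen_macaulay_ring R"
unfolding cohen_macaulay_ring_def using assms local_criterion(1) by blast

theorem regular_ringI:
assumes "noetherian_ring R" "cring R" "!!P. primeideal P R ==> EX gs. reg_at_R R P gs"
shows "regular_ring R"
unfolding regular_ring_def
proof(intro conjI allI impI)
fix P assume P: "primeideal P R"
obtain gs where gs: "reg_at_R R P gs" using assms(3)[OF P] by blast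
hence "cm_at_R R P gs" by(simp add: reg_at_R_def)
from local_criterion(2)[OF assms(1,2) P this gs] show "regular_local_ring (localize_at R P)" .
qed (use assms in auto)

section \<open>Transfer to abstract rings\<close>
definition ideal_in :: "'a::comm_ring_1 set => 'a set => bool" where
"ideal_in D I <-> I <= D & 0 : I & (ALL x:I. ALL y:I. x + y : I) & (ALL x:I. ALL d:D. d * x : I)"
definition nth_in :: "'a::comm_ring_1 set => bool" where
"nth_in D <-> (ALL I. ideal_in D I --> (EX G. finite G & G <= I & I <= gen D G))"

lemma gen_least: "ideal_in D I ==> G <= I ==> gen D G <= I"
proof
fix x assume I: "ideal_in D I" "G <= I" and "x : gen D G"
then obtain r where r: "ALL g:G. r g : D" "x = (SUM g:G. r g * g)" unfolding gen_def by blast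
have s: "sum f A : I" if "!!i. i : A ==> f i : I" for f and A :: "'a set"
 using that I(1) by(induction A rule: fin_ind) (auto simp: ideal_in_def)
show "x : I" unfolding r(2) by(rule s) (use r(1) I in "auto simp: ideal_in_def")
qed

lemma ideal_in_gen: "sbr D ==> G <= D ==> ideal_in D (gen D G)"
unfolding ideal_in_def
proof(intro conjI ballI)
assume D: "sbr D" and G: "G <= D"
show "gen D G <= D"
proof
 fix x assume "x : gen D G"
 then obtain r where "ALL g:G. r g : D" "x = (SUM g:G. r g * g)" unfolding gen_def by blast
 thus "x : D" using G by(auto intro!: sbr_sum[OF D] sbr(5)[OF D])
qed
qed (auto intro: gen_0 gen_add gen_mult)

lemma noeth_local:
assumes D: "sbr D" and D': "sbr D'" and l: "is_local D D'" and n: "nth_in D"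
shows "nth_in D'"
unfolding nth_in_def
proof(intro allI impI)
fix I assume I: "ideal_in D' I"
have DD: "D <= D'" using l by(simp add: is_local_def)
have ID: "ideal_in D (I Int D)" using I[unfolded ideal_in_def] DD sbr(1,4,5)[OF D] unfolding ideal_in_def by auto
from n[unfolded nth_in_def, rule_format, OF ID]
obtain G where G: "finite G" "G <= I Int D" "I Int D <= gen D G" by blast
have "x : gen D' G" if x: "x : I" for x
proof -
 obtain u v where u: "u : D" "v : D'" "u * v = 1" "u * x : D" using l I x unfolding is_local_def ideal_in_def by blast
 have "u * x : I Int D" using I x u DD unfolding ideal_in_def by blast
 hence "u * x : gen D G" using G(3) by blast
 hence "u * x : gen D' G" using DD unfolding gen_def by blast
 hence "v * (u * x) : gen D' G" by(rule gen_mult[OF D' _ u(2)])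
 moreover have "v * (u * x) = (u * v) * x" by(simp add: mult_ac)
 ultimately show ?thesis using u(3) by simp
qed
hence "I <= gen D' G" by blast
thus "EX G. finite G & G <= I & I <= gen D' G" using G(1,2) by(intro exI[of _ G]) auto
qed

text \<open>An abstract ring identified with a subring \<open>D\<close> of a type-class ring. The
  Rees ring, the fiber ring and the charts in the fraction field all enter through this
  interface.\<close>

locale typed_ring = cring R for R (structure) +
fixes D :: "'c::comm_ring_1 set" and h :: "'c => 'a"
assumes D: "sbr D" and bij: "bij_betw h D (cr R)"
 and h_add: "x : D ==> y : D ==> h (x + y) = h x +. h y"
 and h_mult: "x : D ==> y : D ==> h (x * y) = h x *. h y"
 and h_1: "h 1 = \<one>"
begin

lemma h_carr: "x : D ==> h x : cr R" using bij by(auto simp: bij_betw_def)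

lemma h_inj: "x : D ==> y : D ==> h x = h y <-> x = y" using bij by(auto simp: bij_betw_def inj_on_eq_iff)

lemma h_surj: "a : cr R ==> EX x:D. a = h x" using bij by(auto simp: bij_betw_def)

lemma h_0: "h 0 = \<zero>"
using h_add[of 0 0] h_carr[of 0] sbr(1)[OF D] by simp

lemma h_minus: "x : D ==> h (- x) = \<ominus> h x"
using h_add[of x "- x"] h_0 h_carr sbr(3)[OF D] by(metis add.inv_unique add.right_inverse minus_equality a_comm)

lemma h_pow: "x : D ==> h (x ^ n) = h x [^] (n::nat)"
by(induction n) (simp_all add: h_1 h_mult sbr[OF D] m_comm h_carr)
definition pre where "pre I = {x : D. h x : I}"

lemma pre_ideal: "ideal I R ==> ideal_in D (pre I)"
unfolding ideal_in_def pre_def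
using ideal.I_l_closed[of I R] additive_subgroup.a_closed[of I R] additive_subgroup.zero_closed[of I R] ideal.axioms(1)[of I R]
by(auto simp: h_add h_mult h_0 h_carr sbr[OF D])

lemma image_ideal: "ideal_in D I ==> ideal (h ` I) R"
proof(rule idealI[OF ring_axioms])
assume I: "ideal_in D I"
have m: "- x : I" if "x : I" for x
proof -
 have "- 1 * x : I" using I that sbr(2,3)[OF D] unfolding ideal_in_def by blast
 thus ?thesis by simp
qed
have ID: "x : D" if "x : I" for x using I that by(auto simp: ideal_in_def)
show "subgroup (h ` I) (add_monoid R)"
proof(rule add.subgroupI)
 show "h ` I <= cr R" using ID h_carr by auto
 show "h ` I ~= {}" using I by(auto simp: ideal_in_def)
 show "\<ominus> a : h ` I" if "a : h ` I" for a using that m ID h_minus by force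
 show "a +. b : h ` I" if "a : h ` I" "b : h ` I" for a b
  using that ID I unfolding ideal_in_def by(auto simp: h_add[symmetric])
qed
fix a x assume "a : h ` I" "x : cr R"
then obtain i y where "a = h i" "i : I" "x = h y" "y : D" using h_surj by blast
thus "x *. a : h ` I" "a *. x : h ` I"
 using I ID m_comm[of a x] h_carr unfolding ideal_in_def by(auto simp: h_mult[symmetric])
qed

lemma Idl_image:
assumes G: "finite G" "G <= D"
shows "Idl (h ` G) = h ` gen D G"
proof
have GR: "h ` G <= cr R" using G h_carr by auto
show "Idl (h ` G) <= h ` gen D G"
 by(rule genideal_minimal[OF image_ideal[OF ideal_in_gen[OF D G(2)]]]) (use gen_base[OF D G(1)] in auto)
have "gen D G <= pre (Idl (h ` G))"
 by(rule gen_least[OF pre_ideal[OF genideal_ideal[OF GR]]]) (use genideal_self[OF GR] G(2) in "auto simp: pre_def")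
thus "h ` gen D G <= Idl (h ` G)" by(auto simp: pre_def)
qed

lemma Idl_iff: "finite G ==> G <= D ==> x : D ==> h x : Idl (h ` G) <-> x : gen D G"
unfolding Idl_image using ideal_in_gen[OF D, of G] h_inj by(auto simp: ideal_in_def)

lemma noetherian: "nth_in D ==> noetherian_ring R"
proof(rule noetherian_ringI)
fix I assume n: "nth_in D" and I: "ideal I R"
have "EX G. finite G & G <= pre I & pre I <= gen D G" using n pre_ideal[OF I] unfolding nth_in_def by simp
then obtain G where G: "finite G" "G <= pre I" "pre I <= gen D G" by(elim exE conjE)
have GD: "G <= D" using G by(auto simp: pre_def)
have "I = h ` pre I" using h_surj ideal.Icarr[OF I] by(auto simp: pre_def)
also have "pre I = gen D G" using G(3) gen_least[OF pre_ideal[OF I] G(2)] by blast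
finally show "EX A<=cr R. finite A & I = Idl A"
 using Idl_image[OF G(1) GD] G(1) GD h_carr by(intro exI[of _ "h ` G"]) auto
qed

lemma pre_prime: "primeideal P R ==> prm D (pre P)"
proof -
assume P: "primeideal P R"
hence I: "ideal P R" by(rule primeideal.axioms)
have "\<one> ~: P" using ideal.one_imp_carrier[OF I] primeideal.I_notcarr[OF P] by auto
thus ?thesis using pre_ideal[OF I] primeideal.I_prime[OF P] h_carr
 unfolding prm_def ideal_in_def by(auto simp: pre_def h_1 h_mult)
qed

lemma h_pre: "ideal I R ==> h ` pre I = I"
using h_surj ideal.Icarr[of I R] by(auto simp: pre_def)

lemma cm_transfer:
assumes P: "primeideal P R" and c: "cm_at D (pre P) gs"
shows "cm_at_R R P (map h gs)"
unfolding cm_at_R_def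
proof(intro conjI allI impI ballI)
have gp: "set gs <= pre P" using c by(simp add: cm_at_def)
hence gD: "set gs <= D" by(auto simp: pre_def)
show "set (map h gs) <= P" using gp by(auto simp: pre_def)
have st: "set (take i (map h gs)) = h ` set (take i gs)" for i by(simp add: take_map)
have tD: "set (take i gs) <= D" for i using gD set_take_subset by fast
fix i a assume i: "i < length (map h gs)" and a: "a : cr R" and m: "map h gs ! i *. a : Idl (set (take i (map h gs)))"
obtain x where x: "x : D" "a = h x" using h_surj[OF a] by blast
have gi: "gs ! i : D" using gD i by auto
have "h (gs ! i * x) : Idl (h ` set (take i gs))" using m i gi x by(simp add: st h_mult)
hence "gs ! i * x : gen D (set (take i gs))" using Idl_iff[OF _ tD] sbr(5)[OF D gi x(1)] by simp
moreover have "ALL i<length gs. ALL a:D. gs ! i * a : gen D (set (take i gs)) --> (EX s:D - pre P. s * a : gen D (set (take i gs)))"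
 using c unfolding cm_at_def by(elim conjE)
ultimately obtain s where s: "s : D - pre P" "s * x : gen D (set (take i gs))" using i x(1) by auto
hence "h s *. a : Idl (set (take i (map h gs)))"
 using Idl_iff[OF _ tD, of i "s * x"] sbr(5)[OF D _ x(1)] x by(simp add: st h_mult)
moreover have "h s : cr R - P" using s h_carr by(auto simp: pre_def)
ultimately show "EX s:cr R - P. s *. a : Idl (set (take i (map h gs)))" by blast
next
fix n Q assume Q: "(ALL i<=n. primeideal (Q i) R) & (ALL i<n. Q i < Q (Suc i)) & Q n <= P"
have I: "ideal (Q i) R" if "i <= n" for i using Q that by(auto intro: primeideal.axioms)
have "pre (Q i) < pre (Q (Suc i))" if "i < n" for i
proof -
 have "pre (Q i) <= pre (Q (Suc i))" using Q that by(auto simp: pre_def)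
 moreover have "pre (Q i) ~= pre (Q (Suc i))"
 proof
  assume "pre (Q i) = pre (Q (Suc i))"
  hence "h ` pre (Q i) = h ` pre (Q (Suc i))" by(rule arg_cong)
  moreover have "h ` pre (Q i) = Q i" "h ` pre (Q (Suc i)) = Q (Suc i)" using h_pre[OF I] \<open>i < n\<close> by auto
  ultimately have "Q i = Q (Suc i)" by argo
  moreover have "Q i < Q (Suc i)" using Q that by simp
  ultimately show False by blast
 qed
 ultimately show ?thesis by blast
qed
moreover have "pre (Q n) <= pre P" using Q by(auto simp: pre_def)
ultimately have c1: "(ALL i<=n. prm D (pre (Q i))) & (ALL i<n. pre (Q i) < pre (Q (Suc i))) & pre (Q n) <= pre P"
 using Q pre_prime by auto
have key: "ALL k Q. (ALL i<=k. prm D (Q i)) & (ALL i<k. Q i < Q (Suc i)) & Q k <= pre P --> k <= length gs"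
 using c unfolding cm_at_def by(elim conjE)
have "n <= length gs" by(rule key[THEN spec, of n, THEN spec, of "%i. pre (Q i)", THEN mp, OF c1])
thus "n <= length (map h gs)" by simp
qed

lemma reg_transfer:
assumes P: "primeideal P R" and c: "reg_at D (pre P) gs"
shows "reg_at_R R P (map h gs)"
unfolding reg_at_R_def
proof(intro conjI ballI)
have cm: "cm_at D (pre P) gs" using c by(simp add: reg_at_def)
show "cm_at_R R P (map h gs)" by(rule cm_transfer[OF P cm])
have gD: "set gs <= D" using cm by(auto simp: cm_at_def pre_def)
fix a assume a: "a : P"
then obtain x where x: "x : pre P" "a = h x" using h_pre[OF primeideal.axioms(1)[OF P]] by blast
obtain s where s: "s : D - pre P" "s * x : gen D (set gs)" using c x(1) unfolding reg_at_def by blast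
have "h s *. a : Idl (set (map h gs))"
 using Idl_iff[OF _ gD, of "s * x"] s x sbr(5)[OF D] by(auto simp: h_mult pre_def)
moreover have "h s : cr R - P" using s h_carr by(auto simp: pre_def)
ultimately show "EX s:cr R - P. s *. a : Idl (set (map h gs))" by blast
qed

theorem cohen_macaulay:
assumes "nth_in D" "!!p. prm D p ==> EX gs. cm_at D p gs"
shows "cohen_macaulay_ring R"
by(rule cohen_macaulayI[OF noetherian[OF assms(1)] is_cring]) (use assms(2) pre_prime cm_transfer in blast)

theorem regular:
assumes "nth_in D" "!!p. prm D p ==> EX gs. reg_at D p gs"
shows "regular_ring R"
by(rule regular_ringI[OF noetherian[OF assms(1)] is_cring]) (use assms(2) pre_prime reg_transfer in blast)
end

section \<open>Noetherian monoid algebras\<close>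

text \<open>Fix e in \<open>E\<close>. A vector not above e has a coordinate i with a value below
  \<open>e i\<close>; on each of these finitely many slices coordinate i is constant and induction
  on the set of coordinates applies.\<close>

lemma dickson:
assumes "finite (V :: 'i set)"
shows "EX F<=E. finite F & (ALL c:E. EX f:F. ALL i:V. f i <= (c i :: nat))"
using assms
proof(induction "card V" arbitrary: V E rule: less_induct)
case less
show ?case
proof(cases "E = {}")
 case False
 then obtain e where e: "e : E" by blast
 have ex: "EX F. F <= {c : E. c i = k} & finite F & (ALL c:{c : E. c i = k}. EX f:F. ALL j:V - {i}. f j <= c j)" if "i : V" for i k
 proof -
  have "card (V - {i}) < card V" using that less.prems by(rule_tac psubset_card_mono) auto
  from less.hyps[OF this, of "{c : E. c i = k}"] show ?thesis using less.prems by auto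
 qed
 define F where "F i k = (SOME F. F <= {c : E. c i = k} & finite F & (ALL c:{c : E. c i = k}. EX f:F. ALL j:V - {i}. f j <= c j))" for i k
 have FF: "F i k <= {c : E. c i = k} & finite (F i k) & (ALL c:{c : E. c i = k}. EX f:F i k. ALL j:V - {i}. f j <= c j)" if "i : V" for i k
  unfolding F_def by(rule someI_ex[OF ex[OF that]])
 have F: "F i k <= {c : E. c i = k}" "finite (F i k)" if "i : V" for i k using FF[OF that] by blast+
 have F3: "EX f:F i k. ALL j:V - {i}. f j <= c j" if "i : V" "c : E" "c i = k" for i k c using FF[OF that(1), of k] that by blast
 let ?F = "insert e (UN i:V. UN k<e i. F i k)"
 have "EX f:?F. ALL i:V. f i <= c i" if c: "c : E" for c
 proof(cases "ALL i:V. e i <= c i")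
  case False
  then obtain i where i: "i : V" "c i < e i" by(auto simp: not_le)
  obtain f where f: "f : F i (c i)" "ALL j:V - {i}. f j <= c j" using F3[OF i(1) c refl] by blast
  have "f i = c i" using F(1)[OF i(1), of "c i"] f(1) by auto
  hence "ALL j:V. f j <= c j" using f(2) by force
  thus ?thesis using f(1) i by blast
 qed auto
 moreover have "?F <= E" "finite ?F" using F(1,2) e less.prems by auto
 ultimately show ?thesis by blast
qed auto
qed

locale fg_monoid =
fixes M :: "vec set" and Gs :: "vec set" and deg :: "vec => int"
assumes M_0: "0 : M" and M_add: "u : M ==> v : M ==> u + v : M"
 and Gs: "finite Gs" "Gs <= M" and deg: "lin deg" "g : Gs ==> 0 < deg g"
 and M_gen: "u : M ==> EX c. u = (SUM g:Gs. int (c g) ** g)"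
begin
definition cmb :: "(vec => nat) => vec" where "cmb c = (SUM g:Gs. int (c g) ** g)"

lemma M_sc: "u : M ==> int k ** u : M"
by(induction k) (auto simp: M_0 frag_cmul_distrib M_add)

lemma M_sum: "(!!i. i : A ==> f i : M) ==> sum f A : M"
by(induction A rule: fin_ind) (auto intro: M_0 M_add)

lemma cmb_M: "cmb c : M"
unfolding cmb_def using Gs(2) by(intro M_sum M_sc) auto

lemma deg_cmb: "deg (cmb c) = (SUM g:Gs. int (c g) * deg g)"
unfolding cmb_def by(simp add: lin_sum[OF deg(1)] lin_sc[OF deg(1)])

lemma finite_deg: "finite {u : M. deg u <= d}"
proof -
have "{u : M. deg u <= d} <= cmb ` PiE Gs (%_. {..nat d})"
proof
 fix u assume u: "u : {u : M. deg u <= d}"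
 then obtain c where c: "u = cmb c" using M_gen unfolding cmb_def by blast
 have "c g <= nat d" if g: "g : Gs" for g
 proof -
  have "int (c g) <= int (c g) * deg g" using deg(2)[OF g] by(simp add: mult_le_cancel_left1)
  also have "... <= (SUM g:Gs. int (c g) * deg g)"
   by(rule member_le_sum[OF g]) (use Gs(1) deg(2) in "auto simp: less_imp_le")
  finally have "int (c g) <= deg u" using deg_cmb[of c] c by simp
  thus ?thesis using u by auto
 qed
 hence "restrict c Gs : PiE Gs (%_. {..nat d})" by auto
 moreover have "u = cmb (restrict c Gs)" unfolding c cmb_def by(rule sum.cong) auto
 ultimately show "u : cmb ` PiE Gs (%_. {..nat d})" by blast
qed
thus ?thesis by(rule finite_subset) (use Gs(1) in "auto intro!: finite_PiE")
qed
text \<open>A graded order with ties broken by the order of the vector type; it is total and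
  compatible with addition. Positivity of \<open>deg\<close> on the generators leaves finitely many
  elements of bounded degree, so \<open>rnk\<close> is finite and allows induction on
  numbers.\<close>

definition prec :: "vec => vec => bool" where
"prec u v <-> deg u < deg v | (deg u = deg v & u < v)"
definition rnk :: "vec => nat" where "rnk u = card {v : M. prec v u}"

lemma prec_add: "prec u v ==> prec (u + w) (v + w)"
unfolding prec_def by(auto simp: lin_add[OF deg(1)])

lemma rnk_mono: "u : M ==> prec u v ==> rnk u < rnk v"
unfolding rnk_def
proof(rule psubset_card_mono)
show "finite {w : M. prec w v}" by(rule finite_subset[OF _ finite_deg[of "deg v"]]) (auto simp: prec_def)
qed (auto simp: prec_def)

lemma rnk_prec: "u : M ==> v : M ==> rnk u < rnk v <-> prec u v"
using rnk_mono[of u v] rnk_mono[of v u] unfolding prec_def by(metis less_asym linorder_neqE)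

lemma rnk_inj: "u : M ==> v : M ==> rnk u = rnk v <-> u = v"
using rnk_mono[of u v] rnk_mono[of v u] unfolding prec_def by(metis less_irrefl linorder_neqE)

lemma rnk_add: "u : M ==> v : M ==> w : M ==> rnk u < rnk v ==> rnk (u + w) < rnk (v + w)"
using rnk_prec prec_add rnk_mono M_add by metis
definition LE :: "(vec \<Rightarrow>\<^sub>0 'k::zero) => vec" where
"LE f = (SOME u. u : keys f & (ALL v:keys f. rnk v <= rnk u))"

lemma LE: "f ~= 0 ==> LE f : keys f" "f ~= 0 ==> v : keys f ==> rnk v <= rnk (LE f)"
proof -
assume "f ~= 0"
hence ne: "keys f ~= {}" by auto
have "Max (rnk ` keys f) : rnk ` keys f" using ne by(intro Max_in) auto
then obtain u where "u : keys f" "rnk u = Max (rnk ` keys f)" by auto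
hence "EX u. u : keys f & (ALL v:keys f. rnk v <= rnk u)" by(intro exI[of _ u]) simp
from someI_ex[OF this] show "LE f : keys f" "v : keys f ==> rnk v <= rnk (LE f)" unfolding LE_def by auto
qed

lemma LE_M: "f : KM M ==> f ~= 0 ==> LE f : M"
using LE(1)[of f] by(auto simp: KM_def)

lemma LE_mult:
fixes f g :: "('k::field) lau"
assumes f: "f : KM M" "f ~= 0" and g: "g : KM M" "g ~= 0"
shows "LE (f * g) = LE f + LE g" "lk (f * g) (LE f + LE g) = lk f (LE f) * lk g (LE g)"
proof -
have km: "u : M" if "u : keys f | u : keys g" for u using that f g by(auto simp: KM_def)
have lt: "rnk (u + v) < rnk (LE f + LE g)" if "u : keys f" "v : keys g" "(u, v) ~= (LE f, LE g)" for u v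
proof -
 note m = km LE_M[OF f] LE_M[OF g]
 have 1: "u = LE f | rnk u < rnk (LE f)" "v = LE g | rnk v < rnk (LE g)"
  using LE(2)[OF f(2) that(1)] LE(2)[OF g(2) that(2)] rnk_inj[of u "LE f"] rnk_inj[of v "LE g"] that m by(auto simp: le_less)
 have a: "rnk u < rnk (LE f) ==> rnk (u + v) < rnk (LE f + v)" using rnk_add[of u "LE f" v] m that by blast
 have b: "rnk v < rnk (LE g) ==> rnk (LE f + v) < rnk (LE f + LE g)" using rnk_add[of v "LE g" "LE f"] m that by(simp add: add.commute)
 show ?thesis using 1 a b that(3) by auto
qed
have prod: "f * g = (SUM i:keys f \<times> keys g. sng (fst i + snd i) (lk f (fst i) * lk g (snd i)))"
 by(subst (1) sum_sng[of f, symmetric], subst (1) sum_sng[of g, symmetric])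
  (simp add: sum_product mult_single sum.cartesian_product case_prod_unfold)
have "lk (f * g) (LE f + LE g) = (SUM i:keys f \<times> keys g. if i = (LE f, LE g) then lk f (LE f) * lk g (LE g) else 0)"
 unfolding prod lk_sum by(rule sum.cong) (use lt in "force simp: lk_sng when_def")+
thus l: "lk (f * g) (LE f + LE g) = lk f (LE f) * lk g (LE g)"
 using LE(1)[OF f(2)] LE(1)[OF g(2)] by simp
have nz: "lk f (LE f) * lk g (LE g) ~= 0" using LE(1)[OF f(2)] LE(1)[OF g(2)] by(simp add: ik)
hence k: "LE f + LE g : keys (f * g)" using l by(simp add: ik)
hence fg: "f * g ~= 0" by auto
have "LE (f * g) : keys (f * g)" by(rule LE(1)[OF fg])
then obtain u v where uv: "u : keys f" "v : keys g" "LE (f * g) = u + v" using keys_mult[of f g] by blast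
show "LE (f * g) = LE f + LE g"
 using lt[OF uv(1,2)] LE(2)[OF fg k] uv(3) by(cases "(u, v) = (LE f, LE g)") auto
qed

lemma sbr_KM: "sbr (KM M :: ('k::field) lau set)"
by(rule sbr_KMI[OF M_0 M_add])

lemma LE_cancel:
fixes f g :: "('k::field) lau"
assumes f: "f : KM M" "f ~= 0" and g: "g : KM M" "g ~= 0" and w: "w : M" "LE f = LE g + w"
defines "t == sng w (lk f (LE f) / lk g (LE g))"
shows "f - t * g : KM M" "f - t * g ~= 0 ==> rnk (LE (f - t * g)) < rnk (LE f)"
proof -
have nz: "lk g (LE g) ~= 0" "lk f (LE f) ~= 0" using LE(1)[OF g(2)] LE(1)[OF f(2)] by(auto simp: ik)
have t: "t : KM M" "t ~= 0" "LE t = w"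
proof -
 show "t : KM M" using w by(simp add: t_def KM_sng)
 show "t ~= 0" using nz by(metis divide_eq_0_iff lookup_single_eq lookup_zero t_def)
 from LE(1)[OF this] show "LE t = w" by(auto simp: t_def split: if_splits)
qed
show km: "f - t * g : KM M" by(intro KM_diff f KM_mult t g M_add)
have ltg: "LE (t * g) = LE f" "lk (t * g) (LE f) = lk f (LE f)"
 using LE_mult[OF t(1,2) g] t(3) w nz by(auto simp: add.commute t_def)
assume nz': "f - t * g ~= 0"
let ?u = "LE (f - t * g)"
have u: "?u : keys (f - t * g)" by(rule LE(1)[OF nz'])
have "?u ~= LE f" using u ltg(2) by(auto simp: ik lk_diff)
moreover have "rnk ?u <= rnk (LE f)"
proof -
 have "t * g ~= 0" using t(2) g(2) by simp
 moreover have "?u : keys f | ?u : keys (t * g)" using u by(auto simp: ik lk_diff)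
 ultimately show ?thesis using LE(2)[OF f(2)] LE(2)[of "t * g"] ltg(1) by auto
qed
ultimately show "rnk ?u < rnk (LE f)" using rnk_inj[of ?u "LE f"] LE_M[OF km nz'] LE_M[OF f] by simp
qed

text \<open>Groebner reduction. Exponents of M are lifted to coefficient vectors on the generators,
  where \<open>dickson\<close> yields finitely many minimal leading exponents; subtracting a
  monomial multiple lowers the rank of the leading exponent.\<close>

theorem noeth_KM: "nth_in (KM M :: ('k::field) lau set)"
unfolding nth_in_def
proof(intro allI impI)
fix I :: "'k lau set" assume I: "ideal_in (KM M) I"
have IM: "x : KM M" if "x : I" for x using I that by(auto simp: ideal_in_def)
define E where "E = {c. EX f:I. f ~= 0 & LE f = cmb c}"
obtain F where F: "F <= E" "finite F" "!!c. c : E ==> EX f:F. ALL g:Gs. f g <= c g" using dickson[OF Gs(1), of E] by blast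
have "ALL c:F. EX f. f : I & f ~= 0 & LE f = cmb c" using F(1) by(auto simp: E_def)
then obtain p where p: "!!c. c : F ==> p c : I" "!!c. c : F ==> p c ~= 0" "!!c. c : F ==> LE (p c) = cmb c" by metis
let ?G = "p ` F"
have main: "f : gen (KM M) ?G" if "f : I" "f ~= 0" for f
 using that
proof(induction "rnk (LE f)" arbitrary: f rule: less_induct)
 case less
 obtain c where c: "LE f = cmb c" using M_gen[OF LE_M[OF IM[OF less.prems(1)] less.prems(2)]] unfolding cmb_def by blast
 hence "c : E" using less.prems by(auto simp: E_def)
 then obtain e where e: "e : F" "ALL g:Gs. e g <= c g" using F(3) by blast
 define w where "w = cmb (%g. c g - e g)"
 have cw: "LE f = LE (p e) + w"
  unfolding c p(3)[OF e(1)] w_def cmb_def sum.distrib[symmetric]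
  by(rule sum.cong) (use e(2) in "auto simp flip: frag_cmul_distrib")
 note L = LE_cancel[OF IM[OF less.prems(1)] less.prems(2) IM[OF p(1)[OF e(1)]] p(2)[OF e(1)] cmb_M[of "%g. c g - e g", folded w_def] cw]
 let ?t = "sng w (lk f (LE f) / lk (p e) (LE (p e)))"
 have tM: "?t : KM M" unfolding w_def by(intro KM_sng cmb_M)
 have tp: "?t * p e : gen (KM M) ?G" by(rule gen_mult[OF sbr_KM gen_base[OF sbr_KM] tM]) (use F(2) e(1) in auto)
 have "f - ?t * p e : gen (KM M) ?G"
 proof(cases "f - ?t * p e = 0")
  case False
  have "- ?t * p e : I" using I p(1)[OF e(1)] KM_uminus[OF tM] unfolding ideal_in_def by blast
  hence "f + - ?t * p e : I" using I less.prems(1) unfolding ideal_in_def by blast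
  thus ?thesis using less.hyps[OF L(2)[OF False]] False by simp
 qed (simp add: gen_0[OF sbr_KM])
 hence "f - ?t * p e + ?t * p e : gen (KM M) ?G" by(rule gen_add[OF sbr_KM _ tp])
 thus ?case by simp
qed
hence "I <= gen (KM M) ?G" using gen_0[OF sbr_KM] by blast
thus "EX G. finite G & G <= I & I <= gen (KM M) G" using F(2) p(1) by(intro exI[of _ ?G]) auto
qed
end

section \<open>Normality\<close>

text \<open>An integral equation of degree m for a/b shows that b^m times every power of a/b lies in
  \<open>R\<close>. The hypothesis is complete integral closedness written as divisibility, and it
  is applied with c = b^m.\<close>

lemma (in domain) normal_domainI:
assumes cic: "!!a b c. a : cr R ==> b : cr R - {\<zero>} ==> c : cr R - {\<zero>} ==>
 (!!m::nat. EX q:cr R. c *. a [^] m = b [^] m *. q) ==> EX q:cr R. a = b *. q"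
shows "normal_domain R"
unfolding normal_domain_def
proof(intro conjI ballI impI)
show "domain R" by(rule domain_axioms)
define S where "S = cr R - {\<zero>}"
interpret localization R S
 by unfold_locales (use integral in "auto simp: S_def")
interpret L: cring L by(rule cring_L)
have FL: "frac_field R = L" by(simp add: frac_field_def S_def)
have base: "base_image R = {fc a \<one> | a. a : cr R}" by(auto simp: base_image_def frac_def S_def)
have b_carr: "x : cr L" if "x : base_image R" for x using that S1 by(auto simp: base)
have b_add: "x +.\<^bsub>L\<^esub> y : base_image R" and b_mult: "x *.\<^bsub>L\<^esub> y : base_image R" if xy: "x : base_image R" "y : base_image R" for x y
proof -
 from xy obtain a b where "x = fc a \<one>" "y = fc b \<one>" "a : cr R" "b : cr R" by(auto simp: base)
 thus "x +.\<^bsub>L\<^esub> y : base_image R" "x *.\<^bsub>L\<^esub> y : base_image R"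
  unfolding base using S1 by(auto simp: add_L mult_L)
qed
have b_neg: "\<ominus>\<^bsub>L\<^esub> x : base_image R" if x: "x : base_image R" for x
proof -
 from x obtain a where a: "x = fc a \<one>" "a : cr R" by(auto simp: base)
 have "x +.\<^bsub>L\<^esub> fc (\<ominus> a) \<one> = zL" unfolding a zero_L using a S1 by(simp add: add_L r_neg)
 hence "\<ominus>\<^bsub>L\<^esub> x = fc (\<ominus> a) \<one>" using a S1 by(intro L.minus_equality) (auto simp: L.a_comm)
 thus ?thesis using a by(auto simp: base)
qed
have b_sum: "(\<Oplus>\<^bsub>L\<^esub>i\<in>A. f i) : base_image R" if "finite A" "!!i. i : A ==> f i : base_image R" for f and A :: "nat set"
 using that
proof(induction A rule: finite_induct)
 case empty
 show ?case by(auto simp: zero_L base)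
next
 case (insert i A)
 thus ?case using b_carr by(subst L.finsum_insert) (auto intro: b_add)
qed
fix z assume "z : cr (frac_field R)" and int: "integral_over (frac_field R) (base_image R) z"
then obtain a b where z: "z = fc a b" "a : cr R" "b : S" unfolding FL by(metis L_cases)
have bc: "b : cr R" "b ~= \<zero>" using z(3) by(auto simp: S_def)
have zc: "z : cr L" using z by simp
have powS: "s [^] (k::nat) : S" if "s : S" for s k
 using that by(induction k) (auto simp: S1 Sm)
have zpow: "z [^]\<^bsub>L\<^esub> (k::nat) = fc (a [^] k) (b [^] k)" for k
 by(induction k) (use z bc powS in "auto simp: one_L mult_L")
obtain m c where c: "!!i. i < m ==> c i : base_image R"
 "z [^]\<^bsub>L\<^esub> (m::nat) +.\<^bsub>L\<^esub> (\<Oplus>\<^bsub>L\<^esub>i\<in>{..<m}. c i *.\<^bsub>L\<^esub> z [^]\<^bsub>L\<^esub> i) = zL"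
 using int unfolding integral_over_def FL by blast
let ?d = "fc (b [^] m) \<one>"
have dc: "?d : cr L" using bc S1 by simp
have claim: "?d *.\<^bsub>L\<^esub> z [^]\<^bsub>L\<^esub> (k::nat) : base_image R" for k
proof(induction k rule: less_induct)
 case (less k)
 show ?case
 proof(cases "k < m")
  case True
  have "b [^] m = b [^] (m - k) *. b [^] k" using True bc by(simp add: nat_pow_mult)
  hence "b [^] m *. a [^] k = b [^] k *. (b [^] (m - k) *. a [^] k)" using bc z(2) by(simp add: m_ac)
  hence "?d *.\<^bsub>L\<^esub> z [^]\<^bsub>L\<^esub> k = fc (b [^] (m - k) *. a [^] k) \<one>"
   unfolding zpow using bc z powS S1 by(simp add: mult_L) (rule fc_eqI; simp)
  thus ?thesis using bc z by(auto simp: base)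
 next
  case False
  let ?w = "z [^]\<^bsub>L\<^esub> (k - m)"
  let ?s = "\<Oplus>\<^bsub>L\<^esub>i\<in>{..<m}. c i *.\<^bsub>L\<^esub> z [^]\<^bsub>L\<^esub> i"
  have cc: "c i : cr L" if "i < m" for i using c(1)[OF that] b_carr by blast
  have sc: "?s : cr L" by(rule L.finsum_closed) (use cc zc in auto)
  have "\<ominus>\<^bsub>L\<^esub> ?s = z [^]\<^bsub>L\<^esub> m" by(rule L.minus_equality) (use c(2) sc zc in auto)
  moreover have "z [^]\<^bsub>L\<^esub> k = z [^]\<^bsub>L\<^esub> m *.\<^bsub>L\<^esub> ?w" using False zc by(simp add: L.nat_pow_mult)
  ultimately have "?d *.\<^bsub>L\<^esub> z [^]\<^bsub>L\<^esub> k = \<ominus>\<^bsub>L\<^esub> (?s *.\<^bsub>L\<^esub> (?d *.\<^bsub>L\<^esub> ?w))"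
   using sc dc zc by(simp add: L.l_minus L.r_minus L.m_lcomm flip: \<open>\<ominus>\<^bsub>L\<^esub> ?s = z [^]\<^bsub>L\<^esub> m\<close>)
  also have "?s *.\<^bsub>L\<^esub> (?d *.\<^bsub>L\<^esub> ?w) = (\<Oplus>\<^bsub>L\<^esub>i\<in>{..<m}. (c i *.\<^bsub>L\<^esub> z [^]\<^bsub>L\<^esub> i) *.\<^bsub>L\<^esub> (?d *.\<^bsub>L\<^esub> ?w))"
   by(rule L.finsum_ldistr) (use cc zc dc in auto)
  also have "... = (\<Oplus>\<^bsub>L\<^esub>i\<in>{..<m}. c i *.\<^bsub>L\<^esub> (?d *.\<^bsub>L\<^esub> z [^]\<^bsub>L\<^esub> (i + (k - m))))"
   by(rule L.finsum_cong') (use cc zc dc in "auto simp: L.m_ac simp flip: L.nat_pow_mult")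
  also have "... : base_image R" by(rule b_sum) (use False in "auto intro!: b_mult[OF c(1) less.IH]")
  hence "\<ominus>\<^bsub>L\<^esub> (\<Oplus>\<^bsub>L\<^esub>i\<in>{..<m}. c i *.\<^bsub>L\<^esub> (?d *.\<^bsub>L\<^esub> z [^]\<^bsub>L\<^esub> (i + (k - m)))) : base_image R" by(rule b_neg)
  finally show ?thesis .
 qed
qed
have bm: "b [^] m : cr R - {\<zero>}" using powS[OF z(3)] by(simp add: S_def)
have pq: "EX q:cr R. b [^] m *. a [^] k = b [^] k *. q" for k :: nat
proof -
 obtain q where q: "q : cr R" "?d *.\<^bsub>L\<^esub> z [^]\<^bsub>L\<^esub> k = fc q \<one>" using claim[of k] by(auto simp: base)
 have "fc (b [^] m *. a [^] k) (b [^] k) = fc q \<one>" using q(2) unfolding zpow using bc z powS S1 by(simp add: mult_L)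
 then obtain u where u: "u : S" "u *. \<one> *. (b [^] m *. a [^] k) = u *. b [^] k *. q"
  using fc_eq[of "b [^] m *. a [^] k" "b [^] k" q \<one>] q bc z powS S1 by auto
 have uc: "u : cr R" "u ~= \<zero>" using u by(auto simp: S_def)
 have "u *. (b [^] m *. a [^] k) = u *. (b [^] k *. q)" using u(2) uc q bc z by(simp add: m_assoc)
 hence "b [^] m *. a [^] k = b [^] k *. q" using m_lcancel[OF uc(2) uc(1)] q bc z by simp
 thus ?thesis using q by blast
qed
have b0: "b : cr R - {\<zero>}" using bc by simp
have "EX q:cr R. a = b *. q" by(rule cic[OF z(2) b0 bm pq])
then obtain q where q: "q : cr R" "a = b *. q" by(rule bexE)
have "fc a b = fc q \<one>" by(rule fc_eqI) (use q z(2,3) bc S1 in simp_all)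
hence "z = fc q \<one>" unfolding z(1) .
thus "z : base_image R" using \<open>q : cr R\<close> by(auto simp: base)
qed
text \<open>The lattice Z^r, realized inside vectors without fixed length so that r can
  vary.\<close>

definition Vr :: "nat => vec set" where "Vr r = {u. keys u <= {..<r}}"
interpretation Vr: lattice_vec "Vr r" for r
proof unfold_locales
show "u + v : Vr r" if "u : Vr r" "v : Vr r" for u v
 using that order_trans[OF keys_add[of u v]] unfolding Vr_def by blast
qed (auto simp: Vr_def)

lemma Vr_expand: "u : Vr r ==> (SUM k<r. lk u k ** sng k 1) = u"
proof(rule pmI)
fix i assume "u : Vr r"
have "lk (SUM k<r. lk u k ** sng k 1) i = (SUM k<r. if k = i then lk u i else 0)"
 unfolding lk_sum by(rule sum.cong) (auto simp: lk_sng when_def)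
thus "lk (SUM k<r. lk u k ** sng k 1) i = lk u i"
 using \<open>u : Vr r\<close> by(auto simp: Vr_def ik subset_iff)
qed

lemma Vr_unimod: "EX A. Vr.unimod r A & card A = r"
proof -
have "Vr.unimod r ((%k. sng k 1) ` {..<r}) & card ((%k. sng k 1 :: vec) ` {..<r}) = r"
 using Vr.unimod_indexed(1,2)[of r "%k. sng k 1" r "%k u. lk u k", OF _ _ _ Vr_expand[symmetric]]
 by(auto simp: Vr_def lin_def lk_add lk_sng when_def)
thus ?thesis by blast
qed

lemma lookup_single_mult:
fixes f :: "('k::field) lau"
shows "lk (sng s c * f) z = c * lk f (z - s)"
proof(rule additive_eqI[where S = "%f. lk (sng s c * f) z" and T = "%f. c * lk f (z - s)"])
fix q a
show "lk (sng s c * sng q a) z = c * lk (sng q a) (z - s)"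
 by(auto simp: mult_single lk_sng when_def algebra_simps)
qed (simp_all add: distrib_left lk_add)

lemma single_power:
fixes c :: "'k::comm_ring_1"
shows "(sng v c :: 'k lau) ^ q = sng (int q ** v) (c ^ q)"
by(induction q) (auto simp: mult_single frag_cmul_distrib)

lemma CHAR_poly_mapping: "CHAR('a::comm_monoid_add \<Rightarrow>\<^sub>0 'k::comm_ring_1) = CHAR('k)"
proof(rule CHAR_eqI)
have o: "of_nat m = (sng 0 (of_nat m) :: 'a \<Rightarrow>\<^sub>0 'k)" for m by simp
show "of_nat CHAR('k) = (0 :: 'a \<Rightarrow>\<^sub>0 'k)" unfolding o by(simp del: single_of_nat)
fix m assume "of_nat m = (0 :: 'a \<Rightarrow>\<^sub>0 'k)"
hence "(of_nat m :: 'k) = 0" unfolding o by(metis lookup_single_eq lookup_zero)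
thus "CHAR('k) dvd m" by(simp add: of_nat_eq_0_iff_char_dvd)
qed

text \<open>Let k act on K as multiplication by its p^e-th power; by additivity of the Frobenius K
  becomes a vector space over itself. The assignment of 1 to the nonzero vector c0 extends to a
  linear functional.\<close>

lemma semilinear_functional:
fixes c0 :: "'k::field"
assumes p: "p = CHAR('k)" "p > 0" and c0: "c0 ~= 0"
shows "EX mm. (ALL x y. mm (x + y) = mm x + mm y) & (ALL k x. mm (k ^ p ^ e * x) = k * mm x) & mm c0 = (1::'k)"
proof -
let ?s = "%k x :: 'k. k ^ p ^ e * x"
have pr: "Factorial_Ring.prime CHAR('k)" using prime_CHAR_semidom[where ?'a = 'k] p by simp
have fd: "(x + y) ^ p ^ e = x ^ p ^ e + y ^ p ^ e" for x y :: 'k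
 by(rule freshmans_dream'[OF pr]) (simp add: p(1))
interpret s: vector_space ?s
 by unfold_locales (simp_all add: algebra_simps fd power_mult_distrib)
interpret t: vector_space "(*) :: 'k => 'k => 'k"
 by unfold_locales (simp_all add: algebra_simps)
interpret vp: vector_space_pair ?s "(*) :: 'k => 'k => 'k" by unfold_locales
have "s.independent {c0}" using c0 by(simp add: s.dependent_single)
from vp.linear_independent_extend[OF this, of "%_. 1"]
obtain g where g: "Vector_Spaces.linear ?s (*) g" "g c0 = 1" by auto
interpret g: Vector_Spaces.linear ?s "(*)" g by(rule g(1))
show ?thesis using g(2) g.add g.scale by blast
qed

text \<open>All lattice points of a full-dimensional rational cone: \<open>H\<close> cuts it out and
  m0 is an interior point.\<close>

locale sat_monoid = fg_monoid M Gs deg for M Gs deg +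
fixes r :: nat and H :: "(vec => int) set" and m0 :: vec
assumes M_def: "M = {u : Vr r. ALL h:H. 0 <= h u}" and H: "finite H" "h : H ==> lin h"
 and m0: "m0 : Vr r" "h : H ==> 0 < h m0"
begin

lemma M_V: "M <= Vr r" by(auto simp: M_def)

text \<open>For w = LE a - LE b the equations give h (LE c) + m h(w) >= 0 for all m, so h(w) >= 0
  and w lies in M. Cancel the leading term of a by t b: by the binomial theorem a - t b satisfies
  the same hypothesis, and its leading exponent has smaller rank.\<close>

theorem divides_of_powers:
fixes a b c :: "('k::field) lau"
assumes b: "b : KM M" "b ~= 0" and c: "c : KM M" "c ~= 0"
shows "a : KM M ==> (!!m. EX q:KM M. c * a ^ m = b ^ m * q) ==> EX q:KM M. a = b * q"
proof(induction "rnk (LE a)" arbitrary: a rule: less_induct)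
case less
note R = sbr_KM[where 'k = 'k]
show ?case
proof(cases "a = 0")
 case True
 thus ?thesis by(intro bexI[of _ 0]) auto
next
 case a: False
 have LEp: "LE (f ^ m) = int m ** LE f & f ^ m : KM M & f ^ m ~= 0" if "f : KM M" "f ~= 0" for f :: "'k lau" and m
 proof(induction m)
  case 0
  have "(1 :: 'k lau) ~= 0" by simp
  from LE(1)[OF this] have "LE (1 :: 'k lau) = 0" by simp
  thus ?case using sbr(2)[OF R] by simp
 next
  case (Suc m)
  thus ?case using LE_mult(1)[OF that, of "f ^ m"] that sbr(5)[OF R] by(simp add: frag_cmul_distrib)
 qed
 define w where "w = LE a - LE b"
 have wV: "w : Vr r" unfolding w_def by(intro Vr.V_diff) (use LE_M[OF less.prems(1) a] LE_M[OF b] M_V in auto)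
 have "0 <= h w" if h: "h : H" for h
 proof(rule nonneg_limit)
  show "infinite (UNIV :: nat set)" by simp
  fix m :: nat
  obtain q where q: "q : KM M" "c * a ^ m = b ^ m * q" using less.prems(2) by blast
  note am = LEp[OF less.prems(1) a, of m] and bm = LEp[OF b, of m]
  have "q ~= 0" using q(2) c(2) am by auto
  have "LE c + int m ** LE a = int m ** LE b + LE q"
   using LE_mult(1)[OF c, of "a ^ m"] LE_mult(1)[of "b ^ m" q] q am bm \<open>q ~= 0\<close> by simp
  hence "h (LE c) + int m * h (LE a) = int m * h (LE b) + h (LE q)"
   using H(2)[OF h] by(metis lin_add lin_sc)
  moreover have "0 <= h (LE q)" using LE_M[OF q(1) \<open>q ~= 0\<close>] h by(auto simp: M_def)
  ultimately show "0 <= int m * h w + h (LE c)" using H(2)[OF h] by(simp add: w_def lin_diff right_diff_distrib)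
 qed
 hence wM: "w : M" using wV by(simp add: M_def)
 have eq: "LE a = LE b + w" by(simp add: w_def)
 define t where "t = (sng w (lk a (LE a) / lk b (LE b)) :: 'k lau)"
 note LC = LE_cancel[OF less.prems(1) a b wM eq, folded t_def]
 have tM: "t : KM M" unfolding t_def using wM by(rule KM_sng)
 have "EX q:KM M. c * (a - t * b) ^ m = b ^ m * q" for m
 proof -
  obtain q where q: "!!i. q i : KM M" "!!i. c * a ^ i = b ^ i * q i" using less.prems(2) by metis
  have "c * (a - t * b) ^ m = (SUM k<=m. of_nat (m choose k) * (c * a ^ k) * (- (t * b)) ^ (m - k))"
   using binomial_ring[of a "- (t * b)" m] by(simp add: sum_distrib_left mult_ac)
  also have "... = (SUM k<=m. b ^ m * (of_nat (m choose k) * q k * (- t) ^ (m - k)))"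
  proof(rule sum.cong)
   fix k assume "k : {..m}"
   hence "b ^ m = b ^ k * b ^ (m - k)" by(simp flip: power_add)
   moreover have "(- (t * b)) ^ (m - k) = (- t) ^ (m - k) * b ^ (m - k)" by(simp flip: power_mult_distrib)
   ultimately show "of_nat (m choose k) * (c * a ^ k) * (- (t * b)) ^ (m - k) = b ^ m * (of_nat (m choose k) * q k * (- t) ^ (m - k))"
    unfolding q(2) by(simp add: mult_ac)
  qed simp
  also have "... = b ^ m * (SUM k<=m. of_nat (m choose k) * q k * (- t) ^ (m - k))" by(simp add: sum_distrib_left)
  finally have "c * (a - t * b) ^ m = b ^ m * (SUM k<=m. of_nat (m choose k) * q k * (- t) ^ (m - k))" .
  moreover have "of_nat j : (KM M :: 'k lau set)" for j by(induction j) (auto intro: sbr[OF R])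
  hence "(SUM k<=m. of_nat (m choose k) * q k * (- t) ^ (m - k)) : KM M"
   by(intro sbr_sum[OF R] sbr(5,7,3)[OF R] q(1) tM)
  ultimately show ?thesis by blast
 qed
 hence "EX q:KM M. a - t * b = b * q"
  using less.hyps[OF LC(2) LC(1)] by(cases "a - t * b = 0") (auto intro!: bexI[of _ 0])
 then obtain q where "q : KM M" "a = b * (q + t)" by(auto simp: algebra_simps)
 thus ?thesis using tM sbr(4)[OF R] by blast
qed
qed

theorem normal_KM:
fixes R :: "('a, 'b) ring_scheme" (structure) and h :: "('k::field) lau => 'a"
assumes "typed_ring R (KM M) h"
shows "domain R" "normal_domain R"
proof -
interpret typed_ring R "KM M" h by fact
show dom: "domain R"
proof(rule domainI[OF is_cring])
 have "h 1 ~= h 0" using h_inj[of 1 0] sbr(1,2)[OF D] by simp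
 thus "\<one> ~= \<zero>" by(simp add: h_1 h_0)
 fix a b assume ab: "a *. b = \<zero>" "a : cr R" "b : cr R"
 then obtain x y where xy: "x : KM M" "a = h x" "y : KM M" "b = h y" using h_surj by metis
 hence "h (x * y) = h 0" using ab by(simp add: h_mult h_0)
 hence "x * y = 0" using h_inj[of "x * y" 0] xy sbr[OF D] by blast
 thus "a = \<zero> | b = \<zero>" using xy h_0 by auto
qed
interpret domain R by(rule dom)
show "normal_domain R"
proof(rule normal_domainI)
 fix a b c assume abc: "a : cr R" "b : cr R - {\<zero>}" "c : cr R - {\<zero>}"
  and q: "!!m::nat. EX q:cr R. c *. a [^] m = b [^] m *. q"
 obtain x y z where xyz: "x : KM M" "a = h x" "y : KM M" "b = h y" "z : KM M" "c = h z"
  using h_surj[of a] h_surj[of b] h_surj[of c] abc by blast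
 have nz: "y ~= 0" "z ~= 0" using abc(2,3) xyz(4,6) h_0 by auto
 have "EX q:KM M. z * x ^ m = y ^ m * q" for m
 proof -
  obtain q where "q : cr R" "c *. a [^] m = b [^] m *. q" using q by blast
  moreover then obtain s where s: "s : KM M" "q = h s" using h_surj by blast
  ultimately have "h (z * x ^ m) = h (y ^ m * s)" using xyz by(simp add: h_mult h_pow sbr(7)[OF D])
  hence "z * x ^ m = y ^ m * s" by(rule iffD1[OF h_inj, rotated 2]) (use xyz s sbr(5,7)[OF D] in auto)
  thus ?thesis using s by blast
 qed
 from divides_of_powers[OF xyz(3) nz(1) xyz(5) nz(2) xyz(1) this]
 obtain s where "s : KM M" "x = y * s" by blast
 thus "EX q:cr R. a = b *. q" using xyz h_carr by(auto simp: h_mult intro!: bexI[of _ "h s"])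
qed
qed

section \<open>F-rationality\<close>

text \<open>A splitting of the Frobenius that sends a given \<open>c\<close> to \<open>1\<close>; saturation of \<open>M\<close> makes it preserve
  \<open>K[M]\<close> as soon as the Frobenius power exceeds the values of the facet functionals on one exponent of \<open>c\<close>.\<close>
lemma frobenius_splitting:
fixes c :: "('k::field) lau"
assumes p: "p = CHAR('k)" "p > 0" and c: "c : KM M" "c ~= 0"
shows "EX E. ALL e>=E. EX La. (ALL f g. La (f + g) = La f + La g) & (ALL f:KM M. La f : KM M) &
 (ALL f g. La (g ^ p ^ e * f) = g * La f) & La c = (1 :: 'k lau)"
proof -
obtain a0 where a0: "a0 : keys c" using LE(1)[OF c(2)] by blast
have a0M: "a0 : M" using a0 c(1) by(auto simp: KM_def)
\<comment> \<open>Two requirements on q > Bd. The first sum gives h a0 < q, so that 0 <= h a0 + q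
  h(w) forces h(w) >= 0; the second keeps the points a0 + q w with w nonzero out of the support of
  c.\<close>
define Bd where "Bd = (SUM h:H. abs(h a0)) + (SUM v:keys c. SUM i:keys (v - a0). abs(lk (v - a0) i))"
have pr: "Factorial_Ring.prime CHAR('k)" using prime_CHAR_semidom[where ?'a = 'k] p by simp
hence p2: "p >= 2" using p(1) prime_ge_2_nat by blast
show ?thesis
proof(rule exI[of _ "nat Bd"], intro allI impI)
 fix e assume e: "e >= nat Bd"
 define q where "q = p ^ e"
 have "e < p ^ e" using p2 by(intro power_gt_expt) simp
 hence qB: "int q > Bd" using e unfolding q_def by linarith
 have q0: "q > 0" using p(2) by(simp add: q_def)
 have "lk c a0 ~= 0" using a0 by(simp add: ik)
 then obtain mm where mm: "!!x y. mm (x + y) = mm x + mm y" "!!k x. mm (k ^ q * x) = k * mm x" "mm (lk c a0) = (1::'k)"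
  using semilinear_functional[OF p, of "lk c a0" e] unfolding q_def by blast
 have mm0: "mm 0 = 0" using mm(2)[of 0 0] by simp
 \<comment> \<open>Reads off the coefficients on the coset of a0 modulo q and takes their q-th roots
   by means of \<open>mm\<close>.\<close>
 define La where "La f = Abs_poly_mapping (%w. mm (lk f (a0 + int q ** w)))" for f :: "'k lau"
 have inj: "inj (%w. a0 + int q ** w)"
 proof(rule injI)
  fix w w' assume "a0 + int q ** w = a0 + int q ** w'"
  hence "int q ** w = int q ** w'" by simp
  hence "lk (int q ** w) i = lk (int q ** w') i" for i by simp
  thus "w = w'" using q0 by(intro pmI) simp
 qed
 have L: "lk (La f) w = mm (lk f (a0 + int q ** w))" for f w
 proof -
  have "finite ((%w. a0 + int q ** w) -` keys f)" by(rule finite_vimageI[OF finite_keys inj])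
  moreover have "{w. mm (lk f (a0 + int q ** w)) ~= 0} <= (%w. a0 + int q ** w) -` keys f"
   using mm0 by(auto simp: ik)
  ultimately have "finite {w. mm (lk f (a0 + int q ** w)) ~= 0}" by(rule finite_subset[rotated])
  thus ?thesis unfolding La_def by(subst lookup_Abs_poly_mapping) auto
 qed
 have add: "La (f + g) = La f + La g" for f g
  by(rule pmI) (simp add: L lk_add mm(1))
 have KMK: "La f : KM M" if f: "f : KM M" for f
  unfolding KM_def
 proof(intro CollectI subsetI)
  fix w assume "w : keys (La f)"
  hence "lk f (a0 + int q ** w) ~= 0" using L[of f w] mm0 by(auto simp: ik)
  hence z: "a0 + int q ** w : M" using f by(auto simp: KM_def ik subset_iff)
  have "keys w <= {..<r}"
  proof
   fix i assume i: "i : keys w"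
   show "i : {..<r}"
   proof(rule ccontr)
    assume "i ~: {..<r}"
    hence "lk (a0 + int q ** w) i = 0" "lk a0 i = 0" using z a0M M_V unfolding Vr_def ik subset_iff by auto
    thus False using i q0 by(simp add: lk_add ik)
   qed
  qed
  moreover have "0 <= h w" if h: "h : H" for h
  proof -
   have "abs(h a0) <= (SUM h:H. abs(h a0))" using h H(1) by(intro member_le_sum[of h H "%h. abs(h a0)"]) auto
   moreover have "0 <= (SUM v:keys c. SUM i:keys (v - a0). abs(lk (v - a0) i))" by(intro sum_nonneg) auto
   ultimately have "h a0 < int q" using qB unfolding Bd_def by linarith
   moreover have "0 <= h a0 + int q * h w" using z h H(2)[OF h] by(auto simp: M_def lin_add lin_sc)
   ultimately have "0 < int q * (1 + h w)" by(simp add: distrib_left)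
   thus ?thesis using q0 by(simp add: zero_less_mult_iff)
  qed
  ultimately show "w : M" by(simp add: M_def Vr_def)
 qed
 have sg: "La (sng (int q ** v) (k ^ q) * f) = sng v k * La f" for v k f
 proof(rule pmI)
  fix w
  have "a0 + int q ** w - int q ** v = a0 + int q ** (w - v)"
   by(rule pmI) (simp add: lk_add lk_diff right_diff_distrib)
  thus "lk (La (sng (int q ** v) (k ^ q) * f)) w = lk (sng v k * La f) w"
   by(simp only: L lookup_single_mult mm(2))
 qed
 have L0: "La 0 = 0" by(rule pmI) (simp add: L mm0)
 have Lsum: "La (sum F A) = (SUM x:A. La (F x))" for F and A :: "vec set"
  by(induction A rule: fin_ind) (simp_all add: add L0)
 have semi: "La (g ^ q * f) = g * La f" for f g
 proof -
  have prL: "Factorial_Ring.prime CHAR('k lau)" using pr by(simp add: CHAR_poly_mapping)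
  have "g ^ q = (SUM v:keys g. sng v (lk g v)) ^ q" by(simp add: sum_sng)
  also have "... = (SUM v:keys g. sng v (lk g v) ^ q)"
   by(rule freshmans_dream_sum'[OF prL]) (simp add: q_def p(1) CHAR_poly_mapping)
  finally have "g ^ q * f = (SUM v:keys g. sng (int q ** v) (lk g v ^ q) * f)"
   by(simp add: single_power sum_distrib_right)
  hence "La (g ^ q * f) = (SUM v:keys g. sng v (lk g v)) * La f"
   by(simp add: Lsum sg sum_distrib_right)
  thus ?thesis by(simp add: sum_sng)
 qed
 have "La c = 1"
 proof(rule pmI)
  fix w
  have "lk c (a0 + int q ** w) = 0" if w: "w ~= 0"
  proof(rule ccontr)
   assume nz: "lk c (a0 + int q ** w) ~= 0"
   let ?v = "a0 + int q ** w"
   obtain i where i: "lk w i ~= 0" using w by(metis lookup_zero pmI)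
   have vi: "lk (?v - a0) i = int q * lk w i" by(simp add: lk_diff lk_add)
   have "abs(lk (?v - a0) i) <= (SUM i:keys (?v - a0). abs(lk (?v - a0) i))"
    by(rule member_le_sum) (use vi i q0 in "auto simp: ik")
   also have "... <= (SUM v:keys c. SUM i:keys (v - a0). abs(lk (v - a0) i))"
    by(rule member_le_sum[of ?v "keys c" "%v. SUM i:keys (v - a0). abs(lk (v - a0) i)"])
     (use nz in "auto simp: ik intro!: sum_nonneg")
   also have "... <= Bd" unfolding Bd_def by(simp add: sum_nonneg)
   finally have "int q * abs(lk w i) < int q * 1" using qB vi by(simp add: abs_mult)
   thus False using i q0 by(simp add: mult_less_cancel_left)
  qed
  thus "lk (La c) w = lk 1 w" by(cases "w = 0") (auto simp: L mm(3) mm0 lookup_one when_def)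
 qed
 thus "EX La. (ALL f g. La (f + g) = La f + La g) & (ALL f:KM M. La f : KM M) &
   (ALL f g. La (g ^ p ^ e * f) = g * La f) & La c = (1 :: 'k lau)"
  using add KMK semi unfolding q_def by blast
qed
qed

theorem F_rational_KM:
fixes R :: "('a, 'b) ring_scheme" (structure) and h :: "('k::field) lau => 'a"
assumes "typed_ring R (KM M) h" and p: "CHAR('k) > 0"
shows "F_rational CHAR('k) R"
unfolding F_rational_def
proof(intro conjI allI impI)
interpret typed_ring R "KM M" h by fact
interpret domain R by(rule normal_KM(1)[OF assms(1)])
show "cring R" by(rule is_cring)
show "noetherian_ring R" by(rule noetherian[OF noeth_KM])
show "Factorial_Ring.prime CHAR('k)" using prime_CHAR_semidom[where ?'a = 'k] p by simp
have on: "of_nat j : (KM M :: 'k lau set)" for j by(induction j) (auto intro: sbr[OF D])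
have "h (of_nat j) = add_pow R j \<one>" for j
 by(induction j) (simp_all add: h_0 h_add h_1 on sbr[OF D] add.nat_pow_Suc a_comm)
from this[of "CHAR('k)"] show "add_pow R CHAR('k) \<one> = \<zero>"
 using h_0 by(metis CHAR_poly_mapping of_nat_CHAR)
fix G assume G: "finite G & G <= cr R & enat (card G) = ideal_height R (Idl G)"
let ?J = "Idl G" and ?p = "CHAR('k)"
have J: "ideal ?J R" using G by(intro genideal_ideal) auto
have pJ: "ideal_in (KM M) (pre ?J)" by(rule pre_ideal[OF J])
have zp: "minimal_prime R {\<zero>}"
 unfolding minimal_prime_def
proof(intro conjI allI impI)
 show "primeideal {\<zero>} R" by(rule zeroprimeideal)
 fix Q assume "primeideal Q R & Q <= {\<zero>}"
 moreover hence "\<zero> : Q" using additive_subgroup.zero_closed ideal.axioms(1) primeideal.axioms(1) by metis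
 ultimately show "Q = {\<zero>}" by blast
qed
show "tight_closure ?p R ?J = ?J"
proof(intro equalityI subsetI)
 fix a assume "a : tight_closure ?p R ?J"
 then obtain c e0 where ac: "a : cr R" "c : cr R" "ALL P. minimal_prime R P --> c ~: P"
  "ALL e>=e0. c *. a [^] (?p ^ e) : frobenius_power ?p R ?J e" unfolding tight_closure_def by blast
 obtain x d where xd: "x : KM M" "a = h x" "d : KM M" "c = h d" using h_surj ac by metis
 have "d ~= 0" using ac(3) zp xd h_0 by auto
 obtain E where E: "ALL e>=E. EX La. (ALL f g. La (f + g) = La f + La g) & (ALL f:KM M. La f : KM M) &
  (ALL f g. La (g ^ ?p ^ e * f) = g * La f) & La d = (1 :: 'k lau)"
  using frobenius_splitting[OF refl p xd(3) \<open>d ~= 0\<close>] by blast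
 define e where "e = max e0 E"
 obtain La where La: "!!f g. La (f + g) = La f + La g" "!!f. f : KM M ==> La f : KM M"
  "!!f g. La (g ^ ?p ^ e * f) = g * La f" "La d = (1 :: 'k lau)"
  using E[rule_format, of e] by(auto simp: e_def)
 \<comment> \<open>This ideal contains the q-th powers of elements of the given ideal, because
   \<open>La\<close> pulls out q-th powers. Hence it contains the Frobenius power, in particular d
   x^q, and \<open>La d = 1\<close> turns this into membership of x.\<close>
 define K where "K = {y : KM M. ALL s:KM M. La (y * s) : pre ?J}"
 have K: "ideal_in (KM M) K"
  unfolding ideal_in_def
 proof(intro conjI ballI)
  have "La 0 = 0" using La(3)[of 0 0] by simp
  thus "0 : K" using pJ sbr(1)[OF D] by(auto simp: K_def ideal_in_def)
  show "y + z : K" if "y : K" "z : K" for y z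
   using that pJ sbr(4)[OF D] by(auto simp: K_def ideal_in_def distrib_right La(1))
  show "t * y : K" if "y : K" "t : KM M" for y t
   using that sbr(5)[OF D] unfolding K_def by(auto simp: mult.assoc mult.left_commute[of t y])
 qed (auto simp: K_def)
 have "(%a. a [^] (?p ^ e)) ` ?J <= h ` K"
 proof
  fix b assume "b : (%a. a [^] (?p ^ e)) ` ?J"
  then obtain j where j: "j : ?J" "b = j [^] (?p ^ e)" by blast
  then obtain y where y: "y : pre ?J" "j = h y" using h_pre[OF J] by blast
  hence yM: "y : KM M" by(auto simp: pre_def)
  have "y ^ ?p ^ e : K"
   unfolding K_def using La(2,3) y(1) pJ sbr(7)[OF D yM] unfolding ideal_in_def by(auto simp: mult.commute[of y])
  moreover have "b = h (y ^ ?p ^ e)" using j(2) y(2) h_pow[OF yM, of "?p ^ e"] by simp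
  ultimately show "b : h ` K" by blast
 qed
 hence "frobenius_power ?p R ?J e <= h ` K"
  unfolding frobenius_power_def by(rule genideal_minimal[OF image_ideal[OF K]])
 moreover have "c *. a [^] (?p ^ e) : frobenius_power ?p R ?J e" using ac(4) by(simp add: e_def)
 moreover have "c *. a [^] (?p ^ e) = h (d * x ^ ?p ^ e)" using xd sbr(7)[OF D] by(simp add: h_mult h_pow)
 ultimately have "h (d * x ^ ?p ^ e) : h ` K" by auto
 then obtain y where y: "y : K" "h (d * x ^ ?p ^ e) = h y" by blast
 have "d * x ^ ?p ^ e = y" by(rule iffD1[OF h_inj y(2)]) (use xd sbr(5,7)[OF D] y(1) in "auto simp: K_def")
 hence "d * x ^ ?p ^ e : K" using y(1) by simp
 hence "La (d * x ^ ?p ^ e * 1) : pre ?J" using sbr(2)[OF D] unfolding K_def by blast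
 hence "x : pre ?J" using La(3)[of x d] La(4) by(simp add: mult.commute)
 thus "a : ?J" using xd by(simp add: pre_def)
next
 fix a assume a: "a : ?J"
 hence aR: "a : cr R" using ideal.Icarr[OF J] by blast
 have "\<one> ~: P" if "minimal_prime R P" for P
  using that primeideal.I_notcarr ideal.one_imp_carrier primeideal.axioms(1) unfolding minimal_prime_def by metis
 moreover have "\<one> *. a [^] (?p ^ e) : frobenius_power ?p R ?J e" for e
 proof -
  have "(%a. a [^] (?p ^ e)) ` ?J <= cr R" using ideal.Icarr[OF J] by auto
  from genideal_self[OF this] show ?thesis using a aR unfolding frobenius_power_def by auto
 qed
 ultimately show "a : tight_closure ?p R ?J" unfolding tight_closure_def using aR by blast
qed
qed

section \<open>The Cohen--Macaulay property\<close>

theorem CM_KM: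
assumes "prm (KM M :: ('k::field) lau set) p"
shows "EX gs. cm_at (KM M) p gs"
proof -
obtain A where A: "Vr.unimod r A" "card A = r" using Vr_unimod by blast
have ex1: "EX Fa fi. Vr.fan r (card A) {u : Vr r. ALL h:H. 0 <= h u} Fa fi"
 by(rule Vr.region_fan[OF A(1) H(1)]) (use H(2) m0 in auto)
obtain Fa0 fi0 where F0: "Vr.fan r r M Fa0 fi0"
 using ex1 unfolding M_def A(2) by blast
obtain Fa fi1 col where F1: "Vr.fan r r M Fa fi1" and col: "!!A. A : Fa ==> bij_betw col A {..<r}"
 using Vr.barycentric_fan[OF F0] by blast
note f = Vr.fanD[OF F1]
have rayM: "s : M" if "s : Union Fa" for s using that f(2,4) Vr.ray_cone by blast
have ray0: "s ~= 0" if "s : Union Fa" for s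
proof -
 from that obtain B where B: "B : Fa" "s : B" by blast
 thus ?thesis using Vr.cf_ray[OF f(2)[OF B(1)] B(2,2)] lin_0[OF Vr.lin_cf[OF f(2)[OF B(1)] B(2)]] by auto
qed
have degpos: "0 < deg s" if "s : Union Fa" for s
proof -
 obtain c where c: "s = cmb c" using M_gen[OF rayM] \<open>s : Union Fa\<close> unfolding cmb_def by blast
 have "EX g:Gs. c g ~= 0"
 proof(rule ccontr)
  assume "~ (EX g:Gs. c g ~= 0)"
  hence "s = 0" unfolding c cmb_def by(intro sum.neutral) auto
  thus False using ray0[OF that] by simp
 qed
 then obtain g where g: "g : Gs" "c g ~= 0" by blast
 have "0 < int (c g) * deg g" using g deg(2) by simp
 also have "... <= deg s" unfolding c deg_cmb by(rule member_le_sum[OF g(1)]) (use Gs(1) deg(2) in "auto simp: less_imp_le")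
 finally show ?thesis .
qed
have finR: "finite (Union Fa)" using f(1,2) Vr.umfin by auto
\<comment> \<open>Adding a multiple of the linear function \<open>deg\<close> leaves all convexity
  gaps unchanged and makes the heights of the rays positive.\<close>
define N where "N = 1 + (SUM s:Union Fa. abs(fi1 s))"
define fi where "fi s = fi1 s + N * deg s" for s
have N: "abs(fi1 s) < N" if "s : Union Fa" for s
 using member_le_sum[OF that, of "%s. abs(fi1 s)"] finR by(simp add: N_def)
have pos: "0 < fi s" if "s : Union Fa" for s
proof -
 have "N * 1 <= N * deg s" using degpos[OF that] N[OF that] by(intro mult_left_mono) auto
 thus ?thesis using N[OF that] by(simp add: fi_def)
qed
have pl: "Vr.pl r fi A u = Vr.pl r fi1 A u + N * deg u" if "A : Fa" "u : Vr r" for A u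
 by(rule Vr.pl_unique[OF f(2)[OF that(1)] that(2)])
  (auto simp: fi_def Vr.pl_ray[OF f(2)[OF that(1)]] intro!: lin_plus lin_times deg(1) Vr.lin_pl f(2) that(1))
have F: "Vr.fan r r M Fa fi"
 unfolding Vr.fan_def
proof(intro conjI ballI)
 show "Vr.pl r fi A s < fi s" if "A : Fa" "s : Union Fa - A" for A s
  using pl[OF that(1), of s] f(5)[OF that(1), of s] that(2) rayM[of s] M_V by(auto simp: fi_def)
qed (use f in auto)
note f' = Vr.fanD[OF F]
obtain A0 where A0: "A0 : Fa" using f(6)[OF M_0] by blast
\<comment> \<open>The vector w has to separate the pieces of any two cones. Their difference is not
  zero, because a ray of A outside B lies strictly above the piece of B.\<close>
define Q where "Q = {(%u. Vr.pl r fi A u - Vr.pl r fi B u) | A B. A : Fa & B : Fa & A ~= B}"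
have "EX w:Vr.cone r A0. ALL q:Q. q w ~= 0"
proof(rule Vr.generic_vector[OF f(2)[OF A0]])
 have "Q <= (%(A, B). (%u. Vr.pl r fi A u - Vr.pl r fi B u)) ` (Fa \<times> Fa)" by(auto simp: Q_def)
 thus "finite Q" by(rule finite_subset) (use f(1) in auto)
 show "lin q" if "q : Q" for q using that unfolding Q_def by(auto intro!: lin_minus Vr.lin_pl f(2))
 fix q assume "q : Q"
 then obtain A B where AB: "q = (%u. Vr.pl r fi A u - Vr.pl r fi B u)" "A : Fa" "B : Fa" "A ~= B" by(auto simp: Q_def)
 have "~ A <= B" using card_subset_eq[OF Vr.umfin[OF f(2)[OF AB(3)]], of A] f(3) AB by auto
 then obtain s where s: "s : A" "s ~: B" by blast
 hence "s : Union Fa - B" using AB(2) by blast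
 hence "q s ~= 0" using f'(5)[OF AB(3), of s] Vr.pl_ray[OF f(2)[OF AB(2)] s(1), of fi] unfolding AB(1) by simp
 thus "EX u:Vr r. q u ~= 0" using s AB(2) f(2) Vr.um_sub by blast
qed
then obtain w where w: "w : Vr.cone r A0" "!!q. q : Q ==> q w ~= 0" by blast
interpret cf: colored_fan "Vr r" r M Fa fi col w
proof unfold_locales
 show "w : M" using w(1) f(4)[OF A0] by blast
 show "inj_on (%A. Vr.pl r fi A w) Fa"
 proof(rule inj_onI, rule ccontr)
  fix A B assume h: "A : Fa" "B : Fa" "Vr.pl r fi A w = Vr.pl r fi B w" "A ~= B"
  hence "(%u. Vr.pl r fi A u - Vr.pl r fi B u) : Q" by(auto simp: Q_def)
  from w(2)[OF this] show False using h(3) by simp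
 qed
qed (use F col pos M_add M_V in auto)
interpret fa: free_alg "KM M" r "cf.tht :: nat => 'k lau" cf.Bx mon by(rule cf.free_alg_KM[OF M_0])
show ?thesis by(rule fa.ex_cm_at[OF assms])
qed

theorem cohen_macaulay_KM:
fixes R :: "('a, 'b) ring_scheme" and h :: "('k::field) lau => 'a"
assumes "typed_ring R (KM M) h"
shows "cohen_macaulay_ring R"
by(rule typed_ring.cohen_macaulay[OF assms noeth_KM CM_KM])
end

section \<open>Charts of unimodular cones\<close>

text \<open>For a single unimodular cone the free basis is 1, so K[cone A] is a polynomial ring and
  its primes have regular sequences that generate locally. K[C] arises from it by inverting the rays
  in \<open>Z\<close>, and \<open>reg_at_local\<close> applies.\<close>

lemma (in lattice_vec) chart_data:
fixes p :: "('k::field) lau set"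
assumes A: "unimod A" "Z <= A" and C: "C = {u : V. ALL s:A - Z. 0 <= cf A s u}"
shows "nth_in (KM C :: 'k lau set)" "prm (KM C) p ==> EX gs. reg_at (KM C) p gs"
proof -
note fA = umfin[OF A(1)] and AV = um_sub[OF A(1)]
interpret cm: fg_monoid "cone A" A "%u. SUM s:A. cf A s u"
proof unfold_locales
 show "0 : cone A" unfolding cone_def using V_0 by(auto simp: lin_0[OF lin_cf[OF A(1)]])
 show "lin (%u. SUM s:A. cf A s u)" by(intro lin_Sum lin_cf A(1))
 show "0 < (SUM s:A. cf A s g)" if "g : A" for g using that fA by(simp add: cf_ray[OF A(1) _ that])
 show "EX c. u = (SUM g:A. int (c g) ** g)" if u: "u : cone A" for u
 proof(rule exI[of _ "%s. nat (cf A s u)"])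
  have "u = (SUM s:A. cf A s u ** s)" using cf_expand[OF A(1), of u] u by(simp add: cone_def)
  also have "... = (SUM s:A. int (nat (cf A s u)) ** s)" by(rule sum.cong) (use u in "auto simp: cone_def")
  finally show "u = ..." .
 qed
qed (use fA cone_add[OF A(1)] ray_cone[OF A(1)] in auto)
obtain col where "bij_betw col A {0..<card A}" using ex_bij_betw_finite_nat[OF fA] by blast
then interpret c: colored_fan V "card A" "cone A" "{A}" "%_. 1" col 0
 by unfold_locales (use A cm.M_0 cone_add in "auto simp: fan_def atLeast0LessThan cone_def")
note sA = cm.sbr_KM[where 'k = 'k]
interpret fa: free_alg "KM (cone A)" "card A" "c.tht :: nat => 'k lau" c.Bx mon by(rule c.free_alg_KM[OF cm.M_0])
\<comment> \<open>With heights 1 all \<open>nn\<close> are 1, and with w = 0 all \<open>eps\<close>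
  are 0, so the box contains only the origin.\<close>
have Bx: "c.Bx = {0}"
proof -
 have "u = 0" if "u : cone A" "ALL r:A. cf A r u < 1" for u
 proof -
  have "cf A r u = 0" if "r : A" for r using \<open>u : cone A\<close> \<open>ALL r:A. cf A r u < 1\<close> that by(force simp: cone_def)
  hence "(SUM r:A. cf A r u ** r) = 0" by(intro sum.neutral) simp
  thus ?thesis using cf_expand[OF A(1), of u] that(1) by(simp add: cone_def)
 qed
 moreover have "c.best u = A" if "u : cone A" for u using c.best(1)[OF that] by simp
 moreover have "c.eps A r = 0" if "r : A" for r by(simp add: c.eps_def lin_0[OF lin_cf[OF A(1) that]])
 ultimately show ?thesis unfolding c.Bx_def using cm.M_0 by(auto simp: c.nn_def lin_0[OF lin_cf[OF A(1)]])
qed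
have CA: "cone A <= C" by(auto simp: C cone_def)
have C0: "0 : C" using CA cm.M_0 by blast
have Cadd: "u + v : C" if "u : C" "v : C" for u v
 using that by(auto simp: C V_add lin_add[OF lin_cf[OF A(1)]])
have sC: "sbr (KM C :: 'k lau set)" by(rule sbr_KMI[OF C0 Cadd])
\<comment> \<open>The exponent of the product of the variables to be inverted; a large multiple of
  it moves any finite part of \<open>C\<close> into the cone.\<close>
define z where "z = sum id Z"
have zA: "z : cone A" unfolding z_def using A ray_cone[OF A(1)] by(auto intro!: cm.M_sum)
have cz: "cf A s z = (if s : Z then 1 else 0)" if s: "s : A" for s
proof -
 have "cf A s z = (SUM t:Z. if t = s then 1 else 0)"
  unfolding z_def using A(2) s by(subst lin_sum[OF lin_cf[OF A(1) s]]) (auto intro!: sum.cong simp: cf_ray[OF A(1) s])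
 thus ?thesis using finite_subset[OF A(2) fA] by simp
qed
have l: "is_local (KM (cone A) :: 'k lau set) (KM C)"
 unfolding is_local_def
proof(intro conjI ballI)
 show "KM (cone A) <= (KM C :: 'k lau set)" using CA by(auto simp: KM_def)
 fix x :: "'k lau" assume x: "x : KM C"
 define N where "N = (SUM v:keys x. SUM s:A. abs(cf A s v))"
 have N: "abs(cf A s v) <= N" if "v : keys x" "s : A" for v s
  using member_le_sum[of s A "%s. abs(cf A s v)"] member_le_sum[of v "keys x" "%v. SUM s:A. abs(cf A s v)"] that fA
  unfolding N_def by(force simp: sum_nonneg)
 have N0: "0 <= N" unfolding N_def by(simp add: sum_nonneg)
 have zV: "z : V" using zA by(simp add: cone_def)
 have "cf A s (- (N ** z)) = - (N * cf A s z)" if "s : A" for s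
  by(simp add: lin_neg[OF lin_cf[OF A(1) that]] lin_sc[OF lin_cf[OF A(1) that]])
 hence "mon (- (N ** z)) : (KM C :: 'k lau set)"
  by(intro KM_sng) (use zV cz in "auto simp: C intro: V_neg V_sc")
 moreover have "mon (N ** z) : (KM (cone A) :: 'k lau set)"
  using cm.M_sc[OF zA, of "nat N"] N0 by(intro KM_sng) simp
 moreover have "mon (N ** z) * x : KM (cone A)"
 proof -
  have "N ** z + v : cone A" if v: "v : keys x" for v
  proof -
   have vC: "v : V" "!!s. s : A - Z ==> 0 <= cf A s v" using x v by(auto simp: KM_def C)
   have "0 <= N * cf A s z + cf A s v" if "s : A" for s using cz[OF that] N[OF v that] vC(2)[of s] that by auto
   thus ?thesis unfolding cone_def using zV vC
    by(auto simp: lin_add[OF lin_cf[OF A(1)]] lin_sc[OF lin_cf[OF A(1)]] V_add V_sc)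
  qed
  moreover have "keys (mon (N ** z) * x) <= {N ** z + v | v. v : keys x}" using keys_mult[of "mon (N ** z)" x] by auto
  ultimately show ?thesis by(auto simp: KM_def)
 qed
 moreover have "mon (N ** z) * mon (- (N ** z)) = (1 :: 'k lau)"
  unfolding mult_single by(simp only: add.right_inverse mult_1 single_one)
 ultimately show "EX u:KM (cone A). EX v:KM C. u * v = 1 & u * x : KM (cone A)" by blast
qed
show "nth_in (KM C :: 'k lau set)" by(rule noeth_local[OF sA sC l cm.noeth_KM])
assume p: "prm (KM C) p"
have "prm (KM (cone A)) (p Int KM (cone A))" by(rule prm_contr[OF sA _ p]) (use l in "simp add: is_local_def")
then obtain gs where "reg_at (KM (cone A)) (p Int KM (cone A)) gs" using fa.ex_reg_at[OF _ Bx] by auto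
from reg_at_local[OF sA sC l p this] show "EX gs. reg_at (KM C) p gs" by blast
qed

section \<open>Cech cohomology of supported cochains\<close>
definition sg :: "nat set => nat => 'k::comm_ring_1" where "sg T i = (- 1) ^ card {j : T. j < i}"
text \<open>The augmented Cech differential: the empty set is an index as well, and on a one-element
  set the value at {} is returned.\<close>

definition cd :: "(nat set => 'k::comm_ring_1) => nat set => 'k" where
"cd c T = (SUM i:T. sg T i * c (T - {i}))"

lemma sg_insert: "finite T ==> k ~: T ==> sg (insert k T) i = (if k < i then - sg T i else sg T i)"
proof -
assume "finite T" "k ~: T"
moreover have "{j : insert k T. j < i} = (if k < i then insert k {j : T. j < i} else {j : T. j < i})" by auto
ultimately show ?thesis by(simp add: sg_def)
qed

lemma sg_remove: "finite T ==> k : T ==> sg (T - {k}) i = (if k < i then - sg T i else sg T i)"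
proof -
assume "finite T" "k : T"
hence "(sg T i :: 'a) = (if k < i then - sg (T - {k}) i else sg (T - {k}) i)"
 using sg_insert[of "T - {k}" k i] by(simp add: insert_absorb)
thus ?thesis by simp
qed

lemma sg_sq: "sg T i * (sg T i * x) = x"
by(simp add: sg_def flip: mult.assoc power_add mult_2)

text \<open>Exchanging the two omitted indices changes the sign, so the double sum equals its own
  negative and vanishes after division by 2.\<close>

lemma cd_cd:
assumes "(2::'k::field) ~= 0" "finite T"
shows "cd (cd c) T = (0::'k)"
proof -
let ?f = "%i j. sg T i * (sg (T - {i}) j * c (T - {i} - {j}))"
let ?P = "{(i, j). i : T & j : T - {i}}"
have P: "?P = (SIGMA i:T. T - {i})" by auto
have e: "cd (cd c) T = (SUM (i, j):?P. ?f i j)"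
 unfolding cd_def sum_distrib_left P by(subst sum.Sigma) (use assms(2) in auto)
also have "... = (SUM (i, j):?P. ?f j i)"
 by(rule sum.reindex_bij_witness[of _ "%(i, j). (j, i)" "%(i, j). (j, i)"]) auto
also have "... = - (SUM (i, j):?P. ?f i j)"
 unfolding sum_negf[symmetric]
proof(rule sum.cong[OF refl])
 fix x assume "x : ?P"
 then obtain i j where ij: "x = (i, j)" "i : T" "j : T" "j ~= i" by auto
 hence "T - {i} - {j} = T - {i, j}" "T - {j} - {i} = T - {i, j}" "i < j | j < i" by auto
 thus "(case x of (i, j) => ?f j i) = - (case x of (i, j) => ?f i j)"
  using assms(2) ij by(auto simp: sg_remove mult.left_commute)
qed
finally have "cd (cd c) T = - cd (cd c) T" unfolding e[symmetric] .
hence "2 * cd (cd c) T = 0" unfolding mult_2 by(metis add.right_inverse)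
thus ?thesis using assms(1) by simp
qed
text \<open>Exactness of the augmented complex of cochains supported on \<open>E\<close>. For a
  fixed exponent u the family \<open>E\<close> will collect the T whose cone contains u.\<close>

definition acyc :: "'k::field itself => nat set => nat set set => bool" where
"acyc _ I E <-> (ALL c :: nat set => 'k. (ALL T. c T ~= 0 --> T : E) & (ALL T<=I. cd c T = 0) -->
 (EX b. (ALL T. b T ~= 0 --> T : E) & (ALL T<=I. c T = cd b T)))"

text \<open>Mayer--Vietoris. Primitives b1 and b2 of c with supports in E1 and E2 differ by some cd
  e on the union. With e split into its part e1 on E1 and the rest e2, the cochain b1 - cd e1 = b2 +
  cd e2 is supported on both families and is a primitive of c.\<close>

lemma acyc_Int:
assumes two: "(2::'k::field) ~= 0" and I: "finite I" and sub: "E1 <= Pow I" "E2 <= Pow I"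
 and up: "!!S T. S : E1 ==> S <= T ==> T <= I ==> T : E1" "!!S T. S : E2 ==> S <= T ==> T <= I ==> T : E2"
 and a: "acyc TYPE('k) I E1" "acyc TYPE('k) I E2" "acyc TYPE('k) I (E1 Un E2)"
shows "acyc TYPE('k) I (E1 Int E2)"
unfolding acyc_def
proof(intro allI impI, elim conjE)
fix c :: "nat set => 'k" assume c: "ALL T. c T ~= 0 --> T : E1 Int E2" "ALL T<=I. cd c T = 0"
obtain b1 where b1: "ALL T. b1 T ~= 0 --> T : E1" "ALL T<=I. c T = cd b1 T"
 using a(1)[unfolded acyc_def, rule_format, of c] c by auto
obtain b2 where b2: "ALL T. b2 T ~= 0 --> T : E2" "ALL T<=I. c T = cd b2 T"
 using a(2)[unfolded acyc_def, rule_format, of c] c by auto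
have "cd (%T. b1 T - b2 T) T = 0" if "T <= I" for T
 using b1(2) b2(2) that by(simp add: cd_def right_diff_distrib sum_subtractf)
moreover have "ALL T. b1 T - b2 T ~= 0 --> T : E1 Un E2" using b1(1) b2(1) by(metis UnCI diff_self)
ultimately obtain e where e: "ALL T. e T ~= 0 --> T : E1 Un E2" "ALL T<=I. b1 T - b2 T = cd e T"
 using a(3)[unfolded acyc_def, rule_format, of "%T. b1 T - b2 T"] by auto
define e1 where "e1 T = (if T : E1 then e T else 0)" for T
define e2 where "e2 T = (if T : E1 then 0 else e T)" for T
have ee: "cd e T = cd e1 T + cd e2 T" for T
 unfolding cd_def sum.distrib[symmetric] by(rule sum.cong) (auto simp: e1_def e2_def)
have supp: "cd f T = 0" if f: "!!T. f T ~= 0 ==> T : E" and E: "T <= I" "T ~: E"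
 "!!S. S : E ==> S <= T ==> T : E" for f :: "nat set => 'k" and T E
 unfolding cd_def
proof(rule sum.neutral, rule ballI)
 fix i
 have "f (T - {i}) = 0" using f[of "T - {i}"] E(3)[of "T - {i}"] E(2) by blast
 thus "sg T i * f (T - {i}) = 0" by simp
qed
define b where "b T = (if T <= I then b1 T - cd e1 T else 0)" for T
have b': "b T = b2 T + cd e2 T" if "T <= I" for T
proof -
 have "b1 T - b2 T = cd e1 T + cd e2 T" using e(2) ee[of T] that by simp
 thus ?thesis using that by(simp add: b_def algebra_simps)
qed
have "T : E1 Int E2" if "b T ~= 0" for T
proof -
 have T: "T <= I" using that by(auto simp: b_def split: if_splits)
 have "T : E1"
 proof(rule ccontr)
  assume n: "T ~: E1"
  have "cd e1 T = 0" by(rule supp[OF _ T n]) (use n T up(1) in "auto simp: e1_def split: if_splits")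
  thus False using b1(1) n T \<open>b T ~= 0\<close> by(auto simp: b_def)
 qed
 moreover have "T : E2"
 proof(rule ccontr)
  assume n: "T ~: E2"
  have "cd e2 T = 0" by(rule supp[OF _ T n]) (use n T up(2) e(1) in "auto simp: e2_def split: if_splits")
  thus False using b2(1) n b'[OF T] \<open>b T ~= 0\<close> by auto
 qed
 ultimately show ?thesis by blast
qed
moreover have "c T = cd b T" if "T <= I" for T
proof -
 have "cd b T = cd b1 T - cd (cd e1) T"
  unfolding cd_def[of b] cd_def[of b1] cd_def[of "cd e1"] sum_subtractf[symmetric]
  by(rule sum.cong) (use that in "auto simp: b_def right_diff_distrib")
 thus ?thesis using b1(2) that cd_cd[OF two, of T e1] finite_subset[OF that I] by simp
qed
ultimately show "EX b. (ALL T. b T ~= 0 --> T : E1 Int E2) & (ALL T<=I. c T = cd b T)" by blast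
qed

text \<open>Adding i0 to the index set is a contracting homotopy. The condition on \<open>E\<close>
  keeps the supports inside \<open>E\<close>.\<close>

lemma acyc_cone:
assumes I: "finite I" "i0 : I" and E: "!!T. insert i0 T : E ==> T : E"
shows "acyc TYPE('k::field) I E"
unfolding acyc_def
proof(intro allI impI, elim conjE)
fix c :: "nat set => 'k" assume c: "ALL T. c T ~= 0 --> T : E" "ALL T<=I. cd c T = 0"
define b where "b T = (if i0 : T then 0 else sg T i0 * c (insert i0 T))" for T
have "c T = cd b T" if T: "T <= I" for T
proof(cases "i0 : T")
 case True
 have fT: "finite T" using T I finite_subset by blast
 have "cd b T = (SUM i:T. if i = i0 then c T else 0)"
  unfolding cd_def by(rule sum.cong) (use True fT in "auto simp: b_def insert_absorb sg_remove sg_sq")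
 thus ?thesis using True fT by simp
next
 case False
 have fT: "finite T" using T I finite_subset by blast
 have "cd c (insert i0 T) = 0" using c(2) T I(2) by simp
 hence "sg T i0 * c T + (SUM i:T. sg (insert i0 T) i * c (insert i0 T - {i})) = 0"
  unfolding cd_def using False fT by(subst (asm) sum.insert) (auto simp: sg_insert)
 hence "sg T i0 * (sg T i0 * c T + (SUM i:T. sg (insert i0 T) i * c (insert i0 T - {i}))) = 0" by simp
 hence "c T + (SUM i:T. sg T i0 * (sg (insert i0 T) i * c (insert i0 T - {i}))) = 0"
  by(simp add: distrib_left sg_sq sum_distrib_left)
 moreover have "(SUM i:T. sg T i0 * (sg (insert i0 T) i * c (insert i0 T - {i}))) = - cd b T"
  unfolding cd_def sum_negf[symmetric]
 proof(rule sum.cong[OF refl])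
  fix i assume i: "i : T"
  hence "insert i0 T - {i} = insert i0 (T - {i})" "i < i0 | i0 < i" using False by(auto, metis linorder_neqE_nat)
  thus "sg T i0 * (sg (insert i0 T) i * c (insert i0 T - {i})) = - (sg T i * b (T - {i}))"
   using i False fT by(auto simp: b_def sg_insert sg_remove mult.left_commute)
 qed
 ultimately show ?thesis by simp
qed
moreover have "T : E" if "b T ~= 0" for T using that c(1) E[of T] by(auto simp: b_def split: if_splits)
ultimately show "EX b. (ALL T. b T ~= 0 --> T : E) & (ALL T<=I. c T = cd b T)" by blast
qed

section \<open>Generated monoids and rational cones\<close>

inductive_set msp :: "vec set => vec set" for S where
msp_0: "0 : msp S"
| msp_step: "u : msp S ==> s : S ==> u + s : msp S"

lemma msp_add: "u : msp S ==> v : msp S ==> u + v : msp S"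
proof -
assume "v : msp S" "u : msp S"
thus ?thesis by(induction rule: msp.induct) (auto simp flip: add.assoc intro: msp_step)
qed

lemma msp_gen: "s : S ==> s : msp S"
using msp_step[OF msp_0] by fastforce

lemma msp_sc: "u : msp S ==> int k ** u : msp S"
by(induction k) (auto intro: msp_0 msp_add simp: frag_cmul_distrib)

lemma msp_least: "S <= C ==> 0 : C ==> (!!u v. u : C ==> v : C ==> u + v : C) ==> msp S <= C"
proof
fix u assume "S <= C" "0 : C" "!!u v. u : C ==> v : C ==> u + v : C" "u : msp S"
from this(4,1-3) show "u : C" by(induction rule: msp.induct) auto
qed

lemma msp_sub: "S <= msp S' ==> msp S <= msp S'"
by(rule msp_least) (auto intro: msp_0 msp_add)

lemma msp_insert: "u : msp (insert g S) ==> EX v n. v : msp S & u = v + int n ** g"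
proof(induction rule: msp.induct)
case msp_0
thus ?case using msp.msp_0 by(intro exI[of _ 0]) auto
next
case (msp_step u s)
then obtain v n where v: "v : msp S" "u = v + int n ** g" by blast
show ?case
proof(cases "s = g")
 case True
 thus ?thesis using v by(intro exI[of _ v] exI[of _ "Suc n"]) (simp add: frag_cmul_distrib)
next
 case False
 thus ?thesis using v msp_step(2) msp.msp_step[OF v(1)]
  by(intro exI[of _ "v + s"] exI[of _ n]) (auto simp: add_ac)
qed
qed

lemma sc_minus: "c ** (- x) = (- c) ** x" by(rule pmI) simp

text \<open>Rational cones, as saturations of monoids.\<close>
definition rc :: "vec set => vec set" where "rc S = {u. EX k>0. int k ** u : msp S}"

lemma rc_mono: "S <= msp S' ==> rc S <= rc S'"
using msp_sub[of S S'] unfolding rc_def by blast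

text \<open>From k u = a + n g and l u = b - m g the combination (m k + n l) u = m a + n b is free
  of g. If m = 0 the second equation is free of g already.\<close>

lemma rc_Int: "rc (insert g S) Int rc (insert (- g) S) = rc S"
proof(intro equalityI subsetI)
fix u assume u: "u : rc (insert g S) Int rc (insert (- g) S)"
then obtain k l where "0 < k" "0 < l" "int k ** u : msp (insert g S)" "int l ** u : msp (insert (- g) S)"
 unfolding rc_def by blast
moreover then obtain a n b m where ab: "a : msp S" "b : msp S" "int k ** u = a + int n ** g" "int l ** u = b + int m ** (- g)"
 using msp_insert by metis
moreover have "int (m * k + n * l) ** u = int m ** (int k ** u) + int n ** (int l ** u)"
 by(simp add: frag_cmul_distrib)
moreover have "... = int m ** a + int n ** b"
 unfolding ab(3,4) by(rule pmI) (simp add: lk_add algebra_simps)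
ultimately have "int (m * k + n * l) ** u : msp S" using msp_add[OF msp_sc msp_sc] by simp
thus "u : rc S"
proof(cases "m = 0")
 case True
 thus ?thesis unfolding rc_def using ab(2,4) \<open>0 < l\<close> by auto
next
 case False
 hence "0 < m * k + n * l" using \<open>0 < k\<close> by simp
 thus ?thesis unfolding rc_def using \<open>int (m * k + n * l) ** u : msp S\<close> by blast
qed
qed (use rc_mono[of S "insert g S"] rc_mono[of S "insert (- g) S"] msp_gen in blast)

text \<open>A multiple of u involves g with net coefficient n - m, and the sign of this number
  selects the half.\<close>

lemma rc_Un: "rc (insert g (insert (- g) S)) = rc (insert g S) Un rc (insert (- g) S)"
proof(intro equalityI subsetI)
fix u assume "u : rc (insert g (insert (- g) S))"
then obtain k where k: "0 < k" "int k ** u : msp (insert g (insert (- g) S))" unfolding rc_def by blast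
then obtain v n where v: "v : msp (insert (- g) S)" "int k ** u = v + int n ** g" using msp_insert by blast
then obtain w m where w: "w : msp S" "v = w + int m ** (- g)" using msp_insert by blast
have sub: "msp S <= msp (insert h S)" for h by(rule msp_sub) (use msp_gen in blast)
have e: "int k ** u = w + (int n - int m) ** g" unfolding v(2) w(2) by(simp add: frag_cmul_diff_distrib sc_minus)
show "u : rc (insert g S) Un rc (insert (- g) S)"
proof(cases "m <= n")
 case True
 have "int k ** u : msp (insert g S)"
  unfolding e using msp_add[OF subsetD[OF sub w(1)] msp_sc[OF msp_gen[of g "insert g S"], of "n - m"]] True by(simp add: of_nat_diff)
 thus ?thesis using k(1) by(auto simp: rc_def)
next
 case False
 hence "(int n - int m) ** g = int (m - n) ** (- g)" by(simp add: of_nat_diff sc_minus)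
 hence "int k ** u : msp (insert (- g) S)"
  unfolding e using msp_add[OF subsetD[OF sub w(1)] msp_sc[OF msp_gen[of "- g" "insert (- g) S"], of "m - n"]] by simp
 thus ?thesis using k(1) by(auto simp: rc_def)
qed
next
fix u assume "u : rc (insert g S) Un rc (insert (- g) S)"
moreover have "rc (insert g S) <= rc (insert g (insert (- g) S))"
 by(rule rc_mono, rule subsetI, rule msp_gen) auto
moreover have "rc (insert (- g) S) <= rc (insert g (insert (- g) S))"
 by(rule rc_mono, rule subsetI, rule msp_gen) auto
ultimately show "u : rc (insert g (insert (- g) S))" by blast
qed
text \<open>Exponents of the fractions f_k / f_i with i in T, which generate the chart T when the
  monomials with exponents m k are blown up.\<close>

definition df :: "nat set => (nat => vec) => nat set => vec set" where
"df I m T = {m k - m i | k i. k : I & i : T}"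

text \<open>The nerve argument: cutting by all hyperplanes \<open>m i = m j\<close> leaves pieces on which some \<open>m i\<close> is minimal.\<close>
lemma acyc_rc:
assumes two: "(2::'k::field) ~= 0" and I: "finite I" "I ~= {}" and Q: "finite Q"
shows "(!!i j. i : I ==> j : I ==> (i, j) ~: Q ==> m i - m j : S | m j - m i : S) ==>
 acyc TYPE('k) I {T. T <= I & u : rc (S Un df I m T)}"
using Q
proof(induction Q arbitrary: S rule: finite_induct)
case empty
have "EX i:J. ALL k:J. m k - m i : msp S" if "finite J" "J ~= {}" "J <= I" for J
 using that
proof(induction J rule: finite_ne_induct)
 case (singleton x)
 thus ?case by(simp add: msp_0)
next
 case (insert x F)
 then obtain i where i: "i : F" "ALL k:F. m k - m i : msp S" by auto
 have "m x - m i : msp S | m i - m x : msp S" using empty[of x i] i(1) insert.prems msp_gen by blast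
 moreover have "m k - m x : msp S" if "m i - m x : msp S" "k : F" for k
  using msp_add[OF _ that(1), of "m k - m i"] i(2) that(2) by simp
 ultimately show ?case using i msp_0 by(metis diff_self insert_iff)
qed
\<comment> \<open>With all hyperplanes decided, some m i0 is minimal. Adding i0 to T then
  contributes only generators that S already yields, so the family is closed under removing
  i0.\<close>
from this[OF I] obtain i0 where i0: "i0 : I" "ALL k:I. m k - m i0 : msp S" by auto
show ?case
proof(rule acyc_cone[OF I(1) i0(1)], clarify, intro conjI)
 fix T assume T: "insert i0 T <= I" "u : rc (S Un df I m (insert i0 T))"
 have "msp S <= msp (S Un df I m T)" by(rule msp_sub) (use msp_gen in blast)
 moreover have "df I m (insert i0 T) <= df I m T Un {m k - m i0 | k. k : I}" by(auto simp: df_def)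
 ultimately have "S Un df I m (insert i0 T) <= msp (S Un df I m T)" using i0(2) msp_gen[of _ "S Un df I m T"] by blast
 thus "u : rc (S Un df I m T)" using rc_mono T(2) by blast
qed auto
next
case (insert x Q)
obtain i j where x: "x = (i, j)" by(cases x)
\<comment> \<open>The hyperplane for g = m i - m j: S is recovered as the intersection of the halves
  with g and with -g, and their union is S with both. In all three the pair is decided.\<close>
let ?E = "%S. {T. T <= I & u : rc (S Un df I m T)}" and ?g = "m i - m j"
have h: "acyc TYPE('k) I (?E (insert ?g S))" "acyc TYPE('k) I (?E (insert (- ?g) S))"
 "acyc TYPE('k) I (?E (insert ?g (insert (- ?g) S)))"
 by(rule insert.IH; use insert.prems x in "metis insert_iff minus_diff_eq prod.inject")+
have "?E (insert ?g (insert (- ?g) S)) = ?E (insert ?g S) Un ?E (insert (- ?g) S)" using rc_Un[of ?g] by auto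
with h(3) have h3: "acyc TYPE('k) I (?E (insert ?g S) Un ?E (insert (- ?g) S))" by(simp only:)
have up: "T' : ?E R" if "T : ?E R" "T <= T'" "T' <= I" for R T T'
 using rc_mono[of "R Un df I m T" "R Un df I m T'"] msp_gen[of _ "R Un df I m T'"] that by(auto simp: df_def subset_iff)
have "acyc TYPE('k) I (?E (insert ?g S) Int ?E (insert (- ?g) S))"
 by(rule acyc_Int[OF two I(1) _ _ up up h(1,2) h3]) auto
moreover have "?E (insert ?g S) Int ?E (insert (- ?g) S) = ?E S" using rc_Int[of ?g] by auto
ultimately show ?case by(simp only:)
qed

lemma lookup_sg_mult: "lk (sg T i * f) u = sg T i * lk (f :: vec \<Rightarrow>\<^sub>0 'k::field) u"
proof -
have "(- 1) ^ n = (sng 0 ((- 1) ^ n) :: 'k lau)" for n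
 by(induction n) (simp_all add: single_uminus)
hence "(sg T i :: 'k lau) = sng 0 (sg T i)" by(simp add: sg_def)
thus ?thesis by(simp add: lookup_single_mult)
qed

text \<open>Each exponent u is handled separately by \<open>acyc_rc\<close>, and only the finitely
  many exponents of c are kept. The saturation hypothesis leads back from rational cones to monoids;
  q >= 1 keeps the index sets of the primitive nonempty.\<close>

lemma cech_KM:
fixes c :: "nat set => ('k::field) lau"
assumes two: "(2::'k) ~= 0" and I: "finite I" "I ~= {}" and q: "1 <= q"
 and sat: "!!T. T <= I ==> T ~= {} ==> rc (S Un df I m T) <= msp (S Un df I m T)"
 and c: "!!T. T <= I ==> card T = Suc q ==> c T : KM (msp (S Un df I m T))"
 and d: "!!T. T <= I ==> card T = q + 2 ==> cd c T = 0"
shows "EX b. (ALL T<=I. card T = q --> b T : KM (msp (S Un df I m T))) & (ALL T<=I. card T = q + 1 --> c T = cd b T)"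
proof -
have "EX b. (ALL T. b T ~= 0 --> T <= I & u : rc (S Un df I m T)) & (ALL T<=I. card T = q + 1 --> lk (c T) u = cd b T)" for u
proof -
 define cu where "cu T = (if T <= I & card T = q + 1 then lk (c T) u else 0)" for T
 have "u : rc (S Un df I m T)" if "cu T ~= 0" for T
  using that c[of T] unfolding cu_def rc_def KM_def by(auto simp: ik subset_iff split: if_splits intro!: exI[of _ 1])
 hence "ALL T. cu T ~= 0 --> T : {T. T <= I & u : rc (S Un df I m T)}" by(auto simp: cu_def split: if_splits)
 moreover have "cd cu T = 0" if T: "T <= I" for T
 proof(cases "card T = q + 2")
  case True
  hence "cd cu T = (SUM i:T. lk (sg T i * c (T - {i})) u)"
   unfolding cd_def lookup_sg_mult by(intro sum.cong) (use T in "auto simp: cu_def")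
  also have "... = lk (cd c T) u" by(simp add: cd_def lk_sum)
  finally show ?thesis using d[OF T True] by simp
 next
  case False
  have "cu (T - {i}) = 0" if "i : T" for i
   using False that finite_subset[OF T I(1)] card_Suc_Diff1[of T i] by(auto simp: cu_def)
  thus ?thesis unfolding cd_def by(intro sum.neutral) auto
 qed
 moreover have ac: "acyc TYPE('k) I {T. T <= I & u : rc (S Un df I m T)}"
  by(rule acyc_rc[OF two I, of "I \<times> I"]) (use I(1) in auto)
 ultimately have "EX b. (ALL T. b T ~= 0 --> T : {T. T <= I & u : rc (S Un df I m T)}) & (ALL T<=I. cu T = cd b T)"
  unfolding acyc_def by(elim allE[of _ cu] impE) simp_all
 thus ?thesis by(elim ex_forward) (auto simp: cu_def)
qed
then obtain b where b: "!!u T. b u T ~= 0 ==> T <= I & u : rc (S Un df I m T)"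
 "!!u T. T <= I ==> card T = q + 1 ==> lk (c T) u = cd (b u) T" by metis
define U where "U = (UN T:Pow I. keys (c T))"
have U: "finite U" using I(1) by(simp add: U_def)
define B where "B T = (SUM u:U. sng u (b u T))" for T
have lB: "lk (B T) u = (if u : U then b u T else 0)" for u T
proof -
 have "lk (B T) u = (SUM v:U. if v = u then b u T else 0)"
  unfolding B_def lk_sum by(rule sum.cong) (auto simp: lk_sng when_def)
 thus ?thesis using U by simp
qed
have "B T : KM (msp (S Un df I m T))" if "T <= I" "card T = q" for T
proof -
 have "rc (S Un df I m T) <= msp (S Un df I m T)" by(rule sat) (use that q in auto)
 thus ?thesis unfolding KM_def using b(1)[of _ T] by(auto simp: ik lB split: if_splits)
qed
moreover have "c T = cd B T" if T: "T <= I" "card T = q + 1" for T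
proof(rule pmI)
 fix u
 have "lk (cd B T) u = (SUM i:T. sg T i * (if u : U then b u (T - {i}) else 0))"
  by(simp add: cd_def lk_sum lookup_sg_mult lB)
 also have "... = (if u : U then cd (b u) T else 0)" by(simp add: cd_def)
 finally show "lk (c T) u = lk (cd B T) u" using b(2)[OF T, of u] T by(auto simp: U_def ik)
qed
ultimately show ?thesis by blast
qed

section \<open>A toric resolution\<close>
definition dot :: "nat => vec => vec => int" where "dot r u v = (SUM i<r. lk u i * lk v i)"
text \<open>The vector that represents a functional under the standard pairing, so that fans in the
  dual space are covered by the same theory.\<close>

definition vecof :: "nat => (vec => int) => vec" where
"vecof r k = (SUM i<r. k (sng i 1) ** sng i 1)"

lemma dot_commute: "dot r u v = dot r v u"
by(simp add: dot_def mult.commute)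

lemma lin_dot: "lin (dot r u)"
by(simp add: lin_def dot_def lk_add distrib_left sum.distrib)

lemma lin_dot2: "lin (%u. dot r u v)"
by(simp add: lin_def dot_def lk_add distrib_right sum.distrib)

lemma lk_vecof: "lk (vecof r k) j = (if j < r then k (sng j 1) else 0)"
proof -
have "lk (vecof r k) j = (SUM i<r. if i = j then k (sng j 1) else 0)"
 unfolding vecof_def lk_sum by(rule sum.cong) (auto simp: lk_sng when_def)
thus ?thesis by simp
qed

lemma vecof_Vr: "vecof r k : Vr r"
by(auto simp: Vr_def ik lk_vecof split: if_splits)

lemma dot_vecof: "lin k ==> v : Vr r ==> dot r (vecof r k) v = k v"
by(subst (2) Vr_expand[symmetric]) (simp_all add: lin_sum lin_sc dot_def lk_vecof mult.commute)

lemma Vr_eqI: "u : Vr r ==> v : Vr r ==> (!!w. w : Vr r ==> dot r u w = dot r v w) ==> u = v"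
proof(rule pmI)
fix i assume h: "u : Vr r" "v : Vr r" "!!w. w : Vr r ==> dot r u w = dot r v w"
have d: "dot r x (sng i 1) = lk x i" if "i < r" for x
proof -
 have "dot r x (sng i 1) = (SUM j<r. if j = i then lk x i else 0)"
  unfolding dot_def by(rule sum.cong) (auto simp: lk_sng when_def)
 thus ?thesis using that by simp
qed
show "lk u i = lk v i"
proof(cases "i < r")
 case True
 thus ?thesis using h(3)[of "sng i 1"] by(simp add: d Vr_def)
next
 case False
 hence "i ~: keys u" "i ~: keys v" using h(1,2) by(auto simp: Vr_def)
 thus ?thesis by(simp add: ik)
qed
qed
text \<open>The edge directions of the cone dual to that of W; they form a unimodular basis
  again.\<close>

definition dual :: "nat => vec set => vec => vec" where "dual r W s = vecof r (Vr.cf r W s)"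

lemma dual:
assumes W: "Vr.unimod r W" "card W = r"
shows "s : W ==> v : Vr r ==> dot r (dual r W s) v = Vr.cf r W s v"
 and "u : Vr r ==> (SUM s:W. dot r u s ** dual r W s) = u"
 and "Vr.unimod r (dual r W ` W)" and "s : W ==> u : Vr r ==> Vr.cf r (dual r W ` W) (dual r W s) u = dot r u s"
 and "inj_on (dual r W) W"
proof -
note fX = Vr.umfin[OF W(1)] and XV = Vr.um_sub[OF W(1)]
have dV: "dual r W s : Vr r" for s unfolding dual_def by(rule vecof_Vr)
show d: "dot r (dual r W s) v = Vr.cf r W s v" if "s : W" "v : Vr r" for s v
 unfolding dual_def by(rule dot_vecof[OF Vr.lin_cf[OF W(1) that(1)] that(2)])
show ex: "(SUM s:W. dot r u s ** dual r W s) = u" if u: "u : Vr r" for u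
proof(rule Vr_eqI[of _ r])
 fix v assume v: "v : Vr r"
 have "dot r (SUM s:W. dot r u s ** dual r W s) v = (SUM s:W. Vr.cf r W s v * dot r u s)"
  unfolding lin_sum[OF lin_dot2] lin_sc[OF lin_dot2] by(rule sum.cong) (simp_all add: d[OF _ v])
 also have "... = dot r u v" by(rule Vr.lin_expand[OF W(1) v lin_dot, symmetric])
 finally show "dot r (SUM s:W. dot r u s ** dual r W s) v = dot r u v" .
qed (use u dV in "auto intro!: Vr.V_sum Vr.V_sc")
show "inj_on (dual r W) W"
proof(rule inj_onI)
 fix s t assume st: "s : W" "t : W" "dual r W s = dual r W t"
 hence "Vr.cf r W s s = Vr.cf r W t s" using d[of s s] d[of t s] XV by auto
 thus "s = t" using Vr.cf_ray[OF W(1) st(1,1)] Vr.cf_ray[OF W(1) st(2,1)] by(simp split: if_splits)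
qed
obtain x where x: "bij_betw x {..<r} W" using ex_bij_betw_nat_finite[OF fX] W(2) by(auto simp: atLeast0LessThan)
hence xX: "x k : W" if "k < r" for k using that by(auto simp: bij_betw_def)
have img: "(%k. dual r W (x k)) ` {..<r} = dual r W ` W" using x by(auto simp: bij_betw_def image_image[symmetric])
have e: "u = (SUM k<r. dot r u (x k) ** dual r W (x k))" if "u : Vr r" for u
 using ex[OF that] sum.reindex_bij_betw[OF x, of "%s. dot r u s ** dual r W s"] by simp
have D: "dot r (dual r W (x j)) (x k) = (if k = j then 1 else 0)" if "j < r" "k < r" for j k
proof -
 have "x k : Vr r" using XV xX[OF that(2)] by blast
 moreover have "x j = x k <-> k = j" using x that by(auto simp: bij_betw_def inj_on_def)
 ultimately show ?thesis using d[OF xX[OF that(1)]] Vr.cf_ray[OF W(1) xX[OF that(1)] xX[OF that(2)]] by simp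
qed
note U = Vr.unimod_indexed[of r "%k. dual r W (x k)" r "%k u. dot r u (x k)", OF dV lin_dot2 D e, unfolded img]
show "Vr.unimod r (dual r W ` W)" by(rule U(1)) auto
show "Vr.cf r (dual r W ` W) (dual r W s) u = dot r u s" if s: "s : W" and u: "u : Vr r" for s u
proof -
 obtain k where "k < r" "s = x k" using s x by(auto simp: bij_betw_def)
 thus ?thesis using U(3)[of k u] u by simp
qed
qed
context sat_monoid
begin

lemma Gs_V: "Gs <= Vr r" using Gs(2) M_V by blast

lemma msp_Gs: "msp Gs = M"
proof
show "msp Gs <= M" by(rule msp_least) (use Gs(2) M_0 M_add in auto)
show "M <= msp Gs"
proof
 fix u assume "u : M"
 then obtain c where u: "u = (SUM g:Gs. int (c g) ** g)" using M_gen by blast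
 have "(SUM g:A. int (c g) ** g) : msp Gs" if "A <= Gs" for A
  using that by(induction A rule: fin_ind) (auto intro: msp_0 msp_add msp_sc msp_gen)
 thus "u : msp Gs" by(simp add: u)
qed
qed

text \<open>A large multiple of the interior point m0 outweighs the finitely many values h
  f.\<close>

lemma ex_shift:
assumes "finite F" "F <= Vr r"
shows "EX b:Vr r. (%f. f + b) ` F <= M"
proof -
define K where "K = (SUM h:H. SUM f:F. abs(h f))"
have "0 <= h (f + K ** m0)" if hf: "h : H" "f : F" for h f
proof -
 have "abs(h f) <= (SUM f:F. abs(h f))" using hf assms(1) by(intro member_le_sum[of f F "%f. abs(h f)"]) auto
 also have "... <= K" unfolding K_def using hf H(1) by(intro member_le_sum[of h H "%h. SUM f:F. abs(h f)"]) (auto simp: sum_nonneg)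
 finally (order_trans) have "abs(h f) <= K" .
 moreover have "K * 1 <= K * h m0" using m0(2)[OF hf(1)] \<open>abs(h f) <= K\<close> by(intro mult_left_mono) auto
 ultimately show ?thesis by(simp add: lin_add[OF H(2)[OF hf(1)]] lin_sc[OF H(2)[OF hf(1)]])
qed
thus ?thesis using assms(2) m0(1) by(intro bexI[of _ "K ** m0"]) (auto simp: M_def Vr.V_add Vr.V_sc)
qed

text \<open>\<open>deg\<close> is positive on the generators of M and therefore represents an
  interior point of the dual cone.\<close>

lemma resolution_fan:
"EX Fa fi. Vr.fan r r {v : Vr r. ALL g:Gs. 0 <= dot r g v} Fa fi"
proof -
obtain A where A: "Vr.unimod r A" "card A = r" using Vr_unimod by blast
have "0 < dot r g (vecof r deg)" if "g : Gs" for g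
 using dot_vecof[OF deg(1), of g r] that Gs_V deg(2)[OF that] by(auto simp: dot_commute)
hence "EX Fa fi. Vr.fan r (card A) {v : Vr r. ALL h:dot r ` Gs. 0 <= h v} Fa fi"
 by(intro Vr.region_fan[OF A(1), of _ "vecof r deg"]) (use Gs(1) lin_dot vecof_Vr in auto)
thus ?thesis by(simp add: A(2))
qed

text \<open>\<open>m W\<close> runs over the vertices of a lattice polyhedron with normal fan \<open>Fa\<close>. Adding the lattice points
  \<open>m W + dual W s\<close> next to the vertices makes the charts saturated.\<close>
theorem resolution:
"EX F. finite F & F ~= {} & F <= M & (ALL f:F. EX A Z. Vr.unimod r A & Z <= A &
 msp (Gs Un {g - f | g. g : F}) = {u : Vr r. ALL s:A - Z. 0 <= Vr.cf r A s u})"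
proof -
let ?si = "{v : Vr r. ALL g:Gs. 0 <= dot r g v}"
obtain Fa fi where F: "Vr.fan r r ?si Fa fi" using resolution_fan by blast
note f = Vr.fanD[OF F]
note du = dual[OF f(2) f(3)]
have dV: "dual r W s : Vr r" for W s unfolding dual_def by(rule vecof_Vr)
have raycone: "s : ?si" if "W : Fa" "s : W" for W s using f(4)[OF that(1)] Vr.ray_cone[OF f(2)[OF that(1)] that(2)] by blast
\<comment> \<open>N bounds the coordinates of all rays in all cones, which keeps the added points
  inside the cones at the vertices, and it is at least 2, which gives bounded edges length at least
  2.\<close>
define N where "N = 2 + (SUM Y:Fa. SUM t:Y. SUM s:Union Fa. abs(Vr.cf r Y t s))"
have finR: "finite (Union Fa)" using f(1,2) Vr.umfin by auto
have N: "abs(Vr.cf r Y t s) <= N" if "Y : Fa" "t : Y" "s : Union Fa" for Y t s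
proof -
 have "abs(Vr.cf r Y t s) <= (SUM s:Union Fa. abs(Vr.cf r Y t s))" by(rule member_le_sum[OF that(3)]) (use finR in auto)
 also have "... <= (SUM t:Y. SUM s:Union Fa. abs(Vr.cf r Y t s))"
  by(rule member_le_sum[OF that(2), of "%t. SUM s:Union Fa. abs(Vr.cf r Y t s)"])
   (use Vr.umfin[OF f(2)[OF that(1)]] in "auto simp: sum_nonneg")
 also have "... <= (SUM Y:Fa. SUM t:Y. SUM s:Union Fa. abs(Vr.cf r Y t s))"
  by(rule member_le_sum[OF that(1), of "%Y. SUM t:Y. SUM s:Union Fa. abs(Vr.cf r Y t s)"]) (use f(1) in "auto simp: sum_nonneg")
 finally show ?thesis by(simp add: N_def)
qed
have N2: "2 <= N" unfolding N_def by(simp add: sum_nonneg)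
\<comment> \<open>The vertex at which the inequalities \<open>dot r u s >= - N * fi s\<close> become
  equalities for the rays s of W.\<close>
define m where "m W = (- N) ** vecof r (Vr.pl r fi W)" for W
have mV: "m W : Vr r" for W unfolding m_def by(intro Vr.V_sc vecof_Vr)
have md: "dot r (m W) v = - N * Vr.pl r fi W v" if "W : Fa" "v : Vr r" for W v
 unfolding m_def lin_sc[OF lin_dot2] by(simp add: dot_vecof[OF Vr.lin_pl[OF f(2)[OF that(1)]] that(2)])
have mdiff: "0 <= dot r (m Y - m W) s" "s ~: Y ==> N <= dot r (m Y - m W) s"
 if XY: "W : Fa" "Y : Fa" "s : W" for W Y s
proof -
 have sV: "s : Vr r" "s : Union Fa" using raycone[OF XY(1,3)] XY(1,3) by blast+
 have e: "dot r (m Y - m W) s = N * (fi s - Vr.pl r fi Y s)"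
  unfolding lin_diff[OF lin_dot2]
  by(simp add: md[OF XY(1) sV(1)] md[OF XY(2) sV(1)] Vr.pl_ray[OF f(2)[OF XY(1)] XY(3)] right_diff_distrib)
 show "0 <= dot r (m Y - m W) s" using f(7)[OF XY(2) sV(2)] N2 by(simp add: e)
 assume "s ~: Y"
 hence "1 <= fi s - Vr.pl r fi Y s" using f(5)[OF XY(2) sV(2)] by simp
 hence "N * 1 <= N * (fi s - Vr.pl r fi Y s)" using N2 by(intro mult_left_mono) auto
 thus "N <= dot r (m Y - m W) s" by(simp add: e)
qed
define F0 where "F0 = m ` Fa Un {m W + dual r W s | W s. W : Fa & s : W}"
let ?S = "%f0. Gs Un {g - f0 | g. g : F0}" and ?C = "%W Z. {u : Vr r. ALL s:W - Z. 0 <= dot r u s}"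
have F0e: "F0 = m ` Fa Un (UN W:Fa. (%s. m W + dual r W s) ` W)" by(auto simp: F0_def)
have F0: "finite F0" "F0 <= Vr r" "F0 ~= {}"
proof -
 show "finite F0" unfolding F0e using f(1,2) Vr.umfin by auto
 show "F0 <= Vr r" unfolding F0e using mV dV Vr.V_add by auto
 have "0 : ?si" using lin_0[OF lin_dot] Vr.V_0 by auto
 hence "Fa ~= {}" using f(6) by blast
 thus "F0 ~= {}" by(auto simp: F0_def)
qed
\<comment> \<open>All of \<open>F0\<close> lies in the cone at m W. The coordinate contributed by an
  added direction can be negative only if s is not a ray of Y, and then m Y is at distance at least
  N.\<close>
have F0d: "0 <= dot r (g - m W) s" if W: "W : Fa" "s : W" and g: "g : F0" for W s g
proof -
 from g consider Y where "Y : Fa" "g = m Y" | Y t where "Y : Fa" "t : Y" "g = m Y + dual r Y t" by(auto simp: F0_def)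
 thus ?thesis
 proof cases
  case 1
  thus ?thesis using mdiff(1)[OF W(1) _ W(2)] by simp
 next
  case 2
  have sV: "s : Vr r" using raycone[OF W] by blast
  have e: "dot r (g - m W) s = dot r (m Y - m W) s + Vr.cf r Y t s"
   unfolding du(1)[OF 2(1,1,2) sV, symmetric] 2(3) by(simp add: lin_diff[OF lin_dot2] lin_add[OF lin_dot2])
  show ?thesis
  proof(cases "s : Y")
   case True
   thus ?thesis using mdiff(1)[OF W(1) 2(1) W(2)] Vr.cf_ray[OF f(2)[OF 2(1)] 2(2), of s] by(auto simp: e)
  next
   case False
   thus ?thesis using mdiff(2)[OF W(1) 2(1) W(2)] N[OF 2(1,2) UnionI[OF W]] by(simp add: e)
  qed
 qed
qed
\<comment> \<open>An edge at m W is either unbounded, with direction in M, or ends at a neighbouring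
  vertex. In the latter case take w inside the facet opposite s and v beyond it: a cone Y with k w +
  v for infinitely many k shares that facet and differs from W.\<close>
have edge: "dual r W s : M | (EX Y:Fa. EX c>=2. m Y - m W = c ** dual r W s)" if W: "W : Fa" "s : W" for W s
proof(cases "dual r W s : M")
 case False
 then obtain h where h: "h : H" "h (dual r W s) < 0" using dV by(auto simp: M_def not_le)
 define v where "v = vecof r h"
 have hv: "dot r u v = h u" if "u : Vr r" for u
  using dot_vecof[OF H(2)[OF h(1)] that] by(simp add: v_def dot_commute)
 have v: "v : ?si" using Gs(2) Gs_V hv h(1) vecof_Vr by(auto simp: M_def v_def subset_iff)
 hence neg: "Vr.cf r W s v < 0" using du(1)[OF W(1,1,2), of v] hv[OF dV] h(2) by auto
 define w where "w = sum id (W - {s})"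
 have fX: "finite W" by(rule Vr.umfin[OF f(2)[OF W(1)]])
 have lcf: "lin (Vr.cf r Y t)" if "Y : Fa" "t : Y" for Y t by(rule Vr.lin_cf[OF f(2)[OF that(1)] that(2)])
 have wV: "w : Vr r" and kw: "int k ** w + v : ?si" for k
 proof -
  show wV: "w : Vr r" unfolding w_def using raycone[OF W(1)] by(auto intro: Vr.V_sum)
  have "0 <= dot r g w" if "g : Gs" for g
   unfolding w_def using raycone[OF W(1)] that by(auto simp: lin_sum[OF lin_dot] intro!: sum_nonneg)
  thus "int k ** w + v : ?si" using wV v by(auto simp: Vr.V_add Vr.V_sc lin_add[OF lin_dot] lin_sc[OF lin_dot])
 qed
 have cw: "Vr.cf r W t w = (if t = s then 0 else 1)" if t: "t : W" for t
 proof -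
  have "Vr.cf r W t w = (SUM x:W - {s}. if x = t then 1 else 0)"
   unfolding w_def lin_sum[OF lcf[OF W(1) t]] id_def by(rule sum.cong) (use t Vr.cf_ray[OF f(2)[OF W(1)]] in auto)
  thus ?thesis using fX t by simp
 qed
 have "ALL k. EX Y:Fa. int k ** w + v : Vr.cone r Y" using f(6)[OF kw] by blast
 then obtain Yk where Yk: "!!k. Yk k : Fa" "!!k. int k ** w + v : Vr.cone r (Yk k)" by metis
 have "finite (Yk ` (UNIV :: nat set))" using Yk(1) f(1) by(meson finite_subset image_subsetI)
 from pigeonhole_infinite[OF infinite_UNIV_nat this] obtain k0 where inf: "infinite {k. Yk k = Yk k0}" by auto
 define Y where "Y = Yk k0"
 have Y: "Y : Fa" using Yk(1) by(simp add: Y_def)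
 have wY: "w : Vr.cone r Y"
 proof -
  have "0 <= Vr.cf r Y t w" if t: "t : Y" for t
  proof(rule nonneg_limit[OF inf])
   fix k assume "k : {k. Yk k = Yk k0}"
   hence "0 <= Vr.cf r Y t (int k ** w + v)" using Yk(2)[of k] t by(simp add: Y_def Vr.cone_def)
   thus "0 <= int k * Vr.cf r Y t w + Vr.cf r Y t v" by(simp add: lin_add[OF lcf[OF Y t]] lin_sc[OF lcf[OF Y t]])
  qed
  thus ?thesis using wV by(simp add: Vr.cone_def)
 qed
 have wX: "w : Vr.cone r W" using cw wV by(simp add: Vr.cone_def)
 have eq: "Vr.pl r fi Y w = Vr.pl r fi W w"
  using Vr.fan_convex(1)[OF F Y W(1) wX] Vr.fan_convex(1)[OF F W(1) Y wY] by simp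
 have XY: "t : Y" if "t : W" "t ~= s" for t
  by(rule Vr.fan_convex(3)[OF F Y W(1) wX eq that(1)]) (use cw[OF that(1)] that(2) in simp)
 have sY: "s ~: Y"
 proof
  assume "s : Y"
  hence "W <= Y" using XY by blast
  hence "W = Y" using card_subset_eq[OF Vr.umfin[OF f(2)[OF Y]]] f(3) W(1) Y by simp
  hence "0 <= Vr.cf r W s (int k0 ** w + v)" using Yk(2)[of k0] W(2) by(auto simp: Y_def Vr.cone_def)
  thus False using neg cw[OF W(2)] by(simp add: lin_add[OF lcf[OF W]] lin_sc[OF lcf[OF W]])
 qed
 have z: "dot r (m Y - m W) t = 0" if t: "t : W" "t ~= s" for t
 proof -
  have tV: "t : Vr r" using raycone[OF W(1) t(1)] by blast
  show ?thesis unfolding lin_diff[OF lin_dot2]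
   by(simp add: md[OF W(1) tV] md[OF Y tV] Vr.pl_ray[OF f(2)[OF W(1)] t(1)] Vr.pl_ray[OF f(2)[OF Y] XY[OF t]])
 qed
 have "m Y - m W = (SUM t:W. dot r (m Y - m W) t ** dual r W t)" by(rule du(2)[OF W(1,1), symmetric]) (use mV Vr.V_diff in auto)
 also have "... = (SUM t:W. if t = s then dot r (m Y - m W) s ** dual r W s else 0)" by(rule sum.cong) (auto simp: z)
 finally have "m Y - m W = dot r (m Y - m W) s ** dual r W s" using fX W(2) by simp
 moreover have "2 <= dot r (m Y - m W) s" using mdiff(2)[OF W(1) Y W(2) sY] N2 by simp
 ultimately show ?thesis using Y by blast
qed simp
have chart: "msp (?S f0) = ?C W Z"
 if W: "W : Fa" and Z: "Z <= W" and f0: "f0 : F0" "!!s. s : W - Z ==> dot r (m W - f0) s = 0"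
  and gen: "!!s. s : W ==> dual r W s : msp (?S f0)"
   "!!s. s : Z ==> - dual r W s : msp (?S f0)" for W Z f0
proof(intro equalityI)
 show "msp (?S f0) <= ?C W Z"
 proof(rule msp_least)
  show "?S f0 <= ?C W Z"
  proof(intro subsetI CollectI conjI ballI)
   fix u assume u: "u : ?S f0"
   thus "u : Vr r" using Gs_V F0(2) f0 Vr.V_diff by blast
   fix s assume s: "s : W - Z"
   show "0 <= dot r u s"
   proof(cases "u : Gs")
    case True
    thus ?thesis using raycone[OF W, of s] s by auto
   next
    case False
    then obtain g where g: "g : F0" "u = (g - m W) + (m W - f0)" using u by auto
    thus ?thesis using F0d[OF W _ g(1), of s] f0(2)[OF s] s lin_add[OF lin_dot2, of r "g - m W" "m W - f0" s] by auto
   qed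
  qed
 qed (use Vr.V_0 Vr.V_add in "auto simp: lin_add[OF lin_dot2] lin_0[OF lin_dot2]")
 show "?C W Z <= msp (?S f0)"
 proof
  fix u assume u: "u : ?C W Z"
  have t: "dot r u s ** dual r W s : msp (?S f0)" if s: "s : W" for s
  proof(cases "0 <= dot r u s")
   case True
   thus ?thesis using msp_sc[OF gen(1)[OF s], of "nat (dot r u s)"] by simp
  next
   case False
   thus ?thesis using msp_sc[OF gen(2)[of s], of "nat (- dot r u s)"] s u by(auto simp: sc_minus)
  qed
  have "(SUM s:A. dot r u s ** dual r W s) : msp (?S f0)" if "A <= W" for A
   using that t by(induction A rule: fin_ind) (auto intro: msp_0 msp_add)
  from this[of W] show "u : msp (?S f0)" using u du(2)[OF W W] by auto
 qed
qed
have gF: "g - f0 : msp (?S f0)" if "g : F0" for g f0 using that by(intro msp_gen) blast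
have F0s: "m W : F0" "s : W ==> m W + dual r W s : F0" if "W : Fa" for W s using that by(auto simp: F0_def)
have main: "EX W Z. W : Fa & Z <= W & msp (?S f0) = ?C W Z"
 if f0: "f0 : F0" for f0
proof -
 from f0 consider W where "W : Fa" "f0 = m W" | W s where "W : Fa" "s : W" "f0 = m W + dual r W s" by(auto simp: F0_def)
 thus ?thesis
 proof cases
  case 1
  have "msp (?S f0) = ?C W {}"
  proof(rule chart[OF 1(1) _ f0])
   show "dual r W s : msp (?S f0)" if "s : W" for s using gF[OF F0s(2)[OF 1(1) that], of f0] 1(2) by simp
  qed (use 1 in "auto simp: dot_def")
  thus ?thesis using 1(1) by blast
 next
  case 2
  let ?D = "dual r W s"
  have n: "- ?D : msp (?S f0)" using gF[OF F0s(1)[OF 2(1)], of f0] 2(3) by simp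
  have p: "?D : msp (?S f0)"
   using edge[OF 2(1,2)]
  proof(elim disjE bexE exE conjE)
   assume "?D : M"
   thus ?thesis using msp_Gs msp_sub[of Gs "?S f0"] msp_gen[of _ "?S f0"] by blast
  next
   fix Y and c :: int assume Y: "Y : Fa" "2 <= c" "m Y - m W = c ** ?D"
   \<comment> \<open>As c >= 2 the vertex m Y lies on the edge beyond f0, at distance c - 1; going
     back c - 2 steps leaves exactly one copy of the direction.\<close>
   have e: "m Y - f0 = (c - 1) ** ?D" unfolding 2(3) using Y(3) by(simp add: frag_cmul_diff_distrib algebra_simps)
   have "m Y - f0 + int (nat (c - 2)) ** (- ?D) : msp (?S f0)"
    by(rule msp_add[OF gF[OF F0s(1)[OF Y(1)]] msp_sc[OF n]])
   moreover have "m Y - f0 + int (nat (c - 2)) ** (- ?D) = ?D"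
    unfolding e by(rule pmI) (use Y(2) in "simp add: lk_add algebra_simps")
   ultimately show ?thesis by(simp only:)
  qed
  have "msp (?S f0) = ?C W {s}"
  proof(rule chart[OF 2(1) _ f0])
   show "dot r (m W - f0) t = 0" if t: "t : W - {s}" for t
   proof -
    have "dot r (m W - f0) t = - dot r ?D t"
     unfolding 2(3) lin_neg[OF lin_dot2, symmetric] by simp
    also have "... = 0" using du(1)[OF 2(1,1,2), of t] t Vr.cf_ray[OF f(2)[OF 2(1)] 2(2), of t] raycone[OF 2(1), of t] by auto
    finally show ?thesis .
   qed
   show "dual r W t : msp (?S f0)" if t: "t : W" for t
   proof -
    have "m W + dual r W t - f0 + ?D : msp (?S f0)" by(rule msp_add[OF gF[OF F0s(2)[OF 2(1) t]] p])
    thus ?thesis using 2(3) by simp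
   qed
  qed (use 2(2) n in auto)
  thus ?thesis using 2(1,2) by blast
 qed
qed
\<comment> \<open>Translation into M changes no differences, hence no chart.\<close>
obtain b where b: "b : Vr r" "(%f. f + b) ` F0 <= M" using ex_shift[OF F0(1,2)] by blast
have "EX A Z. Vr.unimod r A & Z <= A &
 msp (Gs Un {g - (f0 + b) | g. g : (%f. f + b) ` F0}) = {u : Vr r. ALL s:A - Z. 0 <= Vr.cf r A s u}" if f0: "f0 : F0" for f0
proof -
 obtain W Z where W: "W : Fa" "Z <= W" "msp (?S f0) = ?C W Z"
  using main[OF f0] by blast
 have "{g - (f0 + b) | g. g : (%f. f + b) ` F0} = {g - f0 | g. g : F0}" by force
 moreover have "dual r W ` W - dual r W ` Z = dual r W ` (W - Z)"
  using inj_on_image_set_diff[OF du(5)[OF W(1,1)], of W Z] W(2) by auto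
 ultimately show ?thesis using du(3)[OF W(1,1)] W du(4)[OF W(1,1)]
  by(intro exI[of _ "dual r W ` W"] exI[of _ "dual r W ` Z"]) auto
qed
thus ?thesis using F0 b by(intro exI[of _ "(%f. f + b) ` F0"]) auto
qed
end

section \<open>Rational singularities\<close>

locale laurent = sat_monoid M Gs deg r H m0 + typed_ring R "KM M" h
for M Gs deg r H m0 and R (structure) and h :: "('k::field) lau => 'c"
begin
sublocale domain R by(rule normal_KM(1)) unfold_locales
sublocale localization R "cr R - {\<zero>}"
by unfold_locales (use integral in auto)
sublocale L: cring L by(rule cring_L)
abbreviation mL' (infixl "*:" 70) where "mL' == monoid.mult L"
abbreviation aL' (infixl "+:" 65) where "aL' == ring.add L"
abbreviation uL' ("-: _" [81] 80) where "uL' == a_inv L"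

lemma frac_field_L: "frac_field R = L" and frac_fc: "frac R = fc"
by(simp_all add: frac_field_def frac_def fun_eq_iff)
text \<open>The embedding of Laurent polynomials into the fraction field; any monomial that brings f
  into K[M] serves as denominator, and by \<open>eta\<close> the choice does not matter.\<close>

definition eta :: "'k lau => ('c \<times> 'c) set" where
"eta f = (let w = (SOME w. w : M & mon w * f : KM M) in fc (h (mon w * f)) (h (mon w)))"

lemma shift2:
fixes f g :: "'k lau"
assumes "f : KM (Vr r)" "g : KM (Vr r)"
shows "EX w:M. mon w * f : KM M & mon w * g : KM M"
proof -
obtain w where w: "(%u. u + w) ` (insert 0 (keys f Un keys g)) <= M"
 using ex_shift[of "insert 0 (keys f Un keys g)"] assms Vr.V_0 by(auto simp: KM_def)
have "mon w * x : KM M" if "keys x <= keys f Un keys g" for x :: "'k lau"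
 unfolding KM_def
proof(intro CollectI subsetI)
 fix u assume "u : keys (mon w * x)"
 hence "u - w : keys x" by(simp add: ik lookup_single_mult)
 thus "u : M" using w that by(force simp: image_subset_iff)
qed
thus ?thesis using w by auto
qed

lemma mon_S: "w : M ==> (mon w :: 'k lau) : KM M & h (mon w) : cr R - {\<zero>}"
proof -
assume "w : M"
hence w: "mon w : (KM M :: 'k lau set)" by(rule KM_sng)
have "(mon w :: 'k lau) ~= 0" by(metis lookup_single_eq lookup_zero zero_neq_one)
hence "h (mon w) ~= h 0" using h_inj[OF w KM_0] by simp
thus ?thesis using w h_carr[OF w] h_0 by simp
qed

lemma eta: "w : M ==> mon w * f : KM M ==> eta f = fc (h (mon w * f)) (h (mon w))"
proof -
assume w: "w : M" "mon w * f : KM M"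
define v where "v = (SOME w. w : M & mon w * f : KM M)"
have v: "v : M" "mon v * f : KM M" using someI_ex[of "%w. w : M & mon w * f : KM M"] w unfolding v_def by blast+
have "h (mon w * (mon v * f)) = h (mon v * (mon w * f))" by(simp only: mult.left_commute)
thus ?thesis unfolding eta_def Let_def v_def[symmetric]
 using w v mon_S h_carr by(intro fc_eqI) (auto simp: h_mult)
qed

lemma eta_KM: "f : KM M ==> eta f = fc (h f) \<one>"
using eta[of 0 f] M_0 h_1 by simp

lemma eta_carr: "f : KM (Vr r) ==> eta f : cr L"
using shift2[of f f] eta[of _ f] mon_S h_carr by fastforce

lemma eta_add: "f : KM (Vr r) ==> g : KM (Vr r) ==> eta (f + g) = eta f +: eta g"
and eta_mult: "f : KM (Vr r) ==> g : KM (Vr r) ==> eta (f * g) = eta f *: eta g"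
and eta_inj: "f : KM (Vr r) ==> g : KM (Vr r) ==> eta f = eta g ==> f = g"
proof -
assume "f : KM (Vr r)" "g : KM (Vr r)"
then obtain w where w: "w : M" "mon w * f : KM M" "mon w * g : KM M" using shift2 by blast
let ?w = "mon w :: 'k lau"
note wS = mon_S[OF w(1)]
have c: "h (?w * f) : cr R" "h (?w * g) : cr R" "h ?w : cr R" using w wS h_carr by auto
have e: "eta f = fc (h (?w * f)) (h ?w)" "eta g = fc (h (?w * g)) (h ?w)" by(rule eta[OF w(1,2)], rule eta[OF w(1,3)])
have a: "mon w * (f + g) : KM M" using w by(simp add: distrib_left KM_add)
have hw: "h ?w *. h ?w : cr R - {\<zero>}" using wS by(intro Sm) auto
have "h (?w * (f + g)) = h (?w * f) +. h (?w * g)" using w by(simp add: distrib_left h_add)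
moreover have "eta f +: eta g = fc (h (?w * f) *. h ?w +. h (?w * g) *. h ?w) (h ?w *. h ?w)"
 unfolding e using wS c by(intro add_L) auto
ultimately show "eta (f + g) = eta f +: eta g"
 unfolding eta[OF w(1) a] using wS c hw by(simp, intro fc_eqI) (auto simp: r_distr l_distr m_ac)
have m: "mon (w + w) * (f * g) = (?w * f) * (?w * g)"
proof -
 have "(mon (w + w) :: 'k lau) = ?w * ?w" by(simp only: mult_single mult_1)
 thus ?thesis by(simp only: mult_ac)
qed
have "eta f *: eta g = fc (h (?w * f) *. h (?w * g)) (h ?w *. h ?w)"
 unfolding e using wS c by(intro mult_L) auto
moreover have "eta (f * g) = fc (h (?w * f * (?w * g))) (h (mon (w + w)))"
 using eta[of "w + w" "f * g", unfolded m] M_add[OF w(1,1)] sbr(5)[OF D w(2,3)] by blast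
moreover have "h (mon (w + w)) = h ?w *. h ?w" using h_mult[of ?w ?w] wS by(simp only: mult_single mult_1)
ultimately show "eta (f * g) = eta f *: eta g" using w by(simp add: h_mult)
assume "eta f = eta g"
then obtain u where u: "u : cr R - {\<zero>}" "u *. h ?w *. h (?w * f) = u *. h ?w *. h (?w * g)"
 unfolding e using fc_eq[OF c(1) conjunct2[OF wS] c(2) conjunct2[OF wS]] by blast
hence "h (?w * f) = h (?w * g)" using m_lcancel[of "u *. h ?w" "h (?w * f)" "h (?w * g)"] Sm[OF u(1) conjunct2[OF wS]] c by auto
hence "?w * f = ?w * g" using h_inj w by blast
hence "mon (- w) * (?w * f) = mon (- w) * (?w * g)" by simp
thus "f = g" unfolding mult.assoc[symmetric] mult_single by simp
qed

lemma KMV: "x : KM C ==> C <= Vr r ==> x : KM (Vr r)"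
by(auto simp: KM_def)

lemma eta_0: "eta 0 = zL"
using eta_KM[of 0] h_0 zero_L by simp

lemma eta_1: "eta 1 = oL"
using eta_KM[OF sbr(2)[OF D]] h_1 one_L by simp

lemma eta_minus: "f : KM (Vr r) ==> eta (- f) = -: eta f"
using eta_add[of "- f" f] KM_uminus[of f] eta_0 eta_carr by(metis L.minus_equality add.left_inverse)

lemma typed_chart:
assumes C: "C <= Vr r" "0 : C" "!!u v. u : C ==> v : C ==> u + v : C"
shows "subring (eta ` KM C) L" "typed_ring (L\<lparr>carrier := eta ` KM C\<rparr>) (KM C) eta"
proof -
note s = sbr_KMI[OF C(2,3)] and V = KMV[OF _ C(1)]
have sub: "eta ` KM C <= cr L" using eta_carr V by blast
show r: "subring (eta ` KM C) L"
proof(rule L.subringI[OF sub])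
 show "oL : eta ` KM C" using sbr(2)[OF s] eta_1 by force
 fix x assume "x : eta ` KM C"
 then obtain f where f: "f : KM C" "x = eta f" by blast
 show "-: x : eta ` KM C" unfolding f(2) eta_minus[OF V[OF f(1)], symmetric] by(intro imageI KM_uminus f(1))
 fix y assume "y : eta ` KM C"
 then obtain g where g: "g : KM C" "y = eta g" by blast
 show "x *: y : eta ` KM C"
  unfolding f(2) g(2) eta_mult[OF V[OF f(1)] V[OF g(1)], symmetric] by(intro imageI sbr(5)[OF s] f(1) g(1))
 show "x +: y : eta ` KM C"
  unfolding f(2) g(2) eta_add[OF V[OF f(1)] V[OF g(1)], symmetric] by(intro imageI KM_add f(1) g(1))
qed
have cr: "cring (L\<lparr>carrier := eta ` KM C\<rparr>)" using L.subcringI'[OF r] L.subcring_iff[OF sub] by blast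
show "typed_ring (L\<lparr>carrier := eta ` KM C\<rparr>) (KM C) eta"
proof(intro typed_ring.intro cr typed_ring_axioms.intro s)
 show "bij_betw eta (KM C) (cr (L\<lparr>carrier := eta ` KM C\<rparr>))"
  unfolding bij_betw_def using eta_inj[OF V V] by(auto intro: inj_onI)
qed (use eta_add[OF V V] eta_mult[OF V V] eta_1 in simp_all)
qed

lemma base_image_eta: "base_image R = eta ` KM M"
proof -
have "cr R = h ` KM M" using bij by(auto simp: bij_betw_def)
thus ?thesis unfolding base_image_def frac_fc by(auto simp: eta_KM)
qed

text \<open>The charts of a monomial blow-up are monoid algebras, so regularity and cohomology can
  be read off from their cones.\<close>

lemma blowup_chart_eta:
assumes fs: "fs = map (%w. h (mon w)) ms" and ms: "set ms <= M" and T: "T <= {..<length ms}"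
shows "blowup_chart R fs T = eta ` KM (msp (Gs Un df {..<length ms} ((!) ms) T))"
proof -
let ?S = "Gs Un df {..<length ms} ((!) ms) T"
let ?G = "blowup_chart R fs T"
let ?F = "{frac R (fs ! k) (fs ! i) | k i. k < length fs & i : T}"
have msM: "ms ! k : M" if "k < length ms" for k using that ms by(auto simp: set_conv_nth)
have SV: "?S <= Vr r" using Gs_V msM M_V T by(auto simp: df_def intro!: Vr.V_diff)
have CV: "msp ?S <= Vr r" by(rule msp_least[OF SV]) (auto intro: Vr.V_0 Vr.V_add)
note V = KMV[OF _ CV]
have MC: "M <= msp ?S" unfolding msp_Gs[symmetric] by(rule msp_sub) (use msp_gen in blast)
have fr: "frac R (fs ! k) (fs ! i) = eta (mon (ms ! k - ms ! i))" if "k < length ms" "i < length ms" for k i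
 using eta[of "ms ! i" "mon (ms ! k - ms ! i)"] that msM by(simp add: fs frac_fc mult_single KM_sng)
have lfs: "length fs = length ms" by(simp add: fs)
have F: "?F = {eta (mon s) | s. s : df {..<length ms} ((!) ms) T}"
proof -
 have "i < length ms" if "i : T" for i using T that by auto
 hence "?F = {eta (mon (ms ! k - ms ! i)) | k i. k < length ms & i : T}"
  using fr by(auto simp: lfs) metis+
 thus ?thesis by(auto simp: df_def)
qed
have G: "?G = generate_ring L (eta ` KM M Un ?F)" unfolding blowup_chart_def frac_field_L base_image_eta ..
have "?G <= eta ` KM (msp ?S)"
 unfolding G
proof(rule L.generate_ring_min_subring1)
 show sr: "subring (eta ` KM (msp ?S)) L" by(rule typed_chart(1)[OF CV msp_0 msp_add])
 have "eta (mon s) : eta ` KM (msp ?S)" if "s : df {..<length ms} ((!) ms) T" for s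
  using that by(intro imageI KM_sng msp_gen) auto
 moreover have "KM M <= (KM (msp ?S) :: 'k lau set)" using MC by(auto simp: KM_def)
 ultimately show "eta ` KM M Un ?F <= eta ` KM (msp ?S)" unfolding F by blast
 thus "eta ` KM M Un ?F <= cr L" using subringE(1)[OF sr] by blast
qed
moreover have "eta ` KM (msp ?S) <= ?G"
proof -
 have base: "eta f : ?G" if "f : KM M" for f unfolding G by(rule generate_ring.incl) (use that in blast)
 have mon: "eta (mon u) : ?G" if "u : msp ?S" for u
  using that
 proof(induction rule: msp.induct)
  case msp_0
  thus ?case by(rule base[OF KM_sng[OF M_0]])
 next
  case (msp_step u s)
  have "eta (mon s) : ?G"
  proof(cases "s : Gs")
   case True
   thus ?thesis using Gs(2) by(intro base KM_sng) auto
  next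
   case False
   thus ?thesis unfolding G F using msp_step(2) by(intro generate_ring.incl) blast
  qed
  have "mon (u + s) = (mon u * mon s :: 'k lau)" by(simp add: mult_single)
  show ?case
  proof -
   have "eta (mon u * mon s) = eta (mon u) *: eta (mon s)"
    by(intro eta_mult KM_sng) (use msp_step(1,2) CV SV in auto)
   moreover have "eta (mon u) *: eta (mon s) : ?G"
    using msp_step(3) \<open>eta (mon s) : ?G\<close> unfolding G by(rule generate_ring.eng_mult)
   ultimately show ?thesis unfolding \<open>mon (u + s) = (mon u * mon s :: 'k lau)\<close> by simp
  qed
 qed
 have "eta (SUM u:A. sng u (a u)) : ?G & (SUM u:A. sng u (a u)) : KM (Vr r)"
  if "finite A" "A <= msp ?S" for A a
  using that
 proof(induction A rule: finite_induct)
  case empty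
  thus ?case using base[of 0] by simp
 next
  case (insert u A)
  have "sng u (a u) = cst (a u) * mon u" by(simp add: mult_single)
  moreover have "eta (cst (a u) * mon u) = eta (cst (a u)) *: eta (mon u)"
   using insert.prems CV by(intro eta_mult KM_sng) (auto intro: Vr.V_0)
  ultimately have "eta (sng u (a u)) : ?G"
   using base[OF KM_sng[OF M_0, of "a u"]] mon[of u] insert.prems unfolding G by(auto intro: generate_ring.eng_mult)
  moreover have "sng u (a u) : KM (Vr r)" using insert.prems CV by(intro KM_sng) auto
  ultimately show ?case using insert eta_add unfolding G by(auto intro: generate_ring.eng_add KM_add)
 qed
 note all = this
 show ?thesis
 proof
  fix x assume "x : eta ` KM (msp ?S)"
  then obtain f where f: "f : KM (msp ?S)" "x = eta f" by blast
  thus "x : ?G" using all[of "keys f" "lk f"] by(simp add: sum_sng KM_def)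
 qed
qed
ultimately show ?thesis by blast
qed

lemma eta_sg: "f : KM (Vr r) ==> (-: oL) [^]\<^bsub>L\<^esub> card {j : T. j < i} *: eta f = eta (sg T i * f) & sg T i * f : KM (Vr r)"
proof -
assume f: "f : KM (Vr r)"
have "(-: oL) [^]\<^bsub>L\<^esub> n *: eta f = eta ((- 1) ^ n * f) & (- 1) ^ n * f : KM (Vr r)" for n :: nat
proof(induction n)
 case (Suc n)
 have "(-: oL) [^]\<^bsub>L\<^esub> Suc n *: eta f = -: ((-: oL) [^]\<^bsub>L\<^esub> n *: eta f)"
  using eta_carr[OF f] by(simp add: L.r_minus L.l_minus)
 thus ?case using Suc eta_minus KM_uminus by auto
qed (use f eta_carr in auto)
thus ?thesis by(simp add: sg_def)
qed

lemma cech_d_eta: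
assumes "finite T" "!!i. i : T ==> c (T - {i}) = eta (f (T - {i})) & f (T - {i}) : KM (Vr r)"
shows "cech_d R c T = eta (cd f T)" "cd f T : KM (Vr r)"
proof -
have "(\<Oplus>\<^bsub>L\<^esub>i\<in>A. (-: oL) [^]\<^bsub>L\<^esub> card {j : T. j < i} *: c (T - {i})) = eta (SUM i:A. sg T i * f (T - {i})) &
  (SUM i:A. sg T i * f (T - {i})) : KM (Vr r)" if "finite A" "A <= T" for A
 using that
proof(induction A rule: finite_induct)
 case empty
 thus ?case by(simp add: eta_0)
next
 case (insert i A)
 hence iT: "i : T" "A <= T" by auto
 have e: "(-: oL) [^]\<^bsub>L\<^esub> card {j : T. j < k} *: c (T - {k}) = eta (sg T k * f (T - {k}))"
  and k: "sg T k * f (T - {k}) : KM (Vr r)" if "k : T" for k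
  using assms(2)[OF that] eta_sg by auto
 have "(\<Oplus>\<^bsub>L\<^esub>i\<in>insert i A. (-: oL) [^]\<^bsub>L\<^esub> card {j : T. j < i} *: c (T - {i})) =
  eta (sg T i * f (T - {i})) +: (\<Oplus>\<^bsub>L\<^esub>i\<in>A. (-: oL) [^]\<^bsub>L\<^esub> card {j : T. j < i} *: c (T - {i}))"
 proof(subst L.finsum_insert[OF insert(1,2)])
  show "(%i. (-: oL) [^]\<^bsub>L\<^esub> card {j : T. j < i} *: c (T - {i})) : A \<rightarrow> cr L"
   using e eta_carr[OF k] iT(2) by(intro Pi_I) (simp add: subset_iff)
 qed (use e eta_carr[OF k] iT(1) in simp_all)
 thus ?case using insert.IH[OF iT(2)] insert(1,2) eta_add[OF k[OF iT(1)]] KM_add[OF k[OF iT(1)]] by simp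
qed
from this[OF assms(1) order_refl] show "cech_d R c T = eta (cd f T)" "cd f T : KM (Vr r)"
 by(simp_all add: cech_d_def Let_def frac_field_L cd_def)
qed

theorem rational_singularities_KM:
assumes "CHAR('k) = 0"
shows "rational_singularities R"
proof -
have two: "(2::'k) ~= 0" using of_nat_eq_0_iff_char_dvd[of 2, where 'a = 'k] assms by simp
from resolution obtain F where F: "finite F" "F ~= {}" "F <= M" and ch: "ALL f:F. EX A Z. Vr.unimod r A & Z <= A &
 msp (Gs Un {g - f | g. g : F}) = {u : Vr r. ALL s:A - Z. 0 <= Vr.cf r A s u}" by(elim exE conjE) blast
obtain ms where ms: "set ms = F" using finite_list[OF F(1)] by blast
define fs where "fs = map (%w. h (mon w)) ms"
let ?I = "{..<length ms}" and ?m = "(!) ms"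
have lfs: "length fs = length ms" by(simp add: fs_def)
have ne: "ms ~= []" using ms F(2) by auto
let ?C = "%T. msp (Gs Un df ?I ?m T)"
have chart: "blowup_chart R fs T = eta ` KM (?C T)" if "T <= ?I" for T
 using blowup_chart_eta[OF fs_def _ that] ms F(3) by simp
have msM: "ms ! k : M" if "k < length ms" for k using that ms F(3) by(auto simp: set_conv_nth)
have CV: "?C T <= Vr r" if "T <= ?I" for T
proof(rule msp_least)
 show "Gs Un df ?I ?m T <= Vr r" using Gs_V msM M_V that by(auto simp: df_def intro!: Vr.V_diff)
qed (auto intro: Vr.V_0 Vr.V_add)
have ch1: "EX A Z. Vr.unimod r A & Z <= A & ?C {i} = {u : Vr r. ALL s:A - Z. 0 <= Vr.cf r A s u}" if i: "i < length ms" for i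
proof -
 have "df ?I ?m {i} = {g - ms ! i | g. g : F}" unfolding ms[symmetric] df_def by(auto simp: set_conv_nth)
 thus ?thesis using ch[rule_format, of "ms ! i"] i ms by auto
qed
have reg: "blowup_is_regular R fs"
 unfolding blowup_is_regular_def
proof(intro allI impI)
 fix i assume "i < length fs"
 hence i: "i < length ms" by(simp add: lfs)
 obtain A Z where AZ: "Vr.unimod r A" "Z <= A" "?C {i} = {u : Vr r. ALL s:A - Z. 0 <= Vr.cf r A s u}" using ch1[OF i] by blast
 have "regular_ring (L\<lparr>carrier := eta ` KM (?C {i})\<rparr>)"
  by(rule typed_ring.regular[OF typed_chart(2)[OF CV msp_0 msp_add] Vr.chart_data[OF AZ]]) (use i in auto)
 thus "regular_ring ((frac_field R)\<lparr>carrier := blowup_chart R fs {i}\<rparr>)" using chart[of "{i}"] i by(simp add: frac_field_L)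
qed
\<comment> \<open>The chart of T is the chart of one i in T with e inverted, and the latter is given
  by inequalities. If k u lies in the first, then k (u + n e) lies in the second for some n, so u +
  n e does too, and -e is available in the chart of T.\<close>
have sat: "rc (Gs Un df ?I ?m T) <= ?C T" if T: "T <= ?I" "T ~= {}" for T
proof
 fix u assume "u : rc (Gs Un df ?I ?m T)"
 then obtain k where k: "0 < k" "int k ** u : ?C T" by(auto simp: rc_def)
 obtain i where i: "i : T" using T by blast
 hence iI: "i < length ms" using T by auto
 obtain A Z where AZ: "Vr.unimod r A" "Z <= A" "?C {i} = {u : Vr r. ALL s:A - Z. 0 <= Vr.cf r A s u}" using ch1[OF iI] by blast
 have finT: "finite T" using T finite_subset by blast
 define e where "e = (SUM j:T. ?m j - ?m i)"
 have sumC: "(SUM j:S. f j) : msp Q" if "!!j. j : S ==> f j : msp Q" for S f and Q :: "vec set"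
  using that by(induction S rule: fin_ind) (auto intro: msp_0 msp_add)
 have dC: "?m j - ?m i : ?C {i}" if "j < length ms" for j using that by(intro msp_gen) (auto simp: df_def)
 have eC: "e : ?C {i}" unfolding e_def using T by(intro sumC dC) auto
 have ex: "EX n. v + int n ** e : ?C {i}" if "v : ?C T" for v
  using that
 proof(induction rule: msp.induct)
  case msp_0
  thus ?case using msp.msp_0 by(intro exI[of _ 0]) auto
 next
  case (msp_step v s)
  then obtain n where n: "v + int n ** e : ?C {i}" by blast
  have "s + e : ?C {i}"
  proof(cases "s : Gs")
   case True
   thus ?thesis using msp_add[OF msp_gen eC] by blast
  next
   case False
   then obtain k j where kj: "s = ?m k - ?m j" "k < length ms" "j : T" using msp_step(2) by(auto simp: df_def)
   have "s + e = (?m k - ?m i) + (SUM j:T - {j}. ?m j - ?m i)"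
    unfolding e_def kj(1) by(subst sum.remove[OF finT kj(3)]) simp
   also have "... : ?C {i}" using T by(intro msp_add[OF dC[OF kj(2)]] sumC dC) auto
   finally show ?thesis .
  qed
  with n have "(v + int n ** e) + (s + e) : ?C {i}" by(rule msp_add)
  moreover have "(v + int n ** e) + (s + e) = v + s + int (Suc n) ** e" by(rule pmI) (simp add: lk_add algebra_simps)
  ultimately show ?case by metis
 qed
 obtain n where n: "int k ** u + int n ** e : ?C {i}" using ex[OF k(2)] by blast
 have "(int k ** u + int n ** e) + int ((k - 1) * n) ** e : ?C {i}" by(rule msp_add[OF n msp_sc[OF eC]])
 moreover have "(int k ** u + int n ** e) + int ((k - 1) * n) ** e = int k ** (u + int n ** e)"
  by(rule pmI) (use k(1) in "simp add: lk_add algebra_simps of_nat_diff")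
 ultimately have ke: "int k ** (u + int n ** e) : ?C {i}" by(simp only:)
 have uV: "u + int n ** e : Vr r"
 proof -
  have "keys (u + int n ** e) = keys (int k ** (u + int n ** e))" using k(1) by(auto simp: ik)
  thus ?thesis using ke CV[of "{i}"] iI unfolding Vr_def by auto
 qed
 have "0 <= Vr.cf r A s (u + int n ** e)" if "s : A - Z" for s
 proof -
  have "0 <= Vr.cf r A s (int k ** (u + int n ** e))" using ke that unfolding AZ(3) by blast
  hence "0 <= int k * Vr.cf r A s (u + int n ** e)" using lin_sc[OF Vr.lin_cf[OF AZ(1)], of s] that by simp
  thus ?thesis using k(1) by(simp add: zero_le_mult_iff)
 qed
 hence "u + int n ** e : ?C {i}" using uV by(simp add: AZ(3))
 moreover have "?C {i} <= ?C T" by(rule msp_sub, rule subsetI, rule msp_gen) (use i in "auto simp: df_def")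
 moreover have "int n ** (SUM j:T. ?m i - ?m j) : ?C T"
  using iI by(intro msp_sc sumC msp_gen) (auto simp: df_def)
 ultimately have "u + int n ** e + int n ** (SUM j:T. ?m i - ?m j) : ?C T" using msp_add by blast
 moreover have "(SUM j:T. ?m i - ?m j) = - e" unfolding e_def sum_negf[symmetric] by simp
 moreover have "u + int n ** e + int n ** (- e) = u" by(rule pmI) (simp add: lk_add)
 ultimately show "u : ?C T" by(simp only:)
qed
have "cech_vanishes R fs q" if q: "1 <= q" for q
 unfolding cech_vanishes_def lfs
proof(intro ballI impI)
 fix c assume c: "c : cech_cochains R fs q" and d: "ALL T. T <= ?I & card T = q + 2 --> cech_d R c T = \<zero>\<^bsub>frac_field R\<^esub>"
 have "ALL T. EX f. T <= ?I & card T = Suc q --> c T = eta f & f : KM (?C T)"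
 proof
  fix T
  have "c T : blowup_chart R fs T" if "T <= ?I" "card T = Suc q" using c that by(simp add: cech_cochains_def lfs)
  thus "EX f. T <= ?I & card T = Suc q --> c T = eta f & f : KM (?C T)" using chart[of T] by blast
 qed
 then obtain f where f: "!!T. T <= ?I ==> card T = Suc q ==> c T = eta (f T)" "!!T. T <= ?I ==> card T = Suc q ==> f T : KM (?C T)" by metis
 have sub: "T - {i} <= ?I & card (T - {i}) = Suc p" if "T <= ?I" "card T = Suc (Suc p)" "i : T" for T i p
  using that by auto
 have fin: "finite T" if "T <= ?I" for T using that finite_subset by blast
 have "cd f T = 0" if T: "T <= ?I" "card T = q + 2" for T
 proof -
  have "c (T - {i}) = eta (f (T - {i})) & f (T - {i}) : KM (Vr r)" if "i : T" for i
   using sub[OF T(1) _ that, of q] T(2) f KMV[OF f(2) CV] by auto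
  from cech_d_eta[where c = c and f = f, OF fin[OF T(1)] this] have "eta (cd f T) = eta 0" "cd f T : KM (Vr r)" using d T by(simp_all add: eta_0 frac_field_L)
  thus ?thesis using eta_inj[of "cd f T" 0] by simp
 qed
 hence "EX b. (ALL T<=?I. card T = q --> b T : KM (?C T)) & (ALL T<=?I. card T = q + 1 --> f T = cd b T)"
  by(intro cech_KM[OF two _ _ q sat f(2)]) (use ne in auto)
 then obtain b where b: "ALL T<=?I. card T = q --> b T : KM (?C T)" "ALL T<=?I. card T = q + 1 --> f T = cd b T" by auto
 have "c T = cech_d R (eta \<circ> b) T" if T: "T <= ?I" "card T = q + 1" for T
 proof -
  have "b (T - {i}) : KM (Vr r)" if "i : T" for i
   using sub[OF T(1) _ that, of "q - 1"] T(2) q b(1) KMV[OF _ CV] by auto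
  hence "cech_d R (eta \<circ> b) T = eta (cd b T)" by(intro cech_d_eta(1)[OF fin[OF T(1)]]) auto
  thus ?thesis using f(1) b(2) T by simp
 qed
 moreover have "eta \<circ> b : cech_cochains R fs (q - 1)" unfolding cech_cochains_def lfs using b(1) chart q by auto
 ultimately show "EX b:cech_cochains R fs (q - 1). ALL T. T <= ?I & card T = q + 1 --> c T = cech_d R b T" by blast
qed
moreover have "set fs <= cr R - {\<zero>}" using mon_S ms F(3) by(auto simp: fs_def)
moreover have "typed_ring R (KM M) h" by unfold_locales
moreover have "fs ~= []" using ne by(simp add: fs_def)
ultimately show ?thesis unfolding rational_singularities_def using normal_KM(2) reg by blast
qed
end

section \<open>Saturated affine monoids\<close>

lemma rc_empty: "rc {} = {0}"
proof -
have "msp {} = {0}"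
proof(intro equalityI subsetI)
 fix u :: vec assume "u : msp {}" thus "u : {0}" by(cases rule: msp.cases) auto
qed (simp add: msp_0)
moreover have "int k ** u = 0 <-> u = 0" if "0 < k" for k and u :: vec
 using that by(auto simp: poly_mapping_eq_iff fun_eq_iff)
ultimately show ?thesis unfolding rc_def by(auto intro!: exI[of _ 1])
qed

lemma interpolate:
fixes L U :: "rat set"
assumes "finite L" "!!l u. l : L ==> u : U ==> l <= u" "!!u. u : U ==> 0 <= u"
shows "EX t>=0. (ALL l:L. l <= t) & (ALL u:U. t <= u)"
using assms by(intro exI[of _ "Max (insert 0 L)"]) auto

lemma rc_insert: "u : rc (insert g G) <-> (EX k n. 0 < k & int k ** u - int n ** g : rc G)"
proof
assume "u : rc (insert g G)"
then obtain k where k: "0 < k" "int k ** u : msp (insert g G)" by(auto simp: rc_def)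
from msp_insert[OF k(2)] obtain v n where "v : msp G" "int k ** u = v + int n ** g" by blast
thus "EX k n. 0 < k & int k ** u - int n ** g : rc G"
 using k(1) by(intro exI[of _ k] exI[of _ n]) (auto simp: rc_def intro!: exI[of _ 1])
next
assume "EX k n. 0 < k & int k ** u - int n ** g : rc G"
then obtain k n l where h: "0 < k" "0 < l" "int l ** (int k ** u - int n ** g) : msp G" by(auto simp: rc_def)
have "msp G <= msp (insert g G)" by(rule msp_sub) (use msp_gen in blast)
hence "int l ** (int k ** u - int n ** g) + int (l * n) ** g : msp (insert g G)"
 using h(3) msp_add msp_sc[OF msp_gen[OF insertI1]] by blast
moreover have "int l ** (int k ** u - int n ** g) + int (l * n) ** g = int (l * k) ** u"
 by(rule pmI) (simp add: lk_add lk_diff algebra_simps)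
ultimately have "int (l * k) ** u : msp (insert g G)" by(simp only:)
thus "u : rc (insert g G)" using h unfolding rc_def by(intro CollectI exI[of _ "l * k"]) simp
qed

text \<open>Fourier--Motzkin elimination.\<close>
lemma farkas:
assumes "finite G" "G <= Vr m"
shows "EX H. finite H & (ALL h:H. lin h) & (ALL u:Vr m. u : rc G <-> (ALL h:H. 0 <= h u))"
using assms
proof(induction G rule: finite_induct)
case empty
let ?l = "%c i u. c * lk u i :: int"
have "lin (?l c i)" for c i by(simp add: lin_def lk_add distrib_left)
moreover have "u = 0" if "u : Vr m" "ALL i<m. 0 <= lk u i & lk u i <= 0" for u :: vec
 using that by(intro pmI) (metis Vr_def ik lessThan_iff lookup_zero mem_Collect_eq order_antisym subset_iff)
ultimately show ?case
 by(intro exI[of _ "(%(c, i). ?l c i) ` ({1, - 1} \<times> {..<m})"]) (force simp: rc_empty)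
next
case (insert g G)
from insert.IH[OF subset_trans[OF subset_insertI insert.prems]] obtain H where H: "finite H" "!!h. h : H ==> lin h" "!!u. u : Vr m ==> u : rc G <-> (ALL h:H. 0 <= h u)" by metis
define P where "P = {h : H. 0 < h g}"
define N where "N = {h : H. h g < 0}"
\<comment> \<open>The positive combination of h and h' that vanishes at g.\<close>
define cb where "cb = (%(h, h') u. (- h' g) * h u + h g * h' u :: int)"
have lcb: "lin (cb (h, h'))" if "lin h" "lin h'" for h h'
 unfolding cb_def prod.case by(intro lin_plus lin_times that)
define H' where "H' = {h : H. 0 <= h g} Un cb ` (P \<times> N)"
have PN: "finite P" "finite N" "P <= H" "N <= H" using H(1) by(auto simp: P_def N_def)
have gV: "g : Vr m" using insert.prems by simp
have "u : rc (insert g G) <-> (ALL h:H'. 0 <= h u)" if u: "u : Vr m" for u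
proof -
 have mem: "int k ** u - int n ** g : rc G <-> (ALL h:H. int n * h g <= int k * h u)" for k n
  using H(2) by(subst H(3)) (auto simp: lin_diff lin_sc u gV Vr.V_diff Vr.V_sc)
 show ?thesis
 proof
  assume "u : rc (insert g G)"
  then obtain k n where kn: "0 < k" "!!h. h : H ==> int n * h g <= int k * h u" unfolding rc_insert mem by blast
  have pos: "0 <= x" if "0 <= int k * x" for x using that kn(1) by(simp add: zero_le_mult_iff)
  show "ALL h:H'. 0 <= h u"
   unfolding H'_def
  proof(intro ballI, elim UnE imageE)
   fix h assume "h : {h : H. 0 <= h g}"
   hence "0 <= int n * h g" "int n * h g <= int k * h u" using kn(2)[of h] by auto
   hence "0 <= int k * h u" by linarith
   thus "0 <= h u" by(rule pos)
  next
   fix h x assume x: "h = cb x" "x : P \<times> N"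
   then obtain p q where pq: "x = (p, q)" "p : H" "q : H" "0 < p g" "q g < 0" by(auto simp: P_def N_def)
   have "(- q g) * (int n * p g) + p g * (int n * q g) <= (- q g) * (int k * p u) + p g * (int k * q u)"
    by(intro add_mono mult_left_mono kn(2)) (use pq in auto)
   hence "0 <= int k * ((- q g) * p u + p g * q u)" by(simp add: algebra_simps)
   thus "0 <= h u" unfolding x pq(1) cb_def prod.case by(rule pos)
  qed
 next
  assume h: "ALL h:H'. 0 <= h u"
  \<comment> \<open>A rational t >= 0 is needed with u - t g satisfying all of \<open>H\<close>. The
    ratios are lower bounds for t where h g < 0 and upper bounds where h g > 0; the combinations in
    \<open>H'\<close> make them compatible.\<close>
  let ?q = "%h. of_int (h u) / of_int (h g) :: rat"
  have "EX t>=0. (ALL l:?q ` N. l <= t) & (ALL u:?q ` P. t <= u)"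
  proof(rule interpolate)
   show "0 <= x" if "x : ?q ` P" for x using that h by(auto simp: P_def H'_def)
   fix x y assume "x : ?q ` N" "y : ?q ` P"
   then obtain p q where pq: "p : P" "q : N" "x = ?q q" "y = ?q p" by blast
   have "cb (p, q) : H'" using pq(1,2) unfolding H'_def by blast
   from bspec[OF h this] have "0 <= - q g * p u + p g * q u" unfolding cb_def prod.case .
   hence "of_int (q g * p u) <= (of_int (p g * q u) :: rat)" unfolding of_int_le_iff by simp
   moreover have "(of_int (q g) :: rat) < 0" "(0 :: rat) < of_int (p g)" using pq(1,2) by(simp_all add: P_def N_def)
   ultimately show "x <= y" unfolding pq(3,4) by(simp add: divide_le_eq le_divide_eq mult.commute)
  qed (use PN in auto)
  then obtain t where t: "0 <= t" "!!h. h : N ==> ?q h <= t" "!!h. h : P ==> t <= ?q h" by blast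
  obtain a b where ab: "t = Rat.Fract a b" "0 < b" by(cases t)
  hence a0: "0 <= a" "t = of_int a / of_int b" using t(1) by(auto simp: zero_le_Fract_iff Fract_of_int_quotient zero_le_divide_iff)
  have "a * h g <= b * h u" if "h : H" for h
  proof(cases "h g = 0")
   case True
   thus ?thesis using h that ab(2) by(simp add: H'_def)
  next
   case False
   have "of_int (a * h g) <= (of_int (b * h u) :: rat)"
   proof(cases "0 < h g")
    case True
    thus ?thesis using t(3)[of h] that ab(2) unfolding a0(2) by(simp add: P_def divide_simps) (simp add: mult.commute)
   next
    case neg: False
    thus ?thesis using t(2)[of h] that ab(2) False unfolding a0(2) by(simp add: N_def divide_simps) (simp add: mult.commute)
   qed
   thus ?thesis unfolding of_int_le_iff .
  qed
  thus "u : rc (insert g G)" unfolding rc_insert mem using ab(2) a0(1)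
   by(intro exI[of _ "nat b"] exI[of _ "nat a"]) auto
 qed
qed
moreover have "ALL h:H'. lin h" using H(2) PN(3,4) unfolding H'_def by(auto intro!: lcb)
moreover have "finite H'" using H(1) PN by(simp add: H'_def)
ultimately show ?case by blast
qed

lemma additive_sc:
fixes T :: "vec => vec"
assumes "!!u v. T (u + v) = T u + T v"
shows "T (c ** u) = c ** T u"
proof(rule pmI)
fix i
have "lin (%u. lk (T u) i)" by(simp add: lin_def assms lk_add)
from lin_sc[OF this] show "lk (T (c ** u)) i = lk (c ** T u) i" by simp
qed

text \<open>The least positive last coordinate d divides all last coordinates. A vector that attains
  it completes a basis of the sublattice where the last coordinate vanishes.\<close>

lemma sublattice_basis:
"lattice_vec V ==> V <= Vr m ==> EX r T. (ALL u v. T (u + v) = T u + T v) & bij_betw T (Vr r) V"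
proof(induction m arbitrary: V)
case 0
hence "V = {0}" using lattice_vec.V_0 by(auto simp: Vr_def)
thus ?case by(intro exI[of _ 0] exI[of _ "%_. 0"]) (auto simp: bij_betw_def Vr_def)
next
case (Suc m)
interpret lattice_vec V by fact
have low: "u : Vr m" if "u : V" "lk u m = 0" for u
proof -
 have "m ~: keys u" using that by(simp add: ik)
 thus ?thesis using that Suc.prems(2) by(force simp: Vr_def lessThan_Suc)
qed
have z: "lk u m = 0" if "u : Vr m" for u using that by(auto simp: Vr_def ik)
have "lattice_vec (V Int Vr m)" by unfold_locales (auto simp: V_0 V_add V_neg Vr.V_0 Vr.V_add Vr.V_neg)
from Suc.IH[OF this] obtain r T where T: "!!u v. T (u + v) = T u + T v" "bij_betw T (Vr r) (V Int Vr m)" by auto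
show ?case
proof(cases "V <= Vr m")
 case True
 thus ?thesis using T by(intro exI[of _ r] exI[of _ T]) (simp add: Int_absorb2)
next
 case False
 then obtain v1 where v1: "v1 : V" "lk v1 m ~= 0" using low by blast
 define Q where "Q k <-> 0 < k & (EX v:V. lk v m = int k)" for k
 have "Q (nat (abs (lk v1 m)))" unfolding Q_def using v1 V_neg[OF v1(1)]
  by(cases "0 <= lk v1 m") (auto intro: bexI[of _ v1] bexI[of _ "- v1"])
 hence Q: "Q (Least Q)" and least: "Q k ==> Least Q <= k" for k by(auto intro: LeastI Least_le)
 define d where "d = int (Least Q)"
 obtain v where v: "v : V" "lk v m = d" "0 < d" using Q by(auto simp: Q_def d_def)
 let ?c = "%u. lk u m div d"
 have red: "u - ?c u ** v : V Int Vr m" if u: "u : V" for u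
 proof -
  have w: "u - ?c u ** v : V" using u v V_diff V_sc by blast
  have l: "lk (u - ?c u ** v) m = lk u m mod d" by(simp add: lk_diff v(2) minus_div_mult_eq_mod)
  have "lk u m mod d = 0"
  proof(rule ccontr)
   assume "lk u m mod d ~= 0"
   hence "Q (nat (lk u m mod d))" unfolding Q_def using w l v(3) by(auto intro!: bexI[OF _ w] simp: order_less_le)
   from least[OF this] have "d <= lk u m mod d" using pos_mod_sign[OF v(3), of "lk u m"] unfolding d_def by linarith
   thus False using pos_mod_bound[OF v(3), of "lk u m"] by simp
  qed
  thus ?thesis using low[OF w] w l by simp
 qed
 let ?e = "sng r 1 :: vec"
 define T' where "T' e = T (e - lk e r ** ?e) + lk e r ** v" for e
 have cut: "e - lk e r ** ?e : Vr r" if "e : Vr (Suc r)" for e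
  using that by(auto simp: Vr_def ik lk_diff lk_sng when_def lessThan_Suc subset_iff split: if_splits)
 have TV: "T e : V Int Vr m" if "e : Vr r" for e using that T(2) by(auto simp: bij_betw_def)
 have T'm: "lk (T' e) m = lk e r * d" if "e : Vr (Suc r)" for e
  using z TV[OF cut[OF that]] by(simp add: T'_def lk_add v(2))
 have "T' (x + y) = T' x + T' y" for x y
 proof -
  have "x + y - lk (x + y) r ** ?e = (x - lk x r ** ?e) + (y - lk y r ** ?e)"
   by(simp add: lk_add frag_cmul_distrib)
  thus ?thesis unfolding T'_def by(simp only: T(1) lk_add frag_cmul_distrib ac_simps)
 qed
 moreover have "inj_on T' (Vr (Suc r))"
 proof(rule inj_onI)
  fix x y assume h: "x : Vr (Suc r)" "y : Vr (Suc r)" "T' x = T' y"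
  hence e: "lk x r = lk y r" using T'm[OF h(1)] T'm[OF h(2)] v(3) by simp
  hence "T (x - lk x r ** ?e) = T (y - lk y r ** ?e)" using h(3) by(simp add: T'_def)
  hence "x - lk x r ** ?e = y - lk y r ** ?e" using T(2) cut[OF h(1)] cut[OF h(2)] by(auto simp: bij_betw_def inj_on_def)
  thus "x = y" using e by simp
 qed
 moreover have "T' ` Vr (Suc r) = V"
 proof(intro equalityI subsetI)
  fix u assume "u : T' ` Vr (Suc r)"
  thus "u : V" unfolding T'_def using cut TV v(1) V_add V_sc by blast
 next
  fix u assume u: "u : V"
  obtain e where e: "e : Vr r" "T e = u - ?c u ** v" using red[OF u] T(2) by(metis bij_betw_imp_surj_on imageE)
  have "lk e r = 0" using e(1) by(auto simp: Vr_def ik)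
  hence "T' (e + ?c u ** ?e) = u" using e(2) by(simp add: T'_def lk_add)
  moreover have "e + ?c u ** ?e : Vr (Suc r)"
   using e(1) \<open>lk e r = 0\<close> by(intro Vr.V_add Vr.V_sc) (auto simp: Vr_def)
  ultimately show "u : T' ` Vr (Suc r)" by(metis imageI)
 qed
 ultimately show ?thesis unfolding bij_betw_def by blast
qed
qed
definition push :: "(vec => vec) => ('k::field) lau => 'k lau" where
"push T f = (SUM e:keys f. sng (T e) (lk f e))"

lemma push:
assumes T: "!!u v. T (u + v) = T u + T v" "bij_betw T M' M"
shows "push T (f + g) = push T f + push T g" "push T (f * g) = push T f * push T (g :: vec \<Rightarrow>\<^sub>0 'k::field)"
 "bij_betw (push T) (KM M') (KM M :: 'k lau set)" "push T 1 = (1 :: 'k lau)"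
proof -
have sup: "push T f = (SUM e:S. sng (T e) (lk f e))" if "finite S" "keys f <= S" for S and f :: "'k lau" and T
 unfolding push_def by(rule sum.mono_neutral_left) (use that in "auto simp: ik")
have add: "push T (f + g) = push T f + push T g" for f g :: "'k lau" and T
proof -
 have S: "finite (keys f Un keys g)" by simp
 show ?thesis unfolding sup[OF S keys_add] sup[OF S Un_upper1] sup[OF S Un_upper2] sum.distrib[symmetric]
  by(rule sum.cong) (simp_all add: lk_add single_add)
qed
show "push T (f + g) = push T f + push T g" by(rule add)
have single: "push T (sng e c) = sng (T e) c" for e and c :: 'k and T
 using sup[of "{e}" "sng e c" T] by(auto split: if_splits)
have T0: "T 0 = 0" using T(1)[of 0 0] by simp
show "push T 1 = (1 :: 'k lau)" unfolding single_one[symmetric] single T0 ..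
show "push T (f * g) = push T f * push T g"
proof(rule additive_eqI[where S = "%f. push T (f * g)" and T = "%f. push T f * push T g"])
 fix q c
 show "push T (sng q c * g) = push T (sng q c) * push T g"
  by(rule additive_eqI[where S = "%g. push T (sng q c * g)" and T = "%g. push T (sng q c) * push T g"])
   (simp_all add: distrib_left add single mult_single T(1))
qed (simp_all add: distrib_right add)
define T' where "T' = the_inv_into M' T"
have inv: "e : M' ==> T' (T e) = e" "v : M ==> T (T' v) = v" "e : M' ==> T e : M" "v : M ==> T' v : M'" for e v
 using T(2) unfolding T'_def bij_betw_def by(auto simp: the_inv_into_f_f f_the_inv_into_f intro: the_inv_into_into)
have psum: "push T (sum F A) = (SUM x:A. push T (F x))" for T and F :: "vec => 'k lau" and A
 by(induction A rule: fin_ind) (simp_all add: add, simp_all add: push_def)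
have pp: "push S (push U f) = f & push U f : KM B" if "f : KM A" "!!e. e : A ==> S (U e) = e & U e : B" for S U A B and f :: "'k lau"
proof -
 have k: "S (U e) = e" "U e : B" if "e : keys f" for e using that \<open>f : KM A\<close> \<open>!!e. e : A ==> _\<close> by(auto simp: KM_def)
 have "push S (push U f) = (SUM e:keys f. sng e (lk f e))"
  unfolding push_def[of U] psum single by(rule sum.cong) (use k in auto)
 thus ?thesis using k unfolding push_def[of U] by(auto simp: sum_sng intro!: KM_sum KM_sng)
qed
show "bij_betw (push T) (KM M') (KM M :: 'k lau set)"
 by(rule bij_betwI[where g = "push T'"]) (use pp[of _ M' T' T M] pp[of _ M T T' M'] inv in auto)
qed

text \<open>M is saturated in the group it generates, which can be a proper sublattice. In
  coordinates with respect to a basis of that group M becomes the set of all lattice points of a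
  cone, as \<open>sat_monoid\<close> requires.\<close>

theorem toric_ring:
fixes R :: "('a, 'b) ring_scheme" and deg :: "vec => int" and h :: "('k::field) lau => 'a"
assumes R: "typed_ring R (KM (msp Gs)) h" and Gs: "finite Gs" "Gs <= Vr m" and deg: "lin deg" "!!g. g : Gs ==> 0 < deg g"
 and sat: "!!u v k. u : msp Gs ==> v : msp Gs ==> 0 < k ==> int k ** (u - v) : msp Gs ==> u - v : msp Gs"
shows "cohen_macaulay_ring R & normal_domain R & (CHAR('k) = 0 --> rational_singularities R) &
 (CHAR('k) > 0 --> F_rational CHAR('k) R)"
proof -
let ?M = "msp Gs"
define V where "V = {u - v | u v. u : ?M & v : ?M}"
have V: "lattice_vec V"
proof
 show "0 : V" unfolding V_def using msp_0 by force
 fix x y assume "x : V" "y : V"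
 then obtain a b c d where "x = a - b" "y = c - d" "a : ?M" "b : ?M" "c : ?M" "d : ?M" by(auto simp: V_def)
 hence "x + y = (a + c) - (b + d)" "a + c : ?M" "b + d : ?M" by(auto intro: msp_add)
 thus "x + y : V" unfolding V_def by blast
qed (force simp: V_def)
have MV: "?M <= V" unfolding V_def using msp_0 by force
have MVr: "?M <= Vr m" using Gs(2) Vr.V_0 Vr.V_add by(intro msp_least) auto
hence "V <= Vr m" unfolding V_def using Vr.V_diff by blast
from sublattice_basis[OF V this] obtain r T where T: "!!u v. T (u + v) = T u + T v" "bij_betw T (Vr r) V" by blast
note Tsc = additive_sc[of T, OF T(1)]
have Tdiff: "T (u - v) = T u - T v" for u v using T(1)[of "u - v" v] by simp
have Tinj: "x = y" if "x : Vr r" "y : Vr r" "T x = T y" for x y using that T(2) by(auto simp: bij_betw_def inj_on_def)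
have Tsurj: "EX e:Vr r. T e = v" if "v : V" for v using that T(2) by(auto simp: bij_betw_def)
define M' where "M' = {e : Vr r. T e : ?M}"
define G' where "G' = {e : Vr r. T e : Gs}"
have bM: "bij_betw T M' ?M" unfolding bij_betw_def
proof
 show "inj_on T M'" using Tinj by(auto simp: M'_def intro!: inj_onI)
 show "T ` M' = ?M" using Tsurj MV by(force simp: M'_def)
qed
have G'M: "G' <= M'" using msp_gen by(auto simp: G'_def M'_def)
have finG: "finite G'" by(rule finite_imageD[of T]) (use Gs(1) Tinj in "auto simp: G'_def intro: finite_subset[of _ Gs] intro!: inj_onI")
have T0: "T 0 = 0" using T(1)[of 0 0] by simp
have M'span: "M' = msp G'"
proof(intro equalityI subsetI)
 fix e assume "e : M'"
 moreover have "EX e:Vr r Int msp G'. T e = u" if "u : ?M" for u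
  using that
 proof(induction rule: msp.induct)
  case msp_0
  show ?case using T0 Vr.V_0 msp.msp_0 by blast
 next
  case (msp_step u s)
  obtain e where e: "e : Vr r" "T e = s" using Tsurj MV msp_gen[OF msp_step(2)] by blast
  hence "e : G'" using msp_step(2) by(simp add: G'_def)
  thus ?case using msp_step(3) e T(1) msp.msp_step Vr.V_add by(metis Int_iff)
 qed
 ultimately show "e : msp G'" using Tinj unfolding M'_def by blast
next
 fix e assume "e : msp G'"
 moreover have "msp G' <= M'"
  by(rule msp_least[OF G'M]) (auto simp: M'_def T0 T(1) Vr.V_0 Vr.V_add msp_0 msp_add)
 ultimately show "e : M'" by blast
qed
obtain H0 where H0: "finite H0" "!!h. h : H0 ==> lin h" "!!u. u : Vr r ==> u : rc G' <-> (ALL h:H0. 0 <= h u)"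
proof -
 have "G' <= Vr r" by(auto simp: G'_def)
 from farkas[OF finG this] show thesis by(elim exE conjE) (rule that; blast)
qed
\<comment> \<open>A functional that vanishes on all generators vanishes on the whole lattice, which
  they span. Without these, the sum of the generators is positive for every member of
  \<open>H\<close>.\<close>
define H where "H = {h : H0. EX g:G'. h g ~= 0}"
have genV: "EX a b. u = a - b & a : M' & b : M'" if u: "u : Vr r" for u
proof -
 have "T u : V" using u T(2) by(auto simp: bij_betw_def)
 then obtain v w where vw: "T u = v - w" "v : ?M" "w : ?M" unfolding V_def by blast
 obtain a b where "v = T a" "w = T b" "a : M'" "b : M'" using bij_betw_imp_surj_on[OF bM] vw(2,3) by(metis imageE)
 with vw(1) have "T u = T a - T b" "a : M'" "b : M'" by auto
 thus ?thesis using Tinj[OF u, of "a - b"] Tdiff[of a b] Vr.V_diff[of a r b] by(auto simp: M'_def)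
qed
have h0: "h u = 0" if h: "h : H0" "h ~: H" and u: "u : Vr r" for h u
proof -
 have "h w = 0" if "w : msp G'" for w
  using that by(induction rule: msp.induct) (use h H0(2) in "auto simp: H_def lin_0 lin_add")
 thus ?thesis using genV[OF u] lin_diff[OF H0(2)[OF h(1)]] M'span by auto
qed
have rcM: "rc G' Int Vr r = M'"
proof(intro equalityI subsetI)
 fix u assume u: "u : rc G' Int Vr r"
 then obtain k where k: "0 < k" "int k ** u : M'" unfolding rc_def M'span by blast
 obtain a b where ab: "u = a - b" "a : M'" "b : M'" using genV u by blast
 have "int k ** (T a - T b) : ?M" using k(2) Tsc Tdiff[of a b] ab(1) by(simp add: M'_def)
 hence "T a - T b : ?M" using sat[of "T a" "T b" k] ab k(1) by(simp add: M'_def)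
 thus "u : M'" using ab(1) Tdiff[of a b] u by(simp add: M'_def)
next
 fix u assume "u : M'"
 hence "int 1 ** u : msp G'" "u : Vr r" using M'span by(auto simp: M'_def)
 thus "u : rc G' Int Vr r" unfolding rc_def using zero_less_one by blast
qed
have ndeg: "h g >= 0" if "h : H0" "g : G'" for h g
proof -
 have "g : rc G' Int Vr r" unfolding rcM using that G'M by blast
 thus ?thesis using H0(3)[of g] that by blast
qed
have posH: "0 < h (sum id G')" if h: "h : H" for h
proof -
 obtain g where g: "g : G'" "h g ~= 0" using h by(auto simp: H_def)
 have hH: "h : H0" using h by(simp add: H_def)
 have "0 < h g" using ndeg[OF hH g(1)] g(2) by simp
 also have "h g <= (SUM g:G'. h g)" using g(1) finG ndeg[OF hH] by(intro member_le_sum) auto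
 finally show ?thesis by(simp add: lin_sum[OF H0(2)[OF hH]])
qed
have sat: "sat_monoid M' G' (%u. deg (T u)) r H (sum id G')"
proof
 show "finite G'" "G' <= M'" by fact+
 show "lin (%u. deg (T u))" using deg(1) by(simp add: lin_def T(1))
 show "0 < deg (T g)" if "g : G'" for g using that deg(2) by(simp add: G'_def)
 show "0 : M'" unfolding M'span by(rule msp_0)
 show "u + v : M'" if "u : M'" "v : M'" for u v using that unfolding M'span by(rule msp_add)
 show "EX c. u = (SUM g:G'. int (c g) ** g)" if "u : M'" for u
  using that unfolding M'span
 proof(induction rule: msp.induct)
  case msp_0
  thus ?case by(intro exI[of _ "%_. 0"]) simp
 next
  case (msp_step u s)
  then obtain c where c: "u = (SUM g:G'. int (c g) ** g)" by blast
  have "(SUM g:G'. int (if g = s then 1 else 0) ** g) = (SUM g:G'. if g = s then s else 0)" by(rule sum.cong) auto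
  hence "u + s = (SUM g:G'. int (c g + (if g = s then 1 else 0)) ** g)"
   unfolding c of_nat_add frag_cmul_distrib sum.distrib using finG msp_step(2) by simp
  thus ?case by(intro exI[of _ "%g. c g + (if g = s then 1 else 0)"])
 qed
 show "M' = {u : Vr r. ALL h:H. 0 <= h u}"     proof(intro equalityI subsetI CollectI conjI ballI)
  show "0 <= h u" if "u : M'" "h : H" for u h
   using that H0(3)[of u] unfolding rcM[symmetric] H_def by blast
  fix u assume u: "u : {u : Vr r. ALL h:H. 0 <= h u}"
  have "0 <= h u" if "h : H0" for h using h0[OF that, of u] u by(cases "h : H") auto
  thus "u : M'" using H0(3)[of u] u unfolding rcM[symmetric] by blast
 qed (auto simp: M'_def)
 show "finite H" "!!h. h : H ==> lin h" using H0 by(auto simp: H_def)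
 show "sum id G' : Vr r" by(intro Vr.V_sum) (auto simp: G'_def)
 show "0 < h (sum id G')" if "h : H" for h by(rule posH[OF that])
qed
interpret sat_monoid M' G' "%u. deg (T u)" r H "sum id G'" by(rule sat)
interpret typed_ring R "KM ?M" h by(rule R)
note p = push[of T M' ?M, OF T(1) bM]
have pK: "push T f : KM ?M" if "f : KM M'" for f :: "'k lau" using p(3)[where 'k = 'k] that by(auto simp: bij_betw_def)
have R': "typed_ring R (KM M') (%f. h (push T f))"
proof unfold_locales
 show "sbr (KM M' :: 'k lau set)" by(rule sbr_KM)
 show "bij_betw (%f. h (push T f)) (KM M') (cr R)" using bij_betw_trans[OF p(3) bij] by(simp only: comp_def)
qed (simp_all only: p(1,2,4) h_add h_mult h_1 pK)
have "rational_singularities R" if "CHAR('k) = 0"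
 by(rule laurent.rational_singularities_KM[OF laurent.intro[OF sat R'] that])
thus ?thesis using cohen_macaulay_KM[OF R'] normal_KM(2)[OF R'] F_rational_KM[OF R'] by blast
qed
type_synonym ('n, 'k) pol = "('n, 'k) mpol Polynomial.poly"

section \<open>Powers of monomial ideals\<close>
interpretation P: typed_ring "ring_of_type_algebra :: 'a::comm_ring_1 ring" UNIV "%x. x"
by(intro typed_ring.intro typed_ring_axioms.intro cring_from_type_algebra)
 (auto simp: sbr_def ring_of_type_algebra_def bij_betw_def)

lemma pring_simps [simp]:
"cr (ring_of_type_algebra :: 'a::comm_ring_1 ring) = UNIV"
"x *.\<^bsub>ring_of_type_algebra\<^esub> (y :: 'a) = x * y" "x +.\<^bsub>ring_of_type_algebra\<^esub> (y :: 'a) = x + y"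
"\<one>\<^bsub>ring_of_type_algebra\<^esub> = (1 :: 'a)" "\<zero>\<^bsub>ring_of_type_algebra\<^esub> = (0 :: 'a)"
by(simp_all add: ring_of_type_algebra_def)

lemma xpow_mult: "xpow a * xpow b = (xpow (a + b) :: ('n, 'k::field) mpol)"
by(simp add: xpow_def mult_single)

lemma xpow_KM: "(xpow a :: ('n, 'k::field) mpol) : KM A <-> a : A"
by(simp add: xpow_def KM_def)

lemma KM_least:
assumes "ideal J (pring :: ('n, 'k::field) mpol ring)" "xpow ` A <= J"
shows "KM A <= J"
proof
note J = P.pre_ideal[OF assms(1), unfolded ideal_in_def P.pre_def, simplified]
fix f :: "('n, 'k) mpol" assume f: "f : KM A"
have k: "sng a c : J" if "a : keys f" for a c
proof -
 have "xpow a : J" using f assms(2) that by(auto simp: KM_def)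
 hence "cst c * xpow a : J" using J by blast
 thus ?thesis by(simp add: xpow_def mult_single)
qed
have "(SUM a:S. sng a (lk f a)) : J" if "S <= keys f" for S
 using that J k by(induction S rule: fin_ind) auto
from this[of "keys f"] show "f : J" by(simp add: sum_sng)
qed
definition upc :: "('a::comm_monoid_add) set => bool" where "upc E <-> (ALL a:E. ALL b. a + b : E)"

lemma KM_ideal: "upc E ==> ideal (KM E) (pring :: ('n, 'k::field) mpol ring)"
proof -
assume E: "upc E"
have "d * f : KM E" if "f : KM E" for d f :: "('n, 'k) mpol"
 using keys_mult[of d f] that E by(force simp: KM_def upc_def add.commute)
hence "ideal_in UNIV (KM E :: ('n, 'k) mpol set)" by(auto simp: ideal_in_def KM_add)
from P.image_ideal[OF this] show ?thesis by simp
qed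

lemma Idl_xpow: "Idl\<^bsub>pring\<^esub> (xpow ` M) = (KM {a + b | a b. a : M} :: ('n, 'k::field) mpol set)"
proof(intro equalityI)
have "upc {a + b | a b. a : M}" by(force simp: upc_def add.assoc)
thus "Idl\<^bsub>pring\<^esub> (xpow ` M) <= (KM {a + b | a b. a : M} :: ('n, 'k) mpol set)"
 by(intro P.genideal_minimal KM_ideal) (auto simp: xpow_KM, metis add.right_neutral)
have id: "ideal (Idl\<^bsub>pring\<^esub> (xpow ` M)) (pring :: ('n, 'k) mpol ring)" by(rule P.genideal_ideal) simp
have "xpow (a + b) : (Idl\<^bsub>pring\<^esub> (xpow ` M) :: ('n, 'k) mpol set)" if "a : M" for a b
 using ideal.I_l_closed[OF id, of "xpow a" "xpow b"] P.genideal_self[of "xpow ` M :: ('n, 'k) mpol set"] that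
 by(auto simp: xpow_mult add.commute)
thus "KM {a + b | a b. a : M} <= (Idl\<^bsub>pring\<^esub> (xpow ` M) :: ('n, 'k) mpol set)" by(intro KM_least[OF id]) auto
qed

lemma mono_KM:
"monomial_ideal I <-> upc {a. xpow a : I} & I = (KM {a. xpow a : I} :: ('n, 'k::field) mpol set)"
proof
assume "monomial_ideal I"
then obtain M where I: "I = KM {a + b | a b. a : M}" unfolding monomial_ideal_def Idl_xpow by blast
show "upc {a. xpow a : I} & I = KM {a. xpow a : I}" unfolding I xpow_KM upc_def by(simp, metis add.assoc)
next
let ?E = "{a. xpow a : I}"
assume h: "upc ?E & I = KM ?E"
have "a : {a + b | a b. a : ?E}" if "a : ?E" for a
 using that by(intro CollectI exI[of _ a] exI[of _ 0]) simp
moreover have "{a + b | a b. a : ?E} <= ?E" using h unfolding upc_def by blast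
ultimately have "{a + b | a b. a : ?E} = ?E" by blast
hence "I = Idl\<^bsub>pring\<^esub> (xpow ` ?E)" unfolding Idl_xpow using h by simp
thus "monomial_ideal I" unfolding monomial_ideal_def by(rule exI)
qed
text \<open>Exponents of the k-th power of a monomial ideal; the zeroth power is the unit ideal,
  hence \<open>UNIV\<close>.\<close>

primrec epow :: "('a::comm_monoid_add) set => nat => 'a set" where
"epow E 0 = UNIV"
| "epow E (Suc k) = {a + b | a b. a : epow E k & b : E}"

lemma upc_epow: "upc E ==> upc (epow E k)"
unfolding upc_def by(induction k) (simp, simp, metis add.assoc)

lemma ipow_KM:
assumes "upc E"
shows "ideal_power (KM E :: ('n, 'k::field) mpol set) k = KM (epow E k)"
proof(induction k)
case 0
thus ?case by(simp add: ideal_power_def ideals_set_def KM_def)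
next
case (Suc k)
let ?A = "epow E k"
have "ideal_prod pring (KM ?A) (KM E) = (KM (epow E (Suc k)) :: ('n, 'k) mpol set)"
proof(intro equalityI subsetI)
 fix f :: "('n, 'k) mpol" assume "f : ideal_prod pring (KM ?A) (KM E)"
 thus "f : KM (epow E (Suc k))"
 proof(induction rule: ideal_prod.induct)
  case (prod i j)
  thus ?case using keys_mult[of i j] by(fastforce simp: KM_def)
 qed (simp add: KM_add)
next
 fix f :: "('n, 'k) mpol" assume "f : KM (epow E (Suc k))"
 moreover have "ideal (ideal_prod pring (KM ?A) (KM E)) (pring :: ('n, 'k) mpol ring)"
  by(intro P.ideal_prod_is_ideal KM_ideal upc_epow assms)
 moreover have "xpow (a + b) : ideal_prod pring (KM ?A) (KM E :: ('n, 'k) mpol set)" if "a : ?A" "b : E" for a b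
  using ideal_prod.prod[of "xpow a" "KM ?A" "xpow b" "KM E" "pring :: ('n, 'k) mpol ring"] that by(simp add: xpow_KM xpow_mult)
 ultimately show "f : ideal_prod pring (KM ?A) (KM E)" using KM_least[of _ "epow E (Suc k)"] by(force simp: image_subset_iff)
qed
thus ?case using Suc by(simp add: ideal_power_def ideals_set_def)
qed

lemma epow_add: "epow E (k + l) = {a + b | a b. a : epow E k & b : epow E l}" if "upc E"
proof(induction l)
case 0
have "a + b : epow E k" if "a : epow E k" for a b using upc_epow[OF \<open>upc E\<close>, of k] that by(auto simp: upc_def)
thus ?case by(force intro: exI[of _ 0])
next
case (Suc l)
have "epow E (k + Suc l) = {a + b + c | a b c. a : epow E k & b : epow E l & c : E}" unfolding add_Suc_right epow.simps Suc by blast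
also have "... = {a + b | a b. a : epow E k & b : epow E (Suc l)}" by(auto simp: add.assoc)
finally show ?case .
qed

lemma epow_epow: "upc E ==> epow (epow E k) m = epow E (m * k)"
by(induction m) (simp_all add: epow_add[symmetric] add.commute[of k] flip: epow_add)

lemma xpow_power: "xpow a ^ m = (xpow (SUM i<m. a) :: ('n, 'k::field) mpol)"
by(induction m) (simp_all add: xpow_mult add.commute, simp add: xpow_def)

text \<open>x^a is a root of z^m - x^(m a), which is an integral equation over the k-th
  power.\<close>

lemma normal_saturated:
assumes "upc E" "normal_ideal (KM E :: ('n, 'k::field) mpol set)" "1 <= k" "1 <= m" "(SUM i<m. a) : epow E (m * k)"
shows "a : epow E k"
proof -
let ?c = "%i. if i = m then - (xpow (SUM i<m. a) :: ('n, 'k) mpol) else 0"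
have "- (xpow (SUM i<m. a) :: ('n, 'k) mpol) : KM (epow E (m * k))" using assms(5) by(intro KM_uminus) (simp add: xpow_KM)
hence "ALL i:{1..m}. ?c i : ideal_power (ideal_power (KM E) k) i"
 using assms(1) by(auto simp: ipow_KM upc_epow epow_epow)
moreover have "(SUM i=1..m. ?c i * xpow a ^ (m - i)) = (SUM i=1..m. if i = m then ?c m else 0)" by(rule sum.cong) auto
hence "xpow a ^ m + (SUM i=1..m. ?c i * xpow a ^ (m - i)) = 0" using assms(4) by(simp add: xpow_power)
ultimately have "(xpow a :: ('n, 'k) mpol) : integral_closure (ideal_power (KM E) k)" unfolding integral_closure_def by(intro CollectI exI[of _ m] exI[of _ ?c] conjI)
thus ?thesis using assms(1,2,3) by(simp add: normal_ideal_def ipow_KM xpow_KM)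
qed

lemma expdeg_add: "expdeg (a + b) = expdeg a + expdeg b"
by(simp add: expdeg_def lk_add sum.distrib)

text \<open>Among the divisors of an exponent within \<open>E\<close>, one of least degree is a
  minimal generator and thus has degree d.\<close>

lemma equigenerated_bound:
assumes "upc E" "equigenerated (KM E :: ('n::finite, 'k::field) mpol set)"
shows "EX d. ALL b:E. EX g:E. expdeg g = d & (EX c. b = g + c)"
proof -
obtain d where d: "ALL a:min_mono_gens (KM E :: ('n, 'k) mpol set). expdeg a = d" using assms(2) by(auto simp: equigenerated_def)
have "EX g:E. expdeg g = d & (EX c. b = g + c)" if b: "b : E" for b
proof -
 define Q where "Q g <-> g : E & (EX c. b = g + c)" for g
 have "Q b" using b by(force simp: Q_def intro: exI[of _ 0])
 from ex_has_least_nat[of Q, OF this, of expdeg] obtain g where g: "Q g" "!!g'. Q g' ==> expdeg g <= expdeg g'" by blast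
 have "b' = g" if b': "b' : E" "(xpow b' :: ('n, 'k) mpol) dvd xpow g" for b'
 proof -
  obtain q where "(xpow g :: ('n, 'k) mpol) = xpow b' * q" using b'(2) by(auto simp: dvd_def)
  moreover have "g : keys (xpow g :: ('n, 'k) mpol)" by(simp add: xpow_def)
  ultimately obtain c where c: "g = b' + c" using keys_mult[of "xpow b'" q] by(force simp: xpow_def)
  hence "Q b'" using g(1) b'(1) by(auto simp: Q_def add.assoc)
  hence "expdeg c = 0" using g(2)[of b'] by(simp add: c expdeg_add)
  hence "c = 0" by(intro pmI) (simp add: expdeg_def)
  thus ?thesis using c by simp
 qed
 hence "g : min_mono_gens (KM E :: ('n, 'k) mpol set)" using g(1) by(auto simp: min_mono_gens_def xpow_KM Q_def)
 thus ?thesis using d g(1) by(auto simp: Q_def)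
qed
thus ?thesis by blast
qed

section \<open>Rees ring and special fiber ring as toric rings\<close>
definition idx :: "'n::finite => nat" where "idx = (SOME f. bij_betw f UNIV {..<card (UNIV :: 'n set)})"

lemma idx: "bij_betw (idx :: 'n::finite => nat) UNIV {..<card (UNIV :: 'n set)}"
proof -
have "EX f :: 'n => nat. bij_betw f UNIV {..<card (UNIV :: 'n set)}" using ex_bij_betw_finite_nat[of "UNIV :: 'n set"] by(simp add: atLeast0LessThan)
thus ?thesis unfolding idx_def by(rule someI_ex)
qed

lemma idx_inj: "idx j = idx k <-> (j :: 'n::finite) = k" and idx_less: "idx (j :: 'n) < card (UNIV :: 'n set)"
and idx_surj: "i < card (UNIV :: 'n set) ==> EX j :: 'n. i = idx j"
using bij_betw_imp_inj_on[OF idx[where 'n = 'n]] bij_betw_imp_surj_on[OF idx[where 'n = 'n]] by(auto simp: inj_on_eq_iff)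
text \<open>The monomial x^a t^i as an integer vector; the exponent of t occupies the last
  coordinate.\<close>

definition ve :: "('n::finite \<Rightarrow>\<^sub>0 nat) \<times> nat => vec" where
"ve x = (SUM j:UNIV. sng (idx j) (int (lk (fst x) j))) + sng (card (UNIV :: 'n set)) (int (snd x))"

lemma lk_ve:
fixes x :: "('n::finite \<Rightarrow>\<^sub>0 nat) \<times> nat"
shows "lk (ve x) (idx j) = int (lk (fst x) j)" "lk (ve x) (card (UNIV :: 'n set)) = int (snd x)" "card (UNIV :: 'n set) < i ==> lk (ve x) i = 0"
proof -
note i = idx_inj[where 'n = 'n] idx_less[where 'n = 'n]
have "lk (ve x) (idx j) = (SUM k:UNIV. if k = j then int (lk (fst x) j) else 0)"
 unfolding ve_def lk_add lk_sum using i(2)[of j] less_imp_neq[OF i(2)[of j]] by(auto simp: lk_sng when_def i intro: sum.cong)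
thus "lk (ve x) (idx j) = int (lk (fst x) j)" by simp
show "lk (ve x) (card (UNIV :: 'n set)) = int (snd x)" "card (UNIV :: 'n set) < i ==> lk (ve x) i = 0"
 unfolding ve_def lk_add lk_sum using i(2)
 by(auto simp: lk_sng when_def less_not_refl3[OF i(2)] dest: less_trans[OF i(2)] intro!: sum.neutral)
qed

lemma ve_eqI:
assumes "!!j. lk u (idx (j :: 'n::finite)) = lk v (idx j)" "lk u (card (UNIV :: 'n set)) = lk v (card (UNIV :: 'n set))"
 "!!i. card (UNIV :: 'n set) < i ==> lk u i = (lk v i :: int)"
shows "u = v"
proof(rule pmI)
fix i
show "lk u i = lk v i" using assms idx_surj[where 'n = 'n] by(metis linorder_neqE_nat)
qed

lemma ve_add: "ve (fst x + fst y, snd x + snd y) = ve x + ve (y :: ('n::finite \<Rightarrow>\<^sub>0 nat) \<times> nat)"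
by(rule ve_eqI[where 'n = 'n]) (simp_all add: lk_ve lk_add)

lemma inj_ve: "inj (ve :: ('n::finite \<Rightarrow>\<^sub>0 nat) \<times> nat => vec)"
proof(rule injI)
fix x y :: "('n \<Rightarrow>\<^sub>0 nat) \<times> nat" assume "ve x = ve y"
hence "int (lk (fst x) j) = int (lk (fst y) j)" "int (snd x) = int (snd y)" for j
 by(simp_all flip: lk_ve)
thus "x = y" by(intro prod_eqI pmI) simp_all
qed

lemma ve_Vr: "ve (x :: ('n::finite \<Rightarrow>\<^sub>0 nat) \<times> nat) : Vr (Suc (card (UNIV :: 'n set)))"
using lk_ve(3)[where x = x] unfolding Vr_def by(auto simp: ik) (meson not_less_eq)

text \<open>If a positive multiple of the difference has nonnegative entries, so has the difference,
  and the truncated subtractions in the witness are exact.\<close>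

lemma ve_divide:
fixes x y z :: "('n::finite \<Rightarrow>\<^sub>0 nat) \<times> nat"
assumes "0 < k" "int k ** (ve x - ve y) = ve z"
shows "EX w. ve x - ve y = ve w & fst z = (SUM i<k. fst w) & snd z = k * snd w"
proof -
let ?w = "(fst x - fst y, snd x - snd y)"
have e: "int k * (int a - int b) = int c ==> int a - int b = int (a - b) & c = k * (a - b)" for a b c
proof -
 assume h: "int k * (int a - int b) = int c"
 hence "0 <= int k * (int a - int b)" by simp
 hence "b <= a" using assms(1) by(simp add: zero_le_mult_iff)
 thus ?thesis using h by(metis of_nat_diff of_nat_eq_iff of_nat_mult)
qed
have l: "int k * (lk (ve x) i - lk (ve y) i) = lk (ve z) i" for i
 using arg_cong[OF assms(2), of "%u. lk u i"] by(simp add: lk_diff)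
have a: "int (lk (fst x) j) - int (lk (fst y) j) = int (lk (fst x) j - lk (fst y) j) &
  lk (fst z) j = k * (lk (fst x) j - lk (fst y) j)" for j using l[of "idx j"] by(intro e) (simp add: lk_ve)
have b: "int (snd x) - int (snd y) = int (snd x - snd y) & snd z = k * (snd x - snd y)"
 using l[of "card (UNIV :: 'n set)"] by(intro e) (simp add: lk_ve)
have "ve x - ve y = ve ?w" by(rule ve_eqI[where 'n = 'n]) (simp_all add: lk_ve lk_diff conjunct1[OF a] conjunct1[OF b])
moreover have "fst z = (SUM i<k. fst ?w)" by(rule pmI) (use a in "simp add: lk_diff lk_sum")
ultimately show ?thesis using b by(intro exI[of _ ?w]) simp
qed
definition rmon :: "('n \<Rightarrow>\<^sub>0 nat) \<times> nat => 'k::field => ('n, 'k) pol" where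
"rmon x c = Polynomial.monom (sng (fst x) c) (snd x)"
text \<open>Decodes exponent vectors into monomials x^a t^i. Multiplicativity is proved on the range
  of \<open>ve\<close>, where \<open>inv_into\<close> is a true inverse.\<close>

definition rm :: "('k::field) lau => ('n::finite, 'k) pol" where
"rm f = (SUM v:keys f. rmon (inv_into UNIV ve v) (lk f v))"

lemma rm_add: "rm (f + g) = (rm f + rm g :: ('n::finite, 'k::field) pol)"
proof -
have s: "rm f = (SUM v:S. rmon (inv_into UNIV ve v) (lk f v) :: ('n, 'k) pol)"
 if "finite S" "keys f <= S" for S and f :: "'k lau"
 unfolding rm_def by(rule sum.mono_neutral_left) (use that in "auto simp: ik rmon_def")
have S: "finite (keys f Un keys g)" by simp
show ?thesis unfolding s[OF S keys_add] s[OF S Un_upper1] s[OF S Un_upper2] sum.distrib[symmetric]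
 by(rule sum.cong) (simp_all add: lk_add single_add add_monom rmon_def)
qed

lemma rm_sum: "rm (sum F A) = (SUM x:A. rm (F x) :: ('n::finite, 'k::field) pol)"
by(induction A rule: fin_ind) (simp_all add: rm_add, simp_all add: rm_def)

lemma rm_single: "rm (sng (ve x) c) = (Polynomial.monom (sng (fst x) c) (snd x) :: ('n::finite, 'k::field) pol)"
by(cases "c = 0") (simp_all add: rm_def rmon_def inv_f_f[OF inj_ve])

lemma rm_mult:
fixes f g :: "('k::field) lau"
assumes "f : KM (range (ve :: ('n::finite \<Rightarrow>\<^sub>0 nat) \<times> nat => vec))" "g : KM (range (ve :: ('n \<Rightarrow>\<^sub>0 nat) \<times> nat => vec))"
shows "rm (f * g) = (rm f * rm g :: ('n, 'k) pol)"
proof -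
let ?m = "%(f :: 'k lau) v. sng v (lk f v)"
have s: "rm (?m f u * ?m g v) = (rm (?m f u) * rm (?m g v) :: ('n, 'k) pol)" if "u : keys f" "v : keys g" for u v
proof -
 have "u : range (ve :: ('n \<Rightarrow>\<^sub>0 nat) \<times> nat => vec)" "v : range (ve :: ('n \<Rightarrow>\<^sub>0 nat) \<times> nat => vec)" using assms that unfolding KM_def by blast+
 then obtain x y :: "('n \<Rightarrow>\<^sub>0 nat) \<times> nat" where "u = ve x" "v = ve y" by blast
 thus ?thesis by(simp add: mult_single rm_single mult_monom flip: ve_add)
qed
have "rm ((SUM u:keys f. ?m f u) * (SUM v:keys g. ?m g v)) = (SUM u:keys f. SUM v:keys g. rm (?m f u) * rm (?m g v) :: ('n, 'k) pol)"
 unfolding sum_product rm_sum by(intro sum.cong refl) (simp add: s)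
also have "... = rm (SUM u:keys f. ?m f u) * rm (SUM v:keys g. ?m g v)" unfolding rm_sum sum_product ..
finally show ?thesis by(simp add: sum_sng)
qed

lemma lookup_rm:
fixes f :: "('k::field) lau"
assumes "f : KM (range (ve :: ('n::finite \<Rightarrow>\<^sub>0 nat) \<times> nat => vec))"
shows "lk (pco (rm f) i :: ('n, 'k) mpol) a = lk f (ve (a, i))"
proof -
have "lk (pco (rm f) i) a = (SUM v:keys f. if v = ve (a, i) then lk f (ve (a, i)) else 0)"
 unfolding rm_def Polynomial.coeff_sum lk_sum
proof(rule sum.cong[OF refl])
 fix v assume "v : keys f"
 then obtain x :: "('n \<Rightarrow>\<^sub>0 nat) \<times> nat" where "v = ve x" using assms unfolding KM_def by blast
 thus "lk (pco (rmon (inv_into UNIV ve v) (lk f v)) i) a =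
  (if v = ve (a, i) then lk f (ve (a, i)) else 0)"
  by(cases x) (auto simp: rmon_def inv_f_f[OF inj_ve] lk_sng when_def inj_eq[OF inj_ve])
qed
thus ?thesis by(simp add: ik)
qed

locale eq_normal =
fixes E :: "('n::{finite,linorder} \<Rightarrow>\<^sub>0 nat) set" and d :: nat and I :: "('n, 'k::field) mpol set"
assumes up: "upc E" and I: "I = KM E" and norm: "normal_ideal I"
 and d: "b : E ==> EX g:E. expdeg g = d & (EX c. b = g + c)"
begin
abbreviation vn :: "('n \<Rightarrow>\<^sub>0 nat) \<times> nat => vec" where "vn == ve"
text \<open>Exponents of the Rees ring; in degree i of t all x-degrees are at least i d, and
  \<open>MA\<close> is the face where this minimum is attained.\<close>

definition MR where "MR = vn ` {x. fst x : epow E (snd x)}"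
definition MA where "MA = vn ` {x. fst x : epow E (snd x) & expdeg (fst x) = snd x * d}"

lemma MR_iff: "vn (a, i) : MR <-> a : epow E i" and MA_iff: "vn (a, i) : MA <-> a : epow E i & expdeg a = i * d"
by(force simp: MR_def MA_def inj_eq[OF inj_ve])+

lemma MR_E: "u : MR ==> EX a i. u = vn (a, i)"
by(auto simp: MR_def)

lemma vn_add: "vn (a, i) + vn (b, j) = vn (a + b, i + j)" and vn_0: "vn (0, 0) = 0"
using ve_add[of "(a, i)" "(b, j)"] ve_add[of "(0, 0)" "(0, 0) :: ('n \<Rightarrow>\<^sub>0 nat) \<times> nat"] by simp_all

lemma Rees_carrier: "cr (rees_ring I) = {p. ALL i. pco p i : KM (epow E i)}"
by(simp add: rees_ring_def I ipow_KM[OF up])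

lemma epow_plus: "a : epow E i ==> b : epow E j ==> a + b : epow E (i + j)"
unfolding epow_add[OF up] by blast

lemma MR_0: "0 : MR" and MR_add: "u : MR ==> v : MR ==> u + v : MR"
and MA_0: "0 : MA" and MA_add: "u : MA ==> v : MA ==> u + v : MA" and MAR: "MA <= MR" and MRr: "MR <= range vn"
proof -
show "0 : MR" "0 : MA" unfolding vn_0[symmetric] MR_iff MA_iff by(simp_all add: expdeg_def)
show "MA <= MR" "MR <= range vn" by(auto simp: MR_def MA_def)
show "u + v : MR" if "u : MR" "v : MR" using MR_E[OF that(1)] MR_E[OF that(2)] that by(auto simp: vn_add MR_iff epow_plus)
show "u + v : MA" if "u : MA" "v : MA"
proof -
 have "u : MR" "v : MR" using that by(auto simp: MR_def MA_def)
 thus ?thesis using MR_E[of u] MR_E[of v] that by(auto simp: vn_add MA_iff epow_plus expdeg_add distrib_right)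
qed
qed

lemma KMr: "f : KM MR ==> f : KM (range vn)"
using MRr by(auto simp: KM_def)

lemma rees_typed: "typed_ring (rees_ring I) (KM MR :: 'k lau set) rm"
proof(intro typed_ring.intro typed_ring_axioms.intro)
have "subring (cr (rees_ring I)) (ring_of_type_algebra :: ('n, 'k) pol ring)"
 unfolding Rees_carrier
proof(rule P.subringI)
 let ?C = "{p :: ('n, 'k) pol. ALL i. pco p i : KM (epow E i)}"
 fix p q :: "('n, 'k) pol"
 assume p: "p : ?C"
 have "\<ominus>\<^bsub>ring_of_type_algebra\<^esub> p = - p" using P.h_minus[of p] by simp
 thus "\<ominus>\<^bsub>ring_of_type_algebra\<^esub> p : ?C" using p by(auto intro: KM_uminus)
 assume q: "q : ?C"
 have "pco p j * pco q (i - j) : KM (epow E i)" if "j <= i" for i j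
  unfolding KM_def
 proof(intro CollectI subsetI)
  fix a assume "a : keys (pco p j * pco q (i - j))"
  hence "a : {b + c | b c. b : keys (pco p j) & c : keys (pco q (i - j))}" using keys_mult by blast
  then obtain b c where "a = b + c" "b : keys (pco p j)" "c : keys (pco q (i - j))" by blast
  moreover from this(2,3) have "b : epow E j" "c : epow E (i - j)" using p q by(auto simp: KM_def)
  ultimately show "a : epow E i" using epow_plus[of b j c "i - j"] that by simp
 qed
 thus "p *.\<^bsub>ring_of_type_algebra\<^esub> q : ?C"
  by(auto simp: Polynomial.coeff_mult intro!: KM_sum)
 show "p +.\<^bsub>ring_of_type_algebra\<^esub> q : ?C" using p q by(auto intro: KM_add)
next
 show "\<one>\<^bsub>ring_of_type_algebra\<^esub> : {p :: ('n, 'k) pol. ALL i. pco p i : KM (epow E i)}"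
  by(auto simp: Polynomial.coeff_1 KM_def)
qed simp
thus "cring (rees_ring I)" unfolding rees_ring_def using P.subcringI' P.subcring_iff by force
have "rm f : cr (rees_ring I)" if "f : KM MR" for f :: "'k lau"
 unfolding Rees_carrier KM_def
proof(intro CollectI allI subsetI)
 fix i a assume "a : keys (pco (rm f) i :: ('n, 'k) mpol)"
 hence "vn (a, i) : MR" using that by(auto simp: ik lookup_rm[OF KMr[OF that]] KM_def subset_iff)
 thus "a : epow E i" by(simp add: MR_iff)
qed
moreover have "inj_on (rm :: _ => ('n, 'k) pol) (KM MR)"
proof(rule inj_onI, rule pmI)
 fix f g v assume h: "f : KM MR" "g : KM MR" "(rm f :: ('n, 'k) pol) = rm g"
 show "lk f v = lk g v"
 proof(cases "v : range (vn :: ('n \<Rightarrow>\<^sub>0 nat) \<times> nat => vec)")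
  case True
  then obtain a i where "v = vn (a :: 'n \<Rightarrow>\<^sub>0 nat, i)" by auto
  thus ?thesis using lookup_rm[OF KMr[OF h(1)], of i a] lookup_rm[OF KMr[OF h(2)], of i a] h(3) by simp
 next
  case False
  hence "v ~: keys f" "v ~: keys g" using KMr[OF h(1)] KMr[OF h(2)] by(auto simp: KM_def)
  thus ?thesis by(simp add: ik)
 qed
qed
moreover have "p : rm ` KM MR" if p: "p : cr (rees_ring I)" for p
proof(rule image_eqI)
 let ?f = "SUM i<=Polynomial.degree p. SUM a:keys (pco p i). sng (vn (a, i)) (lk (pco p i) a)"
 have "rm ?f = (SUM i<=Polynomial.degree p. Polynomial.monom (SUM a:keys (pco p i). sng a (lk (pco p i) a)) i)"
  by(simp add: rm_sum rm_single monom_sum)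
 thus "p = rm ?f" by(simp add: sum_sng poly_as_sum_of_monoms)
 show "?f : KM MR" using p by(intro KM_sum KM_sng) (auto simp: Rees_carrier MR_iff KM_def)
qed
ultimately show "bij_betw (rm :: _ => ('n, 'k) pol) (KM MR) (cr (rees_ring I))" unfolding bij_betw_def by blast
have "rm (sng (vn (0, 0)) (1 :: 'k)) = (1 :: ('n, 'k) pol)" unfolding rm_single by(simp add: monom_0 flip: one_pCons)
thus "rm 1 = \<one>\<^bsub>rees_ring I\<^esub>" unfolding vn_0 by(simp add: rees_ring_def)
qed (use sbr_KMI[OF MR_0 MR_add] in "simp_all add: rees_ring_def rm_add rm_mult KMr")
sublocale R: typed_ring "rees_ring I" "KM MR :: 'k lau set" rm by(rule rees_typed)

text \<open>The root of a monomial lies in the right power of I by normality. Equality of degrees is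
  additive, so it passes to differences on the face.\<close>

lemma sat:
assumes asm: "u : MR" "v : MR" "0 < k" "int k ** (u - v) : MR"
shows "u - v : MR" "u : MA ==> v : MA ==> u - v : MA"
proof -
obtain x y z where xyz: "u = vn x" "v = vn y" "int k ** (u - v) = vn z" "fst z : epow E (snd z)"
 using asm(1,2,4) unfolding MR_def by blast
obtain w where w: "u - v = vn w" "fst z = (SUM i<k. fst w)" "snd z = k * snd w" using ve_divide[OF asm(3), of x y z] xyz by auto
have wE: "fst w : epow E (snd w)"
proof(cases "snd w = 0")
 case False
 thus ?thesis using normal_saturated[OF up norm[unfolded I], of "snd w" k "fst w"] xyz(4) w asm(3) by simp
qed simp
thus "u - v : MR" using w(1) by(cases w) (simp add: MR_iff)
assume "u : MA" "v : MA"
hence xy: "expdeg (fst x) = snd x * d" "expdeg (fst y) = snd y * d" using xyz by(cases x; cases y; simp add: MA_iff)+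
have "vn x = vn w + vn y" using w(1) xyz by(simp add: algebra_simps)
hence "x = (fst w + fst y, snd w + snd y)" by(simp add: inj_eq[OF inj_ve] flip: ve_add)
hence "expdeg (fst w) = snd w * d" using xy by(cases x) (simp add: expdeg_add distrib_right)
thus "u - v : MA" using w(1) wE by(cases w) (simp add: MA_iff)
qed

lemma epow_bound: "a : epow E i ==> EX g:epow E i. expdeg g = i * d & (EX c. a = g + c)"
proof(induction i arbitrary: a)
case (Suc i)
then obtain b e where ab: "a = b + e" "b : epow E i" "e : E" by auto
obtain g c g' c' where "g : epow E i" "expdeg g = i * d" "b = g + c" "g' : E" "expdeg g' = d" "e = g' + c'"
 using Suc.IH[OF ab(2)] d[OF ab(3)] by blast
moreover hence "g + g' : epow E (Suc i)" by auto
moreover have "g + c + (g' + c') = g + g' + (c + c')" by(simp add: ac_simps)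
ultimately show ?case using ab(1) by(intro bexI[of _ "g + g'"]) (auto simp: expdeg_add)
next
case 0
thus ?case by(intro bexI[of _ 0]) (auto simp: expdeg_def)
qed
definition GA where "GA = (%g. vn (g, 1)) ` {g : E. expdeg g = d}"
definition GR where "GR = GA Un range (%j. vn (sng (j :: 'n) 1, 0))"

lemma finite_GA: "finite GA"
proof -
have "{g :: 'n \<Rightarrow>\<^sub>0 nat. expdeg g = d} <= (%f. Abs_poly_mapping f) ` (UNIV \<rightarrow>\<^sub>E {..d})"
proof
 fix g :: "'n \<Rightarrow>\<^sub>0 nat" assume "g : {g. expdeg g = d}"
 hence "lk g j <= d" for j using member_le_sum[of j UNIV "lk g"] by(auto simp: expdeg_def)
 thus "g : (%f. Abs_poly_mapping f) ` (UNIV \<rightarrow>\<^sub>E {..d})" by(intro image_eqI[of _ _ "lk g"]) (auto simp: lookup_inverse)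
qed
hence "finite {g :: 'n \<Rightarrow>\<^sub>0 nat. expdeg g = d}" by(rule finite_subset) (intro finite_imageI finite_PiE; simp)
thus ?thesis unfolding GA_def by(auto intro: finite_subset[rotated])
qed

lemma GA_MA: "GA <= MA"
proof -
have "g : epow E 1" if "g : E" for g using that by(auto intro: exI[of _ 0])
hence "vn (g, 1) : MA" if "g : E" "expdeg g = d" for g using that MA_iff[of g 1] by simp
thus ?thesis unfolding GA_def by blast
qed

lemma MA_span: "MA = msp GA"
proof(intro equalityI subsetI)
have "vn (a, i) : msp GA" if "a : epow E i" "expdeg a = i * d" for a i
 using that
proof(induction i arbitrary: a)
 case 0
 have "a = 0" using 0 by(intro pmI) (simp add: expdeg_def)
 thus ?case by(simp add: msp_0 vn_0)
next
 case (Suc i)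
 then obtain b e where ab: "a = b + e" "b : epow E i" "e : E" by auto
 obtain g c g' c' where gc: "expdeg g = i * d" "b = g + c" "expdeg g' = d" "e = g' + c'"
  using epow_bound[OF ab(2)] d[OF ab(3)] by blast
 hence "expdeg b = i * d" "expdeg e = d" using Suc.prems(2) ab(1) by(simp_all add: expdeg_add)
 hence "vn (b, i) + vn (e, 1) : msp GA" using Suc.IH[OF ab(2)] ab(3) by(intro msp_step) (auto simp: GA_def)
 thus ?case by(simp add: ab(1) vn_add)
qed
thus "u : msp GA" if "u : MA" for u using that by(auto simp: MA_def)
show "u : MA" if "u : msp GA" for u using that msp_least[OF GA_MA MA_0 MA_add] by blast
qed

lemma MR_span: "MR = msp GR"
proof(intro equalityI subsetI)
fix u assume "u : MR"
then obtain a i where u: "u = vn (a, i)" "a : epow E i" using MR_E MR_iff by metis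
obtain g c where gc: "g : epow E i" "expdeg g = i * d" "a = g + c" using epow_bound[OF u(2)] by blast
have "msp GA <= msp GR" by(rule msp_sub) (auto simp: GR_def intro: msp_gen)
hence "vn (g, i) : msp GR" using gc MA_span MA_iff[of g i] by auto
moreover have "vn (c, 0) = (SUM j:UNIV. int (lk c j) ** vn (sng j 1, 0))"
 by(rule ve_eqI[where 'n = 'n]) (simp_all add: lk_ve lk_sum lk_sng when_def if_distrib[of "%x. _ * int x"] cong: if_cong)
moreover have "(SUM j:A. int (lk c j) ** vn (sng j 1, 0)) : msp GR" for A :: "'n set"
 by(induction A rule: fin_ind) (auto intro!: msp_0 msp_add msp_sc, auto simp: GR_def intro: msp_gen)
ultimately have "vn (g, i) + vn (c, 0) : msp GR" by(intro msp_add) simp_all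
thus "u : msp GR" by(simp add: u gc(3) vn_add)
next
have "GR <= MR" using GA_MA MAR by(auto simp: GR_def MR_iff)
thus "u : MR" if "u : msp GR" for u using that msp_least[OF _ MR_0 MR_add] by blast
qed
definition dg :: "vec => int" where "dg u = (SUM i<=card (UNIV :: 'n set). lk u i)"

lemma dg: "lin dg" "u : GR ==> 0 < dg u" "GR <= Vr (Suc (card (UNIV :: 'n set)))" "finite GR"
proof -
show "lin dg" by(simp add: lin_def dg_def lk_add sum.distrib)
have nn: "0 <= lk (vn x) i" for x :: "('n \<Rightarrow>\<^sub>0 nat) \<times> nat" and i
proof -
 show ?thesis using lk_ve[where x = x] idx_surj[where 'n = 'n] by(metis linorder_neqE_nat of_nat_0_le_iff order_refl)
qed
have p: "0 < dg (vn x)" if "lk (vn x) i = 1" "i <= card (UNIV :: 'n set)" for x :: "('n \<Rightarrow>\<^sub>0 nat) \<times> nat" and i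
 using member_le_sum[of i "{..card (UNIV :: 'n set)}" "lk (vn x)"] nn that by(auto simp: dg_def)
show "u : GR ==> 0 < dg u"
 unfolding GR_def GA_def
proof(elim UnE imageE)
 fix g assume "u = vn (g, 1)" thus ?thesis using p[of "(g, 1)" "card (UNIV :: 'n set)"] by(simp add: lk_ve)
next
 fix j assume "u = vn (sng j 1, 0)"
 thus ?thesis using p[of "(sng j 1, 0)" "idx j"] idx_less[of j] by(simp add: lk_ve less_imp_le)
qed
show "GR <= Vr (Suc (card (UNIV :: 'n set)))" "finite GR" using ve_Vr finite_GA by(auto simp: GR_def GA_def)
qed

lemma var_ideal: "(var_ideal :: ('n, 'k) mpol set) = KM {a. a ~= 0}"
proof -
have "range (%i. xpow (sng i 1)) = (xpow ` range (%i. sng i 1) :: ('n, 'k) mpol set)" by(simp add: image_image)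
moreover have "{a + b | a b. a : range (%i. sng i 1)} = {a :: 'n \<Rightarrow>\<^sub>0 nat. a ~= 0}"
proof(intro equalityI subsetI)
 fix a :: "'n \<Rightarrow>\<^sub>0 nat" assume "a : {a. a ~= 0}"
 then obtain i where i: "lk a i ~= 0" by(metis lookup_zero mem_Collect_eq pmI)
 hence "a = sng i 1 + (a - sng i 1)"
  by(intro pmI) (auto simp: lk_add lk_diff lk_sng when_def)
 thus "a : {a + b | a b. a : range (%i. sng i 1)}" by blast
next
 fix a :: "'n \<Rightarrow>\<^sub>0 nat" assume "a : {a + b | a b. a : range (%i. sng i 1)}"
 then obtain i b where a: "a = sng i 1 + b" by blast
 have "lk a i ~= 0" by(simp add: a lk_add)
 thus "a : {a. a ~= 0}" by auto
qed
ultimately show ?thesis unfolding var_ideal_def by(simp add: Idl_xpow)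
qed
abbreviation "KX == KM (MR - MA) :: 'k lau set"
abbreviation J where "J == Idl\<^bsub>rees_ring I\<^esub> ((%f. Polynomial.pCons f 0) ` (var_ideal :: ('n, 'k) mpol set))"

lemma vc: "(%f. Polynomial.pCons f 0) ` (var_ideal :: ('n, 'k) mpol set) <= cr (rees_ring I)"
by(auto simp: Rees_carrier coeff_pCons KM_def split: nat.splits)

lemma Jid: "ideal J (rees_ring I)" by(rule R.genideal_ideal[OF vc])

text \<open>A monomial off the face splits as a = g + b with x^g t^i on the face and b nonzero, so
  it is a multiple of x^b. Conversely an excess of degree is never lost in products, so the span of
  these monomials is an ideal.\<close>

lemma J_eq: "J = rm ` KX"
proof(intro equalityI)
have add: "x + y : MR - MA" if h: "x : MR - MA" "y : MR" for x y
proof -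
 obtain a i b j where x: "x = vn (a, i)" "a : epow E i" and y: "y = vn (b, j)" "b : epow E j"
  using MR_E[of x] MR_E[of y] h MR_iff by blast
 have "expdeg a ~= i * d" using h x by(auto simp: MA_iff)
 moreover have "i * d <= expdeg a" "j * d <= expdeg b" using epow_bound[OF x(2)] epow_bound[OF y(2)] by(auto simp: expdeg_add)
 ultimately have "expdeg (a + b) ~= (i + j) * d" by(simp add: expdeg_add distrib_right)
 moreover have "x + y = vn (a + b, i + j)" by(simp add: x y vn_add)
 ultimately show ?thesis using MR_add[of x y] h MA_iff by auto
qed
have "ideal_in (KM MR) KX"
 unfolding ideal_in_def
proof(intro conjI ballI)
 fix x y :: "'k lau" assume "x : KX" "y : KM MR"
 moreover have "keys (x * y) <= {a + b | a b. a : keys x & b : keys y}" by(rule keys_mult)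
 ultimately show "y * x : KX" using add unfolding KM_def mult.commute[of y] by blast
qed (auto simp: KM_add, auto simp: KM_def)
hence "ideal (rm ` KX) (rees_ring I)" by(rule R.image_ideal)
moreover have "Polynomial.pCons f 0 : rm ` KX" if f: "f : KM {a :: 'n \<Rightarrow>\<^sub>0 nat. a ~= 0}" for f :: "('n, 'k) mpol"
proof(rule image_eqI)
 have "rm (SUM a:keys f. sng (vn (a, 0)) (lk f a)) = Polynomial.monom (SUM a:keys f. sng a (lk f a)) 0"
  by(simp add: rm_sum rm_single monom_sum)
 thus "Polynomial.pCons f 0 = rm (SUM a:keys f. sng (vn (a, 0)) (lk f a))" by(simp add: sum_sng monom_0)
 have "expdeg a ~= 0" if "a : keys f" for a
 proof
  assume "expdeg a = 0"
  hence "a = 0" by(intro pmI) (simp add: expdeg_def)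
  thus False using f that by(auto simp: KM_def)
 qed
 thus "(SUM a:keys f. sng (vn (a, 0)) (lk f a)) : KX"
  by(intro KM_sum KM_sng) (auto simp: MR_iff MA_iff)
qed
ultimately show "J <= rm ` KX" by(intro R.genideal_minimal) (auto simp: var_ideal)
have single: "rm (sng u c) : J" if "u : MR - MA" for u and c :: 'k
proof -
 obtain a i where u: "u = vn (a, i)" "a : epow E i" "expdeg a ~= i * d" using MR_E[of u] \<open>u : MR - MA\<close> by(auto simp: MR_iff MA_iff)
 obtain g b where g: "g : epow E i" "expdeg g = i * d" "a = g + b" using epow_bound[OF u(2)] by blast
 have "b ~= 0" using u(3) g by auto
 hence "Polynomial.pCons (xpow b) 0 : J" by(intro subsetD[OF R.genideal_self[OF vc]]) (auto simp: var_ideal xpow_KM)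
 moreover have "Polynomial.monom (sng g c) i : cr (rees_ring I)" using g(1) by(auto simp: Rees_carrier KM_def)
 ultimately have "Polynomial.monom (sng g c) i *.\<^bsub>rees_ring I\<^esub> Polynomial.pCons (xpow b) 0 : J"
  using ideal.I_l_closed[OF Jid] by blast
 thus ?thesis by(simp add: rees_ring_def u(1) g(3) rm_single xpow_def mult_monom mult_single flip: monom_0)
qed
show "rm ` KX <= J"
proof
 fix p :: "('n, 'k) pol" assume "p : rm ` KX"
 then obtain f :: "'k lau" where f: "f : KX" "p = rm f" by blast
 have "rm (SUM v:A. sng v (lk f v)) : J" if "A <= keys f" for A
  using that
 proof(induction A rule: fin_ind)
  case (insert v A)
  hence "rm (sng v (lk f v)) : J" using f(1) by(intro single) (auto simp: KM_def)
  thus ?case using insert additive_subgroup.a_closed[OF ideal.axioms(1)[OF Jid]] by(simp add: rm_add rees_ring_def)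
 qed (use additive_subgroup.zero_closed[OF ideal.axioms(1)[OF Jid]] in "simp_all add: rees_ring_def rm_def")
 from this[of "keys f"] show "p : J" by(simp add: sum_sng f(2))
qed
qed
abbreviation "cs f == J +>\<^bsub>rees_ring I\<^esub> rm f"

text \<open>Each class modulo \<open>J\<close> has exactly one representative supported on the face:
  its terms off the face lie in \<open>J\<close>, and nothing nonzero on the face does.\<close>

lemma fiber_typed: "typed_ring (special_fiber_ring I) (KM MA :: 'k lau set) cs"
proof -
note hom = ideal.rcos_ring_hom[OF Jid]
have AR: "f : KM MR" if "f : KM MA" for f :: "'k lau" using that MAR by(auto simp: KM_def)
have eq: "cs f = cs g <-> f - g : KX"
 if "f : KM MR" "g : KM MR" for f g :: "'k lau"
proof -
 have m: "rm f \<ominus>\<^bsub>rees_ring I\<^esub> rm g = rm (f - g)"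
  using that R.h_add[of f "- g"] R.h_minus[OF that(2)] KM_uminus[OF that(2)] by(simp add: a_minus_def)
 have "cs f = cs g <-> rm (f - g) : J"
  using R.quotient_eq_iff_same_a_r_cos[OF Jid R.h_carr[OF that(1)] R.h_carr[OF that(2)]] m by simp
 also have "... <-> f - g : KX"
 proof
  assume "rm (f - g) : J"
  then obtain x :: "'k lau" where x: "x : KX" "(rm (f - g) :: ('n, 'k) pol) = rm x" unfolding J_eq by blast
  hence "f - g = x" using iffD1[OF R.h_inj x(2)] KM_diff[OF that] by(auto simp: KM_def)
  thus "f - g : KX" using x(1) by simp
 qed (auto simp: J_eq)
 finally show ?thesis .
qed
show ?thesis
proof(intro typed_ring.intro typed_ring_axioms.intro)
 show "cring (special_fiber_ring I)" unfolding special_fiber_ring_def by(rule ideal.quotient_is_cring[OF Jid R.is_cring])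
 show "sbr (KM MA :: 'k lau set)" by(rule sbr_KMI[OF MA_0 MA_add])
 have "f = g" if "f : KM MA" "g : KM MA" "f - g : KX" for f g :: "'k lau"
 proof -
  have "keys (f - g) = {}" using KM_diff[OF that(1,2)] that(3) unfolding KM_def by blast
  hence "f - g = 0" by(simp only: keys_eq_empty)
  thus ?thesis by simp
 qed
 hence "inj_on cs (KM MA :: 'k lau set)" using eq AR by(intro inj_onI) blast
 moreover have rep: "EX g:KM MA. cs f = cs g" if f: "f : KM MR" for f :: "'k lau"
 proof
  let ?s = "%A. SUM v:A. sng v (lk f v)"
  have g: "?s (keys f Int MA) : KM MA" by(intro KM_sum KM_sng) auto
  thus "?s (keys f Int MA) : KM MA" .
  have "?s (keys f) - ?s (keys f Int MA) = ?s (keys f - MA)" using sum.Int_Diff[of "keys f" "%v. sng v (lk f v)" MA] by simp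
  hence "f - ?s (keys f Int MA) = ?s (keys f - MA)" by(simp only: sum_sng)
  moreover have "?s (keys f - MA) : KX" using f by(intro KM_sum KM_sng) (auto simp: KM_def)
  ultimately show "cs f = cs (?s (keys f Int MA))" using eq[OF f AR[OF g]] by simp
 qed
 moreover have "cr (special_fiber_ring I) = cs ` (KM MR :: 'k lau set)"
  unfolding special_fiber_ring_def FactRing_def A_RCOSETS_def' bij_betw_imp_surj_on[OF R.bij, symmetric] by auto
 moreover have "cs ` (KM MR :: 'k lau set) = cs ` KM MA" (is "?F ` _ = _")
  using rep AR by(intro equalityI subsetI; elim imageE) blast+
 ultimately show "bij_betw cs (KM MA :: 'k lau set) (cr (special_fiber_ring I))"
  unfolding bij_betw_def by simp
 fix x y :: "'k lau" assume "x : KM MA" "y : KM MA"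
 note xy = AR[OF this(1)] AR[OF this(2)]
 show "cs (x + y) = (cs x) +.\<^bsub>special_fiber_ring I\<^esub> (cs y)"
  "cs (x * y) = (cs x) *.\<^bsub>special_fiber_ring I\<^esub> (cs y)"
  unfolding special_fiber_ring_def R.h_add[OF xy] R.h_mult[OF xy]
  using ring_hom_add[OF hom] ring_hom_mult[OF hom] R.h_carr xy by auto
next
 show "cs 1 = \<one>\<^bsub>special_fiber_ring I\<^esub>" unfolding special_fiber_ring_def R.h_1 using ring_hom_one[OF hom] by simp
qed
qed

theorem blowup_algebras:
"cohen_macaulay_ring (rees_ring I) & normal_domain (rees_ring I) &
cohen_macaulay_ring (special_fiber_ring I) & normal_domain (special_fiber_ring I) &
(CHAR('k) = 0 --> rational_singularities (special_fiber_ring I)) &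
(CHAR('k) > 0 --> F_rational CHAR('k) (special_fiber_ring I))"
proof -
have GAR: "GA <= GR" by(auto simp: GR_def)
have "cohen_macaulay_ring (rees_ring I) & normal_domain (rees_ring I) &
  (CHAR('k) = 0 --> rational_singularities (rees_ring I)) & (CHAR('k) > 0 --> F_rational CHAR('k) (rees_ring I))"
 by(rule toric_ring[OF rees_typed[unfolded MR_span] dg(4,3,1,2)]) (use sat(1) in "auto simp: MR_span[symmetric]")
moreover have "cohen_macaulay_ring (special_fiber_ring I) & normal_domain (special_fiber_ring I) &
  (CHAR('k) = 0 --> rational_singularities (special_fiber_ring I)) & (CHAR('k) > 0 --> F_rational CHAR('k) (special_fiber_ring I))"
 by(rule toric_ring[OF fiber_typed[unfolded MA_span] finite_GA subset_trans[OF GAR dg(3)] dg(1)])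
  (use dg(2) GAR sat(2) MAR in "auto simp: MA_span[symmetric] subset_iff")
ultimately show ?thesis by blast
qed
end

section \<open>Symmetric strongly shifted ideals\<close>

lemma ex_sort: "EX si :: 'n => 'n. bij si & mono (%i. f (si i) :: nat)" for f :: "'n::{finite,linorder} => nat"
proof -
define xs where "xs = sorted_list_of_set (UNIV :: 'n set)"
define ys where "ys = sort_key f xs"
let ?N = "{..<length xs}"
have b: "bij_betw ((!) xs) ?N UNIV" "bij_betw ((!) ys) ?N UNIV"
 unfolding xs_def ys_def by(rule bij_betw_nth; simp)+
define si where "si = (!) ys \<circ> the_inv_into ?N ((!) xs)"
have s: "si (xs ! k) = ys ! k" if "k < length xs" for k
 using b(1) that by(simp add: si_def bij_betw_def the_inv_into_f_f)
have "mono (%i. f (si i))"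
proof(rule monoI)
 fix i j :: 'n assume ij: "i <= j"
 have "i : (!) xs ` ?N" "j : (!) xs ` ?N" unfolding bij_betw_imp_surj_on[OF b(1)] by simp_all
 then obtain k l where kl: "k < length xs" "l < length xs" "i = xs ! k" "j = xs ! l" by blast
 show "f (si i) <= f (si j)"
 proof(cases "k <= l")
  case True
  hence "map f ys ! k <= map f ys ! l" by(intro sorted_nth_mono) (use kl in "simp_all add: ys_def")
  thus ?thesis using kl s by(simp add: ys_def)
 next
  case False
  hence "j <= i" unfolding kl by(intro sorted_nth_mono) (use kl in "simp_all add: xs_def")
  thus ?thesis using ij by simp
 qed
qed
moreover have "bij si" unfolding si_def by(rule bij_betw_trans[OF bij_betw_the_inv_into[OF b(1)] b(2)])
ultimately show ?thesis by blast
qed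
abbreviation pm :: "('n => 'n) => ('n \<Rightarrow>\<^sub>0 nat) => ('n \<Rightarrow>\<^sub>0 nat)" where "pm == Poly_Mapping.map_key"

lemma lk_pm: "bij si ==> lk (pm si a) i = lk a (si i)"
by(simp add: map_key.rep_eq bij_is_inj)

lemma pm_inv: "bij si ==> pm (inv_into UNIV si) (pm si a) = a" "bij si ==> pm si (pm (inv_into UNIV si) a) = a"
by(rule pmI; simp add: lk_pm bij_imp_bij_inv bij_is_surj bij_is_inj surj_f_inv_f)+

lemma pm_add: "bij si ==> pm si (a + b) = pm si a + pm si b"
by(rule pmI) (simp add: lk_pm lk_add)

lemma lk_move: "lk (move a i j) k = lk a k - (if k = j then 1 else 0) + (if k = i then 1 else 0)"
by(simp add: move_def lk_add lk_diff lk_sng when_def)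
text \<open>Exponent sets of symmetric strongly shifted ideals. Moves are allowed at every exponent
  instead of only at partitions; \<open>sss_iff\<close> obtains this by sorting, moving and
  permuting back.\<close>

definition ssc :: "('n::{finite,linorder} \<Rightarrow>\<^sub>0 nat) set => bool" where
"ssc E <-> upc E & (ALL a:E. ALL si. bij si --> pm si a : E) & (ALL a:E. ALL i j. lk a i < lk a j --> move a i j : E)"

lemma sym_fixed_KM: "sym_fixed (KM E :: ('n::{finite,linorder}, 'k::field) mpol set) <-> (ALL a:E. ALL si. bij si --> pm si a : E)"
proof -
have inj: "inj (pm si)" if "bij si" for si :: "'n => 'n" by(rule inj_on_inverseI[where g = "pm (inv_into UNIV si)"]) (simp add: pm_inv that)
show ?thesis
 unfolding sym_fixed_def
proof(intro iffI ballI allI impI)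
 fix a and si :: "'n => 'n" assume h: "ALL si. bij si --> permute_vars si ` (KM E :: ('n, 'k) mpol set) <= KM E" "a : E" "bij si"
 let ?ta = "inv_into UNIV si"
 have b: "bij ?ta" using h(3) by(rule bij_imp_bij_inv)
 have "permute_vars ?ta (xpow (pm ?ta (pm si a)) :: ('n, 'k) mpol) = xpow (pm si a)"
  unfolding permute_vars_def xpow_def by(rule map_key_single[OF inj[OF b]])
 moreover have "permute_vars ?ta (xpow a :: ('n, 'k) mpol) : KM E" using h(1,2) b xpow_KM by blast
 ultimately show "pm si a : E" using h(3) by(simp add: pm_inv xpow_KM)
next
 fix si :: "'n => 'n" assume h: "ALL a:E. ALL si. bij si --> pm si a : E" "bij si"
 show "permute_vars si ` (KM E :: ('n, 'k) mpol set) <= KM E"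
 proof clarify
  fix f :: "('n, 'k) mpol" assume f: "f : KM E"
  have "a : E" if "pm si a : keys f" for a
   using h f that pm_inv(1)[OF h(2), of a] bij_imp_bij_inv[OF h(2)] by(metis (mono_tags, lifting) KM_def mem_Collect_eq subsetD)
  thus "permute_vars si f : KM E" by(auto simp: KM_def permute_vars_def keys_map_key[OF inj[OF h(2)]])
 qed
qed
qed

lemma sss_iff: "sym_strongly_shifted I <-> ssc {a. xpow a : I} & I = (KM {a. xpow a : I} :: ('n::{finite,linorder}, 'k::field) mpol set)"
proof -
let ?E = "{a. xpow a : I}"
have sf: "sym_fixed I <-> (ALL a:?E. ALL si. bij si --> pm si a : ?E)" if "I = KM ?E" using sym_fixed_KM[of ?E, where 'k = 'k] that by simp
show ?thesis
proof
 assume s: "sym_strongly_shifted I"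
 hence IE: "upc ?E" "I = KM ?E" "sym_fixed I" by(auto simp: sym_strongly_shifted_def mono_KM)
 note pE = sf[OF IE(2), THEN iffD1, OF IE(3), rule_format]
 have "move a i j : ?E" if a: "a : ?E" "lk a i < lk a j" for a i j
 proof -
  obtain si :: "'n => 'n" where si: "bij si" "mono (%i. lk a (si i))" using ex_sort by blast
  let ?ta = "inv_into UNIV si"
  have st: "si (?ta k) = k" for k using si(1) by(simp add: bij_is_surj surj_f_inv_f)
  have "pm si a : parts_of I" using pE[OF a(1) si(1)] si by(simp add: parts_of_def parts_def lk_pm[OF si(1), abs_def])
  moreover have lt: "lk (pm si a) (?ta i) < lk (pm si a) (?ta j)" using a(2) by(simp add: lk_pm si(1) st)
  moreover have "?ta i < ?ta j"
   using monoD[OF si(2), of "?ta j" "?ta i"] a(2) by(simp add: st not_le[symmetric]) (meson leI)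
  ultimately have "move (pm si a) (?ta i) (?ta j) : ?E" using s unfolding sym_strongly_shifted_def by simp
  from pE[OF this bij_imp_bij_inv[OF si(1)]] have "pm ?ta (move (pm si a) (?ta i) (?ta j)) : ?E" .
  moreover have "?ta k = ?ta l <-> k = l" for k l using st by metis
  hence "pm ?ta (move (pm si a) (?ta i) (?ta j)) = move a i j"
   by(intro pmI) (simp add: lk_pm si(1) bij_imp_bij_inv lk_move st)
  ultimately show ?thesis by simp
 qed
 thus "ssc ?E & I = KM ?E" using IE pE by(auto simp: ssc_def)
next
 assume h: "ssc ?E & I = KM ?E"
 hence "sym_fixed I" using sf by(auto simp: ssc_def)
 thus "sym_strongly_shifted I" using h unfolding sym_strongly_shifted_def mono_KM by(auto simp: ssc_def parts_of_def)
qed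
qed

text \<open>Prefix sums; \<open>ps a i\<close> is the least sum of \<open>card {..i}\<close> entries of a partition \<open>a\<close>.\<close>
definition ps :: "('n::{finite,linorder} \<Rightarrow>\<^sub>0 nat) => 'n => nat" where "ps a i = (SUM j<=i. lk a j)"
text \<open>Testing all sets W of a given size makes the condition invariant under permutations of
  a, so it applies to exponents that are not sorted.\<close>

definition dmn :: "('n::{finite,linorder} \<Rightarrow>\<^sub>0 nat) => ('n \<Rightarrow>\<^sub>0 nat) => bool" where
"dmn l a <-> (ALL i W. card W = card {..i} --> ps l i <= (SUM j:W. lk a j))"

lemma parts_mono: "a : parts ==> i <= j ==> lk a i <= lk a j"
by(simp add: parts_def monoD)

text \<open>The first entries of a partition are its smallest, so a prefix has the least sum among
  sets of its size.\<close>

lemma dmn_parts: "a : parts ==> dmn l a <-> (ALL i. ps l i <= ps a i)"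
proof
assume a: "a : parts" and h: "ALL i. ps l i <= ps a i"
have "ps a i <= (SUM j:W. lk a j)" if c: "card W = card {..i}" for i W
proof -
 have "card ({..i} - W) = card (W - {..i})" using c card_Diff_subset_Int[of "{..i}" W] card_Diff_subset_Int[of W "{..i}"] by(simp add: Int_commute)
 moreover have "(SUM j:{..i} - W. lk a j) <= of_nat (card ({..i} - W)) * lk a i"
  by(rule sum_bounded_above) (use a in "auto intro: parts_mono")
 moreover have "of_nat (card (W - {..i})) * lk a i <= (SUM j:W - {..i}. lk a j)"
  by(rule sum_bounded_below) (use a in "auto intro: parts_mono")
 ultimately show ?thesis
  using sum.Int_Diff[of "{..i}" "lk a" W] sum.Int_Diff[of W "lk a" "{..i}"] by(simp add: ps_def Int_commute)
qed
thus "dmn l a" unfolding dmn_def by(intro allI impI) (rule order_trans[OF h[rule_format]])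
qed (auto simp: dmn_def ps_def)

lemma dom_refl: "l : parts ==> dmn l l"
by(simp add: dmn_parts)

lemma dom_trans: "dmn l m ==> dmn m a ==> dmn l a"
proof -
assume h: "dmn l m" "dmn m a"
have "ps l i <= ps m i" for i using h(1) by(simp add: dmn_def ps_def)
thus ?thesis using h(2) unfolding dmn_def by(meson order_trans)
qed

lemma ssc_dom: "ssc {a :: 'n::{finite,linorder} \<Rightarrow>\<^sub>0 nat. EX l:B. dmn l a}"
unfolding ssc_def
proof(intro conjI ballI allI impI)
have "dmn l a ==> dmn l (a + b)" for l a b :: "'n \<Rightarrow>\<^sub>0 nat" unfolding dmn_def by(simp add: lk_add sum.distrib trans_le_add1)
thus "upc {a :: 'n \<Rightarrow>\<^sub>0 nat. EX l:B. dmn l a}" unfolding upc_def by blast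
next
fix a and si :: "'n => 'n" assume a: "a : {a. EX l:B. dmn l a}" and si: "bij si"
have "dmn l (pm si a)" if l: "dmn l a" for l
 unfolding dmn_def
proof(intro allI impI)
 fix i :: 'n and W :: "'n set" assume "card W = card {..i}"
 hence "card (si ` W) = card {..i}" using card_image[of si W] bij_is_inj[OF si] by(simp add: inj_on_subset)
 hence "ps l i <= (SUM j:si ` W. lk a j)" using l by(simp add: dmn_def)
 also have "... = (SUM j:W. lk (pm si a) j)"
  by(subst sum.reindex[OF inj_on_subset[OF bij_is_inj[OF si] subset_UNIV]]) (simp add: lk_pm si)
 finally show "ps l i <= (SUM j:W. lk (pm si a) j)" .
qed
thus "pm si a : {a. EX l:B. dmn l a}" using a by blast
next
fix a i j assume a: "a : {a. EX l:B. dmn l a}" and ij: "lk a i < lk a j"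
have "dmn l (move a i j)" if l: "dmn l a" for l
 unfolding dmn_def
proof(intro allI impI)
 fix k :: 'n and W :: "'n set" assume W: "card W = card {..k}"
 have lW: "ps l k <= (SUM x:W. lk a x)" using l W by(simp add: dmn_def)
 show "ps l k <= (SUM x:W. lk (move a i j) x)"
 proof(cases "j : W")
  case True
  have r: "(SUM x:W - {j}. lk a x) + (lk a j - 1) + (if i : W then 1 else 0) <= (SUM x:W. lk (move a i j) x)"
  proof -
   have "i ~= j" using ij by auto
   have "(SUM x:W. lk (move a i j) x) = (lk a j - 1) + (SUM x:W - {j}. lk a x + (if x = i then 1 else 0))"
    using True \<open>i ~= j\<close> by(subst sum.remove[of W j]) (auto simp: lk_move intro!: sum.cong)
   also have "(SUM x:W - {j}. lk a x + (if x = i then 1 else 0)) = (SUM x:W - {j}. lk a x) + (if i : W then 1 else 0)"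
    unfolding sum.distrib using \<open>i ~= j\<close> by simp
   finally show ?thesis by simp
  qed
  show ?thesis
  proof(cases "i : W")
   case True
   thus ?thesis using r lW ij sum.remove[OF _ \<open>j : W\<close>, of "lk a"] by simp
  next
   case False
   \<comment> \<open>W loses one unit at j. Exchanging j for i gives a set of the same size whose
     old sum is smaller by at least 1, and this sum is still bounded below by the prefix sum of
     l.\<close>
   hence "card (insert i (W - {j})) = card {..k}" using W True by(metis card.insert card.remove card_Diff_singleton finite finite_Diff insert_Diff_single insert_iff DiffE)
   hence "ps l k <= (SUM x:insert i (W - {j}). lk a x)" using l unfolding dmn_def by blast
   also have "... = lk a i + (SUM x:W - {j}. lk a x)" using False by(subst sum.insert) auto
   finally show ?thesis using r ij False by simp
  qed
 next
  case False
  hence "(SUM x:W. lk a x) <= (SUM x:W. lk (move a i j) x)" by(intro sum_mono) (auto simp: lk_move)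
  thus ?thesis using lW by simp
 qed
qed
thus "move a i j : {a. EX l:B. dmn l a}" using a by blast
qed

lemma ps_split: "ps a i = (SUM j<i. lk a j) + lk a i"
proof -
have "{..i} = insert i {..<i}" by auto
thus ?thesis by(simp add: ps_def)
qed

lemma first_difference:
assumes "a ~= b"
obtains k where "!!j. j < k ==> lk a j = lk b j" "!!j. j < k ==> ps a j = ps b j"
 "(SUM j<k. lk a j) = (SUM j<k. lk b j)" "lk a k ~= lk (b :: 'n::{finite,linorder} \<Rightarrow>\<^sub>0 nat) k"
proof -
let ?K = "{k. lk a k ~= lk b k}"
have ne: "?K ~= {}" using assms by(metis (mono_tags, lifting) empty_Collect_eq pmI)
have k: "lk a j = lk b j" if "j < Min ?K" for j
proof(rule ccontr)
 assume "lk a j ~= lk b j"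
 hence "Min ?K <= j" by(intro Min_le) auto
 thus False using that by simp
qed
show thesis
proof(rule that[of "Min ?K"])
 show "ps a j = ps b j" if "j < Min ?K" for j
  unfolding ps_def by(intro sum.cong refl k) (use that in "simp only: atMost_iff; simp")
 show "(SUM j<Min ?K. lk a j) = (SUM j<Min ?K. lk b j)" by(intro sum.cong refl k) (simp only: lessThan_iff)
 show "lk a (Min ?K) ~= lk b (Min ?K)" using Min_in[OF _ ne] by simp
qed (rule k)
qed

lemma ps_succ:
assumes "p < q" "!!x. x < q ==> x <= p"
shows "ps a q = ps a p + lk a q"
proof -
have "{..<q} = {..p}" using assms by(auto intro: le_less_trans)
thus ?thesis by(simp add: ps_split[of a q] ps_def[of a p])
qed

text \<open>A partition \<open>a \<noteq> l\<close> dominating \<open>l\<close> arises by one multiplication or move from a smaller one.\<close>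
lemma ssc_parts:
assumes E: "ssc E" "l : E" "l : parts"
shows "a : parts ==> dmn l a ==> a : E"
proof(induction "SUM i:UNIV. ps a i" arbitrary: a rule: less_induct)
case less
note a = less.prems(1) and la = less.prems(2)[unfolded dmn_parts[OF less.prems(1)], rule_format]
show ?case
proof(cases "a = l")
 case False
 obtain k where k: "!!j. j < k ==> lk a j = lk l j" "!!j. j < k ==> ps a j = ps l j"
  "(SUM j<k. lk a j) = (SUM j<k. lk l j)" "lk a k ~= lk l k" using first_difference[OF False] by metis
 have ak: "lk l k < lk a k" using la[of k] k(3,4) by(simp add: ps_split)
 hence pk: "ps l k < ps a k" using k(3) by(simp add: ps_split)
 have below: "lk a j < lk a k" if "j < k" for j using k(1)[OF that] parts_mono[OF E(3) less_imp_le[OF that]] ak by linarith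
 have smaller: "b : E" if "b : parts" "!!i. ps l i <= ps b i" "!!i. ps b i <= ps a i" "ps b k < ps a k" for b
 proof(rule less.hyps)
  show "sum (ps b) UNIV < sum (ps a) UNIV" by(rule sum_strict_mono_ex1) (use that in auto)
 qed (use that in "simp_all add: dmn_parts")
 show ?thesis
 proof(cases "ALL p>k. ps l p < ps a p")
  case True
  \<comment> \<open>All prefix sums from k on have slack, so a is a multiple by variable k of a
    smaller partition that still dominates l.\<close>
  let ?b = "a - sng k 1"
  have ab: "a = ?b + sng k 1" using ak by(intro pmI) (auto simp: lk_add lk_diff lk_sng when_def)
  have pb: "ps ?b i = ps a i - (if k <= i then 1 else 0)" for i
  proof -
   have "ps a i = ps ?b i + ps (sng k 1) i" by(subst (1) ab) (simp add: ps_def lk_add sum.distrib)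
   moreover have "ps (sng k 1) i = (SUM j<=i. if j = k then 1 else 0)"
    unfolding ps_def by(rule sum.cong) (auto simp: lk_sng when_def)
   ultimately show ?thesis by simp
  qed
  have "?b : E"
  proof(rule smaller)
   have "lk ?b i <= lk ?b j" if "i < j" for i j
    using below[of i] parts_mono[OF a less_imp_le[OF that]] that by(auto simp: lk_diff lk_sng when_def)
   thus "?b : parts" by(auto simp: parts_def mono_def le_less)
   show "ps l i <= ps ?b i" for i
    using True[rule_format, of i] la[of i] pk unfolding pb by(cases "i = k"; cases "k < i") auto
   show "ps ?b k < ps a k" using pk unfolding pb by simp
  qed (simp_all only: pb diff_le_self)
  thus ?thesis using E(1) ab unfolding ssc_def upc_def by metis
 next
  case False
  \<comment> \<open>At q, the first position after k where the prefix sums agree again, one unit is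
    moved back from k to q; a is then a move of the result. \<open>below\<close> and
    \<open>above\<close> ensure that the result is sorted.\<close>
  let ?P = "{p. k < p & ps a p = ps l p}"
  from False obtain x where x: "k < x" "~ ps l x < ps a x" by blast
  hence "ps a x = ps l x" using la[of x] by simp
  hence ne: "?P ~= {}" using x(1) by blast
  define q where "q = Min ?P"
  have "q : ?P" unfolding q_def by(rule Min_in[OF finite ne])
  hence q: "k < q" "ps a q = ps l q" by blast+
  have mid: "ps l p < ps a p" if "k <= p" "p < q" for p
  proof(cases "p = k")
   case False
   hence "k < p" using that(1) by simp
   moreover have "p ~: ?P" using Min_le[of ?P p] that(2) unfolding q_def[symmetric] by(meson finite leD)
   ultimately have "ps a p ~= ps l p" by blast
   thus ?thesis using la[of p] by linarith
  qed (simp add: pk)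
  define p where "p = Max {..<q}"
  have pin: "p : {..<q}" unfolding p_def by(rule Max_in) (use q(1) in auto)
  have pmax: "x <= p" if "x < q" for x unfolding p_def by(rule Max_ge) (use that in auto)
  have "lk a q < lk l q"
   using ps_succ[of p q a] ps_succ[of p q l] pin pmax mid[OF pmax[OF q(1)]] q(2) by auto
  have above: "lk a q < lk a j" if "q < j" for j
  proof -
   define r where "r = Min {q<..}"
   have "r : {q<..}" unfolding r_def by(rule Min_in) (use that in auto)
   moreover have "r <= j" unfolding r_def by(rule Min_le) (use that in auto)
   ultimately have r: "q < r" "r <= j" by simp_all
   have "x <= q" if "x < r" for x using that Min_le[of "{q<..}" x] unfolding r_def by(meson finite greaterThan_iff leD not_le)
   hence "lk l r <= lk a r" using ps_succ[OF r(1), of a] ps_succ[OF r(1), of l] la[of r] q(2) by simp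
   thus ?thesis using \<open>lk a q < lk l q\<close> parts_mono[OF E(3) less_imp_le[OF r(1)]] parts_mono[OF a r(2)] by linarith
  qed
  let ?b = "move a q k"
  have lb: "lk ?b i = lk a i - (if i = k then 1 else 0) + (if i = q then 1 else 0)" for i by(rule lk_move)
  have pb: "ps ?b i = ps a i - (if k <= i & i < q then 1 else 0)" for i
  proof -
   have "ps ?b i + (if k <= i then 1 else 0) = ps a i + (if q <= i then 1 else 0)"
   proof -
    have "(SUM j<=i. lk ?b j + (if j = k then 1 else 0)) = (SUM j<=i. lk a j + (if j = q then 1 else 0))"
     by(rule sum.cong) (use ak q(1) in "auto simp: lb")
    thus ?thesis unfolding ps_def sum.distrib by simp
   qed
   moreover have "k <= i" if "q <= i" using that q(1) by simp
   ultimately show ?thesis by(auto simp: not_less split: if_splits)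
  qed
  have bE: "?b : E"
  proof(rule smaller)
   have "lk ?b i <= lk ?b j" if "i < j" for i j
   proof -
    have m: "lk a i <= lk a j" using that by(intro parts_mono[OF a] less_imp_le)
    consider "i = q" | "j = k" | "i ~= q" "j ~= k" by blast
    thus ?thesis
    proof cases
     case 1
     thus ?thesis using above[of j] that q(1) unfolding lb by auto
    next
     case 2
     thus ?thesis using below[of i] that q(1) unfolding lb by auto
    next
     case 3
     thus ?thesis using m unfolding lb by auto
    qed
   qed
   thus "?b : parts" by(auto simp: parts_def mono_def le_less)
   show "ps l i <= ps ?b i" for i using la[of i] mid[of i] by(auto simp: pb)
  qed (use pk q(1) in "auto simp: pb")
  have "lk ?b k < lk ?b q" using parts_mono[OF a less_imp_le[OF q(1)]] q(1) ak unfolding lb by auto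
  hence "move ?b k q : E" using E(1) bE unfolding ssc_def by blast
  moreover have "move ?b k q = a" using ak q(1) by(intro pmI) (auto simp: lk_move)
  ultimately show ?thesis by simp
 qed
qed (simp add: E(2))
qed

lemma ssc_dom_least:
fixes a :: "'n::{finite,linorder} \<Rightarrow>\<^sub>0 nat"
assumes E: "ssc E" "l : E" "l : parts" and a: "dmn l a"
shows "a : E"
proof -
obtain si :: "'n => 'n" where si: "bij si" "mono (%i. lk a (si i))" using ex_sort by blast
hence "pm si a : parts" by(simp add: parts_def lk_pm[OF si(1), abs_def])
moreover have "dmn l (pm si a)" using ssc_dom[of "{l}"] a si(1) unfolding ssc_def by simp
ultimately have "pm si a : E" by(rule ssc_parts[OF E])
hence "pm (inv_into UNIV si) (pm si a) : E" using E(1) bij_imp_bij_inv[OF si(1)] unfolding ssc_def by blast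
thus ?thesis by(simp add: pm_inv si(1))
qed

lemma Sss_dom:
assumes "B <= parts"
shows "Sss B = (KM {a. EX l:B. dmn l a} :: ('n::{finite,linorder}, 'k::field) mpol set)"
unfolding Sss_def
proof(rule hull_unique)
show "xpow ` B <= (KM {a. EX l:B. dmn l a} :: ('n, 'k) mpol set)" using assms dom_refl by(fastforce simp: xpow_KM)
show "sym_strongly_shifted (KM {a. EX l:B. dmn l a} :: ('n, 'k) mpol set)" unfolding sss_iff xpow_KM using ssc_dom by simp
fix t :: "('n, 'k) mpol set" assume t: "xpow ` B <= t" "sym_strongly_shifted t"
hence E: "ssc {a. xpow a : t}" "t = KM {a. xpow a : t}" using sss_iff[of t] by blast+
have "a : {a. xpow a : t}" if "l : B" "dmn l a" for l a
 by(rule ssc_dom_least[OF E(1) _ _ that(2)]) (use t(1) assms that(1) in auto)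
thus "KM {a. EX l:B. dmn l a} <= t" by(subst E(2)) (auto simp: KM_def)
qed

section \<open>Principal symmetric strongly shifted ideals\<close>

lemma move_add: "lk a i < lk a j ==> move (a + b) i j = move a i j + b"
by(rule pmI) (auto simp: lk_move lk_add)

lemma epow_SucI: "b : epow E k ==> c : E ==> b + c : epow E (Suc k)"
by auto

text \<open>If b + c has a smaller entry at i than at j, so has b or c, and the move is made in that
  summand.\<close>

lemma ssc_epow: "ssc E ==> ssc (epow E k)"
proof(induction k)
case (Suc k)
hence IH: "ssc (epow E k)" by simp
show ?case
 unfolding ssc_def
proof(intro conjI ballI allI impI)
 show "upc (epow E (Suc k))" using Suc.prems by(intro upc_epow) (simp add: ssc_def)
 fix a assume "a : epow E (Suc k)"
 then obtain b c where a: "a = b + c" "b : epow E k" "c : E" by auto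
 show "pm si a : epow E (Suc k)" if "bij si" for si using that a IH Suc.prems unfolding a(1) pm_add[OF that] by(intro epow_SucI) (auto simp: ssc_def)
 fix i j assume "lk a i < lk a j"
 then consider "lk b i < lk b j" | "lk c i < lk c j" by(force simp: a lk_add)
 thus "move a i j : epow E (Suc k)"
 proof cases
  case 1
  thus ?thesis using a IH unfolding a(1) move_add[OF 1] by(intro epow_SucI) (auto simp: ssc_def)
 next
  case 2
  hence "move a i j = b + move c i j" by(simp add: a(1) add.commute[of b] move_add)
  thus ?thesis using 2 a Suc.prems by(simp only:, intro epow_SucI) (auto simp: ssc_def)
 qed
qed
qed (simp add: ssc_def upc_def)

lemma expdeg_pm: "bij si ==> expdeg (pm si a) = expdeg (a :: 'n::finite \<Rightarrow>\<^sub>0 nat)"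
unfolding expdeg_def by(simp add: lk_pm sum.reindex_bij_betw)

lemma expdeg_move: "lk a i < lk a j ==> expdeg (move a i j) = expdeg (a :: 'n::finite \<Rightarrow>\<^sub>0 nat)"
proof -
assume h: "lk a i < lk a j"
have "(SUM k:UNIV. lk (move a i j) k + (if k = j then 1 else 0)) = (SUM k:UNIV. lk a k + (if k = i then 1 else 0))"
 by(rule sum.cong) (use h in "auto simp: lk_move")
thus ?thesis unfolding sum.distrib expdeg_def by simp
qed

locale principal =
fixes l :: "'n::{finite,linorder} \<Rightarrow>\<^sub>0 nat" and I :: "('n, 'k::field) mpol set"
assumes l: "l : parts" and I: "I = Sss {l}"
begin
abbreviation "E (m :: nat) == {a. dmn (SUM i<m. l) a}"

lemma ssc_E: "ssc (E m)"
using ssc_dom[of "{SUM i<m. l}"] by simp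

lemma I_E: "I = KM (E 1)"
using Sss_dom[of "{l}"] l I by simp

lemma l_parts: "(SUM i<m. l) : parts"
using l by(simp add: parts_def mono_def lk_sum)

text \<open>The exponents with a divisor in \<open>E 1\<close> of the degree of l form an
  \<open>ssc\<close> set that contains l; hence they are all of \<open>E 1\<close>.\<close>

lemma equi: "equigenerated I"
proof -
have E: "ssc (E 1)" by(rule ssc_E)
let ?C = "{a : E 1. EX g:E 1. expdeg g = expdeg l & (EX c. a = g + c)}"
have "ssc ?C"
 unfolding ssc_def
proof(intro conjI ballI allI impI)
 show "upc ?C"
  unfolding upc_def
 proof(intro ballI allI)
  fix a b assume "a : ?C"
  then obtain g c where a: "a : E 1" "g : E 1" "expdeg g = expdeg l" "a = g + c" by blast
  have "a + b : E 1" using E a(1) unfolding ssc_def upc_def by blast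
  moreover have "a + b = g + (c + b)" by(simp add: a(4) add.assoc)
  ultimately show "a + b : ?C" using a(2,3) by blast
 qed
 fix a assume "a : ?C"
 then obtain g c where a: "a : E 1" "g : E 1" "expdeg g = expdeg l" "a = g + c" by blast
 show "pm si a : ?C" if s: "bij si" for si
 proof -
  have "pm si a : E 1" "pm si g : E 1" using E a(1,2) s unfolding ssc_def by blast+
  thus ?thesis using a(3,4) s by(auto simp: pm_add expdeg_pm intro!: bexI[of _ "pm si g"])
 qed
 fix i j assume ij: "lk a i < lk a j"
 have m: "move a i j : E 1" using E a(1) ij unfolding ssc_def by blast
 show "move a i j : ?C"
 proof(cases "lk c j = 0")
  case True
  hence gij: "lk g i < lk g j" using ij by(simp add: a(4) lk_add)
  hence "move g i j : E 1" using E a(2) unfolding ssc_def by blast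
  thus ?thesis using m gij a(3,4) by(auto simp: move_add expdeg_move intro!: bexI[of _ "move g i j"])
 next
  case False
  hence "move a i j = g + move c i j" unfolding a(4) by(intro pmI) (auto simp: lk_move lk_add)
  thus ?thesis using m a by blast
 qed
qed
moreover have "l : ?C" using dom_refl[OF l] by(auto intro: exI[of _ 0])
ultimately have sub: "E 1 <= ?C" using ssc_dom_least[OF _ _ l] by auto
have "expdeg a = expdeg l" if a: "a : min_mono_gens I" for a
proof -
 have m: "a : E 1" "!!b. b : E 1 ==> (xpow b :: ('n, 'k) mpol) dvd xpow a ==> b = a"
  using a unfolding min_mono_gens_def I_E xpow_KM by blast+
 then obtain g c where g: "g : E 1" "expdeg g = expdeg l" "a = g + c" using sub by blast
 have "(xpow g :: ('n, 'k) mpol) dvd xpow a" unfolding g(3) xpow_mult[symmetric] by simp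
 thus ?thesis using m(2)[OF g(1)] g(2) by simp
qed
thus ?thesis by(auto simp: equigenerated_def)
qed

text \<open>The inequalities of domination add up, which gives one inclusion. For the other, the
  m-fold sum of l lies in the power, and \<open>ssc_epow\<close> makes the power closed under
  domination.\<close>

lemma epow_E: "epow (E 1) m = E m"
proof(intro equalityI subsetI)
show "a : E m" if "a : epow (E 1) m" for a
 using that
proof(induction m arbitrary: a)
 case 0
 show ?case unfolding dmn_def ps_def by simp
next
 case (Suc m)
 then obtain b c where a: "a = b + c" "b : E m" "c : E 1" by auto
 have "ps (SUM i<Suc m. l) i = ps (SUM i<m. l) i + ps (SUM i<(1::nat). l) i" for i
  by(simp add: ps_def lk_add sum.distrib)
 thus ?case using a(2,3) unfolding a(1) mem_Collect_eq dmn_def lk_add sum.distrib by(simp only:) (blast intro: add_mono)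
qed
have "(SUM i<m. l) : epow (E 1) m"
 by(induction m) (use dom_refl[OF l] in "auto simp: add.commute[of l]")
thus "a : epow (E 1) m" if "a : E m" for a
 by(rule ssc_dom_least[OF ssc_epow[OF ssc_E] _ l_parts]) (use that in auto)
qed

text \<open>Every weight \<open>\<Sum>j\<in>W. a\<^sub>j\<close> extends to a valuation, because the lowest forms of a product multiply.\<close>
abbreviation "Wt W c == {a :: 'n \<Rightarrow>\<^sub>0 nat. c <= (SUM j:W. lk a j)}"

lemma Wt_mult: "f : KM (Wt W c) ==> g : KM (Wt W e) ==> f * g : (KM (Wt W (c + e)) :: ('n, 'k) mpol set)"
proof -
assume h: "f : KM (Wt W c)" "g : KM (Wt W e)"
have "a + b : Wt W (c + e)" if "a : Wt W c" "b : Wt W e" for a b using that by(simp add: lk_add sum.distrib)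
thus ?thesis using h keys_mult[of f g] unfolding KM_def by blast
qed

lemma Wt_lowest:
assumes f: "f : KM (Wt W c)" "f ~: KM (Wt W (Suc c))" and g: "g : KM (Wt W e)" "g ~: KM (Wt W (Suc e))"
shows "f * g ~: (KM (Wt W (Suc (c + e))) :: ('n, 'k) mpol set)"
proof
assume h: "f * g : KM (Wt W (Suc (c + e)))"
let ?w = "%a. SUM j:W. lk a j"
have dec: "EX x y. f = x + y & keys x <= {a. ?w a = c} & x ~= 0 & y : KM (Wt W (Suc c))"
 if f: "f : KM (Wt W c)" "f ~: KM (Wt W (Suc c))" for f :: "('n, 'k) mpol" and c
proof -
 let ?s = "%A. SUM a:A. sng a (lk f a)" and ?A = "{a. ?w a = c}"
 have e: "f = ?s (keys f Int ?A) + ?s (keys f - ?A)"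
  unfolding sum.Int_Diff[OF finite_keys[of f], of "%v. sng v (lk f v)" ?A, symmetric] by(simp only: sum_sng)
 have y: "?s (keys f - ?A) : KM (Wt W (Suc c))" using f(1) by(intro KM_sum KM_sng) (force simp: KM_def)
 moreover have "?s (keys f Int ?A) : KM ?A" by(intro KM_sum KM_sng) auto
 moreover have "?s (keys f Int ?A) ~= 0"
 proof
  assume z: "?s (keys f Int ?A) = 0"
  have "f : KM (Wt W (Suc c))" by(subst e) (use z y in "simp only: add_0")
  thus False using f(2) by simp
 qed
 ultimately show ?thesis using e y unfolding KM_def by blast
qed
obtain x y where f': "f = x + y" "keys x <= {a. ?w a = c}" "x ~= 0" "y : KM (Wt W (Suc c))" using dec[OF f] by blast
obtain x' y' where g': "g = x' + y'" "keys x' <= {a. ?w a = e}" "x' ~= 0" "y' : KM (Wt W (Suc e))" using dec[OF g] by blast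
have x': "x' : KM (Wt W e)" using g'(2) by(auto simp: KM_def)
have "f * y' : KM (Wt W (Suc (c + e)))" "y * x' : KM (Wt W (Suc (c + e)))"
 using Wt_mult[OF f(1) g'(4)] Wt_mult[OF f'(4) x'] by simp_all
hence "f * g - f * y' - y * x' : KM (Wt W (Suc (c + e)))" using h by(intro KM_diff)
moreover have "f * g - f * y' - y * x' = x * x'" unfolding g'(1) f'(1) by(simp add: algebra_simps)
ultimately have "keys (x * x') <= Wt W (Suc (c + e))" by(simp add: KM_def)
moreover have "keys (x * x') <= {a. ?w a = c + e}" using keys_mult[of x x'] f'(2) g'(2) by(force simp: lk_add sum.distrib)
ultimately have "keys (x * x') = {}" by(intro equals0I) (force dest: subsetD)
hence "x * x' = 0" by(simp only: keys_eq_empty)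
thus False using f'(3) g'(3) by simp
qed

text \<open>If f had weight t below the bound c for some W, then f^n would have weight exactly n t,
  while every other term of the integral equation has weight at least i c + (n - i) t, which exceeds
  n t.\<close>

lemma normal: "normal_ideal I"
unfolding normal_ideal_def
proof(intro allI impI)
fix m :: nat assume "1 <= m"
have up: "upc (E m)" for m using ssc_E unfolding ssc_def by blast
have P: "ideal_power I m = KM (E m)" for m unfolding I_E ipow_KM[OF up] epow_E ..
have PP: "ideal_power (KM (E m)) i = (KM (E (i * m)) :: ('n, 'k) mpol set)" for i
 unfolding ipow_KM[OF up] using epow_epow[OF up[of 1], of m i] by(simp only: epow_E)
show "integral_closure (ideal_power I m) = ideal_power I m"
 unfolding P
proof(intro equalityI subsetI)
 fix f :: "('n, 'k) mpol" assume "f : KM (E m)"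
 hence "- f : ideal_power (KM (E m)) 1" unfolding PP by(simp add: KM_uminus)
 thus "f : integral_closure (KM (E m))"
  unfolding integral_closure_def by(intro CollectI exI[of _ 1] exI[of _ "%_. - f"]) simp
next
 fix f :: "('n, 'k) mpol" assume "f : integral_closure (KM (E m))"
 then obtain n a where na: "!!i. i : {1..n} ==> a i : KM (E (i * m))" "f ^ n + (SUM i=1..n. a i * f ^ (n - i)) = 0"
  unfolding integral_closure_def PP by blast
 have "f : KM (Wt W (ps (SUM i<m. l) k))" if W: "card W = card {..k}" for W k
 proof(rule ccontr)
  let ?c = "ps (SUM i<m. l) k" and ?w = "%a. SUM j:W. lk a j"
  assume nf: "f ~: KM (Wt W ?c)"
  hence ne: "keys f ~= {}" by(auto simp: KM_def)
  define t where "t = Min (?w ` keys f)"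
  have ft: "f : KM (Wt W t)" unfolding KM_def t_def by auto
  have "t : ?w ` keys f" unfolding t_def using ne by(intro Min_in) auto
  hence fs: "f ~: KM (Wt W (Suc t))" by(auto simp: KM_def)
  have tc: "t < ?c"
  proof(rule ccontr)
   assume "~ t < ?c"
   hence "Wt W t <= Wt W ?c" by auto
   thus False using ft nf by(auto simp: KM_def)
  qed
  have fp: "f ^ r : KM (Wt W (r * t)) & f ^ r ~: KM (Wt W (Suc (r * t)))" for r
  proof(induction r)
   case 0
   have "keys (1 :: ('n, 'k) mpol) = {0}" by simp
   thus ?case by(simp add: KM_def)
  next
   case (Suc r)
   thus ?case using Wt_mult[OF ft, of "f ^ r" "r * t"] Wt_lowest[OF ft fs, of "f ^ r" "r * t"] by simp
  qed
  have "a i * f ^ (n - i) : KM (Wt W (Suc (n * t)))" if i: "i : {1..n}" for i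
  proof -
   have "dmn (SUM j<i * m. l) b ==> i * ?c <= ?w b" for b
   proof -
    assume "dmn (SUM j<i * m. l) b"
    hence "ps (SUM j<i * m. l) k <= ?w b" using W by(simp add: dmn_def)
    moreover have "ps (SUM j<r. l) k = r * ps l k" for r by(simp add: ps_def lk_sum sum_distrib_left)
    ultimately show ?thesis by(simp add: mult.assoc)
   qed
   hence "a i : KM (Wt W (i * ?c))" using na(1)[OF i] by(auto simp: KM_def)
   from Wt_mult[OF this conjunct1[OF fp]] have "a i * f ^ (n - i) : KM (Wt W (i * ?c + (n - i) * t))" .
   moreover have "Suc (n * t) <= i * ?c + (n - i) * t"
   proof -
    have "i * t + (n - i) * t = n * t" using i by(simp flip: add_mult_distrib)
    moreover have "i * t < i * ?c" using i tc by simp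
    ultimately show ?thesis by linarith
   qed
   ultimately show ?thesis by(force simp: KM_def)
  qed
  hence "- (SUM i=1..n. a i * f ^ (n - i)) : KM (Wt W (Suc (n * t)))" by(intro KM_uminus KM_sum)
  moreover have "f ^ n = - (SUM i=1..n. a i * f ^ (n - i))" using na(2) by(simp add: eq_neg_iff_add_eq_0)
  ultimately show False using fp[of n] by simp
 qed
 thus "f : KM (E m)" unfolding KM_def dmn_def by blast
qed
qed
end

section \<open>Partition Borel generators\<close>

lemma parts_eqI: "(!!i. ps a i = ps b i) ==> a = (b :: 'n::{finite,linorder} \<Rightarrow>\<^sub>0 nat)"
by(rule ccontr, erule first_difference) (metis add_left_cancel ps_split)

text \<open>The least generating set consists of the partitions in I that the remaining ones cannot
  replace, i.e. the minimal ones for domination. They suffice because the sum of all prefix sums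
  decreases along strict domination.\<close>

lemma borel_gens:
fixes I :: "('n::{finite,linorder}, 'k::field) mpol set"
assumes B: "B <= parts" "I = Sss B"
shows "borel_gens I <= parts" "I = Sss (borel_gens I)"
 "l : borel_gens I ==> m : borel_gens I ==> dmn l m ==> l = m"
proof -
let ?D = "%B. {a. EX l:B. dmn l a} :: ('n \<Rightarrow>\<^sub>0 nat) set"
define PI where "PI = parts_of I"
have PI: "PI = {a : parts. EX l:B. dmn l a}" unfolding PI_def parts_of_def B(2) Sss_dom[OF B(1)] xpow_KM by simp
have PIp: "PI <= parts" "B <= PI" using B(1) dom_refl by(auto simp: PI)
have eqD: "Sss S = I <-> ?D S = ?D B" if "S <= parts" for S
proof -
 have "KM A = (KM A' :: ('n, 'k) mpol set) <-> A = A'" for A A' by(metis xpow_KM subsetI equalityI)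
 thus ?thesis unfolding B(2) Sss_dom[OF B(1)] Sss_dom[OF that] .
qed
have DPI: "?D PI = ?D B"
proof(intro equalityI subsetI)
 fix a assume "a : ?D PI"
 then obtain l m where "m : B" "dmn m l" "dmn l a" unfolding PI by blast
 thus "a : ?D B" using dom_trans[of m l a] by blast
qed (use PIp(2) in blast)
define B0 where "B0 = {l : PI. Sss (PI - {l}) ~= I}"
have B0p: "B0 <= parts" using PIp by(auto simp: B0_def)
have least: "B0 <= B'" if B': "B' <= parts" "I = Sss B'" for B'
proof(rule ccontr)
 assume "~ B0 <= B'"
 then obtain l where l: "l : B0" "l ~: B'" by blast
 have D': "?D B' = ?D B" using eqD[OF B'(1)] B'(2) by simp
 have "B' <= PI - {l}" using B'(1) l(2) D' dom_refl unfolding PI by blast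
 hence "?D (PI - {l}) = ?D B" using D' DPI by blast
 hence "Sss (PI - {l}) = I" using eqD[of "PI - {l}"] PIp by blast
 thus False using l(1) by(simp add: B0_def)
qed
have cover: "l : PI ==> EX l0:B0. dmn l0 l" for l
proof(induction "SUM i:UNIV. ps l i" arbitrary: l rule: less_induct)
 case less
 have lp: "l : parts" using less.prems PIp by blast
 show ?case
 proof(cases "l : B0")
  case False
  hence "?D (PI - {l}) = ?D B" using less.prems eqD[of "PI - {l}"] PIp by(auto simp: B0_def)
  moreover have "l : ?D B" using less.prems by(simp add: PI)
  ultimately obtain m where m: "m : PI" "m ~= l" "dmn m l" by blast
  have "EX i. ps m i < ps l i" using m(2,3) parts_eqI[of m l] unfolding dmn_parts[OF lp] by(metis le_neq_implies_less)
  hence "sum (ps m) UNIV < sum (ps l) UNIV" using m(3) unfolding dmn_parts[OF lp] by(intro sum_strict_mono_ex1) auto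
  from less.hyps[OF this m(1)] show ?thesis using m(3) dom_trans by blast
 qed (use dom_refl[OF lp] in blast)
qed
have "?D B0 = ?D PI"
proof(intro equalityI subsetI)
 fix a assume "a : ?D PI"
 then obtain l where l: "l : PI" "dmn l a" by blast
 thus "a : ?D B0" using cover[OF l(1)] dom_trans[OF _ l(2)] by blast
qed (auto simp: B0_def)
hence "?D B0 = ?D B" unfolding DPI .
hence I0: "I = Sss B0" using eqD[OF B0p] by simp
have eq: "borel_gens I = B0" unfolding borel_gens_def by(rule Least_equality) (use B0p I0 least in auto)
show "borel_gens I <= parts" "I = Sss (borel_gens I)" unfolding eq using B0p I0 by auto
show "l = m" if "l : borel_gens I" "m : borel_gens I" "dmn l m"
proof(rule ccontr)
 assume "l ~= m"
 hence "l : PI - {m}" using that by(auto simp: eq B0_def)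
 hence "?D (PI - {m}) = ?D PI" using that(3) dom_trans by blast
 hence "Sss (PI - {m}) = I" using eqD[of "PI - {m}"] DPI PIp by blast
 thus False using that(2) by(simp add: eq B0_def)
qed
qed

text \<open>Prefix sums grow under multiplication and under moves to smaller indices, so lower
  bounds on them define a strongly stable ideal.\<close>

lemma Borel_ps:
assumes "xpow a : (Borel (xpow ` B) :: ('n::{finite,linorder}, 'k::field) mpol set)"
shows "EX l:B. ALL i. ps l i <= ps a i"
proof -
let ?E = "{a. EX l:B. ALL i. ps l i <= ps a i}"
have "strongly_stable (KM ?E :: ('n, 'k) mpol set)"
 unfolding strongly_stable_def mono_KM xpow_KM
proof(intro conjI allI impI; (elim conjE)?)
 have "ps a i <= ps (a + b) i" for a b :: "'n \<Rightarrow>\<^sub>0 nat" and i by(simp add: ps_def lk_add sum.distrib)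
 thus "upc {a. a : ?E}" unfolding upc_def by(blast intro: order_trans)
 fix a i j assume a: "a : ?E" "i < j" "lk a j ~= 0"
 have "ps a k <= ps (move a i j) k" for k
 proof -
  have "(SUM x<=k. lk (move a i j) x + (if x = j then 1 else 0)) = (SUM x<=k. lk a x + (if x = i then 1 else 0))"
   by(rule sum.cong) (use a(2,3) in "auto simp: lk_move")
  thus ?thesis using a(2) unfolding sum.distrib ps_def by(auto split: if_splits)
 qed
 thus "move a i j : ?E" using a(1) by(auto intro: order_trans)
qed simp
moreover have "xpow ` B <= (KM ?E :: ('n, 'k) mpol set)" by(auto simp: xpow_KM)
ultimately have "Borel (xpow ` B) <= (KM ?E :: ('n, 'k) mpol set)" unfolding Borel_def by(intro hull_minimal)
hence "(xpow a :: ('n, 'k) mpol) : KM ?E" using assms by blast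
thus ?thesis by(simp add: xpow_KM)
qed

text \<open>The lex-segment property produces a generator n whose prefix sums before the last
  position exceed the smallest first entry u by at most 1. Such a generator is comparable with all
  others, and since the generators form an antichain it is the only one.\<close>

lemma lex_segment_principal:
fixes G :: "('n::{finite,linorder} \<Rightarrow>\<^sub>0 nat) set"
assumes G: "G <= parts" "G ~= {}" and anti: "!!l m. l : G ==> m : G ==> dmn l m ==> l = m"
 and J: "equigenerated (Borel (xpow ` G) :: ('n, 'k::field) mpol set)" "lex_segment_ideal (Borel (xpow ` G) :: ('n, 'k) mpol set)"
shows "card G = 1"
proof -
let ?J = "Borel (xpow ` G) :: ('n, 'k) mpol set"
define z a0 where "z = Max (UNIV :: 'n set)" and "a0 = Min (UNIV :: 'n set)"
have z: "i <= z" and a0: "a0 <= i" for i by(simp_all add: z_def a0_def)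
have psz: "ps a z = expdeg a" for a unfolding ps_def expdeg_def using z by(intro sum.cong) auto
have psa: "lk a a0 <= ps a i" for a i unfolding ps_def using a0 by(intro member_le_sum) auto
have psm: "i <= j ==> ps a i <= ps a j" for a i j unfolding ps_def by(intro sum_mono2) auto
have GJ: "xpow l : ?J" if "l : G" for l using that hull_subset[of "xpow ` G :: ('n, 'k) mpol set" strongly_stable] by(auto simp: Borel_def)
have domG: "l = m" if "l : G" "m : G" "!!i. ps l i <= ps m i" for l m
 using anti[OF that(1,2)] dmn_parts[of m l] that G(1) by blast
have EJ: "upc {a. xpow a : ?J}" "?J = KM {a. xpow a : ?J}" using J(2) by(auto simp: lex_segment_ideal_def mono_KM)
obtain d where d: "ALL b:{a. xpow a : ?J}. EX g:{a. xpow a : ?J}. expdeg g = d & (EX c. b = g + c)"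
 using equigenerated_bound[OF EJ(1)] J(1) EJ(2) by metis
have degG: "expdeg l = d" if l: "l : G" for l
proof -
 obtain g c where g: "xpow g : ?J" "expdeg g = d" "l = g + c" using d GJ[OF l] by blast
 obtain m where m: "m : G" "!!i. ps m i <= ps g i" using Borel_ps[OF g(1)] by blast
 have "ps g i <= ps l i" for i by(simp add: g(3) ps_def lk_add sum.distrib)
 hence "m = l" using domG[OF m(1) l] m(2) order_trans by blast
 thus ?thesis using m(2)[of z] g(2,3) by(simp add: psz expdeg_add)
qed
obtain l1 where l1: "l1 : G" "!!l. l : G ==> lk l1 a0 <= lk l a0"
 using G(2) ex_has_least_nat[of "%l. l : G" _ "%l. lk l a0"] by blast
define u where "u = lk l1 a0"
have "EX n:G. ALL p<z. ps n p <= u + 1"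
proof(cases "a0 < z & u < d")
 case True
 \<comment> \<open>Same degree as \<open>l1\<close> but first exponent u + 1, hence
   lexicographically larger; the rest of the degree sits in the last variable, so its prefix sums
   stay at u + 1 as long as possible.\<close>
 let ?b = "sng a0 (u + 1) + sng z (d - (u + 1))"
 have pb: "ps ?b i = u + 1 + (if i = z then d - (u + 1) else 0)" for i
 proof -
  have "ps ?b i = (SUM j<=i. if j = a0 then u + 1 else 0) + (SUM j<=i. if j = z then d - (u + 1) else 0)"
   unfolding ps_def sum.distrib[symmetric] by(rule sum.cong) (auto simp: lk_add lk_sng when_def)
  thus ?thesis using a0[of i] z[of i] by(auto simp: antisym)
 qed
 have "lex_greater ?b l1" unfolding lex_greater_def using True a0
  by(intro exI[of _ a0]) (auto simp: lk_add lk_sng when_def u_def not_le[symmetric])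
 moreover have "expdeg ?b = expdeg l1" using pb[of z] True by(simp add: psz degG[OF l1(1)])
 ultimately have "xpow ?b : ?J" using J(2) GJ[OF l1(1)] unfolding lex_segment_ideal_def by blast
 then obtain n where n: "n : G" "!!i. ps n i <= ps ?b i" using Borel_ps by blast
 have "ps n p <= u + 1" if "p < z" for p using n(2)[of p] less_imp_neq[OF that] unfolding pb by simp
 thus ?thesis using n(1) by blast
next
 case False
 have "ps l1 p <= u + 1" if "p < z" for p
 proof -
  have "a0 < z" using that a0[of p] by simp
  hence "d <= u" using False by simp
  thus ?thesis using psm[OF less_imp_le[OF that], of l1] by(simp add: psz degG[OF l1(1)])
 qed
 thus ?thesis using l1(1) by blast
qed
then obtain n where n: "n : G" "!!p. p < z ==> ps n p <= u + 1" by blast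
have np: "n : parts" using n(1) G(1) by blast
have "l = n" if l: "l : G" for l
proof(cases "ALL p<z. ps n p <= ps l p")
 case True
 have "ps n i <= ps l i" for i using True z[of i] degG[OF l] degG[OF n(1)] by(cases "i = z") (auto simp: psz)
 thus ?thesis using domG[OF n(1) l] by simp
next
 case False
 \<comment> \<open>Here l and n have prefix sums u and u + 1 at p. Strictly between p and the last
   position there is no index: entries of n there would be positive and push its prefix sum to u +
   2. So n dominates l.\<close>
 then obtain p where p: "p < z" "ps l p < ps n p" by auto
 have lu: "u <= ps l p" using psa[of l p] l1(2)[OF l] by(simp add: u_def)
 have "ps l i <= ps n i" for i
 proof(cases "i = z")
  case False
  hence iz: "i < z" using z[of i] by simp
  show ?thesis
  proof(cases "i <= p")
   case True
   thus ?thesis using psm[OF True, of l] n(2)[OF p(1)] p(2) psa[of n i] l1(2)[OF n(1)] by(simp add: u_def)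
  next
   case pi: False
   have "lk n i ~= 0"
   proof
    assume "lk n i = 0"
    hence "ps n p = 0" unfolding ps_def using parts_mono[OF np, of _ i] pi by(intro sum.neutral) (metis atMost_iff le_zero_eq linear order_trans)
    thus False using p(2) by simp
   qed
   moreover have "ps n p + lk n i <= ps n i"
   proof -
    have "(SUM j<=p. lk n j) <= (SUM j<i. lk n j)" using pi by(intro sum_mono2) (auto simp: not_le)
    thus ?thesis by(simp add: ps_split[of n i] ps_def[of n p])
   qed
   ultimately show ?thesis using n(2)[OF iz] p(2) lu by simp
  qed
 qed (simp add: psz degG[OF l] degG[OF n(1)])
 thus ?thesis using domG[OF l n(1)] by simp
qed
hence "G = {n}" using n(1) by blast
thus ?thesis by simp
qed

theorem proposition4p3:
  fixes B :: "('n::{finite,linorder} \<Rightarrow>\<^sub>0 nat) set"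
    and I :: "('n, 'k::field) mpol set"
  assumes "B \<subseteq> parts" and "I = Sss B" and "I \<noteq> {0}" and "I \<noteq> UNIV"
  shows
    "(card (borel_gens I) = 1 \<longrightarrow> equigenerated I \<and> normal_ideal I) \<and>
     (let J = (Borel (xpow ` borel_gens I) :: ('n, 'k) mpol set) in
        equigenerated J \<and> lex_segment_ideal J \<longrightarrow> equigenerated I \<and> normal_ideal I) \<and>
     (equigenerated I \<and> normal_ideal I \<longrightarrow>
        cohen_macaulay_ring (rees_ring I) \<and> normal_domain (rees_ring I) \<and>
        cohen_macaulay_ring (special_fiber_ring I) \<and> normal_domain (special_fiber_ring I) \<and>
        (CHAR('k) = 0 \<longrightarrow> rational_singularities (special_fiber_ring I)) \<and>
        (CHAR('k) > 0 \<longrightarrow> F_rational CHAR('k) (special_fiber_ring I)))"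
proof -
  note G = borel_gens[OF assms(1,2)]
  have I: "I = KM {a. \<exists>l\<in>B. dmn l a}" using assms(1,2) Sss_dom by simp
  have up: "upc {a. \<exists>l\<in>B. dmn l a}" using ssc_dom[of B] by (simp add: ssc_def)
  have one: "equigenerated I \<and> normal_ideal I" if "card (borel_gens I) = 1"
  proof -
    obtain l where l: "borel_gens I = {l}" using card_1_singletonE[OF \<open>card (borel_gens I) = 1\<close>] by blast
    interpret principal l I by unfold_locales (use G(1,2) l in auto)
    show ?thesis using equi normal by blast
  qed
  moreover have "equigenerated I \<and> normal_ideal I"
    if "equigenerated (Borel (xpow ` borel_gens I) :: ('n, 'k) mpol set)" "lex_segment_ideal (Borel (xpow ` borel_gens I) :: ('n, 'k) mpol set)"
  proof -
    have "borel_gens I \<noteq> {}"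
    proof
      assume "borel_gens I = {}"
      then have "I = {0}" using G(2) Sss_dom[of "{} :: ('n \<Rightarrow>\<^sub>0 nat) set"] by (simp add: KM_def)
      then show False using assms(3) by simp
    qed
    then show ?thesis using lex_segment_principal[OF G(1) _ G(3) that] one by blast
  qed
  moreover have "cohen_macaulay_ring (rees_ring I) \<and> normal_domain (rees_ring I) \<and>
        cohen_macaulay_ring (special_fiber_ring I) \<and> normal_domain (special_fiber_ring I) \<and>
        (CHAR('k) = 0 \<longrightarrow> rational_singularities (special_fiber_ring I)) \<and>
        (CHAR('k) > 0 \<longrightarrow> F_rational CHAR('k) (special_fiber_ring I))" if h: "equigenerated I" "normal_ideal I"
  proof -
    obtain d where "\<forall>b\<in>{a. \<exists>l\<in>B. dmn l a}. \<exists>g\<in>{a. \<exists>l\<in>B. dmn l a}. expdeg g = d \<and> (\<exists>c. b = g + c)"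
    proof -
      have "equigenerated (KM {a. \<exists>l\<in>B. dmn l a} :: ('n, 'k) mpol set)" by (subst I[symmetric]) (rule h(1))
      from equigenerated_bound[OF up this] show thesis by (elim exE) (rule that)
    qed
    then interpret eq_normal "{a. \<exists>l\<in>B. dmn l a}" d I by unfold_locales (use up I h(2) in auto)
    show ?thesis by (rule blowup_algebras)
  qed
  ultimately show ?thesis by (simp add: Let_def)
qed

end
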